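(* Let $n\ge3$. For every iterated sequence $S$ for $\mathrm{Gr}(2,\mathbb C^n)$ there is an isomorphism of $\mathbb C$-algebras $$\mathrm{gr}_S(A_{2,n})\cong\mathbb C[p_{ij}]_{i<j}/\mathrm{in}_{C_S}(\mathcal I_{2,n}).$$ Conversely, for every maximal prime cone $C\subset\mathrm{trop}(\mathrm{Gr}(2,\mathbb C^n))$ there exists a birational sequence $S$ for $\mathrm{Gr}(2,\mathbb C^n)$ such that $\mathbb C[p_{ij}]_{i<j}/\mathrm{in}_C(\mathcal I_{2,n})\cong\mathrm{gr}_S(A_{2,n})$.
   Context: Roots and birational sequences. Positive roots of type $\mathtt A_{n-1}$ are $\varepsilon_i-\varepsilon_j$, $1\le i<j\le n$. For $\beta=\varepsilon_i-\varepsilon_j$ let $f_\beta$ be the elementary $n\times n$ matrix with a $1$ in position $(j,i)$. Put $d=2(n-2)$. For a sequence $S=(\beta_1,\dots,\beta_d)$ of positive roots (repetitions allowed) let $\psi_S(y)=(\mathbb 1+y_1f_{\beta_1})\cdots(\mathbb 1+y_df_{\beta_d})$. $S$ is birational for $\mathrm{Gr}(2,\mathbb C^n)$ if the map $\mathbb A^d\to\mathrm{Gr}(2,\mathbb C^n)$ sending $y$ to the span of the first two columns of $\psi_S(y)$ is birational. Iterated sequences for $\mathrm{Gr}(2,\mathbb C^n)$ are the sequences $S=(\varepsilon_{i_n}-\varepsilon_n,\varepsilon_{j_n}-\varepsilon_n,\dots,\varepsilon_{i_3}-\varepsilon_3,\varepsilon_{j_3}-\varepsilon_3)$ with $i_l,j_l\in\{1,\dots,l-1\}$,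 $i_l\ne j_l$, for $3\le l\le n$; they are birational. Plücker algebra. $\mathcal I_{2,n}\subset\mathbb C[p_{ij}\mid1\le i<j\le n]$ is the Plücker ideal, generated by $p_{ij}p_{kl}-p_{ik}p_{jl}+p_{il}p_{jk}$ for $1\le i<j<k<l\le n$, and $A_{2,n}=\mathbb C[p_{ij}]/\mathcal I_{2,n}=\bigoplus_{m\ge0}A_m$ with its standard grading. Valuation. For a birational sequence $S$ let $\mathrm{ht}(\varepsilon_i-\varepsilon_j)=j-i$, $\Psi(m)=\sum_i m_i\mathrm{ht}(\beta_i)$, and order $\mathbb Z^d$ by $m\prec_\Psi n$ iff $\Psi(m)<\Psi(n)$, or $\Psi(m)=\Psi(n)$ and $m>_{\mathrm{lex}}n$. For $0\ne g=\sum a_uy^u\in\mathbb C[y_1,\dots,y_d]$ let $\mathfrak v_S(g)=\min_{\prec_\Psi}\{u\mid a_u\ne0\}$. For nonzero homogeneous $f\in A_{2,n}$ let $\mathfrak v_S(f)=\mathfrak v_S(\psi_S^*(f))$, where $\psi_S^*(f)$ is obtained by substituting for each $p_{ij}$ the $2\times2$ minor of $\psi_S(y)$ on rows $i,j$ and columns $1,2$. Associated graded algebra. $\mathrm{gr}_S(A_{2,n})=\bigoplus_{m\ge0}\bigoplus_{a\in\mathbb Z^d}F_{m,\succeq a}/F_{m,\succ a}$, where $F_{m,\succeq a}=\{f\in A_m\setminus\{0\}\mid\mathfrak v_S(f)\succeq_\Psi a\}\cup\{0\}$ and $F_{m,\succ a}$ is defined likewise with $\succ_\Psi$. Tropical Grassmannian.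 For $w\in\mathbb R^{\binom n2}$, $\mathrm{in}_w(f)$ is the sum of the terms $a_up^u$ of $f$ with $w\cdot u$ minimal, and $\mathrm{in}_w(\mathcal I_{2,n})$ is generated by all $\mathrm{in}_w(f)$, $f\in\mathcal I_{2,n}$. $\mathrm{trop}(\mathrm{Gr}(2,\mathbb C^n))$ is the set of $w$ for which $\mathrm{in}_w(\mathcal I_{2,n})$ contains no monomial, with fan structure as a subfan of the Gröbner fan ($v,w$ are in the relative interior of the same cone iff $\mathrm{in}_v(\mathcal I_{2,n})=\mathrm{in}_w(\mathcal I_{2,n})$). For a cone $C$, $\mathrm{in}_C(\mathcal I_{2,n})=\mathrm{in}_w(\mathcal I_{2,n})$ for any $w$ in the relative interior of $C$; $C$ is prime if this ideal is prime. Trees. A trivalent tree is a tree all of whose internal (non-leaf) vertices have valency three; it is labeled if its $n$ leaves are labeled by $1,\dots,n$. An edge is internal if it joins two internal vertices. For a labeled trivalent tree $T$ with $n$ leaves let $w_T\in\mathbb R^{\binom n2}$ have $(i,j)$-entry $-\#\{\text{internal edges on the path from leaf }i\text{ to leaf }j\}$; it lies in the relative interior of a unique maximal cone $C_T$ of $\mathrm{trop}(\mathrm{Gr}(2,\mathbb C^n))$. The cone $C_S$. For an iterated sequence $S=(\varepsilon_{i_n}-\varepsilon_n,\varepsilon_{j_n}-\varepsilon_n,\dots,\varepsilon_{i_3}-\varepsilon_3,\varepsilon_{j_3}-\varepsilon_3)$ with $i_l,j_l\in\{1,\dots,l-1\}$, $i_l\ne j_l$, for $3\le l\le n$, let $T_3^S$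 be the tree with one internal vertex and leaves $1,2,3$; for $4\le l\le n$ let $T_l^S$ be obtained from $T_{l-1}^S$ by replacing the edge with leaf $i_l$ by three edges forming a cherry with leaves $i_l$ and $l$ (i.e. subdivide the edge at leaf $i_l$ and attach a new leaf $l$ at the new vertex). Put $T_S=T_n^S$ and $C_S=C_{T_S}$. *)

theory Defs
  imports
    "HOL-Analysis.Analysis"
    "HOL-Analysis.Finite_Function_Topology"
    "HOL-Library.Poly_Mapping"
    "HOL-Library.Product_Plus"
    "HOL-Algebra.Module"
    "HOL-Algebra.QuotRing"
    "HOL-Algebra.Product_Groups"
    "Jordan_Normal_Form.VS_Connect"
begin

section \<open>Commutative algebras over the complex numbers\<close>

text \<open>
  A complex algebra is a record of type \<open>(complex, 'a) module\<close>: a HOL-Algebra ring together with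
  a scalar multiplication.
\<close>

definition alg_isomorphic :: "(complex, 'a) module \<Rightarrow> (complex, 'b) module \<Rightarrow> bool"
  where "alg_isomorphic A B \<longleftrightarrow>
    (\<exists>h \<in> ring_iso A B. \<forall>c. \<forall>x \<in> carrier A. h (c \<odot>\<^bsub>A\<^esub> x) = c \<odot>\<^bsub>B\<^esub> h x)"

definition quot_alg :: "(complex, 'a) module \<Rightarrow> 'a set \<Rightarrow> (complex, 'a set) module"
  where "quot_alg A I =
    ring.extend (A Quot I) (module.fields (\<lambda>c X. \<Union>f\<in>X. I +>\<^bsub>A\<^esub> (c \<odot>\<^bsub>A\<^esub> f)))"

text \<open>
  A polynomial is a finitely supported function from exponent vectors to coefficients; the ring
  operations of \<^typ>\<open>('v \<Rightarrow>\<^sub>0 nat) \<Rightarrow>\<^sub>0 complex\<close> are those of polynomials.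
\<close>

type_synonym 'v cpoly = "('v \<Rightarrow>\<^sub>0 nat) \<Rightarrow>\<^sub>0 complex"

definition const_poly :: "complex \<Rightarrow> 'v cpoly"
  where "const_poly c = Poly_Mapping.single 0 c"

definition var_poly :: "'v \<Rightarrow> 'v cpoly"
  where "var_poly x = Poly_Mapping.single (Poly_Mapping.single x 1) 1"

definition poly_alg :: "'v set \<Rightarrow> (complex, 'v cpoly) module"
  where "poly_alg V =
    \<lparr>carrier = {f. \<forall>u \<in> Poly_Mapping.keys f. Poly_Mapping.keys u \<subseteq> V},
     mult = (*), one = 1, zero = 0, add = (+), smult = (\<lambda>c f. const_poly c * f)\<rparr>"

definition poly_subst :: "(complex \<Rightarrow> 'b) \<Rightarrow> ('v \<Rightarrow> 'b) \<Rightarrow> 'v cpoly \<Rightarrow> 'b::comm_ring_1"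
  where "poly_subst c s f =
    (\<Sum>u \<in> Poly_Mapping.keys f. c (Poly_Mapping.lookup f u) *
       (\<Prod>x \<in> Poly_Mapping.keys u. s x ^ Poly_Mapping.lookup u x))"

section \<open>The Pluecker algebra\<close>

definition pairs :: "nat \<Rightarrow> (nat \<times> nat) set"
  where "pairs n = {(i, j). 1 \<le> i \<and> i < j \<and> j \<le> n}"

type_synonym ppoly = "(nat \<times> nat) cpoly"

abbreviation plucker_ring :: "nat \<Rightarrow> (complex, ppoly) module"
  where "plucker_ring n \<equiv> poly_alg (pairs n)"

definition plucker_ideal :: "nat \<Rightarrow> ppoly set"
  where "plucker_ideal n = Idl\<^bsub>plucker_ring n\<^esub>
    {var_poly (i, j) * var_poly (k, l) - var_poly (i, k) * var_poly (j, l)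
       + var_poly (i, l) * var_poly (j, k) | i j k l.
     1 \<le> i \<and> i < j \<and> j < k \<and> k < l \<and> l \<le> n}"

definition plucker_alg :: "nat \<Rightarrow> (complex, ppoly set) module"
  where "plucker_alg n = quot_alg (plucker_ring n) (plucker_ideal n)"

definition homogeneous_polys :: "nat \<Rightarrow> nat \<Rightarrow> ppoly set"
  where "homogeneous_polys n m = {f \<in> carrier (plucker_ring n).
    \<forall>u \<in> Poly_Mapping.keys f. (\<Sum>x \<in> Poly_Mapping.keys u. Poly_Mapping.lookup u x) = m}"

definition plucker_graded_part :: "nat \<Rightarrow> nat \<Rightarrow> ppoly set set"
  where "plucker_graded_part n m =
    (\<lambda>f. plucker_ideal n +>\<^bsub>plucker_ring n\<^esub> f) ` homogeneous_polys n m"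

section \<open>Birational sequences\<close>

text \<open>
  The positive root \<open>\<epsilon>\<^sub>i - \<epsilon>\<^sub>j\<close> is the pair \<open>(i, j)\<close>, so \<open>pairs n\<close> is also the set of positive
  roots.  Roots and Pluecker coordinates are indexed from 1, but the rows and columns of matrices,
  the entries of a list of roots and the variables \<open>y\<close> are indexed from 0.
\<close>

type_synonym root = "nat \<times> nat"

definition root_mat :: "nat \<Rightarrow> root \<Rightarrow> 'a::comm_ring_1 mat"
  where "root_mat n \<beta> =
    mat n n (\<lambda>(r, c). if r = snd \<beta> - 1 \<and> c = fst \<beta> - 1 then 1 else 0)"

definition psi_mat :: "nat \<Rightarrow> root list \<Rightarrow> (nat \<Rightarrow> 'a) \<Rightarrow> 'a::comm_ring_1 mat"
  where "psi_mat n S y =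
    foldr (\<lambda>k M. (1\<^sub>m n + y k \<cdot>\<^sub>m root_mat n (S ! k)) * M) [0..<length S] (1\<^sub>m n)"

definition psi_minor :: "nat \<Rightarrow> root list \<Rightarrow> (nat \<Rightarrow> 'a) \<Rightarrow> nat \<times> nat \<Rightarrow> 'a::comm_ring_1"
  where "psi_minor n S y = (\<lambda>(i, j). let M = psi_mat n S y in
    M $$ (i - 1, 0) * M $$ (j - 1, 1) - M $$ (i - 1, 1) * M $$ (j - 1, 0))"

abbreviation cspan :: "nat \<Rightarrow> complex vec set \<Rightarrow> complex vec set"
  where "cspan n \<equiv> LinearCombinations.module.span class_ring (module_vec TYPE(complex) n)"

definition grassmannian2 :: "nat \<Rightarrow> complex vec set set"
  where "grassmannian2 n = {W.
    VectorSpace.subspace class_ring W (module_vec TYPE(complex) n) \<and>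
    vectorspace.dim class_ring (module_vec TYPE(complex) n\<lparr>carrier := W\<rparr>) = 2}"

text \<open>
  Homogeneous coordinates are determined only up to a common nonzero factor.  One choice is fixed;
  what follows uses only the vanishing of homogeneous polynomials and quotients of homogeneous
  polynomials of equal degree, which do not depend on it.
\<close>

definition plucker_coords :: "nat \<Rightarrow> complex vec set \<Rightarrow> nat \<times> nat \<Rightarrow> complex"
  where "plucker_coords n W = (SOME p. \<exists>u \<in> carrier_vec n. \<exists>v \<in> carrier_vec n.
    W = cspan n {u, v} \<and>
    p = (\<lambda>(i, j). u $ (i - 1) * v $ (j - 1) - v $ (i - 1) * u $ (j - 1)))"

definition eval_plucker :: "nat \<Rightarrow> ppoly \<Rightarrow> complex vec set \<Rightarrow> complex"
  where "eval_plucker n F W = poly_subst (\<lambda>c. c) (plucker_coords n W) F"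

definition zariski_open_gr :: "nat \<Rightarrow> complex vec set set \<Rightarrow> bool"
  where "zariski_open_gr n V \<longleftrightarrow> (\<exists>H \<subseteq> (\<Union>m. homogeneous_polys n m).
    V = {W \<in> grassmannian2 n. \<exists>F \<in> H. eval_plucker n F W \<noteq> 0})"

definition regular_on_gr :: "nat \<Rightarrow> complex vec set set \<Rightarrow> (complex vec set \<Rightarrow> complex) \<Rightarrow> bool"
  where "regular_on_gr n V h \<longleftrightarrow> (\<forall>W \<in> V. \<exists>N \<subseteq> V. zariski_open_gr n N \<and> W \<in> N \<and>
    (\<exists>m. \<exists>F \<in> homogeneous_polys n m. \<exists>G \<in> homogeneous_polys n m. \<forall>X \<in> N.
      eval_plucker n G X \<noteq> 0 \<and> h X = eval_plucker n F X / eval_plucker n G X))"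

definition sequence_map :: "nat \<Rightarrow> root list \<Rightarrow> complex vec \<Rightarrow> complex vec set"
  where "sequence_map n S y =
    (let M = psi_mat n S (\<lambda>k. y $ k) in cspan n {col M 0, col M 1})"

text \<open>
  The matrix \<open>psi_mat n S y\<close> is unipotent lower triangular with polynomial entries, so
  \<open>sequence_map n S\<close> is a morphism from all of affine space to the Grassmannian.  It is birational
  if it has a rational inverse \<open>g\<close>, given by regular functions on a nonempty open set \<open>V\<close>.
\<close>

definition birational_sequence :: "nat \<Rightarrow> root list \<Rightarrow> bool"
  where "birational_sequence n S \<longleftrightarrow>
    set S \<subseteq> pairs n \<and> length S = 2 * (n - 2) \<and>
    (\<exists>V g. zariski_open_gr n V \<and> V \<noteq> {} \<and>
      (\<forall>W \<in> V. g W \<in> carrier_vec (2 * (n - 2))) \<and>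
      (\<forall>k < 2 * (n - 2). regular_on_gr n V (\<lambda>W. g W $ k)) \<and>
      (\<forall>W \<in> V. sequence_map n S (g W) = W) \<and>
      (\<forall>y \<in> carrier_vec (2 * (n - 2)). sequence_map n S y \<in> V \<longrightarrow> g (sequence_map n S y) = y))"

definition iterated_indices :: "nat \<Rightarrow> (nat \<Rightarrow> nat) \<Rightarrow> (nat \<Rightarrow> nat) \<Rightarrow> bool"
  where "iterated_indices n i j \<longleftrightarrow>
    (\<forall>l \<in> {3..n}. i l \<in> {1..l - 1} \<and> j l \<in> {1..l - 1} \<and> i l \<noteq> j l)"

definition iterated_sequence :: "nat \<Rightarrow> (nat \<Rightarrow> nat) \<Rightarrow> (nat \<Rightarrow> nat) \<Rightarrow> root list"
  where "iterated_sequence n i j = concat (map (\<lambda>l. [(i l, l), (j l, l)]) (rev [3..<Suc n]))"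

section \<open>The valuation and its associated graded algebra\<close>

definition height :: "root \<Rightarrow> int"
  where "height \<beta> = int (snd \<beta>) - int (fst \<beta>)"

definition Psi :: "root list \<Rightarrow> (nat \<Rightarrow>\<^sub>0 int) \<Rightarrow> int"
  where "Psi S a = (\<Sum>k < length S. Poly_Mapping.lookup a k * height (S ! k))"

text \<open>
  The library order on \<^typ>\<open>nat \<Rightarrow>\<^sub>0 int\<close> is the lexicographic one: \<open>b < a\<close> iff \<open>b k < a k\<close> at
  the first index \<open>k\<close> where \<open>a\<close> and \<open>b\<close> differ.
\<close>

definition prec :: "root list \<Rightarrow> (nat \<Rightarrow>\<^sub>0 int) \<Rightarrow> (nat \<Rightarrow>\<^sub>0 int) \<Rightarrow> bool"
  where "prec S a b \<longleftrightarrow> Psi S a < Psi S b \<or> Psi S a = Psi S b \<and> b < a"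

definition valuation_poly :: "root list \<Rightarrow> nat cpoly \<Rightarrow> nat \<Rightarrow>\<^sub>0 int"
  where "valuation_poly S g =
    (let E = Poly_Mapping.map int ` Poly_Mapping.keys g
     in THE u. u \<in> E \<and> (\<forall>v \<in> E. u = v \<or> prec S u v))"

definition psi_pullback :: "nat \<Rightarrow> root list \<Rightarrow> ppoly \<Rightarrow> nat cpoly"
  where "psi_pullback n S f = poly_subst const_poly (psi_minor n S var_poly) f"

text \<open>
  An element of the Pluecker algebra is a coset, on which the pullback is constant because the
  minors satisfy the Pluecker relations.
\<close>

definition valuation :: "nat \<Rightarrow> root list \<Rightarrow> ppoly set \<Rightarrow> nat \<Rightarrow>\<^sub>0 int"
  where "valuation n S X = valuation_poly S (the_elem (psi_pullback n S ` X))"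

definition filt_ge :: "nat \<Rightarrow> root list \<Rightarrow> nat \<times> (nat \<Rightarrow>\<^sub>0 int) \<Rightarrow> ppoly set set"
  where "filt_ge n S = (\<lambda>(m, a).
    {f \<in> plucker_graded_part n m - {\<zero>\<^bsub>plucker_alg n\<^esub>}.
       valuation n S f = a \<or> prec S a (valuation n S f)} \<union> {\<zero>\<^bsub>plucker_alg n\<^esub>})"

definition filt_gt :: "nat \<Rightarrow> root list \<Rightarrow> nat \<times> (nat \<Rightarrow>\<^sub>0 int) \<Rightarrow> ppoly set set"
  where "filt_gt n S = (\<lambda>(m, a).
    {f \<in> plucker_graded_part n m - {\<zero>\<^bsub>plucker_alg n\<^esub>}.
       prec S a (valuation n S f)} \<union> {\<zero>\<^bsub>plucker_alg n\<^esub>})"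

definition gr_index :: "nat \<Rightarrow> (nat \<times> (nat \<Rightarrow>\<^sub>0 int)) set"
  where "gr_index n = UNIV \<times> {a. Poly_Mapping.keys a \<subseteq> {..<2 * (n - 2)}}"

definition gr_component ::
    "nat \<Rightarrow> root list \<Rightarrow> nat \<times> (nat \<Rightarrow>\<^sub>0 int) \<Rightarrow> ppoly set set monoid"
  where "gr_component n S p =
    (add_monoid (plucker_alg n)\<lparr>carrier := filt_ge n S p\<rparr>) Mod filt_gt n S p"

definition gr_support ::
    "nat \<Rightarrow> root list \<Rightarrow> (nat \<times> (nat \<Rightarrow>\<^sub>0 int) \<Rightarrow> ppoly set set) \<Rightarrow> (nat \<times> (nat \<Rightarrow>\<^sub>0 int)) set"
  where "gr_support n S X = {p \<in> gr_index n. X p \<noteq> \<one>\<^bsub>gr_component n S p\<^esub>}"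

text \<open>
  The additive group is the direct sum of the components.  The product of the class of \<open>f\<close> in
  degree \<open>p\<close> with the class of \<open>g\<close> in degree \<open>q\<close> is the class of \<open>f g\<close> in degree \<open>p + q\<close>.
\<close>

definition gr_class_mult ::
    "nat \<Rightarrow> root list \<Rightarrow> nat \<times> (nat \<Rightarrow>\<^sub>0 int) \<Rightarrow> ppoly set set \<Rightarrow> ppoly set set \<Rightarrow> ppoly set set"
  where "gr_class_mult n S r C D =
    (\<Union>f\<in>C. \<Union>g\<in>D. filt_gt n S r +>\<^bsub>plucker_alg n\<^esub> (f \<otimes>\<^bsub>plucker_alg n\<^esub> g))"

definition gr_mult ::
    "nat \<Rightarrow> root list \<Rightarrow> (nat \<times> (nat \<Rightarrow>\<^sub>0 int) \<Rightarrow> ppoly set set) \<Rightarrow>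
     (nat \<times> (nat \<Rightarrow>\<^sub>0 int) \<Rightarrow> ppoly set set) \<Rightarrow> nat \<times> (nat \<Rightarrow>\<^sub>0 int) \<Rightarrow> ppoly set set"
  where "gr_mult n S X Y = (\<lambda>r \<in> gr_index n.
    finprod (gr_component n S r) (\<lambda>(p, q). gr_class_mult n S r (X p) (Y q))
      {(p, q). p \<in> gr_support n S X \<and> q \<in> gr_support n S Y \<and> p + q = r})"

definition gr_alg ::
    "nat \<Rightarrow> root list \<Rightarrow> (complex, nat \<times> (nat \<Rightarrow>\<^sub>0 int) \<Rightarrow> ppoly set set) module"
  where "gr_alg n S = (let G = sum_group (gr_index n) (gr_component n S) in
    \<lparr>carrier = carrier G,
     mult = gr_mult n S,
     one = (\<lambda>r \<in> gr_index n.
       if r = 0 then filt_gt n S r +>\<^bsub>plucker_alg n\<^esub> \<one>\<^bsub>plucker_alg n\<^esub>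
       else \<one>\<^bsub>gr_component n S r\<^esub>),
     zero = \<one>\<^bsub>G\<^esub>,
     add = (\<otimes>\<^bsub>G\<^esub>),
     smult = (\<lambda>c X. \<lambda>r \<in> gr_index n.
       \<Union>f \<in> X r. filt_gt n S r +>\<^bsub>plucker_alg n\<^esub> (c \<odot>\<^bsub>plucker_alg n\<^esub> f))\<rparr>)"

section \<open>The tropical Grassmannian\<close>

type_synonym weight = "nat \<times> nat \<Rightarrow>\<^sub>0 real"

definition weights :: "nat \<Rightarrow> weight set"
  where "weights n = {w. Poly_Mapping.keys w \<subseteq> pairs n}"

definition weight_of :: "weight \<Rightarrow> (nat \<times> nat \<Rightarrow>\<^sub>0 nat) \<Rightarrow> real"
  where "weight_of w u =
    (\<Sum>x \<in> Poly_Mapping.keys u. Poly_Mapping.lookup w x * real (Poly_Mapping.lookup u x))"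

definition initial_form :: "weight \<Rightarrow> ppoly \<Rightarrow> ppoly"
  where "initial_form w f =
    (\<Sum>u \<in> {u \<in> Poly_Mapping.keys f. \<forall>v \<in> Poly_Mapping.keys f. weight_of w u \<le> weight_of w v}.
       Poly_Mapping.single u (Poly_Mapping.lookup f u))"

definition initial_ideal :: "nat \<Rightarrow> weight \<Rightarrow> ppoly set"
  where "initial_ideal n w = Idl\<^bsub>plucker_ring n\<^esub> (initial_form w ` plucker_ideal n)"

definition trop_gr :: "nat \<Rightarrow> weight set"
  where "trop_gr n = {w \<in> weights n. \<forall>u. Poly_Mapping.single u 1 \<notin> initial_ideal n w}"

text \<open>
  A cone of the fan is the closure of a set of weights with a common initial ideal; the topology
  on \<^typ>\<open>weight\<close> induces the Euclidean one on \<open>weights n\<close>.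
\<close>

definition trop_cones :: "nat \<Rightarrow> weight set set"
  where "trop_cones n =
    (\<lambda>w. closure {v \<in> weights n. initial_ideal n v = initial_ideal n w}) ` trop_gr n"

definition maximal_cones :: "nat \<Rightarrow> weight set set"
  where "maximal_cones n =
    {C \<in> trop_cones n. \<forall>D \<in> trop_cones n. C \<subseteq> D \<longrightarrow> C = D}"

definition cone_ideal :: "nat \<Rightarrow> weight set \<Rightarrow> ppoly set"
  where "cone_ideal n C = initial_ideal n (SOME w. w \<in> rel_interior C)"

definition prime_cone :: "nat \<Rightarrow> weight set \<Rightarrow> bool"
  where "prime_cone n C \<longleftrightarrow> primeideal (cone_ideal n C) (plucker_ring n)"

section \<open>Labeled trees\<close>

text \<open>
  A tree is given by its set of edges, an edge being a two-element set of vertices.  The leaf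
  labeled \<open>i\<close> is \<open>Leaf i\<close>.
\<close>

datatype vertex = Leaf nat | Inner nat

definition valency :: "vertex set set \<Rightarrow> vertex \<Rightarrow> nat"
  where "valency T x = card {e \<in> T. x \<in> e}"

definition internal_edges :: "vertex set set \<Rightarrow> vertex set set"
  where "internal_edges T = {e \<in> T. \<forall>x \<in> e. valency T x \<noteq> 1}"

definition path_edges :: "vertex list \<Rightarrow> vertex set set"
  where "path_edges p = {{p ! k, p ! Suc k} | k. Suc k < length p}"

definition tree_path :: "vertex set set \<Rightarrow> vertex \<Rightarrow> vertex \<Rightarrow> vertex list"
  where "tree_path T x y = (THE p. p \<noteq> [] \<and> distinct p \<and> hd p = x \<and> last p = y \<and>
    path_edges p \<subseteq> T)"

definition tree_weight :: "nat \<Rightarrow> vertex set set \<Rightarrow> weight"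
  where "tree_weight n T = (\<Sum>(i, j) \<in> pairs n. Poly_Mapping.single (i, j)
    (- real (card (internal_edges T \<inter> path_edges (tree_path T (Leaf i) (Leaf j))))))"

definition tree_cone :: "nat \<Rightarrow> vertex set set \<Rightarrow> weight set"
  where "tree_cone n T = (THE C. C \<in> maximal_cones n \<and> tree_weight n T \<in> rel_interior C)"

text \<open>Subdivide the edge at leaf \<open>a\<close> and attach a new leaf \<open>l\<close> at the new vertex \<open>Inner l\<close>.\<close>

definition attach_leaf :: "nat \<Rightarrow> nat \<Rightarrow> vertex set set \<Rightarrow> vertex set set"
  where "attach_leaf a l T = (let x = (THE x. {x, Leaf a} \<in> T) in
    T - {{x, Leaf a}} \<union> {{x, Inner l}, {Inner l, Leaf a}, {Inner l, Leaf l}})"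

definition sequence_tree :: "nat \<Rightarrow> (nat \<Rightarrow> nat) \<Rightarrow> vertex set set"
  where "sequence_tree n i = fold (\<lambda>l. attach_leaf (i l) l) [4..<Suc n]
    {{Inner 3, Leaf 1}, {Inner 3, Leaf 2}, {Inner 3, Leaf 3}}"

definition sequence_cone :: "nat \<Rightarrow> (nat \<Rightarrow> nat) \<Rightarrow> weight set"
  where "sequence_cone n i = tree_cone n (sequence_tree n i)"

end

theory Submission
  imports Defs "HOL-Library.Multiset"
begin

text \<open>
  Fix an iterated sequence. The minors of \<open>\<psi>\<^sub>S(y)\<close> satisfy
  \<open>p(k, l) = x\<^sub>l p(k, i\<^sub>l) + z\<^sub>l p(k, j\<^sub>l)\<close> for \<open>k < l\<close>, where \<open>x\<^sub>l\<close> and \<open>z\<^sub>l\<close> are the variables of the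
  two roots that end in \<open>l\<close>. If \<open>k = i\<^sub>l\<close>, the first summand vanishes. Otherwise it dominates, for the
  order of the valuation as well as for suitable weights of the variables. Hence every minor has a
  leading term \<open>sg k l\<close> times \<open>y\<close> to the power \<open>E k l\<close>, given by a recursion (\<open>minor_lookup\<close>).

  Replacing every Pluecker coordinate by its leading term, with an additional variable that records
  the degree, gives a homomorphism \<open>phi\<close> onto a semigroup algebra. Its kernel is a toric ideal, and the
  theorem says that both algebras in it are the quotient by this ideal. The key to both is
  \<open>fibre_connected\<close>: monomials with the same image under \<open>phi\<close> are connected by exchanges of
  \<open>p(p, r) p(q, s)\<close> with \<open>p(p, s) p(q, r)\<close>, where \<open>pq|rs\<close> is a split of the tree of \<open>S\<close>. Such an exchange
  is a Pluecker relation up to the third term \<open>p(p, q) p(r, s)\<close>, which is of higher order.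

  For a weight in the interior of the cone of the tree the exchanges are therefore initial forms of
  Pluecker relations. They generate the kernel of \<open>phi\<close>, and the kernel contains every initial form,
  because the lowest part of a polynomial that vanishes on the parametrization vanishes on the lowest
  parts of the coordinates (\<open>initial_ideal_open_cone\<close>). For the valuation, an exchange rewrites a
  polynomial modulo the Pluecker ideal into one in which the leading terms no longer cancel
  (\<open>straightening\<close>). So all values come from monomials, every component of the graded algebra
  is at most one-dimensional, and the graded algebra is the semigroup algebra (\<open>to_gr_iso\<close>).

  A point of the tropical Grassmannian satisfies the four point condition, so it has a cherry.
  Removing one leaf of the cherry and repeating exhibits, up to a relabeling \<open>\<sigma>\<close> of the leaves, an
  iterated sequence whose closed cone contains the point (\<open>trop_labeled\<close>). Hence the maximal cones
  are the relabeled cones of iterated sequences (\<open>maximal_cone_labeled\<close>). The semigroup does not see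
  the relabeling. This gives the converse, because the parameters of an iterated sequence can be
  recovered from a generic plane as quotients of Pluecker coordinates (\<open>birational_iterated_sequence\<close>).
\<close>

section \<open>Polynomials as finitely supported functions\<close>

abbreviation lookup :: "('a \<Rightarrow>\<^sub>0 'b::zero) \<Rightarrow> 'a \<Rightarrow> 'b"
  where "lookup \<equiv> Poly_Mapping.lookup"

abbreviation keys :: "('a \<Rightarrow>\<^sub>0 'b::zero) \<Rightarrow> 'a set"
  where "keys \<equiv> Poly_Mapping.keys"

abbreviation single :: "'a \<Rightarrow> 'b \<Rightarrow> 'a \<Rightarrow>\<^sub>0 'b::zero"
  where "single \<equiv> Poly_Mapping.single"

lemma sum_of_terms: "(\<Sum>u\<in>keys f. single u (lookup f u)) = f"
proof (rule poly_mapping_eqI)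
  fix k
  have "lookup (\<Sum>u\<in>keys f. single u (lookup f u)) k
      = (\<Sum>u\<in>keys f. if u = k then lookup f u else 0)"
    by (simp add: lookup_sum lookup_single when_def)
  also have "\<dots> = lookup f k"
    by (simp add: in_keys_iff)
  finally show "lookup (\<Sum>u\<in>keys f. single u (lookup f u)) k = lookup f k" .
qed

lemma keys_sum_subset: "keys (sum f A) \<subseteq> (\<Union>x\<in>A. keys (f x))"
  by (induction A rule: infinite_finite_induct) (auto dest!: set_mp[OF keys_add])

lemma keys_diff_subset: "keys (f - g :: 'a \<Rightarrow>\<^sub>0 'b::ab_group_add) \<subseteq> keys f \<union> keys g"
  by (auto simp: in_keys_iff lookup_minus)

lemma keys_minus [simp]: "keys (- f :: 'a \<Rightarrow>\<^sub>0 'b::ab_group_add) = keys f"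
  by (auto simp: in_keys_iff)

lemma keys_nat_add: "keys (u + v :: 'a \<Rightarrow>\<^sub>0 nat) = keys u \<union> keys v"
  by (auto simp: in_keys_iff lookup_add)

text \<open>
  Exponents of polynomials are built up one variable at a time, which turns statements about monomials
  into statements about multiplication by a variable.
\<close>

lemma exponent_induct [consumes 1, case_names zero add]:
  fixes u :: "'v \<Rightarrow>\<^sub>0 nat"
  assumes "keys u \<subseteq> V"
    and "P 0" and step: "\<And>u x. keys u \<subseteq> V \<Longrightarrow> x \<in> V \<Longrightarrow> P u \<Longrightarrow> P (single x 1 + u)"
  shows "P u"
  using assms(1)
proof (induction "\<Sum>x\<in>keys u. lookup u x" arbitrary: u rule: less_induct)
  case less
  show ?case
  proof (cases "u = 0")
    case True
    then show ?thesis using assms(2) by simp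
  next
    case False
    then obtain x where x: "x \<in> keys u"
      by (metis all_not_in_conv in_keys_iff lookup_zero poly_mapping_eqI)
    define v where "v = u - single x 1"
    have lv: "lookup v y = lookup u y - (if x = y then 1 else 0)" for y
      by (simp add: v_def lookup_minus lookup_single when_def)
    have u: "u = single x 1 + v"
      using x by (intro poly_mapping_eqI) (auto simp: lookup_add lv lookup_single when_def in_keys_iff)
    have kv: "keys v \<subseteq> keys u" by (auto simp: in_keys_iff lv)
    have "(\<Sum>y\<in>keys v. lookup v y) = (\<Sum>y\<in>keys u. lookup v y)"
      by (rule sum.mono_neutral_left) (use kv in \<open>auto simp: in_keys_iff\<close>)
    also have "\<dots> < (\<Sum>y\<in>keys u. lookup u y)"
      by (rule sum_strict_mono_ex1) (use x in \<open>auto simp: lv in_keys_iff\<close>)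
    finally have "P v" using less.hyps kv less.prems by blast
    then show ?thesis using step[of v x] u x kv less.prems by auto
  qed
qed

definition mono_eval :: "('v \<Rightarrow> 'b::comm_ring_1) \<Rightarrow> ('v \<Rightarrow>\<^sub>0 nat) \<Rightarrow> 'b"
  where "mono_eval s u = (\<Prod>x\<in>keys u. s x ^ lookup u x)"

lemma mono_eval_superset:
  assumes "finite A" "keys u \<subseteq> A"
  shows "mono_eval s u = (\<Prod>x\<in>A. s x ^ lookup u x)"
  unfolding mono_eval_def
  by (rule prod.mono_neutral_left) (use assms in \<open>auto simp: in_keys_iff\<close>)

lemma mono_eval_add: "mono_eval s (u + v) = mono_eval s u * mono_eval s v"
proof -
  let ?A = "keys u \<union> keys v"
  have "mono_eval s (u + v) = (\<Prod>x\<in>?A. s x ^ lookup (u + v) x)"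
    by (rule mono_eval_superset) (auto simp: keys_nat_add)
  also have "\<dots> = (\<Prod>x\<in>?A. s x ^ lookup u x) * (\<Prod>x\<in>?A. s x ^ lookup v x)"
    by (simp add: lookup_add power_add prod.distrib)
  also have "\<dots> = mono_eval s u * mono_eval s v"
    by (simp add: mono_eval_superset[of ?A])
  finally show ?thesis .
qed

lemma mono_eval_zero [simp]: "mono_eval s 0 = 1"
  by (simp add: mono_eval_def)

lemma mono_eval_single [simp]: "mono_eval s (single x k) = s x ^ k"
  by (simp add: mono_eval_def)

text \<open>
  The substitutions that are used differ in their coefficients: complex numbers, constant polynomials
  and constants of the semigroup algebra. All that matters is that they come from a ring homomorphism.
\<close>

definition coeff_hom :: "(complex \<Rightarrow> 'b::comm_ring_1) \<Rightarrow> bool"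
  where "coeff_hom c \<longleftrightarrow> c 0 = 0 \<and> c 1 = 1 \<and>
    (\<forall>a b. c (a + b) = c a + c b) \<and> (\<forall>a b. c (a * b) = c a * c b)"

lemma coeff_hom_id: "coeff_hom (\<lambda>c. c)"
  by (simp add: coeff_hom_def)

lemma coeff_hom_single: "coeff_hom (single (0::'e::comm_monoid_add))"
  by (simp add: coeff_hom_def single_add mult_single)

lemma coeff_hom_const_poly: "coeff_hom const_poly"
  using coeff_hom_single by (simp add: const_poly_def[abs_def])

context
  fixes c :: "complex \<Rightarrow> 'b::comm_ring_1"
  assumes c: "coeff_hom c"
begin

lemma poly_subst_superset:
  assumes "finite A" "keys f \<subseteq> A"
  shows "poly_subst c s f = (\<Sum>u\<in>A. c (lookup f u) * mono_eval s u)"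
  unfolding poly_subst_def mono_eval_def
  by (rule sum.mono_neutral_left)
    (use assms c in \<open>auto simp: in_keys_iff coeff_hom_def\<close>)

lemma poly_subst_keys: "poly_subst c s f = (\<Sum>u\<in>keys f. c (lookup f u) * mono_eval s u)"
  by (rule poly_subst_superset) auto

lemma poly_subst_add: "poly_subst c s (f + g) = poly_subst c s f + poly_subst c s g"
proof -
  let ?A = "keys f \<union> keys g"
  have "poly_subst c s (f + g) = (\<Sum>u\<in>?A. c (lookup (f + g) u) * mono_eval s u)"
    by (rule poly_subst_superset) (auto dest!: set_mp[OF keys_add])
  also have "\<dots> = (\<Sum>u\<in>?A. c (lookup f u) * mono_eval s u) + (\<Sum>u\<in>?A. c (lookup g u) * mono_eval s u)"
    using c by (simp add: lookup_add coeff_hom_def distrib_right sum.distrib)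
  also have "\<dots> = poly_subst c s f + poly_subst c s g"
    by (simp add: poly_subst_superset[of ?A])
  finally show ?thesis .
qed

lemma poly_subst_zero [simp]: "poly_subst c s 0 = 0"
  by (simp add: poly_subst_keys)

lemma poly_subst_sum: "poly_subst c s (sum f A) = (\<Sum>x\<in>A. poly_subst c s (f x))"
  by (induction A rule: infinite_finite_induct) (auto simp: poly_subst_add)

lemma poly_subst_uminus: "poly_subst c s (- f) = - poly_subst c s f"
  using poly_subst_add[of s f "- f"] by (simp add: eq_neg_iff_add_eq_0 add.commute)

lemma poly_subst_diff: "poly_subst c s (f - g) = poly_subst c s f - poly_subst c s g"
  using poly_subst_add[of s f "- g"] by (simp add: poly_subst_uminus)

lemma poly_subst_single: "poly_subst c s (single u a) = c a * mono_eval s u"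
  using c by (cases "a = 0") (auto simp: poly_subst_keys coeff_hom_def)

lemma poly_subst_const: "poly_subst c s (const_poly a) = c a"
  by (simp add: const_poly_def poly_subst_single)

lemma poly_subst_one [simp]: "poly_subst c s 1 = 1"
  using poly_subst_const[of s 1] c by (simp add: const_poly_def coeff_hom_def)

lemma poly_subst_var: "poly_subst c s (var_poly x) = s x"
  using c by (simp add: var_poly_def poly_subst_single coeff_hom_def)

lemma poly_subst_mult: "poly_subst c s (f * g) = poly_subst c s f * poly_subst c s g"
proof -
  have "f * g = (\<Sum>u\<in>keys f. single u (lookup f u)) * (\<Sum>v\<in>keys g. single v (lookup g v))"
    by (simp add: sum_of_terms)
  also have "\<dots> = (\<Sum>u\<in>keys f. \<Sum>v\<in>keys g. single (u + v) (lookup f u * lookup g v))"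
    by (simp add: sum_product mult_single)
  finally have "poly_subst c s (f * g) =
      (\<Sum>u\<in>keys f. \<Sum>v\<in>keys g. c (lookup f u * lookup g v) * mono_eval s (u + v))"
    by (simp add: poly_subst_sum poly_subst_single)
  also have "\<dots> = (\<Sum>u\<in>keys f. \<Sum>v\<in>keys g.
      (c (lookup f u) * mono_eval s u) * (c (lookup g v) * mono_eval s v))"
    using c by (intro sum.cong refl) (simp add: mono_eval_add coeff_hom_def algebra_simps)
  also have "\<dots> = poly_subst c s f * poly_subst c s g"
    by (simp add: poly_subst_keys sum_product)
  finally show ?thesis .
qed

lemma poly_subst_power: "poly_subst c s (f ^ k) = poly_subst c s f ^ k"
  by (induction k) (auto simp: poly_subst_mult)

end

lemma const_poly_mult_single: "const_poly a * single u b = single u (a * b)"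
  by (simp add: const_poly_def mult_single)

lemma lookup_const_poly_mult: "lookup (const_poly a * f) u = a * lookup f u"
proof -
  have "const_poly a * f = (\<Sum>u\<in>keys f. single u (a * lookup f u))"
    by (subst (1) sum_of_terms[of f, symmetric]) (simp add: sum_distrib_left const_poly_mult_single)
  then have "lookup (const_poly a * f) u = (\<Sum>v\<in>keys f. if v = u then a * lookup f v else 0)"
    by (simp add: lookup_sum lookup_single when_def)
  then show ?thesis by (simp add: in_keys_iff)
qed

lemma keys_const_poly_mult: "keys (const_poly a * f) \<subseteq> keys f"
  by (auto simp: in_keys_iff lookup_const_poly_mult)

subsection \<open>Algebras of polynomials\<close>

lemma carrier_poly_alg: "f \<in> carrier (poly_alg V) \<longleftrightarrow> (\<forall>u\<in>keys f. keys u \<subseteq> V)"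
  by (simp add: poly_alg_def)

lemma poly_alg_simps [simp]:
  "mult (poly_alg V) = (*)" "one (poly_alg V) = 1" "zero (poly_alg V) = 0"
  "add (poly_alg V) = (+)" "smult (poly_alg V) c f = const_poly c * f"
  by (simp_all add: poly_alg_def)

lemma poly_alg_zero_closed [simp]: "0 \<in> carrier (poly_alg V)"
  and poly_alg_one_closed [simp]: "1 \<in> carrier (poly_alg V)"
  by (auto simp: carrier_poly_alg)

lemma poly_alg_add_closed: "f \<in> carrier (poly_alg V) \<Longrightarrow> g \<in> carrier (poly_alg V) \<Longrightarrow>
    f + g \<in> carrier (poly_alg V)"
  unfolding carrier_poly_alg using keys_add[of f g] by blast

lemma poly_alg_minus_closed: "f \<in> carrier (poly_alg V) \<Longrightarrow> - f \<in> carrier (poly_alg V)"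
  unfolding carrier_poly_alg by simp

lemma poly_alg_diff_closed: "f \<in> carrier (poly_alg V) \<Longrightarrow> g \<in> carrier (poly_alg V) \<Longrightarrow>
    f - g \<in> carrier (poly_alg V)"
  unfolding carrier_poly_alg using keys_diff_subset[of f g] by blast

lemma poly_alg_mult_closed: "f \<in> carrier (poly_alg V) \<Longrightarrow> g \<in> carrier (poly_alg V) \<Longrightarrow>
    f * g \<in> carrier (poly_alg V)"
  unfolding carrier_poly_alg using keys_mult[of f g] by (fastforce simp: keys_nat_add)

lemma poly_alg_const_closed: "const_poly c \<in> carrier (poly_alg V)"
  by (simp add: carrier_poly_alg const_poly_def)

lemma poly_alg_single_closed: "keys u \<subseteq> V \<Longrightarrow> single u a \<in> carrier (poly_alg V)"
  by (simp add: carrier_poly_alg)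

lemma poly_alg_var_closed: "x \<in> V \<Longrightarrow> var_poly x \<in> carrier (poly_alg V)"
  by (simp add: carrier_poly_alg var_poly_def)

lemma poly_alg_sum_closed:
  "(\<And>x. x \<in> A \<Longrightarrow> f x \<in> carrier (poly_alg V)) \<Longrightarrow> sum f A \<in> carrier (poly_alg V)"
  by (induction A rule: infinite_finite_induct) (auto intro: poly_alg_add_closed)

lemmas poly_alg_closed = poly_alg_add_closed poly_alg_minus_closed poly_alg_diff_closed
  poly_alg_mult_closed poly_alg_const_closed poly_alg_single_closed poly_alg_var_closed
  poly_alg_sum_closed

lemma cring_poly_alg: "cring (poly_alg V)"
proof (rule cringI)
  show "abelian_group (poly_alg V)"
  proof (rule abelian_groupI)
    fix x assume "x \<in> carrier (poly_alg V)"
    then show "\<exists>y\<in>carrier (poly_alg V). y \<oplus>\<^bsub>poly_alg V\<^esub> x = \<zero>\<^bsub>poly_alg V\<^esub>"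
      by (intro bexI[of _ "- x"]) (auto intro: poly_alg_closed)
  qed (auto intro: poly_alg_closed simp: add_ac)
  show "Group.comm_monoid (poly_alg V)"
    by (rule comm_monoidI) (auto intro: poly_alg_closed simp: mult_ac)
qed (auto simp: distrib_right)

lemma poly_alg_a_inv [simp]: "f \<in> carrier (poly_alg V) \<Longrightarrow> \<ominus>\<^bsub>poly_alg V\<^esub> f = - f"
proof -
  assume f: "f \<in> carrier (poly_alg V)"
  interpret cring "poly_alg V" by (rule cring_poly_alg)
  show ?thesis using f by (intro minus_equality[symmetric, THEN sym]) (auto intro: poly_alg_closed)
qed

lemma poly_alg_coset: "I +>\<^bsub>poly_alg V\<^esub> f = {h + f | h. h \<in> I}"
  by (auto simp: a_r_coset_def r_coset_def)

locale poly_ideal =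
  fixes V :: "'v set" and I :: "'v cpoly set"
  assumes ideal: "ideal I (poly_alg V)"
begin

interpretation I: ideal I "poly_alg V" by (rule ideal)

lemma subset: "f \<in> I \<Longrightarrow> f \<in> carrier (poly_alg V)"
  using I.Icarr .

lemma zero_mem: "0 \<in> I" using additive_subgroup.zero_closed[OF I.additive_subgroup_axioms] by simp

lemma add_mem: "f \<in> I \<Longrightarrow> g \<in> I \<Longrightarrow> f + g \<in> I"
  using additive_subgroup.a_closed[OF I.additive_subgroup_axioms] by simp

lemma mult_mem: "f \<in> I \<Longrightarrow> g \<in> carrier (poly_alg V) \<Longrightarrow> f * g \<in> I"
  using I.I_r_closed by simp

lemma mult_mem': "f \<in> I \<Longrightarrow> g \<in> carrier (poly_alg V) \<Longrightarrow> g * f \<in> I"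
  using I.I_l_closed by simp

lemma minus_mem: "f \<in> I \<Longrightarrow> - f \<in> I"
  using mult_mem[of f "const_poly (-1)"] by (simp add: poly_alg_closed const_poly_def single_uminus)

lemma diff_mem: "f \<in> I \<Longrightarrow> g \<in> I \<Longrightarrow> f - g \<in> I"
  using add_mem[of f "- g"] minus_mem by simp

lemma sum_mem: "(\<And>x. x \<in> A \<Longrightarrow> f x \<in> I) \<Longrightarrow> sum f A \<in> I"
  by (induction A rule: infinite_finite_induct) (auto intro: add_mem zero_mem)

lemma coset_mem: "g \<in> I +>\<^bsub>poly_alg V\<^esub> f \<longleftrightarrow> g - f \<in> I"
  by (auto simp: poly_alg_coset) (metis diff_add_cancel)

lemma coset_eq_iff: "I +>\<^bsub>poly_alg V\<^esub> f = I +>\<^bsub>poly_alg V\<^esub> g \<longleftrightarrow> f - g \<in> I"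
proof
  assume "I +>\<^bsub>poly_alg V\<^esub> f = I +>\<^bsub>poly_alg V\<^esub> g"
  moreover have "f \<in> I +>\<^bsub>poly_alg V\<^esub> f" by (simp add: coset_mem zero_mem)
  ultimately show "f - g \<in> I" by (simp add: coset_mem)
next
  assume *: "f - g \<in> I"
  have "h - f \<in> I \<longleftrightarrow> h - g \<in> I" for h
    using add_mem[OF _ *, of "h - f"] diff_mem[OF _ *, of "h - g"] by auto
  then show "I +>\<^bsub>poly_alg V\<^esub> f = I +>\<^bsub>poly_alg V\<^esub> g"
    by (auto simp: coset_mem)
qed

lemma coset_self: "f \<in> I +>\<^bsub>poly_alg V\<^esub> f"
  by (simp add: coset_mem zero_mem)

lemma coset_zero: "I +>\<^bsub>poly_alg V\<^esub> 0 = I"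
  by (auto simp: coset_mem)

lemma quot_carrier: "carrier (quot_alg (poly_alg V) I) = (\<lambda>f. I +>\<^bsub>poly_alg V\<^esub> f) ` carrier (poly_alg V)"
  by (auto simp: quot_alg_def ring.defs FactRing_def A_RCOSETS_def')

lemma quot_add: "f \<in> carrier (poly_alg V) \<Longrightarrow> g \<in> carrier (poly_alg V) \<Longrightarrow>
  (I +>\<^bsub>poly_alg V\<^esub> f) \<oplus>\<^bsub>quot_alg (poly_alg V) I\<^esub> (I +>\<^bsub>poly_alg V\<^esub> g) = I +>\<^bsub>poly_alg V\<^esub> (f + g)"
  using I.a_rcos_sum by (simp add: quot_alg_def ring.defs FactRing_def)

lemma quot_mult: "f \<in> carrier (poly_alg V) \<Longrightarrow> g \<in> carrier (poly_alg V) \<Longrightarrow>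
  (I +>\<^bsub>poly_alg V\<^esub> f) \<otimes>\<^bsub>quot_alg (poly_alg V) I\<^esub> (I +>\<^bsub>poly_alg V\<^esub> g) = I +>\<^bsub>poly_alg V\<^esub> (f * g)"
  using I.rcoset_mult_add by (simp add: quot_alg_def ring.defs FactRing_def)

lemma quot_one: "\<one>\<^bsub>quot_alg (poly_alg V) I\<^esub> = I +>\<^bsub>poly_alg V\<^esub> 1"
  by (simp add: quot_alg_def ring.defs FactRing_def)

lemma quot_zero: "\<zero>\<^bsub>quot_alg (poly_alg V) I\<^esub> = I"
  by (simp add: quot_alg_def ring.defs FactRing_def)

lemma quot_smult:
  assumes "f \<in> carrier (poly_alg V)"
  shows "c \<odot>\<^bsub>quot_alg (poly_alg V) I\<^esub> (I +>\<^bsub>poly_alg V\<^esub> f) = I +>\<^bsub>poly_alg V\<^esub> (const_poly c * f)"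
proof -
  have "I +>\<^bsub>poly_alg V\<^esub> (const_poly c * g) = I +>\<^bsub>poly_alg V\<^esub> (const_poly c * f)"
    if "g \<in> I +>\<^bsub>poly_alg V\<^esub> f" for g
    using mult_mem'[of "g - f" "const_poly c"] that
    by (simp add: coset_mem coset_eq_iff poly_alg_closed right_diff_distrib)
  then have "(\<Union>g\<in>I +>\<^bsub>poly_alg V\<^esub> f. I +>\<^bsub>poly_alg V\<^esub> (const_poly c * g))
      = I +>\<^bsub>poly_alg V\<^esub> (const_poly c * f)"
    using coset_self[of f] by blast
  then show ?thesis
    by (simp add: quot_alg_def ring.defs module.defs FactRing_def)
qed

lemma ring_quot: "ring (quot_alg (poly_alg V) I)"
proof -
  interpret Q: ring "poly_alg V Quot I" by (rule I.quotient_is_ring)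
  note eqs = quot_alg_def ring.defs
  show ?thesis
  proof (rule ringI)
    show "abelian_group (quot_alg (poly_alg V) I)"
    proof (rule abelian_groupI)
      fix x assume x: "x \<in> carrier (quot_alg (poly_alg V) I)"
      show "\<exists>y\<in>carrier (quot_alg (poly_alg V) I). y \<oplus>\<^bsub>quot_alg (poly_alg V) I\<^esub> x
          = \<zero>\<^bsub>quot_alg (poly_alg V) I\<^esub>"
        using x Q.a_inv_closed Q.l_neg unfolding eqs by auto
    qed (use Q.a_assoc Q.a_comm Q.add.m_closed in \<open>auto simp: eqs\<close>)
    show "Group.monoid (quot_alg (poly_alg V) I)"
      by (rule monoidI) (use Q.m_assoc in \<open>auto simp: eqs\<close>)
  qed (use Q.l_distr Q.r_distr in \<open>auto simp: eqs\<close>)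
qed

end

section \<open>The combinatorics of an iterated sequence\<close>

text \<open>
  Both the exponent and the sign of the leading term of a minor follow the recursion of the minors.
  At stage \<open>l\<close> the function \<open>fz\<close> handles the pair \<open>(i\<^sub>l, l)\<close>, where only the second summand survives, and
  \<open>fx\<close> the other pairs; \<open>c\<close> is the value at \<open>(1, 2)\<close> and \<open>iv\<close> the effect of reversing a pair.
\<close>

primrec pair_rec :: "('a \<Rightarrow> 'a) \<Rightarrow> 'a \<Rightarrow> (nat \<Rightarrow> 'a \<Rightarrow> 'a) \<Rightarrow> (nat \<Rightarrow> 'a \<Rightarrow> 'a) \<Rightarrow>
    (nat \<Rightarrow> nat) \<Rightarrow> (nat \<Rightarrow> nat) \<Rightarrow> nat \<Rightarrow> nat \<Rightarrow> nat \<Rightarrow> 'a"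
  where
    "pair_rec iv c fx fz i j 0 = (\<lambda>k l. c)"
  | "pair_rec iv c fx fz i j (Suc m) = (\<lambda>k l.
      let prev = pair_rec iv c fx fz i j m;
          new = (\<lambda>k. if k = i (Suc m) then fz (Suc m) (prev (i (Suc m)) (j (Suc m)))
                     else fx (Suc m) (prev k (i (Suc m))))
      in if Suc m < 3 then (if k < l then c else iv c)
         else if l = Suc m then new k
         else if k = Suc m then iv (new l)
         else prev k l)"

lemma pair_rec_stable:
  assumes "k \<le> m" "l \<le> m" "2 \<le> m" "m \<le> m'"
  shows "pair_rec iv c fx fz i j m' k l = pair_rec iv c fx fz i j m k l"
  using assms(4)
proof (induction m' rule: dec_induct)
  case (step m')
  then show ?case using assms by (simp add: Let_def)
qed simp

locale iterated =
  fixes n :: nat and i j :: "nat \<Rightarrow> nat"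
  assumes n: "3 \<le> n" and indices: "iterated_indices n i j"
begin

lemma i_range: "3 \<le> l \<Longrightarrow> l \<le> n \<Longrightarrow> 1 \<le> i l \<and> i l < l"
  and j_range: "3 \<le> l \<Longrightarrow> l \<le> n \<Longrightarrow> 1 \<le> j l \<and> j l < l"
  and i_neq_j: "3 \<le> l \<Longrightarrow> l \<le> n \<Longrightarrow> i l \<noteq> j l"
  using indices unfolding iterated_indices_def by (auto dest!: bspec[of _ _ l])

definition x_var :: "nat \<Rightarrow> nat" where "x_var l = 2 * (n - l)"
definition z_var :: "nat \<Rightarrow> nat" where "z_var l = 2 * (n - l) + 1"

definition E :: "nat \<Rightarrow> nat \<Rightarrow> nat \<Rightarrow>\<^sub>0 nat"
  where "E = pair_rec id 0 (\<lambda>l e. single (x_var l) 1 + e) (\<lambda>l e. single (z_var l) 1 + e) i j n"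

definition sg :: "nat \<Rightarrow> nat \<Rightarrow> complex"
  where "sg = pair_rec uminus 1 (\<lambda>l e. e) (\<lambda>l e. e) i j n"

context
  fixes iv c fx fz and R :: "nat \<Rightarrow> nat \<Rightarrow> 'a"
  defines "R \<equiv> pair_rec iv c fx fz i j n"
  assumes iv: "\<And>a. iv (iv a) = a"
begin

lemma pair_rec_base: "R 1 2 = c" "R 2 1 = iv c"
proof -
  have "R k l = pair_rec iv c fx fz i j 2 k l" if "k \<le> 2" "l \<le> 2" for k l
    unfolding R_def by (rule pair_rec_stable) (use that n in auto)
  then show "R 1 2 = c" "R 2 1 = iv c" by (auto simp: numeral_2_eq_2)
qed

lemma pair_rec_step:
  assumes l: "3 \<le> l" "l \<le> n" and k: "k < l"
  shows "R k l = (if k = i l then fz l (R (i l) (j l)) else fx l (R k (i l)))"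
    and "R l k = iv (R k l)"
proof -
  obtain m where m: "l = Suc m" using l by (cases l) auto
  have A: "R p q = pair_rec iv c fx fz i j l p q" if "p \<le> l" "q \<le> l" for p q
    unfolding R_def by (rule pair_rec_stable) (use that l in auto)
  have B: "R p q = pair_rec iv c fx fz i j m p q" if "p \<le> m" "q \<le> m" for p q
    unfolding R_def by (rule pair_rec_stable) (use that m l in auto)
  have *: "i l \<le> m" "j l \<le> m" "k \<le> m" using i_range[OF l] j_range[OF l] m k by auto
  have new: "R k l = (if k = i l then fz l (pair_rec iv c fx fz i j m (i l) (j l))
      else fx l (pair_rec iv c fx fz i j m k (i l)))"
    using A[of k l] l k m by (simp add: Let_def)
  then show "R k l = (if k = i l then fz l (R (i l) (j l)) else fx l (R k (i l)))"
    using * by (simp add: B)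
  have "R l k = iv (if k = i l then fz l (pair_rec iv c fx fz i j m (i l) (j l))
      else fx l (pair_rec iv c fx fz i j m k (i l)))"
    using A[of l k] l k m by (simp add: Let_def)
  then show "R l k = iv (R k l)" using new by simp
qed

lemma pair_rec_inv:
  assumes "k \<in> {1..n}" "l \<in> {1..n}" "k \<noteq> l"
  shows "R l k = iv (R k l)"
proof -
  have *: "R l k = iv (R k l)" if "1 \<le> k" "k < l" "l \<le> n" for k l
  proof (cases "3 \<le> l")
    case True then show ?thesis using pair_rec_step(2) that by blast
  next
    case False
    then have "k = 1" "l = 2" using that by auto
    then show ?thesis using pair_rec_base by simp
  qed
  show ?thesis
    using *[of k l] *[of l k] assms iv[of "R l k"] by (cases k l rule: linorder_cases) auto
qed

end

lemma E_base: "E 1 2 = 0"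
  using pair_rec_base(1)[of id 0] by (simp add: E_def)

lemma E_sym: "k \<in> {1..n} \<Longrightarrow> l \<in> {1..n} \<Longrightarrow> E k l = E l k"
  by (cases "k = l") (auto simp: E_def pair_rec_inv[where iv = id and k = l and l = k])

lemma E_x: "3 \<le> l \<Longrightarrow> l \<le> n \<Longrightarrow> k < l \<Longrightarrow> k \<noteq> i l \<Longrightarrow> E k l = single (x_var l) 1 + E k (i l)"
  and E_z: "3 \<le> l \<Longrightarrow> l \<le> n \<Longrightarrow> E (i l) l = single (z_var l) 1 + E (i l) (j l)"
  using pair_rec_step(1)[of id l k] pair_rec_step(1)[of id l "i l"] i_range by (auto simp: E_def)

lemma sg_base: "sg 1 2 = 1"
  unfolding sg_def by (rule pair_rec_base) simp

lemma sg_antisym: "k \<in> {1..n} \<Longrightarrow> l \<in> {1..n} \<Longrightarrow> k \<noteq> l \<Longrightarrow> sg l k = - sg k l"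
  unfolding sg_def by (rule pair_rec_inv) simp_all

lemma sg_x: "3 \<le> l \<Longrightarrow> l \<le> n \<Longrightarrow> k < l \<Longrightarrow> k \<noteq> i l \<Longrightarrow> sg k l = sg k (i l)"
  and sg_z: "3 \<le> l \<Longrightarrow> l \<le> n \<Longrightarrow> sg (i l) l = sg (i l) (j l)"
  using i_range by (auto simp: sg_def pair_rec_step(1)[where iv = uminus and k = k and l = l]
      pair_rec_step(1)[where iv = uminus and k = "i l" and l = l])

text \<open>Induction along the construction: every pair of positions \<open>k < l\<close> descends to \<open>(1, 2)\<close>.\<close>

lemma position_induct [consumes 3, case_names base x z]:
  assumes "1 \<le> k" "k < l" "l \<le> n"
    and base: "P 1 2"
    and x: "\<And>k l. 3 \<le> l \<Longrightarrow> l \<le> n \<Longrightarrow> 1 \<le> k \<Longrightarrow> k < l \<Longrightarrow> k \<noteq> i l \<Longrightarrow>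
        (\<And>p q. 1 \<le> p \<Longrightarrow> p < q \<Longrightarrow> q < l \<Longrightarrow> P p q) \<Longrightarrow> P k l"
    and z: "\<And>l. 3 \<le> l \<Longrightarrow> l \<le> n \<Longrightarrow>
        (\<And>p q. 1 \<le> p \<Longrightarrow> p < q \<Longrightarrow> q < l \<Longrightarrow> P p q) \<Longrightarrow> P (i l) l"
  shows "P k l"
  using assms(1-3)
proof (induction l arbitrary: k rule: less_induct)
  case (less l)
  show ?case
  proof (cases "3 \<le> l")
    case True
    then show ?thesis using less x[of l k] z[of l] by (cases "k = i l") auto
  next
    case False
    then have "k = 1" "l = 2" using less.prems by auto
    then show ?thesis using base by (simp add: numeral_2_eq_2)
  qed
qed

lemma sg_values:
  assumes "k \<in> {1..n}" "l \<in> {1..n}" "k \<noteq> l"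
  shows "sg k l = 1 \<or> sg k l = -1"
proof -
  have *: "sg k l = 1 \<or> sg k l = -1" if "1 \<le> k" "k < l" "l \<le> n" for k l
    using that
  proof (induction rule: position_induct)
    case base then show ?case using sg_base by simp
  next
    case (x k l)
    have "sg k (i l) = 1 \<or> sg k (i l) = -1"
    proof (cases k "i l" rule: linorder_cases)
      case less
      then show ?thesis using x(6)[of k "i l"] x(1-5) i_range[of l] by simp
    next
      case greater
      then have "sg (i l) k = 1 \<or> sg (i l) k = -1" "sg k (i l) = - sg (i l) k"
        using x(6)[of "i l" k] x(1-5) i_range[of l] sg_antisym[of "i l" k] by auto
      then show ?thesis by auto
    qed (use x in simp)
    then show ?case using x(1-5) by (simp add: sg_x)
  next
    case (z l)
    have "sg (i l) (j l) = 1 \<or> sg (i l) (j l) = -1"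
    proof (cases "j l" "i l" rule: linorder_cases)
      case greater
      then show ?thesis using z(3)[of "i l" "j l"] z(1-2) i_range[of l] j_range[of l] by simp
    next
      case less
      then have "sg (j l) (i l) = 1 \<or> sg (j l) (i l) = -1" "sg (i l) (j l) = - sg (j l) (i l)"
        using z(3)[of "j l" "i l"] z(1-2) i_range[of l] j_range[of l] sg_antisym[of "j l" "i l"] by auto
      then show ?thesis by auto
    qed (use z i_neq_j in force)
    then show ?case using z(1-2) by (simp add: sg_z)
  qed
  show ?thesis
    using *[of k l] *[of l k] assms sg_antisym[of l k] by (cases k l rule: linorder_cases) auto
qed

lemma sg_square: "k \<in> {1..n} \<Longrightarrow> l \<in> {1..n} \<Longrightarrow> k \<noteq> l \<Longrightarrow> sg k l * sg k l = 1"
  using sg_values by fastforce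

text \<open>
  The exponent of the pair \<open>(k, l)\<close> involves only variables that were introduced up to stage \<open>max k l\<close>,
  so the variables of the last stage can be read off from an exponent sum.
\<close>

lemma keys_E:
  assumes "k \<in> {1..n}" "l \<in> {1..n}" "k \<noteq> l"
  shows "keys (E k l) \<subseteq> {2 * (n - max k l)..<2 * (n - 2)}"
proof -
  have *: "keys (E k l) \<subseteq> {2 * (n - l)..<2 * (n - 2)}" if "1 \<le> k" "k < l" "l \<le> n" for k l
    using that
  proof (induction rule: position_induct)
    case base then show ?case using E_base by simp
  next
    case (x k l)
    have "keys (E k (i l)) \<subseteq> {2 * (n - l)..<2 * (n - 2)}"
    proof (cases k "i l" rule: linorder_cases)
      case less
      then show ?thesis using x(6)[of k "i l"] x(1-5) i_range[of l] by fastforce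
    next
      case greater
      then show ?thesis using x(6)[of "i l" k] x(1-5) i_range[of l] E_sym[of k "i l"] by fastforce
    qed (use x in simp)
    then show ?case using x(1-5) by (auto simp: E_x keys_nat_add x_var_def)
  next
    case (z l)
    have "keys (E (i l) (j l)) \<subseteq> {2 * (n - l)..<2 * (n - 2)}"
    proof (cases "j l" "i l" rule: linorder_cases)
      case less
      then show ?thesis
        using z(3)[of "j l" "i l"] z(1-2) i_range[of l] j_range[of l] E_sym[of "i l" "j l"] by fastforce
    next
      case greater
      then show ?thesis using z(3)[of "i l" "j l"] z(1-2) i_range[of l] j_range[of l] by fastforce
    qed (use z i_neq_j in force)
    then show ?case using z(1-2) by (auto simp: E_z keys_nat_add z_var_def)
  qed
  show ?thesis
    using *[of k l] *[of l k] assms E_sym[of k l] by (cases k l rule: linorder_cases) auto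
qed

subsection \<open>Splits\<close>

text \<open>
  \<open>split p q r s\<close> says that in the tree of the sequence the path from \<open>p\<close> to \<open>q\<close> avoids the path from \<open>r\<close>
  to \<open>s\<close>. The leaf \<open>l\<close> forms a cherry with \<open>i\<^sub>l\<close> when it is attached. So it behaves like \<open>i\<^sub>l\<close> with
  respect to the older leaves, and the cherry is split from all of them.
\<close>

inductive split :: "nat \<Rightarrow> nat \<Rightarrow> nat \<Rightarrow> nat \<Rightarrow> bool"
  where
    cherry: "4 \<le> l \<Longrightarrow> l \<le> n \<Longrightarrow> k \<in> {1..<l} - {i l} \<Longrightarrow> c \<in> {1..<l} - {i l} \<Longrightarrow> k \<noteq> c \<Longrightarrow>
      split (i l) l k c"
  | lift: "split (i l) p q r \<Longrightarrow> 4 \<le> l \<Longrightarrow> l \<le> n \<Longrightarrow> p < l \<Longrightarrow> q < l \<Longrightarrow> r < l \<Longrightarrow> split l p q r"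
  | swap1: "split p q r s \<Longrightarrow> split q p r s"
  | swap2: "split p q r s \<Longrightarrow> split r s p q"

lemma split_distinct: "split p q r s \<Longrightarrow> distinct [p, q, r, s] \<and> {p, q, r, s} \<subseteq> {1..n}"
proof (induction rule: split.induct)
  case (cherry l k c)
  then show ?case using i_range[of l] by auto
qed auto

text \<open>
  A trivalent tree splits any four leaves. If the largest of them is \<open>l\<close>, then either \<open>i\<^sub>l\<close> is among
  the others and forms a cherry with it, or \<open>l\<close> can be replaced by \<open>i\<^sub>l\<close>.
\<close>

lemma split_exists:
  assumes "distinct [p, q, r, s]" "{p, q, r, s} \<subseteq> {1..n}"
  shows "split p q r s \<or> split p r q s \<or> split p s q r"
proof -
  define Q where "Q p q r s \<longleftrightarrow> split p q r s \<or> split p r q s \<or> split p s q r" for p q r s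
  have Q_sym: "Q q p r s = Q p q r s" "Q p r q s = Q p q r s" "Q p q s r = Q p q r s" for p q r s
    unfolding Q_def by (meson swap1 swap2)+
  have "Q p q r s" if "distinct [p, q, r, s]" "{p, q, r, s} \<subseteq> {1..m}" "m \<le> n" for m
    using that
  proof (induction m arbitrary: p q r s)
    case (Suc l)
    have top: "Q p q r (Suc l)" if "distinct [p, q, r, Suc l]" "{p, q, r} \<subseteq> {1..l}" for p q r
    proof -
      have "card {p, q, r} \<le> card {1..l}" by (rule card_mono) (use that in auto)
      then have l: "4 \<le> Suc l" "Suc l \<le> n" using that Suc.prems by auto
      show ?thesis
      proof (cases "i (Suc l) \<in> {p, q, r}")
        case True
        have "split (i (Suc l)) (Suc l) u v"
          if "u \<in> {p, q, r} - {i (Suc l)}" "v \<in> {p, q, r} - {i (Suc l)}" "u \<noteq> v" for u v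
          using cherry[OF l, of u v] that \<open>{p, q, r} \<subseteq> {1..l}\<close> by force
        then show ?thesis
          using True that(1) unfolding Q_def by (auto intro: swap1 swap2)
      next
        case False
        have "Q (i (Suc l)) p q r"
          using Suc.IH[of "i (Suc l)" p q r] False that i_range[of "Suc l"] l by auto
        then have "Q (Suc l) p q r"
          unfolding Q_def using lift[OF _ l] that by force
        then show ?thesis using Q_sym by metis
      qed
    qed
    show ?case
    proof (cases "Suc l \<in> {p, q, r, s}")
      case False
      then have "{p, q, r, s} \<subseteq> {1..l}" using Suc.prems by (auto simp: le_Suc_eq)
      then show ?thesis using Suc by auto
    next
      case True
      then consider "p = Suc l" | "q = Suc l" | "r = Suc l" | "s = Suc l" by auto
      then show ?thesis
      proof cases
        case 1
        have "{q, r, s} \<subseteq> {1..l}" using Suc.prems 1 by (auto simp: le_Suc_eq)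
        then have "Q q r s p" using top[of q r s] Suc.prems 1 by auto
        then show ?thesis by (metis Q_sym)
      next
        case 2
        have "{p, r, s} \<subseteq> {1..l}" using Suc.prems 2 by (auto simp: le_Suc_eq)
        then have "Q p r s q" using top[of p r s] Suc.prems 2 by auto
        then show ?thesis by (metis Q_sym)
      next
        case 3
        have "{p, q, s} \<subseteq> {1..l}" using Suc.prems 3 by (auto simp: le_Suc_eq)
        then have "Q p q s r" using top[of p q s] Suc.prems 3 by auto
        then show ?thesis by (metis Q_sym)
      next
        case 4
        have "{p, q, r} \<subseteq> {1..l}" using Suc.prems 4 by (auto simp: le_Suc_eq)
        then show ?thesis using top[of p q r] Suc.prems 4 by simp
      qed
    qed
  qed auto
  from this[of n] show ?thesis using assms unfolding Q_def by simp
qed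

text \<open>
  A function on pairs behaves like a tree metric on the cherry of every stage: of the three ways to
  pair up \<open>i\<^sub>l, l, k, c\<close> the two that break the cherry agree, and they precede the one that keeps it.
  This is used for leading exponents, for weights and for path lengths in the tree, whence the
  general codomain and order.
\<close>

definition level :: "('e \<Rightarrow> 'e \<Rightarrow> bool) \<Rightarrow> (nat \<Rightarrow> nat \<Rightarrow> 'e::cancel_comm_monoid_add) \<Rightarrow> bool"
  where "level lt F \<longleftrightarrow> (\<forall>l\<in>{4..n}. \<forall>k\<in>{1..<l} - {i l}. \<forall>c\<in>{1..<l} - {i l}. k \<noteq> c \<longrightarrow>
    F k l + F (i l) c = F c l + F (i l) k \<and> lt (F k l + F (i l) c) (F (i l) l + F k c))"

lemma levelD:
  assumes "level lt F" "4 \<le> l" "l \<le> n" "k \<in> {1..<l} - {i l}" "c \<in> {1..<l} - {i l}" "k \<noteq> c"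
  shows "F k l + F (i l) c = F c l + F (i l) k" "lt (F k l + F (i l) c) (F (i l) l + F k c)"
  using assms unfolding level_def by (meson atLeastAtMost_iff)+

text \<open>
  Since a split descends to the cherry of some stage by replacing leaves with their partners, it
  is enough to require the comparison at the cherries.
\<close>

lemma split_level:
  fixes F :: "nat \<Rightarrow> nat \<Rightarrow> 'e::cancel_comm_monoid_add"
  assumes F: "level lt F"
    and sym: "\<And>k l. k \<in> {1..n} \<Longrightarrow> l \<in> {1..n} \<Longrightarrow> F k l = F l k"
    and lt: "\<And>a b c. lt (a + c) (b + c) = lt a b"
    and "split p q r s"
  shows "F p r + F q s = F p s + F q r \<and> lt (F p r + F q s) (F p q + F r s)"
  using assms(4)
proof (induction rule: split.induct)
  case (cherry l k c)
  then have r: "l \<in> {1..n}" "k \<in> {1..n}" "c \<in> {1..n}" "i l \<in> {1..n}" using i_range[of l] by auto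
  have 1: "F k l + F (i l) c = F c l + F (i l) k" "lt (F c l + F (i l) k) (F (i l) l + F c k)"
    using levelD[OF F, of l] cherry by auto
  then show ?case using r sym[of l c] sym[of l k] sym[of c k]
    by (simp add: add.commute)
next
  case (lift l p q r)
  let ?a = "i l"
  have d: "distinct [?a, p, q, r]" "{?a, p, q, r} \<subseteq> {1..n}"
    using split_distinct[OF lift.hyps(1)] by auto
  then have r: "p \<in> {1..<l} - {?a}" "q \<in> {1..<l} - {?a}" "r \<in> {1..<l} - {?a}" "l \<in> {1..n}"
      "p \<in> {1..n}" "q \<in> {1..n}" "r \<in> {1..n}"
    using lift by auto
  have e1: "F l q + F ?a r = F l r + F ?a q"
    using levelD(1)[OF F lift.hyps(2,3) r(2,3)] d sym[of q l] sym[of r l] r by simp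
  have e2: "F l q + F ?a p = F l p + F ?a q"
    using levelD(1)[OF F lift.hyps(2,3) r(2,1)] d sym[of q l] sym[of p l] r by simp
  have IH: "F ?a q + F p r = F ?a r + F p q" "lt (F ?a q + F p r) (F ?a p + F q r)"
    using lift.IH by auto
  have "(F l q + F p r) + (F ?a r + F ?a q) = (F l q + F ?a r) + (F ?a q + F p r)"
    by (simp add: ac_simps)
  also have "\<dots> = (F l r + F ?a q) + (F ?a r + F p q)" by (simp only: e1 IH)
  also have "\<dots> = (F l r + F p q) + (F ?a r + F ?a q)" by (simp add: ac_simps)
  finally have g1: "F l q + F p r = F l r + F p q" by simp
  have "(F l q + F p r) + F ?a p = (F l q + F ?a p) + F p r" by (simp add: ac_simps)
  also have "\<dots> = (F ?a q + F p r) + F l p" by (simp add: e2 ac_simps)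
  finally have "lt ((F l q + F p r) + F ?a p) ((F ?a p + F q r) + F l p)"
    using IH(2) lt by simp
  then have "lt ((F l q + F p r) + F ?a p) ((F l p + F q r) + F ?a p)"
    by (simp add: ac_simps)
  then show ?case using g1 lt by simp
next
  case (swap1 p q r s)
  then have "{p, q, r, s} \<subseteq> {1..n}" using split_distinct by blast
  then have "F q p = F p q" using sym by simp
  moreover have "F q r + F p s = F p r + F q s" "F q s + F p r = F p r + F q s"
    using swap1.IH by (simp_all add: add.commute)
  ultimately show ?case using conjunct2[OF swap1.IH] by metis
next
  case (swap2 p q r s)
  then have "{p, q, r, s} \<subseteq> {1..n}" using split_distinct by blast
  then have "F r p = F p r" "F s q = F q s" "F r q = F q r" "F s p = F p s"
    using sym by simp_all
  then show ?case using swap2.IH by (metis add.commute)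
qed

text \<open>
  The signs are compatible with the exchange along a split, so the exchange is a difference of
  monomials and not a sum.
\<close>

lemma sg_split: "split p q r s \<Longrightarrow> sg p r * sg q s = sg p s * sg q r"
proof (induction rule: split.induct)
  case (cherry l k c)
  have r: "l \<in> {1..n}" "k \<in> {1..n}" "c \<in> {1..n}" "i l \<in> {1..n}" "k \<noteq> l" "c \<noteq> l" "k \<noteq> i l" "c \<noteq> i l"
    using cherry i_range[of l] by auto
  have "sg l c = sg (i l) c" "sg l k = sg (i l) k"
    using sg_antisym[of c l] sg_antisym[of k l] sg_antisym[of c "i l"] sg_antisym[of k "i l"]
      sg_x[of l c] sg_x[of l k] r cherry by auto
  then show ?case by simp
next
  case (lift l p q r)
  have d: "distinct [i l, p, q, r]" "{i l, p, q, r} \<subseteq> {1..n}"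
    using split_distinct[OF lift.hyps(1)] by auto
  have "sg l k = sg (i l) k" if "k \<in> {p, q, r}" for k
    using sg_antisym[of k l] sg_antisym[of k "i l"] sg_x[of l k] d lift that by force
  then show ?case using lift.IH by simp
next
  case (swap2 p q r s)
  then have "{p, q, r, s} \<subseteq> {1..n} \<and> distinct [p, q, r, s]" using split_distinct by blast
  then show ?case using swap2.IH sg_antisym[of p r] sg_antisym[of q s] sg_antisym[of p s] sg_antisym[of q r]
    by (simp add: mult.commute)
qed (simp add: mult.commute)

end

context iterated
begin

subsection \<open>Connectedness of the fibres\<close>

text \<open>
  Monomials are multisets of ordered pairs, the edges of a multigraph on the leaves. Reversing an edge
  changes only a sign. The other move exchanges ends of two edges along a split; by
  \<open>split_level\<close> it does not change the exponent sum.
\<close>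

inductive move :: "(nat \<times> nat) multiset \<Rightarrow> (nat \<times> nat) multiset \<Rightarrow> bool"
  where
    flip: "move (add_mset (x, y) C) (add_mset (y, x) C)"
  | quad: "split p q r s \<Longrightarrow>
      move (add_mset (p, r) (add_mset (q, s) C)) (add_mset (p, s) (add_mset (q, r) C))"

abbreviation moves where "moves \<equiv> move\<^sup>*\<^sup>*"

definition edges :: "nat \<Rightarrow> (nat \<times> nat) set"
  where "edges m = {(x, y). x \<in> {1..m} \<and> y \<in> {1..m} \<and> x \<noteq> y}"

definition E_sum :: "(nat \<times> nat) multiset \<Rightarrow> nat \<Rightarrow>\<^sub>0 nat"
  where "E_sum A = (\<Sum>(x, y)\<in>#A. E x y)"

lemma E_sum_simps [simp]: "E_sum {#} = 0" "E_sum (add_mset (x, y) A) = E x y + E_sum A"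
  "E_sum (A + B) = E_sum A + E_sum B"
  by (simp_all add: E_sum_def)

lemma move_sym: "move A B \<Longrightarrow> move B A"
proof (induction rule: move.induct)
  case (quad p q r s C)
  have "move (add_mset (p, s) (add_mset (q, r) C)) (add_mset (p, r) (add_mset (q, s) C))"
    by (rule move.quad) (metis quad swap1 swap2)
  then show ?case .
qed (rule move.flip)

lemma moves_sym: "moves A B \<Longrightarrow> moves B A"
  by (induction rule: rtranclp_induct) (auto intro: move_sym converse_rtranclp_into_rtranclp)

lemma move_add: "move A B \<Longrightarrow> move (A + C) (B + C)"
proof (induction rule: move.induct)
  case (flip x y D)
  show ?case using move.flip[of x y "D + C"] by simp
next
  case (quad p q r s D)
  then show ?case using move.quad[of p q r s "D + C"] by simp
qed

lemma moves_add: "moves A B \<Longrightarrow> moves (A + C) (B + C)"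
  by (induction rule: rtranclp_induct) (auto intro: move_add rtranclp.rtrancl_into_rtrancl)

lemma moves_add_mset: "moves A B \<Longrightarrow> moves (add_mset e A) (add_mset e B)"
  using moves_add[of A B "{#e#}"] by simp

lemma moves_add2: "moves A B \<Longrightarrow> moves C D \<Longrightarrow> moves (A + C) (B + D)"
  using moves_add[of A B C] moves_add[of C D B] by (metis add.commute rtranclp_trans)

context
  fixes l
  assumes l: "3 \<le> l" "l \<le> n"
begin

abbreviation par where "par \<equiv> i l"

definition cherry_edges where "cherry_edges = {(par, l), (l, par)}"
text \<open>
  The last leaf \<open>l\<close> is contracted into its partner \<open>par\<close>. A multiset of edges none of which joins the two
  is determined by its image and by the choice, at every end at \<open>par\<close>, of one of \<open>par\<close> and \<open>l\<close>.
\<close>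

definition coll where "coll x = (if x = l then par else x)"
definition coll_edge where "coll_edge = map_prod coll coll"
definition top_count where "top_count L = size (filter_mset (\<lambda>(x, y). x = l \<or> y = l) L)"
definition top_valid where "top_valid L \<longleftrightarrow> set_mset L \<subseteq> edges l - cherry_edges"

lemma a_less: "1 \<le> par" "par < l" using i_range[OF l] by auto

lemma valid_simps: "top_valid (add_mset e L) \<longleftrightarrow> e \<in> edges l - cherry_edges \<and> top_valid L"
  by (auto simp: top_valid_def)

lemma top_count_simps: "top_count {#} = 0"
  "top_count (add_mset (x, y) L) = (if x = l \<or> y = l then 1 else 0) + top_count L"
  by (auto simp: top_count_def)

lemma contract_simps: "coll_edge (x, y) = (coll x, coll y)"
  by (simp add: coll_edge_def)

lemma edge_iff: "(x, y) \<in> edges l - cherry_edges \<longleftrightarrow> x \<in> {1..l} \<and> y \<in> {1..l} \<and> coll x \<noteq> coll y"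
  using a_less unfolding edges_def cherry_edges_def coll_def by (cases "x = l"; cases "y = l") auto

lemma h_range: "x \<in> {1..l} \<Longrightarrow> coll x \<in> {1..<l}"
  using a_less by (auto simp: coll_def)

lemma h_neq: "(x, y) \<in> edges l - cherry_edges \<Longrightarrow> coll x \<noteq> coll y \<and> coll x \<in> {1..<l} \<and> coll y \<in> {1..<l}"
  unfolding edge_iff using h_range by blast

lemma split_uncontract:
  assumes "split (coll u1) (coll u2) (coll v1) (coll v2)" "{u1, u2, v1, v2} \<subseteq> {1..l}"
  shows "split u1 u2 v1 v2"
proof -
  have d: "distinct [coll u1, coll u2, coll v1, coll v2]" "{coll u1, coll u2, coll v1, coll v2} \<subseteq> {1..n}"
    using split_distinct[OF assms(1)] by auto
  have lt: "u = l \<and> coll u = par \<or> u < l \<and> coll u = u" if "u \<in> {u1, u2, v1, v2}" for u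
    using that assms(2) by (auto simp: coll_def)
  have hl: "coll u1 < l" "coll u2 < l" "coll v1 < l" "coll v2 < l" 
    using lt[of u1] lt[of u2] lt[of v1] lt[of v2] a_less by auto
  then have "{coll u1, coll u2, coll v1, coll v2} \<subseteq> {1..<l}" using d by simp
  then have "card {coll u1, coll u2, coll v1, coll v2} \<le> card {1..<l}" by (intro card_mono) auto
  then have l4: "4 \<le> l" using d by auto
  have *: "split l q r s" if "split par q r s" "q < l" "r < l" "s < l" for q r s
    using lift[OF that(1) l4 l(2) that(2-)] .
  consider "u1 = l" "coll u2 = u2" "coll v1 = v1" "coll v2 = v2"
    | "u2 = l" "coll u1 = u1" "coll v1 = v1" "coll v2 = v2"
    | "v1 = l" "coll u1 = u1" "coll u2 = u2" "coll v2 = v2"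
    | "v2 = l" "coll u1 = u1" "coll u2 = u2" "coll v1 = v1"
    | "coll u1 = u1" "coll u2 = u2" "coll v1 = v1" "coll v2 = v2"
  proof -
    have "\<not> (u1 = l \<and> u2 = l)" "\<not> (u1 = l \<and> v1 = l)" "\<not> (u1 = l \<and> v2 = l)"
      "\<not> (u2 = l \<and> v1 = l)" "\<not> (u2 = l \<and> v2 = l)" "\<not> (v1 = l \<and> v2 = l)"
      using d by auto
    moreover have "coll u = u" if "u \<noteq> l" for u using that by (simp add: coll_def)
    ultimately show thesis using that by metis
  qed
  then show ?thesis
  proof cases
    case 1
    then have "split par u2 v1 v2" using assms(1) by (simp add: coll_def[of l])
    then show ?thesis using *[of u2 v1 v2] hl unfolding 1 by simp
  next
    case 2
    then have "split par u1 v1 v2" using swap1[OF assms(1)] by (simp add: coll_def[of l])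
    then have "split l u1 v1 v2" using *[of u1 v1 v2] hl unfolding 2 by simp
    then show ?thesis using 2 swap1 by simp
  next
    case 3
    then have "split par v2 u1 u2" using swap2[OF assms(1)] by (simp add: coll_def[of l])
    then have "split l v2 u1 u2" using *[of v2 u1 u2] hl unfolding 3 by simp
    then show ?thesis using 3 swap2 by simp
  next
    case 4
    then have "split par v1 u1 u2" using swap1[OF swap2[OF assms(1)]] by (simp add: coll_def[of l])
    then have "split l v1 u1 u2" using *[of v1 u1 u2] hl unfolding 4 by simp
    then show ?thesis using 4 swap1 swap2 by blast
  next
    case 5
    then show ?thesis using assms(1) by simp
  qed
qed

text \<open>
  A move of the contracted multigraph can be lifted to any given preimage. The lift may end in a
  preimage with other choices, but their number is the same.
\<close>

lemma lift_move:
  assumes "move M M'" "image_mset coll_edge L = M" "top_valid L"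
  shows "\<exists>L'. move L L' \<and> image_mset coll_edge L' = M' \<and> top_count L' = top_count L \<and> top_valid L'"
  using assms
proof (induction arbitrary: L rule: move.induct)
  case (flip x y C)
  then obtain L1 u v where L: "L = add_mset (u, v) L1" "coll_edge (u, v) = (x, y)" "image_mset coll_edge L1 = C"
    using msed_map_invR[of coll_edge L "(x, y)" C] by (metis surj_pair)
  show ?case
    using L flip(2) by (intro exI[of _ "add_mset (v, u) L1"])
      (auto simp: move.flip contract_simps valid_simps top_count_simps edges_def cherry_edges_def)
next
  case (quad p q r s C)
  obtain L1 u1 v1 where L1: "L = add_mset (u1, v1) L1" "coll_edge (u1, v1) = (p, r)"
      "image_mset coll_edge L1 = add_mset (q, s) C"
    using msed_map_invR[of coll_edge L "(p, r)" "add_mset (q, s) C"] quad.prems by (metis surj_pair)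
  obtain L2 u2 v2 where L2: "L1 = add_mset (u2, v2) L2" "coll_edge (u2, v2) = (q, s)"
      "image_mset coll_edge L2 = C"
    using msed_map_invR[of coll_edge L1 "(q, s)" C] L1 by (metis surj_pair)
  have coll: "coll u1 = p" "coll v1 = r" "coll u2 = q" "coll v2 = s" using L1 L2 by (auto simp: contract_simps)
  have e: "(u1, v1) \<in> edges l - cherry_edges" "(u2, v2) \<in> edges l - cherry_edges" "top_valid L2"
    using quad.prems L1 L2 by (auto simp: valid_simps)
  have d: "distinct [coll u1, coll u2, coll v1, coll v2]" using split_distinct[OF quad.hyps] coll by simp
  have s: "split u1 u2 v1 v2"
    by (rule split_uncontract) (use quad.hyps coll e in \<open>auto simp: edges_def\<close>)
  have e': "(u1, v2) \<in> edges l - cherry_edges" "(u2, v1) \<in> edges l - cherry_edges"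
    using e d unfolding edge_iff by simp_all
  have "move L (add_mset (u1, v2) (add_mset (u2, v1) L2))"
    using move.quad[OF s, of L2] L1 L2 by simp
  moreover have "top_count (add_mset (u1, v2) (add_mset (u2, v1) L2)) = top_count L"
    using d L1 L2 by (auto simp: top_count_simps)
  ultimately show ?case
    using L1 L2 e e' by (intro exI[of _ "add_mset (u1, v2) (add_mset (u2, v1) L2)"])
      (auto simp: contract_simps valid_simps)
qed

lemma lift_moves:
  assumes "moves M M'" "image_mset coll_edge L = M" "top_valid L"
  shows "\<exists>L'. moves L L' \<and> image_mset coll_edge L' = M' \<and> top_count L' = top_count L \<and> top_valid L'"
  using assms(1)
proof (induction rule: rtranclp_induct)
  case base
  then show ?case using assms by blast
next
  case (step M1 M2)
  then obtain L1 where L1: "moves L L1" "image_mset coll_edge L1 = M1" "top_count L1 = top_count L" "top_valid L1"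
    by blast
  then show ?case using lift_move[OF step(2) L1(2) L1(4)] by (metis rtranclp.rtrancl_into_rtrancl)
qed

lemma flip2: "moves {#(x, y), f#} {#(y, x), f#}" "moves {#f, (x, y)#} {#f, (y, x)#}"
proof -
  show 1: "moves {#(x, y), f#} {#(y, x), f#}" for x y f
    using move.flip[of x y "{#f#}"] by simp
  show "moves {#f, (x, y)#} {#f, (y, x)#}" using 1[of x y f] by (simp add: add_mset_commute)
qed

text \<open>
  If two edges end in different halves of the cherry, the halves can be exchanged: the split that
  is involved is the cherry itself.
\<close>

lemma relabel:
  assumes "e \<in> {(par, k), (k, par)}" "e' \<in> {(l, k), (k, l)}" "coll_edge e' = e"
    and "f \<in> {(l, c), (c, l)}" "k \<in> {1..<l} - {par}" "c \<in> {1..<l} - {par}"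
  shows "moves {#e, f#} {#e', coll_edge f#}"
proof -
  have cs: "coll_edge (l, x) = (par, x)" "coll_edge (x, l) = (x, par)" if "x < l" for x
    using that by (auto simp: contract_simps coll_def)
  have base: "moves {#(par, k), (l, c)#} {#(l, k), (par, c)#}"
  proof (cases "k = c")
    case True then show ?thesis by (simp add: add_mset_commute)
  next
    case False
    have "card {par, k, c} \<le> card {1..<l}" by (rule card_mono) (use assms a_less in auto)
    then have "4 \<le> l" using False assms by auto
    then have "split par l k c" using cherry[of l k c] l assms False by auto
    then have "move {#(par, k), (l, c)#} {#(par, c), (l, k)#}" using move.quad[of par l k c "{#}"] by simp
    then show ?thesis by (simp add: add_mset_commute)
  qed
  have [simp]: "par \<noteq> l" "k \<noteq> l" "c \<noteq> l" "k \<noteq> par" "c \<noteq> par" using assms a_less by auto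
  have kc: "k < l" "c < l" using assms by auto
  have e: "e = (par, k) \<and> e' = (l, k) \<or> e = (k, par) \<and> e' = (k, l)"
    using assms(1-3) cs[OF kc(1)] by auto
  have "moves {#e, f#} {#(par, k), f#}" "moves {#(par, k), f#} {#(par, k), (l, c)#}"
    "moves {#(l, k), (par, c)#} {#e', (par, c)#}" "moves {#e', (par, c)#} {#e', coll_edge f#}"
    using e assms(4) kc flip2 by (auto simp: cs)
  then show ?thesis using base by (meson rtranclp_trans)
qed

text \<open>
  The choices of the ends can be permuted freely by \<open>relabel\<close>, so preimages with the same number of
  ends at \<open>l\<close> are connected whenever their images are.
\<close>

lemma lifts_connected:
  assumes "top_valid L" "top_valid L'" "image_mset coll_edge L = image_mset coll_edge L'" "top_count L = top_count L'"
  shows "moves L L'"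
  using assms
proof (induction "size L" arbitrary: L L' rule: less_induct)
  case less
  have main: "moves L L'"
    if "top_valid L" "top_valid L'" "image_mset coll_edge L = image_mset coll_edge L'" "top_count L = top_count L'"
      and L: "L = add_mset (u, v) L1" and L': "L' = add_mset (u', v') L1'"
      and eq: "coll_edge (u, v) = coll_edge (u', v')" and nl: "\<not> (u = l \<or> v = l)" "u' = l \<or> v' = l"
      and IH: "\<And>K K'. size K < size L \<Longrightarrow> top_valid K \<Longrightarrow> top_valid K' \<Longrightarrow>
        image_mset coll_edge K = image_mset coll_edge K' \<Longrightarrow> top_count K = top_count K' \<Longrightarrow> moves K K'"
    for L L' u v u' v' L1 L1'
  proof -
    have v: "(u, v) \<in> edges l - cherry_edges" "(u', v') \<in> edges l - cherry_edges" "top_valid L1" "top_valid L1'"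
      using that by (auto simp: valid_simps)
    have im: "image_mset coll_edge L1 = image_mset coll_edge L1'"
      using that(3) eq unfolding L L' by simp
    have tc: "top_count L1 = Suc (top_count L1')"
      using that(4) nl unfolding L L' by (auto simp: top_count_simps)
    then have "filter_mset (\<lambda>(x, y). x = l \<or> y = l) L1 \<noteq> {#}"
      unfolding top_count_def by (metis nat.distinct(2) size_empty)
    then obtain f where "f \<in># filter_mset (\<lambda>(x, y). x = l \<or> y = l) L1"
      by (meson multiset_nonemptyE)
    then obtain f1 f2 L2 where f: "L1 = add_mset (f1, f2) L2" "f1 = l \<or> f2 = l"
      by (cases f) (use multi_member_split[of f L1] in auto)
    define c where "c = (if f1 = l then f2 else f1)"
    have fe: "(f1, f2) \<in> edges l - cherry_edges" "top_valid L2" using v f by (auto simp: valid_simps)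
    then have c: "c \<in> {1..<l} - {par}" "(f1, f2) \<in> {(l, c), (c, l)}"
      using f a_less by (auto simp: c_def edges_def cherry_edges_def)
    define k where "k = (if u' = l then v' else u')"
    have k: "k \<in> {1..<l} - {par}" "(u', v') \<in> {(l, k), (k, l)}"
      using v nl a_less by (auto simp: k_def edges_def cherry_edges_def)
    have uv: "(u, v) = coll_edge (u', v')"
      using eq nl by (auto simp: contract_simps coll_def split: if_splits)
    then have "(u, v) \<in> {(par, k), (k, par)}" using k by (auto simp: contract_simps coll_def)
    then have "moves {#(u, v), (f1, f2)#} {#(u', v'), coll_edge (f1, f2)#}"
      using relabel[OF _ k(2) uv[symmetric] c(2) k(1) c(1)] by blast
    then have "moves ({#(u, v), (f1, f2)#} + L2) ({#(u', v'), coll_edge (f1, f2)#} + L2)"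
      by (rule moves_add)
    then have 1: "moves L (add_mset (u', v') (add_mset (coll_edge (f1, f2)) L2))"
      by (simp add: L f)
    have cf: "coll_edge (f1, f2) = (coll f1, coll f2)" by (simp add: contract_simps)
    have hl: "coll x \<noteq> l" for x using a_less by (simp add: coll_def)
    have hh: "coll (coll x) = coll x" for x by (simp add: coll_def)
    have "top_valid (add_mset (coll_edge (f1, f2)) L2)"
      using fe h_neq[OF fe(1)] hl by (auto simp: cf valid_simps edges_def cherry_edges_def)
    moreover have "image_mset coll_edge (add_mset (coll_edge (f1, f2)) L2) = image_mset coll_edge L1'"
      using im f by (simp add: contract_simps hh)
    moreover have "top_count (add_mset (coll_edge (f1, f2)) L2) = top_count L1'"
      using tc f hl by (auto simp: cf top_count_simps)
    ultimately have "moves (add_mset (coll_edge (f1, f2)) L2) L1'"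
      using IH[of "add_mset (coll_edge (f1, f2)) L2" L1'] v by (simp add: L f)
    then have "moves (add_mset (u', v') (add_mset (coll_edge (f1, f2)) L2)) L'"
      unfolding L' by (rule moves_add_mset)
    with 1 show ?thesis by (rule rtranclp_trans)
  qed
  show ?case
  proof (cases L)
    case empty
    then show ?thesis using less.prems by simp
  next
    case (add e L1)
    obtain u v where e: "e = (u, v)" by (cases e)
    have "image_mset coll_edge L' = add_mset (coll_edge e) (image_mset coll_edge L1)"
      using less.prems add by simp
    then obtain L1' e' where L'e: "L' = add_mset e' L1'" "coll_edge e' = coll_edge e"
        "image_mset coll_edge L1' = image_mset coll_edge L1"
      using msed_map_invR[of coll_edge L' "coll_edge e" "image_mset coll_edge L1"] by blast
    obtain u' v' where e': "e' = (u', v')" by (cases e')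
    note L' = L'e[unfolded e']
    have sz: "size L' = size L" using less.prems(3) by (metis size_image_mset)
    have IH: "moves K K'" if "size K < size L" "top_valid K" "top_valid K'"
        "image_mset coll_edge K = image_mset coll_edge K'" "top_count K = top_count K'" for K K'
      using less.hyps that by blast
    have ne: "coll u \<noteq> coll v" "coll u' \<noteq> coll v'" using h_neq less.prems by (auto simp: L' add e valid_simps)
    consider "(u, v) = (u', v')" | "(u, v) \<noteq> (u', v')" "\<not> (u = l \<or> v = l)" "u' = l \<or> v' = l"
      | "(u, v) \<noteq> (u', v')" "u = l \<or> v = l" "\<not> (u' = l \<or> v' = l)"
    proof -
      have hh: "coll u = coll u'" "coll v = coll v'" using L'(2) unfolding e contract_simps by auto
      have "\<not> (u = l \<and> v = l)" "\<not> (u' = l \<and> v' = l)" "\<not> (u = l \<and> v' = l)" "\<not> (u' = l \<and> v = l)"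
        using ne hh by auto
      moreover have "u = u'" if "u \<noteq> l" "u' \<noteq> l" using hh(1) that by (simp add: coll_def)
      moreover have "v = v'" if "v \<noteq> l" "v' \<noteq> l" using hh(2) that by (simp add: coll_def)
      ultimately show thesis using that by metis
    qed
    then show ?thesis
    proof cases
      case 1
      have "top_valid L1" "top_valid L1'" "size L1 < size L"
        using less.prems(1,2) L'(1) by (simp_all add: add valid_simps)
      moreover have "top_count L1 = top_count L1'"
        using less.prems(4) 1 unfolding L'(1) add e by (simp add: top_count_simps)
      ultimately have "moves L1 L1'"
        using IH L'(3) by metis
      then show ?thesis using moves_add_mset 1 unfolding L'(1) add e by metis
    next
      case 2
      then show ?thesis
        using main[OF less.prems, of u v L1 u' v' L1'] IH L' by (simp add: add e)
    next
      case 3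
      have "moves L' L"
        using main[OF less.prems(2,1) less.prems(3,4)[symmetric], of u' v' L1' u v L1] IH L' 3 sz
        by (simp add: add e)
      then show ?thesis by (rule moves_sym)
    qed
  qed
qed

lemma x_z_distinct: "x_var l \<noteq> z_var l" by (simp add: x_var_def z_var_def)

lemma lookup_E_top:
  assumes "(x, y) \<in> edges l"
  shows "lookup (E x y) (z_var l) = (if (x, y) \<in> cherry_edges then 1 else 0)"
    and "(x, y) \<notin> cherry_edges \<Longrightarrow>
      E x y = (if x = l \<or> y = l then single (x_var l) 1 else 0) + E (coll x) (coll y)"
proof -
  have small: "lookup (E k m) (z_var l) = 0" if "k \<in> {1..<l}" "m \<in> {1..<l}" "k \<noteq> m" for k m
  proof -
    have "keys (E k m) \<subseteq> {2 * (n - max k m)..<2 * (n - 2)}"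
      by (rule keys_E) (use that l in auto)
    moreover have "z_var l \<notin> {2 * (n - max k m)..<2 * (n - 2)}"
      using that l by (auto simp: z_var_def max_def)
    ultimately show ?thesis by (metis in_keys_iff subsetD)
  qed
  have [simp]: "lookup (single (x_var l) (Suc 0)) (z_var l) = 0"
    using x_z_distinct by (simp add: lookup_single when_def)
  have main: "lookup (E k l) (z_var l) = (if k = par then 1 else 0) \<and>
      (k \<noteq> par \<longrightarrow> E k l = single (x_var l) 1 + E k par)" if "k \<in> {1..<l}" for k
  proof (cases "k = par")
    case True
    then show ?thesis using small[of par "j l"] E_z[OF l] a_less j_range[OF l] i_neq_j[OF l]
      by (simp add: lookup_add)
  next
    case False
    then show ?thesis using small[of k par] E_x[OF l, of k] a_less that by (simp add: lookup_add)
  qed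
  have "x \<in> {1..<l} \<and> y \<in> {1..<l} \<and> x \<noteq> y \<or> x \<in> {1..<l} \<and> y = l \<or> x = l \<and> y \<in> {1..<l}"
    using assms by (auto simp: edges_def)
  then have "lookup (E x y) (z_var l) = (if (x, y) \<in> cherry_edges then 1 else 0) \<and> ((x, y) \<notin> cherry_edges \<longrightarrow>
      E x y = (if x = l \<or> y = l then single (x_var l) 1 else 0) + E (coll x) (coll y))"
  proof (elim disjE conjE)
    assume "x \<in> {1..<l}" "y \<in> {1..<l}" "x \<noteq> y"
    then show ?thesis using small[of x y] by (auto simp: cherry_edges_def coll_def)
  next
    assume "x \<in> {1..<l}" "y = l"
    then show ?thesis using main[of x] a_less by (auto simp: cherry_edges_def coll_def)
  next
    assume *: "x = l" "y \<in> {1..<l}"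
    have "E l y = E y l" "E par y = E y par" using * l a_less by (auto intro: E_sym)
    then show ?thesis using main[of y] a_less * by (auto simp: cherry_edges_def coll_def)
  qed
  then show "lookup (E x y) (z_var l) = (if (x, y) \<in> cherry_edges then 1 else 0)"
    "(x, y) \<notin> cherry_edges \<Longrightarrow> E x y = (if x = l \<or> y = l then single (x_var l) 1 else 0) + E (coll x) (coll y)"
    by auto
qed

text \<open>
  Among the pairs up to \<open>l\<close> the variable \<open>z\<^sub>l\<close> occurs only in the exponent of the cherry edge and thus counts it.
\<close>

lemma cherry_count:
  "set_mset A \<subseteq> edges l \<Longrightarrow> lookup (E_sum A) (z_var l) = size (filter_mset (\<lambda>e. e \<in> cherry_edges) A)"
proof (induction A)
  case (add e A)
  then show ?case using lookup_E_top(1)[of "fst e" "snd e"] by (cases e) (auto simp: lookup_add)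
qed simp

lemma E_sum_contract:
  "top_valid L \<Longrightarrow> E_sum L = single (x_var l) (top_count L) + E_sum (image_mset coll_edge L)"
proof (induction L)
  case (add e L)
  obtain u v where [simp]: "e = (u, v)" by (cases e)
  show ?case using add lookup_E_top(2)[of u v]
    by (auto simp: valid_simps top_count_simps contract_simps single_add ac_simps)
qed (simp add: top_count_simps)

text \<open>
  The variable \<open>x\<^sub>l\<close> occurs once for every end at \<open>l\<close> of an edge that is not the cherry edge.
\<close>

lemma top_count_lookup:
  assumes "top_valid L"
  shows "lookup (E_sum L) (x_var l) = top_count L"
proof -
  have "lookup (E x y) (x_var l) = 0" if "x \<in> {1..<l}" "y \<in> {1..<l}" "x \<noteq> y" for x y
  proof -
    have "keys (E x y) \<subseteq> {2 * (n - max x y)..<2 * (n - 2)}"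
      by (rule keys_E) (use that l in auto)
    moreover have "x_var l \<notin> {2 * (n - max x y)..<2 * (n - 2)}"
      using that l by (auto simp: x_var_def max_def)
    ultimately show ?thesis by (metis in_keys_iff subsetD)
  qed
  then have "lookup (E_sum (image_mset coll_edge L)) (x_var l) = 0"
    using assms
  proof (induction L)
    case (add e L)
    then show ?case using h_neq[of "fst e" "snd e"]
      by (cases e) (auto simp: valid_simps contract_simps lookup_add)
  qed simp
  then show ?thesis using E_sum_contract[OF assms] by (simp add: lookup_add)
qed

lemma E_sum_cherry: "set_mset A \<subseteq> cherry_edges \<Longrightarrow> E_sum A = (\<Sum>e\<in>#replicate_mset (size A) (). E par l)"
proof (induction A)
  case (add e A)
  have "E l par = E par l" using a_less l by (intro E_sym) auto
  then show ?case using add by (cases e) (auto simp: cherry_edges_def)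
qed simp

lemma moves_cherry: "set_mset A \<subseteq> cherry_edges \<Longrightarrow> moves A (replicate_mset (size A) (par, l))"
proof (induction A)
  case (add e A)
  have "moves {#e#} {#(par, l)#}"
    using add.prems move.flip[of l par "{#}"] by (auto simp: cherry_edges_def)
  then show ?case using moves_add2[of "{#e#}" "{#(par, l)#}" A] add by simp
qed simp

lemma moves_top_step:
  assumes IH: "\<And>A B. set_mset A \<subseteq> edges (l - 1) \<Longrightarrow> set_mset B \<subseteq> edges (l - 1) \<Longrightarrow>
      size A = size B \<Longrightarrow> E_sum A = E_sum B \<Longrightarrow> moves A B"
    and "set_mset A \<subseteq> edges l" "set_mset B \<subseteq> edges l" "size A = size B" "E_sum A = E_sum B"
  shows "moves A B"
proof -
  define Z where "Z A = filter_mset (\<lambda>e. e \<in> cherry_edges) A" for A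
  define Y where "Y A = filter_mset (\<lambda>e. e \<notin> cherry_edges) A" for A
  have part: "A = Z A + Y A" for A
    unfolding Z_def Y_def by (metis multiset_partition)
  have zc: "set_mset (Z A) \<subseteq> cherry_edges" for A by (auto simp: Z_def)
  have size: "size (Z A) = size (Z B)"
    using cherry_count[OF assms(2)] cherry_count[OF assms(3)] assms(5) by (simp add: Z_def)
  have mz: "moves (Z A) (Z B)"
    using moves_cherry[OF zc[of A]] moves_sym[OF moves_cherry[OF zc[of B]]] size
    by (metis rtranclp_trans)
  have "E_sum (Z A) = E_sum (Z B)" using E_sum_cherry[OF zc] size by simp
  then have EY: "E_sum (Y A) = E_sum (Y B)"
    using assms(5) part[of A] part[of B] by (metis E_sum_simps(3) add_left_cancel)
  have vA: "top_valid (Y A)" and vB: "top_valid (Y B)"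
    using assms by (auto simp: top_valid_def Y_def)
  have tc: "top_count (Y A) = top_count (Y B)"
    using top_count_lookup[OF vA] top_count_lookup[OF vB] EY by simp
  have sub: "set_mset (image_mset coll_edge L) \<subseteq> edges (l - 1)" if "top_valid L" for L
    using that h_neq unfolding top_valid_def by (fastforce simp: contract_simps edges_def)
  have "E_sum (image_mset coll_edge (Y A)) = E_sum (image_mset coll_edge (Y B))"
    using E_sum_contract[OF vA] E_sum_contract[OF vB] EY tc by simp
  moreover have "size (Y A) = size (Y B)"
    using assms(4) size part[of A] part[of B] by (metis add_left_cancel size_union)
  ultimately have "moves (image_mset coll_edge (Y A)) (image_mset coll_edge (Y B))"
    using IH sub vA vB by simp
  from lift_moves[OF this refl vA] obtain L where L: "moves (Y A) L"
      "image_mset coll_edge L = image_mset coll_edge (Y B)" "top_count L = top_count (Y A)" "top_valid L"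
    by blast
  have "moves L (Y B)" by (rule lifts_connected) (use L vB tc in auto)
  then have "moves (Y A) (Y B)" using L by simp
  then show ?thesis using moves_add2[OF mz] part by metis
qed

end

text \<open>
  Induction on the last leaf. The exponent sum determines the number of cherry edges and the number of
  other ends at the last leaf. After these are accounted for, the contracted multisets still have
  equal exponent sums, so they are connected by the induction hypothesis, and the connection lifts.
\<close>

theorem fibre_connected:
  assumes "set_mset A \<subseteq> edges n" "set_mset B \<subseteq> edges n" "size A = size B" "E_sum A = E_sum B"
  shows "moves A B"
proof -
  have "moves A B" if "2 \<le> m" "m \<le> n" "set_mset A \<subseteq> edges m" "set_mset B \<subseteq> edges m"
      "size A = size B" "E_sum A = E_sum B" for m A B
    using that
  proof (induction m arbitrary: A B rule: dec_induct)
    case base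
    have *: "moves A (replicate_mset (size A) (1, 2))" if "set_mset A \<subseteq> edges 2" for A
      using that
    proof (induction A)
      case (add e A)
      have "e = (1, 2) \<or> e = (2, 1)" using add.prems by (auto simp: edges_def)
      then have "moves {#e#} {#(1, 2)#}" using move.flip[of 2 1 "{#}"] by auto
      then show ?case using moves_add2[of "{#e#}" "{#(1, 2)#}" A] add by simp
    qed simp
    show ?case using *[of A] moves_sym[OF *[of B]] base by (metis rtranclp_trans)
  next
    case (step m)
    show ?case
      by (rule moves_top_step[of "Suc m"]) (use step in auto)
  qed
  from this[of n] show ?thesis using assms n by simp
qed

end

section \<open>Leading terms of the minors\<close>

subsection \<open>The minors of an iterated sequence\<close>

lemma length_concat_pairs: "length (concat (map (\<lambda>l. [f l, g l]) xs)) = 2 * length xs"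
  by (induction xs) auto

lemma nth_concat_pairs:
  assumes "k < length xs"
  shows "concat (map (\<lambda>l. [f l, g l]) xs) ! (2 * k) = f (xs ! k)"
    and "concat (map (\<lambda>l. [f l, g l]) xs) ! (2 * k + 1) = g (xs ! k)"
  using assms
proof (induction xs arbitrary: k)
  case (Cons a xs)
  { case 1 then show ?case using Cons.IH(1)[of "k - 1"] by (cases k) auto }
  { case 2 then show ?case using Cons.IH(2)[of "k - 1"] by (cases k) auto }
qed auto

text \<open>
  Multiplication by an elementary factor from the left adds a multiple of one row to another.
\<close>

lemma row_operation:
  fixes A :: "'a::comm_ring_1 mat"
  assumes A: "A \<in> carrier_mat n n" and "p \<in> {1..n}" "q \<in> {1..n}" "r < n" "c < n"
  shows "((1\<^sub>m n + y \<cdot>\<^sub>m root_mat n (p, q)) * A) $$ (r, c)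
    = A $$ (r, c) + (if r = q - 1 then y * A $$ (p - 1, c) else 0)"
proof -
  have R: "(root_mat n (p, q) :: 'a mat) \<in> carrier_mat n n" by (simp add: root_mat_def)
  have "(root_mat n (p, q) * A) $$ (r, c) = (\<Sum>k<n. (if r = q - 1 \<and> k = p - 1 then 1 else 0) * A $$ (k, c))"
    using assms by (simp add: root_mat_def times_mat_def scalar_prod_def atLeast0LessThan)
  also have "\<dots> = (\<Sum>k<n. if k = p - 1 then (if r = q - 1 then A $$ (k, c) else 0) else 0)"
    by (rule sum.cong) auto
  also have "\<dots> = (if r = q - 1 then A $$ (p - 1, c) else 0)"
    using assms by (subst sum.delta) auto
  finally have *: "(root_mat n (p, q) * A) $$ (r, c) = (if r = q - 1 then A $$ (p - 1, c) else 0)" .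
  have "(1\<^sub>m n + y \<cdot>\<^sub>m root_mat n (p, q)) * A = A + y \<cdot>\<^sub>m (root_mat n (p, q) * A)"
    using add_mult_distrib_mat[OF one_carrier_mat smult_carrier_mat[OF R] A, of y]
    by (simp add: mult_smult_assoc_mat[OF R A] left_mult_one_mat[OF A])
  then have "((1\<^sub>m n + y \<cdot>\<^sub>m root_mat n (p, q)) * A) $$ (r, c)
      = A $$ (r, c) + y * (root_mat n (p, q) * A) $$ (r, c)"
    using assms(4,5) carrier_matD[OF A] carrier_matD[OF R] by simp
  then show ?thesis unfolding * by simp
qed

lemma psi_minor_antisym: "psi_minor n S y (l, k) = - psi_minor n S y (k, l)"
  by (simp add: psi_minor_def Let_def algebra_simps)

lemma psi_minor_self: "psi_minor n S y (k, k) = 0"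
  by (simp add: psi_minor_def Let_def algebra_simps)

lemma psi_minor_pluecker:
  "psi_minor n S y (p, q) * psi_minor n S y (r, s) - psi_minor n S y (p, r) * psi_minor n S y (q, s)
    + psi_minor n S y (p, s) * psi_minor n S y (q, r) = 0"
  by (simp add: psi_minor_def Let_def algebra_simps)

context iterated
begin

abbreviation S where "S \<equiv> iterated_sequence n i j"

lemma length_S: "length S = 2 * (n - 2)"
  using n by (simp add: iterated_sequence_def length_concat_pairs)

lemma nth_S:
  assumes "3 \<le> l" "l \<le> n"
  shows "S ! x_var l = (i l, l)" "S ! z_var l = (j l, l)"
proof -
  have 1: "n - l < length (rev [3..<Suc n])" using assms by auto
  have 2: "rev [3..<Suc n] ! (n - l) = l" using assms by (simp add: rev_nth del: upt_Suc)
  show "S ! x_var l = (i l, l)" "S ! z_var l = (j l, l)"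
    using nth_concat_pairs[OF 1, of "\<lambda>l. (i l, l)" "\<lambda>l. (j l, l)"] 2
    by (simp_all add: iterated_sequence_def x_var_def z_var_def)
qed

text \<open>
  The factors with larger second index act last and change only the row of that index.
  Both factors of stage \<open>l\<close> add multiples of earlier rows to row \<open>l\<close>, which until then is a row
  of the identity matrix and does not contribute to the first two columns.
\<close>

lemma psi_mat_rows:
  fixes y :: "nat \<Rightarrow> 'a::comm_ring_1"
  defines "M \<equiv> psi_mat n S y"
  shows psi_mat_carrier: "M \<in> carrier_mat n n"
    and psi_mat_row: "\<And>l c. 3 \<le> l \<Longrightarrow> l \<le> n \<Longrightarrow> c < 2 \<Longrightarrow>
      M $$ (l - 1, c) = y (x_var l) * M $$ (i l - 1, c) + y (z_var l) * M $$ (j l - 1, c)"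
    and psi_mat_top: "\<And>r c. r < 2 \<Longrightarrow> c < 2 \<Longrightarrow> M $$ (r, c) = (if r = c then 1 else 0)"
proof -
  define F where "F = (\<lambda>k A. (1\<^sub>m n + y k \<cdot>\<^sub>m root_mat n (S ! k)) * A)"
  define Q where "Q m A \<longleftrightarrow> A \<in> carrier_mat n n \<and>
    (\<forall>l c. 3 \<le> l \<longrightarrow> l \<le> m \<longrightarrow> c < 2 \<longrightarrow>
      A $$ (l - 1, c) = y (x_var l) * A $$ (i l - 1, c) + y (z_var l) * A $$ (j l - 1, c)) \<and>
    (\<forall>r c. r < 2 \<or> m \<le> r \<and> r < n \<longrightarrow> c < 2 \<longrightarrow> A $$ (r, c) = (if r = c then 1 else 0))"
    for m and A :: "'a mat"
  have "Q m (foldr F [2 * (n - m)..<2 * (n - 2)] (1\<^sub>m n))" if "2 \<le> m" "m \<le> n" for m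
    using that
  proof (induction m rule: dec_induct)
    case base
    then show ?case using n by (auto simp: Q_def)
  next
    case (step m)
    define l where "l = Suc m"
    define A where "A = foldr F [2 * (n - m)..<2 * (n - 2)] (1\<^sub>m n)"
    have l: "3 \<le> l" "l \<le> n" using step by (auto simp: l_def)
    have ij: "1 \<le> i l" "i l < l" "1 \<le> j l" "j l < l" using i_range[OF l] j_range[OF l] by auto
    have QA: "Q m A" using step by (simp add: A_def)
    then have A: "A \<in> carrier_mat n n" by (simp add: Q_def)
    have z: "z_var l = Suc (x_var l)" "Suc (z_var l) = 2 * (n - m)" "x_var l = 2 * (n - Suc m)"
      using l by (auto simp: x_var_def z_var_def l_def)
    have "[2 * (n - Suc m)..<2 * (n - 2)] = x_var l # z_var l # [2 * (n - m)..<2 * (n - 2)]"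
    proof -
      have "x_var l < 2 * (n - 2)" "z_var l < 2 * (n - 2)"
        using l by (auto simp: x_var_def z_var_def)
      then show ?thesis using z by (metis upt_conv_Cons)
    qed
    then have fold: "foldr F [2 * (n - Suc m)..<2 * (n - 2)] (1\<^sub>m n) = F (x_var l) (F (z_var l) A)"
      by (simp add: A_def)
    define B where "B = F (z_var l) A"
    define C where "C = F (x_var l) B"
    have Fc: "F k X \<in> carrier_mat n n" if "X \<in> carrier_mat n n" for k X
      unfolding F_def using that by (intro mult_carrier_mat[of _ n n]) (auto simp: root_mat_def)
    have carr: "B \<in> carrier_mat n n" "C \<in> carrier_mat n n" using A Fc by (auto simp: B_def C_def)
    have Bi: "B $$ (r, c) = A $$ (r, c) + (if r = l - 1 then y (z_var l) * A $$ (j l - 1, c) else 0)"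
      if "r < n" "c < n" for r c
      unfolding B_def F_def nth_S(2)[OF l] by (rule row_operation) (use A that ij l in auto)
    have Ci: "C $$ (r, c) = B $$ (r, c) + (if r = l - 1 then y (x_var l) * B $$ (i l - 1, c) else 0)"
      if "r < n" "c < n" for r c
      unfolding C_def F_def nth_S(1)[OF l] by (rule row_operation) (use carr that ij l in auto)
    have old: "C $$ (r, c) = A $$ (r, c)" if "r < n" "c < n" "r \<noteq> l - 1" for r c
      using Bi Ci that by simp
    have new: "C $$ (l - 1, c) = A $$ (l - 1, c) + y (z_var l) * A $$ (j l - 1, c) + y (x_var l) * A $$ (i l - 1, c)"
      if "c < n" for c
      using Bi Ci that ij l by auto
    have Az: "A $$ (l - 1, c) = 0" if "c < 2" for c
      using QA that l unfolding Q_def l_def by auto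
    have "C $$ (p - 1, c) = y (x_var p) * C $$ (i p - 1, c) + y (z_var p) * C $$ (j p - 1, c)"
      if "3 \<le> p" "p \<le> Suc m" "c < 2" for p c
    proof (cases "p = l")
      case True
      then show ?thesis
        using new[of c] Az[of c] old[of "i l - 1" c] old[of "j l - 1" c] ij l that n by auto
    next
      case False
      then have p: "p \<le> m" "p < l" using that by (auto simp: l_def)
      have "A $$ (p - 1, c) = y (x_var p) * A $$ (i p - 1, c) + y (z_var p) * A $$ (j p - 1, c)"
        using QA that p by (simp add: Q_def)
      then show ?thesis
        using old[of "p - 1" c] old[of "i p - 1" c] old[of "j p - 1" c] i_range[of p] j_range[of p]
          p l that n by auto
    qed
    moreover have "C $$ (r, c) = (if r = c then 1 else 0)"
      if "r < 2 \<or> Suc m \<le> r \<and> r < n" "c < 2" for r c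
    proof -
      have "r \<noteq> l - 1" "r < n" "c < n" using that l n by (auto simp: l_def)
      moreover have "A $$ (r, c) = (if r = c then 1 else 0)"
        using QA that unfolding Q_def by auto
      ultimately show ?thesis using old by simp
    qed
    ultimately have "Q (Suc m) C" using carr by (auto simp: Q_def)
    then show ?case by (simp only: fold B_def[symmetric] C_def[symmetric])
  qed
  from this[of n] have "Q n (foldr F [0..<2 * (n - 2)] (1\<^sub>m n))" using n by simp
  then have "Q n M" by (simp only: M_def psi_mat_def F_def length_S)
  then show "M \<in> carrier_mat n n"
    "\<And>l c. 3 \<le> l \<Longrightarrow> l \<le> n \<Longrightarrow> c < 2 \<Longrightarrow>
      M $$ (l - 1, c) = y (x_var l) * M $$ (i l - 1, c) + y (z_var l) * M $$ (j l - 1, c)"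
    "\<And>r c. r < 2 \<Longrightarrow> c < 2 \<Longrightarrow> M $$ (r, c) = (if r = c then 1 else 0)"
    by (auto simp: Q_def)
qed

definition minor :: "(nat \<Rightarrow> 'a) \<Rightarrow> nat \<Rightarrow> nat \<Rightarrow> 'a::comm_ring_1"
  where "minor y k l = psi_minor n S y (k, l)"

lemma minor_antisym: "minor y l k = - minor y k l"
  and minor_self [simp]: "minor y k k = 0"
  by (simp_all add: minor_def psi_minor_antisym[of _ _ _ l k] psi_minor_self)

lemma minor_pluecker:
  "minor y p q * minor y r s - minor y p r * minor y q s + minor y p s * minor y q r = 0"
  unfolding minor_def by (rule psi_minor_pluecker)

lemma minor_base: "minor y 1 2 = 1"
  using psi_mat_top[of 0 0 y] psi_mat_top[of 0 1 y] psi_mat_top[of 1 0 y] psi_mat_top[of 1 1 y]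
  by (simp add: minor_def psi_minor_def Let_def)

lemma minor_step:
  assumes "3 \<le> l" "l \<le> n"
  shows "minor y k l = y (x_var l) * minor y k (i l) + y (z_var l) * minor y k (j l)"
  using psi_mat_row[OF assms, of 0 y] psi_mat_row[OF assms, of 1 y]
  by (simp add: minor_def psi_minor_def Let_def algebra_simps)

subsection \<open>Orders on exponents\<close>

text \<open>
  The two notions of size of an exponent, the order of the valuation and weights, are treated at once:
  exponents are mapped to an ordered monoid, and the minors are evaluated at the point
  whose coordinates are the corresponding monomials.
\<close>

definition exponent_hom :: "((nat \<Rightarrow>\<^sub>0 nat) \<Rightarrow> 'e::cancel_comm_monoid_add) \<Rightarrow> bool"
  where "exponent_hom h \<longleftrightarrow> h 0 = 0 \<and> (\<forall>u v. h (u + v) = h u + h v)"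

definition generic_point :: "((nat \<Rightarrow>\<^sub>0 nat) \<Rightarrow> 'e) \<Rightarrow> nat \<Rightarrow> ('e::cancel_comm_monoid_add \<Rightarrow>\<^sub>0 complex)"
  where "generic_point h k = single (h (single k 1)) 1"

lemma keys_single_mult:
  "keys (single a 1 * g :: 'e::cancel_comm_monoid_add \<Rightarrow>\<^sub>0 complex) \<subseteq> (+) a ` keys g"
  using keys_mult[of "single a (1::complex)" g] by auto

lemma lookup_single_mult:
  fixes g :: "'e::cancel_comm_monoid_add \<Rightarrow>\<^sub>0 complex"
  shows "lookup (single a c * g) (a + e) = c * lookup g e"
proof -
  have "single a c * g = (\<Sum>k\<in>keys g. single (a + k) (c * lookup g k))"
    by (subst (1) sum_of_terms[of g, symmetric]) (simp add: sum_distrib_left mult_single)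
  then have "lookup (single a c * g) (a + e) = (\<Sum>k\<in>keys g. if k = e then c * lookup g k else 0)"
    by (simp add: lookup_sum lookup_single when_def)
  then show ?thesis by (simp add: in_keys_iff)
qed

text \<open>
  In the step for a pair \<open>k < l\<close> with \<open>k \<noteq> i\<^sub>l\<close> the first summand has the predicted exponent. The hypothesis
  \<open>z\<close> says that the second summand does not precede it.
\<close>

lemma minor_keys:
  fixes h :: "(nat \<Rightarrow>\<^sub>0 nat) \<Rightarrow> 'e::cancel_comm_monoid_add"
  assumes h: "exponent_hom h"
    and refl: "\<And>a. leq a a" and trans: "\<And>a b c. leq a b \<Longrightarrow> leq b c \<Longrightarrow> leq a c"
    and transl: "\<And>a b c. leq a b \<Longrightarrow> leq (c + a) (c + b)"
    and z: "\<And>l k. 3 \<le> l \<Longrightarrow> l \<le> n \<Longrightarrow> 1 \<le> k \<Longrightarrow> k < l \<Longrightarrow> k \<noteq> i l \<Longrightarrow> k \<noteq> j l \<Longrightarrow>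
      leq (h (E k l)) (h (single (z_var l) 1) + h (E k (j l)))"
    and kl: "k \<in> {1..n}" "l \<in> {1..n}" "k \<noteq> l"
    and e: "e \<in> keys (minor (generic_point h) k l)"
  shows "leq (h (E k l)) e"
proof -
  define N where "N = minor (generic_point h)"
  have orient: "\<forall>e\<in>keys (N p q). leq (h (E p q)) e"
    if "p \<in> {1..<l}" "q \<in> {1..<l}" "l \<le> n" "p \<noteq> q"
      and IH: "\<And>p q. 1 \<le> p \<Longrightarrow> p < q \<Longrightarrow> q < l \<Longrightarrow> \<forall>e\<in>keys (N p q). leq (h (E p q)) e" for p q l
  proof (cases p q rule: linorder_cases)
    case greater
    then show ?thesis using IH[of q p] that E_sym[of p q] minor_antisym[of "generic_point h" q p]
      unfolding N_def by simp
  qed (use that in auto)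
  have *: "\<forall>e\<in>keys (N k l). leq (h (E k l)) e" if "1 \<le> k" "k < l" "l \<le> n" for k l
    using that
  proof (induction rule: position_induct)
    case base
    then show ?case using h E_base refl by (simp add: N_def minor_base[simplified] exponent_hom_def)
  next
    case (x k l)
    have il: "i l \<in> {1..<l}" "j l \<in> {1..<l}" using i_range j_range x by auto
    have "keys (N k l) \<subseteq> keys (generic_point h (x_var l) * N k (i l)) \<union> keys (generic_point h (z_var l) * N k (j l))"
      unfolding N_def minor_step[OF x(1,2)] by (rule keys_add)
    also have "\<dots> \<subseteq> (+) (h (single (x_var l) 1)) ` keys (N k (i l)) \<union> (+) (h (single (z_var l) 1)) ` keys (N k (j l))"
      unfolding generic_point_def by (intro Un_mono keys_single_mult)
    finally have sub: "keys (N k l) \<subseteq> \<dots>" .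
    have 1: "leq (h (E k l)) (h (single (x_var l) 1) + e)" if "e \<in> keys (N k (i l))" for e
    proof -
      have "h (E k l) = h (single (x_var l) 1) + h (E k (i l))"
        using x h by (simp add: E_x exponent_hom_def)
      moreover have "leq (h (E k (i l))) e"
        using orient[of k l "i l"] x il that by auto
      ultimately show ?thesis using transl by metis
    qed
    have 2: "leq (h (E k l)) (h (single (z_var l) 1) + e)" if "e \<in> keys (N k (j l))" for e
    proof -
      have kj: "k \<noteq> j l" using that by (auto simp: N_def)
      then have "leq (h (E k (j l))) e"
        using orient[of k l "j l"] x il that by auto
      then show ?thesis using trans[OF z[OF x(1-5) kj] transl] by blast
    qed
    show ?case using sub 1 2 by blast
  next
    case (z l)
    have il: "i l \<in> {1..<l}" "j l \<in> {1..<l}" using i_range j_range z by auto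
    have "keys (N (i l) l) \<subseteq> (+) (h (single (z_var l) 1)) ` keys (N (i l) (j l))"
      using keys_single_mult unfolding N_def minor_step[OF z(1,2)] by (simp add: generic_point_def)
    moreover have "leq (h (E (i l) l)) (h (single (z_var l) 1) + e)" if "e \<in> keys (N (i l) (j l))" for e
    proof -
      have "h (E (i l) l) = h (single (z_var l) 1) + h (E (i l) (j l))"
        using z h by (simp add: E_z exponent_hom_def)
      moreover have "leq (h (E (i l) (j l))) e"
        using orient[of "i l" l "j l"] z il that i_neq_j[of l] by auto
      ultimately show ?thesis using transl by metis
    qed
    ultimately show ?case by blast
  qed
  show ?thesis
  proof (cases k l rule: linorder_cases)
    case less
    then show ?thesis using *[of k l] kl e by (simp add: N_def)
  next
    case greater
    have "N k l = - N l k" unfolding N_def by (rule minor_antisym)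
    then show ?thesis using *[of l k] kl greater E_sym[of k l] e by (simp add: N_def)
  qed (use kl in simp)
qed

text \<open>
  If the comparison is strict, the second summand cannot cancel the leading term of the first.
\<close>

lemma minor_lookup:
  fixes h :: "(nat \<Rightarrow>\<^sub>0 nat) \<Rightarrow> 'e::cancel_comm_monoid_add"
  assumes h: "exponent_hom h"
    and irrefl: "\<And>a. \<not> lt a a" and trans: "\<And>a b c. lt a b \<Longrightarrow> lt b c \<Longrightarrow> lt a c"
    and transl: "\<And>a b c. lt a b \<Longrightarrow> lt (c + a) (c + b)"
    and z: "\<And>l k. 3 \<le> l \<Longrightarrow> l \<le> n \<Longrightarrow> 1 \<le> k \<Longrightarrow> k < l \<Longrightarrow> k \<noteq> i l \<Longrightarrow> k \<noteq> j l \<Longrightarrow>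
      lt (h (E k l)) (h (single (z_var l) 1) + h (E k (j l)))"
    and kl: "k \<in> {1..n}" "l \<in> {1..n}" "k \<noteq> l"
  shows "lookup (minor (generic_point h) k l) (h (E k l)) = sg k l"
proof -
  define N where "N = minor (generic_point h)"
  define leq where "leq a b \<longleftrightarrow> a = b \<or> lt a b" for a b
  have keys: "leq (h (E k l)) e" if "k \<in> {1..n}" "l \<in> {1..n}" "k \<noteq> l" "e \<in> keys (N k l)" for k l e
    by (rule minor_keys[OF h, of leq]) (use trans transl z that in \<open>auto simp: leq_def N_def\<close>)
  have orient: "lookup (N p q) (h (E p q)) = sg p q"
    if "p \<in> {1..<l}" "q \<in> {1..<l}" "l \<le> n" "p \<noteq> q"
      and IH: "\<And>p q. 1 \<le> p \<Longrightarrow> p < q \<Longrightarrow> q < l \<Longrightarrow> lookup (N p q) (h (E p q)) = sg p q" for p q l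
  proof (cases p q rule: linorder_cases)
    case greater
    have "N p q = - N q p" unfolding N_def by (rule minor_antisym)
    then show ?thesis using IH[of q p] that E_sym[of p q] sg_antisym[of q p] greater by simp
  qed (use that in auto)
  have *: "lookup (N k l) (h (E k l)) = sg k l" if "1 \<le> k" "k < l" "l \<le> n" for k l
    using that
  proof (induction rule: position_induct)
    case base
    then show ?case using h E_base sg_base by (simp add: N_def minor_base[simplified] exponent_hom_def)
  next
    case (x k l)
    have il: "i l \<in> {1..<l}" "j l \<in> {1..<l}" using i_range j_range x by auto
    have hE: "h (E k l) = h (single (x_var l) 1) + h (E k (i l))"
      using x h by (simp add: E_x exponent_hom_def)
    have "lookup (generic_point h (x_var l) * N k (i l)) (h (E k l)) = sg k (i l)"
      unfolding hE generic_point_def lookup_single_mult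
      using orient[of k l "i l"] x il by auto
    moreover have "lookup (generic_point h (z_var l) * N k (j l)) (h (E k l)) = 0"
    proof (rule ccontr)
      assume "\<not> ?thesis"
      then have "h (E k l) \<in> keys (generic_point h (z_var l) * N k (j l))"
        by (simp add: in_keys_iff)
      then obtain e where e: "e \<in> keys (N k (j l))" "h (E k l) = h (single (z_var l) 1) + e"
        using keys_single_mult unfolding generic_point_def by blast
      then have kj: "k \<noteq> j l" by (auto simp: N_def)
      have "leq (h (E k (j l))) e" using keys[of k "j l"] x il kj e by auto
      then have "lt (h (E k l)) (h (E k l))"
        using z[OF x(1-5) kj] e(2) transl trans unfolding leq_def by metis
      then show False using irrefl by blast
    qed
    moreover have "N k l = generic_point h (x_var l) * N k (i l) + generic_point h (z_var l) * N k (j l)"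
      unfolding N_def by (rule minor_step[OF x(1,2)])
    ultimately show ?case using x by (simp add: lookup_add sg_x)
  next
    case (z l)
    have il: "i l \<in> {1..<l}" "j l \<in> {1..<l}" using i_range j_range z by auto
    have hE: "h (E (i l) l) = h (single (z_var l) 1) + h (E (i l) (j l))"
      using z h by (simp add: E_z exponent_hom_def)
    have "N (i l) l = generic_point h (z_var l) * N (i l) (j l)"
      unfolding N_def minor_step[OF z(1,2)] by simp
    then show ?case
      using orient[of "i l" l "j l"] z il i_neq_j[of l]
      unfolding hE generic_point_def by (simp only: lookup_single_mult) (simp add: sg_z)
  qed
  show ?thesis
  proof (cases k l rule: linorder_cases)
    case less
    then show ?thesis using *[of k l] kl by (simp add: N_def)
  next
    case greater
    have "N k l = - N l k" unfolding N_def by (rule minor_antisym)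
    then show ?thesis
      using *[of l k] kl greater E_sym[of k l] sg_antisym[of l k] by (simp add: N_def)
  qed (use kl in simp)
qed

text \<open>
  The comparison of the two summands in the recursion is the level condition for \<open>k\<close> and \<open>c = j\<^sub>l\<close>,
  from which the common factor \<open>E (i\<^sub>l) (j\<^sub>l)\<close> is cancelled.
\<close>

lemma level_z:
  fixes h :: "(nat \<Rightarrow>\<^sub>0 nat) \<Rightarrow> 'e::cancel_comm_monoid_add"
  assumes h: "exponent_hom h" and L: "level lt (\<lambda>k l. h (E k l))"
    and cancel: "\<And>a b c. lt (a + c) (b + c) \<Longrightarrow> lt a b"
    and lk: "3 \<le> l" "l \<le> n" "1 \<le> k" "k < l" "k \<noteq> i l" "k \<noteq> j l"
  shows "lt (h (E k l)) (h (single (z_var l) 1) + h (E k (j l)))"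
proof -
  have il: "i l \<in> {1..<l}" "j l \<in> {1..<l}" "i l \<noteq> j l" using i_range j_range i_neq_j lk by auto
  have "card {k, i l, j l} \<le> card {1..<l}" by (rule card_mono) (use lk il in auto)
  then have "4 \<le> l" using lk il by auto
  then have "lt (h (E k l) + h (E (i l) (j l))) (h (E (i l) l) + h (E k (j l)))"
    using levelD(2)[OF L, of l k "j l"] lk il by auto
  also have "h (E (i l) l) = h (single (z_var l) 1) + h (E (i l) (j l))"
    using lk h by (simp add: E_z exponent_hom_def)
  finally have "lt (h (E k l) + h (E (i l) (j l)))
      ((h (single (z_var l) 1) + h (E k (j l))) + h (E (i l) (j l)))"
    by (simp add: ac_simps)
  then show ?thesis by (rule cancel)
qed

end

subsection \<open>The order of the valuation\<close>

abbreviation zexp :: "(nat \<Rightarrow>\<^sub>0 nat) \<Rightarrow> nat \<Rightarrow>\<^sub>0 int" where "zexp \<equiv> Poly_Mapping.map int"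

lemma lookup_zexp [simp]: "lookup (zexp u) k = int (lookup u k)"
  by transfer (simp add: when_def)

lemma zexp_add: "zexp (u + v) = zexp u + zexp v"
  by (rule poly_mapping_eqI) (simp add: lookup_add)

lemma zexp_zero [simp]: "zexp 0 = 0"
  by (rule poly_mapping_eqI) simp

lemma zexp_inj: "zexp u = zexp v \<longleftrightarrow> u = v"
  by (auto simp: poly_mapping_eq_iff fun_eq_iff)

lemma Psi_add: "Psi S (a + b) = Psi S a + Psi S b"
  by (simp add: Psi_def lookup_add distrib_right sum.distrib)

lemma prec_irrefl: "\<not> prec S a a"
  by (simp add: prec_def)

lemma prec_trans: "prec S a b \<Longrightarrow> prec S b c \<Longrightarrow> prec S a c"
  by (auto simp: prec_def)

lemma prec_total: "prec S a b \<or> a = b \<or> prec S b a"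
  by (auto simp: prec_def)

lemma prec_add: "prec S (a + c) (b + c) \<longleftrightarrow> prec S a b"
  by (auto simp: prec_def Psi_add)

lemma lex_less_poly_mapping:
  fixes a b :: "nat \<Rightarrow>\<^sub>0 int"
  shows "lookup a k < lookup b k \<Longrightarrow> (\<And>k'. k' < k \<Longrightarrow> lookup a k' = lookup b k') \<Longrightarrow> a < b"
  by (auto simp: less_poly_mapping.rep_eq less_fun_def)

context iterated
begin

lemma Psi_single: "k < 2 * (n - 2) \<Longrightarrow> Psi S (zexp (single k 1)) = height (S ! k)"
proof -
  assume k: "k < 2 * (n - 2)"
  have "Psi S (zexp (single k 1)) = (\<Sum>m<2 * (n - 2). if m = k then height (S ! m) else 0)"
    unfolding Psi_def length_S by (rule sum.cong) (auto simp: lookup_single when_def)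
  then show ?thesis using k by simp
qed

text \<open>
  The height of the leading exponent depends on the pair only through \<open>k + l\<close>. All three products in
  a Pluecker relation thus have the same height, and the lexicographic part decides.
\<close>

lemma Psi_E:
  assumes "k \<in> {1..n}" "l \<in> {1..n}" "k \<noteq> l"
  shows "Psi S (zexp (E k l)) = int k + int l - 3"
proof -
  have *: "Psi S (zexp (E k l)) = int k + int l - 3" if "1 \<le> k" "k < l" "l \<le> n" for k l
    using that
  proof (induction rule: position_induct)
    case base then show ?case using E_base by (simp add: Psi_def)
  next
    case (x k l)
    have "Psi S (zexp (E k (i l))) = int k + int (i l) - 3"
      using x(6)[of k "i l"] x(6)[of "i l" k] x(1-5) i_range[of l] E_sym[of k "i l"]
      by (cases k "i l" rule: linorder_cases) auto
    moreover have "Psi S (zexp (single (x_var l) 1)) = int l - int (i l)"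
      using x nth_S[of l] Psi_single[of "x_var l"] by (simp add: height_def x_var_def)
    ultimately show ?case using x by (simp add: E_x zexp_add Psi_add)
  next
    case (z l)
    have "Psi S (zexp (E (i l) (j l))) = int (i l) + int (j l) - 3"
      using z(3)[of "j l" "i l"] z(3)[of "i l" "j l"] z(1-2) i_range[of l] j_range[of l] i_neq_j[of l]
        E_sym[of "i l" "j l"]
      by (cases "j l" "i l" rule: linorder_cases) auto
    moreover have "Psi S (zexp (single (z_var l) 1)) = int l - int (j l)"
      using z nth_S[of l] Psi_single[of "z_var l"] by (simp add: height_def z_var_def)
    ultimately show ?case using z by (simp add: E_z zexp_add Psi_add)
  qed
  show ?thesis
    using *[of k l] *[of l k] assms E_sym[of k l] by (cases k l rule: linorder_cases) auto
qed

text \<open>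
  By \<open>Psi_E\<close> the heights agree. The variable \<open>x\<^sub>l\<close> comes first among the variables involved and occurs in the
  products that break the cherry, but not in the one that keeps it; so these are
  lexicographically larger and come first in the order of the valuation.
\<close>

lemma level_E: "level (\<lambda>u v. prec S (zexp u) (zexp v)) E"
  unfolding level_def
proof (intro ballI impI conjI)
  fix l k c assume *: "l \<in> {4..n}" "k \<in> {1..<l} - {i l}" "c \<in> {1..<l} - {i l}" "k \<noteq> c"
  then have l: "3 \<le> l" "l \<le> n" by auto
  have a: "i l \<in> {1..<l}" "j l \<in> {1..<l}" "i l \<noteq> j l" using i_range[OF l] j_range[OF l] i_neq_j[OF l] by auto
  have s: "E (i l) c = E c (i l)" "E (i l) k = E k (i l)" using * a l by (auto intro: E_sym)
  show "E k l + E (i l) c = E c l + E (i l) k"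
    using * l E_x[OF l, of k] E_x[OF l, of c] s by (auto simp: ac_simps)
  let ?L = "E k l + E (i l) c" and ?R = "E (i l) l + E k c"
  have low: "lookup (E p q) m = 0" if "p \<in> {1..<l}" "q \<in> {1..<l}" "p \<noteq> q" "m \<le> x_var l + 1" for p q m
  proof -
    have "keys (E p q) \<subseteq> {2 * (n - max p q)..<2 * (n - 2)}"
      by (rule keys_E) (use that l in auto)
    moreover have "m \<notin> {2 * (n - max p q)..<2 * (n - 2)}"
      using that l by (auto simp: x_var_def max_def)
    ultimately show ?thesis by (metis in_keys_iff subsetD)
  qed
  have L: "?L = single (x_var l) 1 + E k (i l) + E (i l) c"
    and R: "?R = single (z_var l) 1 + E (i l) (j l) + E k c"
    using * l by (simp_all add: E_x E_z)
  have "lookup ?L m = (if m = x_var l then 1 else 0)" if "m \<le> x_var l" for m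
    unfolding L using low[of k "i l" m] low[of "i l" c m] * a that
    by (auto simp: lookup_add lookup_single when_def)
  moreover have "lookup ?R m = 0" if "m \<le> x_var l" for m
    unfolding R using low[of "i l" "j l" m] low[of k c m] * a that
    by (auto simp: lookup_add lookup_single when_def x_var_def z_var_def)
  ultimately have "zexp ?R < zexp ?L"
    by (intro lex_less_poly_mapping[of _ "x_var l"]) auto
  moreover have "Psi S (zexp ?L) = Psi S (zexp ?R)"
    using Psi_E[of k l] Psi_E[of "i l" c] Psi_E[of "i l" l] Psi_E[of k c] * a l
    by (auto simp: zexp_add Psi_add)
  ultimately show "prec S (zexp ?L) (zexp ?R)" by (simp add: prec_def)
qed

end

section \<open>The Pluecker ideal and its initial ideals\<close>

subsection \<open>Signed Pluecker coordinates\<close>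

text \<open>
  Signed coordinates \<open>p(a, b) = - p(b, a)\<close> are indexed by unordered pairs in any order. This makes the
  Pluecker relations available for all arrangements of four indices.
\<close>

definition pv :: "nat \<Rightarrow> nat \<Rightarrow> ppoly"
  where "pv a b = (if a < b then var_poly (a, b) else - var_poly (b, a))"

definition wt :: "weight \<Rightarrow> nat \<Rightarrow> nat \<Rightarrow> real"
  where "wt w a b = lookup w (min a b, max a b)"

lemma wt_sym: "wt w a b = wt w b a"
  by (simp add: wt_def min.commute max.commute)

lemma sorted4:
  fixes Q :: "nat \<Rightarrow> nat \<Rightarrow> nat \<Rightarrow> nat \<Rightarrow> bool"
  assumes s1: "\<And>a b c d. Q a b c d \<Longrightarrow> Q b a c d" and s2: "\<And>a b c d. Q a b c d \<Longrightarrow> Q a c b d"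
    and s3: "\<And>a b c d. Q a b c d \<Longrightarrow> Q a b d c"
    and base: "\<And>a b c d. A a \<Longrightarrow> A b \<Longrightarrow> A c \<Longrightarrow> A d \<Longrightarrow> a < b \<Longrightarrow> b < c \<Longrightarrow> c < d \<Longrightarrow> Q a b c d"
    and "A a" "A b" "A c" "A d" "distinct [a, b, c, d]"
  shows "Q a b c d"
proof -
  have three: "Q a b c d" if "A a" "A b" "A c" "A d" "distinct [a, b, c]" "a < d" "b < d" "c < d" for a b c d
  proof -
    have "a < b \<or> b < a" "a < c \<or> c < a" "b < c \<or> c < b" using that(5) by auto
    then have "a < b \<and> b < c \<or> a < c \<and> c < b \<or> b < a \<and> a < c \<or> b < c \<and> c < a \<or> c < a \<and> a < b \<or> c < b \<and> b < a"
      by (elim disjE) simp_all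
    then show ?thesis
    proof (elim disjE conjE)
      assume "a < b" "b < c"
      then show ?thesis using base[OF that(1,2,3,4)] that(8) by simp
    next
      assume "a < c" "c < b"
      then have "Q a c b d" using base[OF that(1,3,2,4)] that(7) by simp
      then show ?thesis by (rule s2)
    next
      assume "b < a" "a < c"
      then have "Q b a c d" using base[OF that(2,1,3,4)] that(8) by simp
      then show ?thesis by (rule s1)
    next
      assume "b < c" "c < a"
      then have "Q b c a d" using base[OF that(2,3,1,4)] that(6) by simp
      then show ?thesis by (rule s1[OF s2])
    next
      assume "c < a" "a < b"
      then have "Q c a b d" using base[OF that(3,1,2,4)] that(7) by simp
      then show ?thesis by (rule s2[OF s1])
    next
      assume "c < b" "b < a"
      then have "Q c b a d" using base[OF that(3,2,1,4)] that(6) by simp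
      then show ?thesis by (rule s1[OF s2[OF s1]])
    qed
  qed
  have ne: "\<not> a < b \<Longrightarrow> b < a" "\<not> a < c \<Longrightarrow> c < a" "\<not> a < d \<Longrightarrow> d < a" "\<not> b < c \<Longrightarrow> c < b"
    "\<not> b < d \<Longrightarrow> d < b" "\<not> c < d \<Longrightarrow> d < c"
    using assms(9) by auto
  have "(a < d \<and> b < d \<and> c < d) \<or> (a < c \<and> b < c \<and> d < c) \<or> (a < b \<and> c < b \<and> d < b) \<or>
      (b < a \<and> c < a \<and> d < a)"
  proof (cases "a < b")
    case True
    show ?thesis using True ne by (cases "c < d"; cases "b < d"; cases "b < c") (metis less_trans)+
  next
    case False
    show ?thesis using ne(1)[OF False] ne by (cases "c < d"; cases "a < d"; cases "a < c") (metis less_trans)+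
  qed
  then show ?thesis
  proof (elim disjE conjE)
    assume "a < d" "b < d" "c < d"
    then show ?thesis using three[OF assms(5,6,7,8)] assms(9) by simp
  next
    assume "a < c" "b < c" "d < c"
    then have "Q a b d c" using three[OF assms(5,6,8,7)] assms(9) by simp
    then show ?thesis by (rule s3)
  next
    assume "a < b" "c < b" "d < b"
    then have "Q a c d b" using three[OF assms(5,7,8,6)] assms(9) by simp
    then show ?thesis by (rule s2[OF s3])
  next
    assume "b < a" "c < a" "d < a"
    then have "Q b c d a" using three[OF assms(6,7,8,5)] assms(9) by auto
    then show ?thesis by (rule s1[OF s2[OF s3]])
  qed
qed

lemma pv_antisym: "a \<noteq> b \<Longrightarrow> pv b a = - pv a b"
  by (auto simp: pv_def)

lemma pv_closed: "a \<in> {1..n} \<Longrightarrow> b \<in> {1..n} \<Longrightarrow> a \<noteq> b \<Longrightarrow> pv a b \<in> carrier (plucker_ring n)"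
  unfolding pv_def by (auto intro!: poly_alg_closed simp: pairs_def)

lemma poly_ideal_kernel:
  assumes c: "coeff_hom c"
  shows "ideal {f \<in> carrier (poly_alg V). poly_subst c s f = 0} (poly_alg V)"
proof -
  interpret cring "poly_alg V" by (rule cring_poly_alg)
  show ?thesis
  proof (rule idealI)
    show "ring (poly_alg V)" by (rule ring_axioms)
    show "subgroup {f \<in> carrier (poly_alg V). poly_subst c s f = 0} (add_monoid (poly_alg V))"
    proof (rule add.subgroupI)
      fix f assume "f \<in> {f \<in> carrier (poly_alg V). poly_subst c s f = 0}"
      then show "\<ominus>\<^bsub>poly_alg V\<^esub> f \<in> {f \<in> carrier (poly_alg V). poly_subst c s f = 0}"
        using c by (simp add: poly_alg_closed poly_subst_uminus)
    qed (use c in \<open>auto simp: poly_subst_add poly_alg_closed intro: exI[of _ 0]\<close>)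
  qed (use c in \<open>auto simp: poly_subst_mult poly_alg_closed\<close>)
qed

lemma plucker_gens_closed:
  "{var_poly (i, j) * var_poly (k, l) - var_poly (i, k) * var_poly (j, l)
      + var_poly (i, l) * var_poly (j, k) | i j k l.
     1 \<le> i \<and> i < j \<and> j < k \<and> k < l \<and> l \<le> n} \<subseteq> carrier (plucker_ring n)"
  by (auto intro!: poly_alg_closed simp: pairs_def)

lemma poly_ideal_plucker: "poly_ideal (pairs n) (plucker_ideal n)"
proof (rule poly_ideal.intro)
  interpret cring "plucker_ring n" by (rule cring_poly_alg)
  show "ideal (plucker_ideal n) (plucker_ring n)"
    unfolding plucker_ideal_def by (rule genideal_ideal) (rule plucker_gens_closed)
qed

interpretation plucker: poly_ideal "pairs n" "plucker_ideal n" for n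
  by (rule poly_ideal_plucker)

lemma pv_pluecker:
  assumes "distinct [a, b, c, d]" "{a, b, c, d} \<subseteq> {1..n}"
  shows "pv a b * pv c d - pv a c * pv b d + pv a d * pv b c \<in> plucker_ideal n"
proof -
  define Q where "Q a b c d \<longleftrightarrow> distinct [a, b, c, d] \<and>
    pv a b * pv c d - pv a c * pv b d + pv a d * pv b c \<in> plucker_ideal n" for a b c d
  have "Q a b c d"
  proof (rule sorted4[of Q "\<lambda>x. x \<in> {1..n}"])
    fix a b c d assume *: "a \<in> {1..n}" "b \<in> {1..n}" "c \<in> {1..n}" "d \<in> {1..n}" "a < b" "b < c" "c < d"
    interpret cring "plucker_ring n" by (rule cring_poly_alg)
    have "var_poly (a, b) * var_poly (c, d) - var_poly (a, c) * var_poly (b, d)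
      + var_poly (a, d) * var_poly (b, c) \<in> plucker_ideal n"
      unfolding plucker_ideal_def
      by (rule subsetD[OF genideal_self[OF plucker_gens_closed]]) (use * in auto)
    then show "Q a b c d" using * by (simp add: Q_def pv_def)
  next
    fix a b c d assume "Q a b c d"
    then have d: "distinct [a, b, c, d]" and "pv a b * pv c d - pv a c * pv b d + pv a d * pv b c \<in> plucker_ideal n"
      by (auto simp: Q_def)
    then have m: "- (pv a b * pv c d - pv a c * pv b d + pv a d * pv b c) \<in> plucker_ideal n"
      by (intro plucker.minus_mem)
    have "pv b a = - pv a b" "pv c b = - pv b c" "pv d c = - pv c d" using d by (auto intro: pv_antisym)
    then have "pv b a * pv c d - pv b c * pv a d + pv b d * pv a c = - (pv a b * pv c d - pv a c * pv b d + pv a d * pv b c)"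
      "pv a c * pv b d - pv a b * pv c d + pv a d * pv c b = - (pv a b * pv c d - pv a c * pv b d + pv a d * pv b c)"
      "pv a b * pv d c - pv a d * pv b c + pv a c * pv b d = - (pv a b * pv c d - pv a c * pv b d + pv a d * pv b c)"
      by simp_all
    then show "Q b a c d" "Q a c b d" "Q a b d c" 
      unfolding Q_def using m d by (metis distinct_length_2_or_more)+
  qed (use assms in auto)
  then show ?thesis by (simp add: Q_def)
qed

text \<open>
  Any antisymmetric values that satisfy the three-term relations define a homomorphism that kills the ideal.
\<close>

lemma plucker_ideal_kernel:
  assumes c: "coeff_hom c"
    and rel: "\<And>a b c d. g a b * g c d - g a c * g b d + g a d * g b c = 0"
    and f: "f \<in> plucker_ideal n"
  shows "poly_subst c (\<lambda>(a, b). g a b) f = 0"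
proof -
  interpret cring "plucker_ring n" by (rule cring_poly_alg)
  have "plucker_ideal n \<subseteq> {f \<in> carrier (plucker_ring n). poly_subst c (\<lambda>(a, b). g a b) f = 0}"
    unfolding plucker_ideal_def
  proof (rule genideal_minimal[OF poly_ideal_kernel[OF c]], safe)
    fix i j k l assume *: "1 \<le> i" "i < j" "j < k" "k < l" "l \<le> n"
    show "var_poly (i, j) * var_poly (k, l) - var_poly (i, k) * var_poly (j, l)
        + var_poly (i, l) * var_poly (j, k) \<in> carrier (plucker_ring n)"
      using * by (auto intro!: poly_alg_closed simp: pairs_def)
    show "poly_subst c (\<lambda>(a, b). g a b) (var_poly (i, j) * var_poly (k, l) - var_poly (i, k) * var_poly (j, l)
        + var_poly (i, l) * var_poly (j, k)) = 0"
      using rel by (simp add: poly_subst_add[OF c] poly_subst_diff[OF c] poly_subst_mult[OF c] poly_subst_var[OF c])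
  qed
  then show ?thesis using f by auto
qed

lemma poly_subst_pv:
  assumes c: "coeff_hom c" and "g b a = - g a b" "a \<noteq> b"
  shows "poly_subst c (\<lambda>(a, b). g a b) (pv a b) = g a b"
  using assms(2,3) by (auto simp: pv_def poly_subst_uminus[OF c] poly_subst_var[OF c])

subsection \<open>Initial forms\<close>

lemma weight_of_add: "weight_of w (u + v) = weight_of w u + weight_of w v"
proof -
  have *: "weight_of w u = (\<Sum>x\<in>A. lookup w x * real (lookup u x))" if "finite A" "keys u \<subseteq> A" for A u
    unfolding weight_of_def by (rule sum.mono_neutral_left) (use that in \<open>auto simp: in_keys_iff\<close>)
  show ?thesis
    using *[of "keys u \<union> keys v" "u + v"] *[of "keys u \<union> keys v" u] *[of "keys u \<union> keys v" v]
    by (simp add: keys_nat_add lookup_add distrib_left sum.distrib)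
qed

lemma weight_of_zero [simp]: "weight_of w 0 = 0"
  by (simp add: weight_of_def)

lemma weight_of_single [simp]: "weight_of w (single x k) = lookup w x * real k"
  by (simp add: weight_of_def)

lemma initial_form_zero [simp]: "initial_form w 0 = 0"
  by (simp add: initial_form_def)

lemma initial_form_lookup:
  "lookup (initial_form w f) u =
    (if u \<in> keys f \<and> (\<forall>v\<in>keys f. weight_of w u \<le> weight_of w v) then lookup f u else 0)"
proof -
  let ?M = "{u \<in> keys f. \<forall>v \<in> keys f. weight_of w u \<le> weight_of w v}"
  have "lookup (initial_form w f) u = (\<Sum>v\<in>?M. if v = u then lookup f v else 0)"
    by (simp add: initial_form_def lookup_sum lookup_single when_def)
  also have "finite ?M" by simp
  then have "(\<Sum>v\<in>?M. if v = u then lookup f v else 0) = (if u \<in> ?M then lookup f u else 0)"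
    by (simp add: sum.delta)
  finally show ?thesis by simp
qed

lemma initial_form_keys: "keys (initial_form w f) \<subseteq> keys f"
  by (auto simp: in_keys_iff initial_form_lookup split: if_splits)

lemma initial_form_closed: "f \<in> carrier (poly_alg V) \<Longrightarrow> initial_form w f \<in> carrier (poly_alg V)"
  using initial_form_keys[of w f] unfolding carrier_poly_alg by blast

lemma initial_form_split:
  assumes "f \<noteq> 0"
  obtains c where "\<And>u. u \<in> keys (initial_form w f) \<Longrightarrow> weight_of w u = c"
    "\<And>u. u \<in> keys (f - initial_form w f) \<Longrightarrow> u \<in> keys f \<and> c < weight_of w u"
proof -
  have ne: "keys f \<noteq> {}" using assms by (metis keys_eq_empty)
  define c where "c = Min (weight_of w ` keys f)"
  have c: "c \<le> weight_of w u" if "u \<in> keys f" for u using that by (simp add: c_def)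
  have "c \<in> weight_of w ` keys f" unfolding c_def using ne by (intro Min_in) auto
  then obtain u0 where u0: "u0 \<in> keys f" "weight_of w u0 = c" by auto
  have iff: "(\<forall>v\<in>keys f. weight_of w u \<le> weight_of w v) \<longleftrightarrow> weight_of w u = c" if "u \<in> keys f" for u
    using c u0 that by (metis order_antisym)
  show thesis
  proof (rule that)
    show "weight_of w u = c" if "u \<in> keys (initial_form w f)" for u
      using that iff by (auto simp: in_keys_iff initial_form_lookup split: if_splits)
    show "u \<in> keys f \<and> c < weight_of w u" if "u \<in> keys (f - initial_form w f)" for u
      using that iff c by (fastforce simp: in_keys_iff lookup_minus initial_form_lookup split: if_splits)
  qed
qed

lemma initial_form_eqI:
  assumes "\<And>u. u \<in> keys g \<Longrightarrow> weight_of w u = c" "\<And>u. u \<in> keys h \<Longrightarrow> c < weight_of w u" "g \<noteq> 0"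
  shows "initial_form w (g + h) = g"
proof (rule poly_mapping_eqI)
  fix u
  obtain u0 where u0: "u0 \<in> keys g" using assms(3) by (metis keys_eq_empty all_not_in_conv)
  have disj: "lookup h u = 0" if "u \<in> keys g" for u using assms(1,2) that by (force simp: in_keys_iff)
  have u0': "u0 \<in> keys (g + h)" using u0 disj by (auto simp: in_keys_iff lookup_add)
  have min: "c \<le> weight_of w v" if "v \<in> keys (g + h)" for v
    using assms(1,2) that keys_add[of g h] by fastforce
  show "lookup (initial_form w (g + h)) u = lookup g u"
  proof (cases "u \<in> keys g")
    case True
    then show ?thesis
      using min assms(1) disj by (auto simp: initial_form_lookup lookup_add in_keys_iff)
  next
    case False
    have "\<not> (u \<in> keys (g + h) \<and> (\<forall>v\<in>keys (g + h). weight_of w u \<le> weight_of w v))"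
    proof
      assume *: "u \<in> keys (g + h) \<and> (\<forall>v\<in>keys (g + h). weight_of w u \<le> weight_of w v)"
      then have "u \<in> keys h" using False keys_add[of g h] by auto
      then show False using * u0' assms(1,2) u0 by fastforce
    qed
    then show ?thesis using False by (auto simp: initial_form_lookup in_keys_iff)
  qed
qed

lemma plucker_initial_closed: "initial_form w ` plucker_ideal n \<subseteq> carrier (plucker_ring n)"
  using plucker.subset initial_form_closed by blast

lemma poly_ideal_initial: "poly_ideal (pairs n) (initial_ideal n w)"
proof (rule poly_ideal.intro)
  interpret cring "plucker_ring n" by (rule cring_poly_alg)
  show "ideal (initial_ideal n w) (plucker_ring n)"
    unfolding initial_ideal_def by (rule genideal_ideal) (rule plucker_initial_closed)
qed

lemma initial_form_mem: "f \<in> plucker_ideal n \<Longrightarrow> initial_form w f \<in> initial_ideal n w"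
proof -
  assume f: "f \<in> plucker_ideal n"
  interpret cring "plucker_ring n" by (rule cring_poly_alg)
  show ?thesis unfolding initial_ideal_def
    by (rule subsetD[OF genideal_self[OF plucker_initial_closed]]) (use f in blast)
qed

text \<open>
  An ideal is generated by initial forms, so a homomorphism that kills these kills the whole ideal.
\<close>

lemma initial_ideal_kernel:
  assumes c: "coeff_hom c" and "\<And>f. f \<in> plucker_ideal n \<Longrightarrow> poly_subst c s (initial_form w f) = 0"
    and "f \<in> initial_ideal n w"
  shows "poly_subst c s f = 0"
proof -
  interpret cring "plucker_ring n" by (rule cring_poly_alg)
  have "initial_ideal n w \<subseteq> {f \<in> carrier (plucker_ring n). poly_subst c s f = 0}"
    unfolding initial_ideal_def
    by (rule genideal_minimal[OF poly_ideal_kernel[OF c]]) (use assms(2) plucker.subset in \<open>auto intro: initial_form_closed\<close>)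
  then show ?thesis using assms by auto
qed

subsection \<open>Lowest parts\<close>

definition restr :: "('e \<Rightarrow> real) \<Rightarrow> real \<Rightarrow> ('e \<Rightarrow>\<^sub>0 complex) \<Rightarrow> 'e \<Rightarrow>\<^sub>0 complex"
  where "restr \<omega> c g = (\<Sum>k\<in>{k \<in> keys g. \<omega> k = c}. single k (lookup g k))"

lemma lookup_restr: "lookup (restr \<omega> c g) k = (if \<omega> k = c then lookup g k else 0)"
proof -
  have "lookup (restr \<omega> c g) k = (\<Sum>l\<in>{k \<in> keys g. \<omega> k = c}. if l = k then lookup g l else 0)"
    by (simp add: restr_def lookup_sum lookup_single when_def)
  also have "finite {k \<in> keys g. \<omega> k = c}" by simp
  then have "(\<Sum>l\<in>{k \<in> keys g. \<omega> k = c}. if l = k then lookup g l else 0)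
      = (if k \<in> {k \<in> keys g. \<omega> k = c} then lookup g k else 0)"
    by (simp add: sum.delta)
  finally show ?thesis by (auto simp: in_keys_iff)
qed

text \<open>
  \<open>lowest \<omega> c g h\<close>: all exponents of \<open>g\<close> have weight at least \<open>c\<close>, and \<open>h\<close> is the part of weight \<open>c\<close>, which
  may vanish. Allowing zero makes the notion stable under sums.
\<close>

definition lowest :: "('e \<Rightarrow> real) \<Rightarrow> real \<Rightarrow> ('e \<Rightarrow>\<^sub>0 complex) \<Rightarrow> ('e \<Rightarrow>\<^sub>0 complex) \<Rightarrow> bool"
  where "lowest \<omega> c g h \<longleftrightarrow> (\<forall>k\<in>keys h. \<omega> k = c) \<and> (\<forall>k\<in>keys (g - h). c < \<omega> k)"

lemma lowest_restr:
  assumes "\<And>k. k \<in> keys g \<Longrightarrow> c \<le> \<omega> k"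
  shows "lowest \<omega> c g (restr \<omega> c g)"
  using assms unfolding lowest_def
  by (auto simp: in_keys_iff lookup_restr lookup_minus split: if_splits) force

lemma lowest_zero: "lowest \<omega> c 0 h \<Longrightarrow> h = 0"
  unfolding lowest_def by (metis all_not_in_conv diff_0 keys_eq_empty keys_minus less_irrefl)

lemma lowest_mult:
  fixes \<omega> :: "'e::comm_monoid_add \<Rightarrow> real"
  assumes \<omega>: "\<And>a b. \<omega> (a + b) = \<omega> a + \<omega> b" and "lowest \<omega> c g h" "lowest \<omega> c' g' h'"
  shows "lowest \<omega> (c + c') (g * g') (h * h')"
proof -
  have low: "\<And>k. k \<in> keys h \<Longrightarrow> \<omega> k = c" "\<And>k. k \<in> keys h' \<Longrightarrow> \<omega> k = c'"
    "\<And>k. k \<in> keys (g - h) \<Longrightarrow> c < \<omega> k" "\<And>k. k \<in> keys (g' - h') \<Longrightarrow> c' < \<omega> k"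
    using assms(2,3) unfolding lowest_def by blast+
  have eq: "g * g' - h * h' = (g - h) * (g' - h') + (g - h) * h' + h * (g' - h')"
    by (simp add: algebra_simps)
  have "\<omega> k = c + c'" if "k \<in> keys (h * h')" for k
    using that keys_mult[of h h'] low(1,2) by (auto simp: \<omega>)
  moreover have "c + c' < \<omega> k" if "k \<in> keys (g * g' - h * h')" for k
  proof -
    have "k \<in> keys ((g - h) * (g' - h')) \<or> k \<in> keys ((g - h) * h') \<or> k \<in> keys (h * (g' - h'))"
      using that unfolding eq by (auto dest!: set_mp[OF keys_add])
    then consider x y where "k = x + y" "x \<in> keys (g - h)" "y \<in> keys (g' - h')"
      | x y where "k = x + y" "x \<in> keys (g - h)" "y \<in> keys h'"
      | x y where "k = x + y" "x \<in> keys h" "y \<in> keys (g' - h')"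
      using keys_mult[of "g - h" "g' - h'"] keys_mult[of "g - h" h'] keys_mult[of h "g' - h'"] by blast
    then show ?thesis
    proof cases
      case 1
      then show ?thesis using low(3)[of x] low(4)[of y] by (simp add: \<omega>)
    next
      case 2
      then show ?thesis using low(3)[of x] low(2)[of y] by (simp add: \<omega>)
    next
      case 3
      then show ?thesis using low(1)[of x] low(4)[of y] by (simp add: \<omega>)
    qed
  qed
  ultimately show ?thesis unfolding lowest_def by blast
qed

lemma lowest_one: "\<omega> 0 = 0 \<Longrightarrow> lowest \<omega> 0 1 1"
  by (simp add: lowest_def)

lemma lowest_add:
  assumes "lowest \<omega> c g h" "lowest \<omega> c g' h'"
  shows "lowest \<omega> c (g + g') (h + h')"
  using assms unfolding lowest_def
  by (auto simp: add_diff_add dest!: set_mp[OF keys_add])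

lemma lowest_smult:
  assumes "lowest \<omega> c g (h :: 'e::comm_monoid_add \<Rightarrow>\<^sub>0 complex)"
  shows "lowest \<omega> c (single 0 a * g) (single 0 a * h)"
proof -
  have "keys (single 0 a * f) \<subseteq> keys f" for f :: "'e \<Rightarrow>\<^sub>0 complex"
    using keys_mult[of "single 0 a" f] by (auto split: if_splits)
  then show ?thesis using assms unfolding lowest_def right_diff_distrib[symmetric] by blast
qed

lemma lowest_higher: "lowest \<omega> c' g h \<Longrightarrow> c < c' \<Longrightarrow> lowest \<omega> c g 0"
  unfolding lowest_def
proof (intro conjI ballI)
  fix k assume *: "(\<forall>k\<in>keys h. \<omega> k = c') \<and> (\<forall>k\<in>keys (g - h). c' < \<omega> k)" "c < c'" "k \<in> keys (g - 0)"
  then have "k \<in> keys (g - h) \<or> k \<in> keys h" by (auto simp: in_keys_iff lookup_minus)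
  then show "c < \<omega> k" using * by auto
qed simp

text \<open>
  If the images of the variables under a substitution have lowest parts prescribed by the weight
  \<open>w\<close>, then the image of a polynomial has as its lowest part the image of its initial form under
  the substitution of the lowest parts.
\<close>

lemma lowest_subst:
  fixes \<omega> :: "'e::comm_monoid_add \<Rightarrow> real"
  assumes \<omega>: "\<omega> 0 = 0" "\<And>a b. \<omega> (a + b) = \<omega> a + \<omega> b"
    and low: "\<And>x. x \<in> V \<Longrightarrow> lowest \<omega> (lookup w x) (s x) (t x)"
    and f: "f \<in> carrier (poly_alg V)" "poly_subst (single 0) s f = 0"
  shows "poly_subst (single 0) t (initial_form w f) = 0"
proof (cases "f = 0")
  case True
  then show ?thesis by (simp add: poly_subst_zero[OF coeff_hom_single])
next
  case False
  have mono: "lowest \<omega> (weight_of w u) (mono_eval s u) (mono_eval t u)" if "keys u \<subseteq> V" for u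
    using that
  proof (induction rule: exponent_induct)
    case zero
    then show ?case using lowest_one[of \<omega>] \<omega> by simp
  next
    case (add u x)
    then show ?case
      using lowest_mult[OF \<omega>(2) low[of x] add(3)] by (simp add: mono_eval_add weight_of_add)
  qed
  obtain c where c: "\<And>u. u \<in> keys (initial_form w f) \<Longrightarrow> weight_of w u = c"
    "\<And>u. u \<in> keys (f - initial_form w f) \<Longrightarrow> u \<in> keys f \<and> c < weight_of w u"
    using initial_form_split[OF False] by metis
  have fin: "lowest \<omega> c (\<Sum>u\<in>A. g u) (\<Sum>u\<in>A. h u)"
    if "finite A" "\<And>u. u \<in> A \<Longrightarrow> lowest \<omega> c (g u) (h u)" for A :: "('a \<Rightarrow>\<^sub>0 nat) set" and g h
    using that
  proof (induction A)
    case empty then show ?case by (simp add: lowest_def)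
  next
    case (insert u A) then show ?case by (simp add: lowest_add)
  qed
  have kV: "keys u \<subseteq> V" if "u \<in> keys f" for u using f that by (auto simp: carrier_poly_alg)
  have 1: "lowest \<omega> c (poly_subst (single 0) s (initial_form w f)) (poly_subst (single 0) t (initial_form w f))"
    unfolding poly_subst_keys[OF coeff_hom_single]
  proof (rule fin)
    fix u assume u: "u \<in> keys (initial_form w f)"
    show "lowest \<omega> c (single 0 (lookup (initial_form w f) u) * mono_eval s u)
        (single 0 (lookup (initial_form w f) u) * mono_eval t u)"
      using lowest_smult[OF mono[OF kV]] u initial_form_keys[of w f] c(1)[OF u] by fastforce
  qed simp
  have 2: "lowest \<omega> c (poly_subst (single 0) s (f - initial_form w f)) (\<Sum>u\<in>keys (f - initial_form w f). 0)"
    unfolding poly_subst_keys[OF coeff_hom_single]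
  proof (rule fin)
    fix u assume u: "u \<in> keys (f - initial_form w f)"
    show "lowest \<omega> c (single 0 (lookup (f - initial_form w f) u) * mono_eval s u) 0"
      using lowest_higher[OF lowest_smult[OF mono[OF kV]]] c(2)[OF u] by blast
  qed simp
  have "lowest \<omega> c (poly_subst (single 0) s f) (poly_subst (single 0) t (initial_form w f))"
    using lowest_add[OF 1 2] by (simp add: poly_subst_diff[OF coeff_hom_single])
  then show ?thesis using f(2) by (simp add: lowest_zero)
qed

interpretation initial: poly_ideal "pairs n" "initial_ideal n w" for n w
  by (rule poly_ideal_initial)

subsection \<open>Initial forms of the Pluecker relations\<close>

definition pv_exp :: "nat \<Rightarrow> nat \<Rightarrow> nat \<times> nat \<Rightarrow>\<^sub>0 nat"
  where "pv_exp a b = single (min a b, max a b) 1"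

lemma pv_single: "pv a b = single (pv_exp a b) (if a < b then 1 else -1)"
  by (auto simp: pv_def pv_exp_def var_poly_def single_uminus min_def max_def)

lemma pv_mult: "pv a b * pv c d =
    single (pv_exp a b + pv_exp c d) ((if a < b then 1 else -1) * (if c < d then 1 else -1))"
  by (simp add: pv_single mult_single)

lemma pv_exp_weight: "weight_of w (pv_exp a b + pv_exp c d) = wt w a b + wt w c d"
  by (simp add: weight_of_add pv_exp_def wt_def)

lemma pv_exp_distinct:
  assumes "distinct [a, b, c, d]"
  shows "pv_exp a b + pv_exp c d \<noteq> pv_exp a c + pv_exp b d"
    "pv_exp a b + pv_exp c d \<noteq> pv_exp a d + pv_exp b c"
    "pv_exp a c + pv_exp b d \<noteq> pv_exp a d + pv_exp b c"
proof -
  have ne: "(min x y, max x y) \<noteq> (min z t, max z t)" if "{x, y} \<noteq> {z, t}" for x y z t :: nat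
    using that by (auto simp: min_def max_def split: if_splits)
  have 1: "lookup (pv_exp x y + pv_exp z t) (min x y, max x y) \<noteq> 0" for x y z t
    by (simp add: pv_exp_def lookup_add)
  have 0: "lookup (pv_exp x y + pv_exp z t) (min a b, max a b) = 0"
    if "{x, y} \<noteq> {a, b}" "{z, t} \<noteq> {a, b}" for x y z t a b
    using ne[OF that(1)] ne[OF that(2)] by (simp add: pv_exp_def lookup_add lookup_single_not_eq)
  show "pv_exp a b + pv_exp c d \<noteq> pv_exp a c + pv_exp b d"
    using 1[of a b c d] 0[of a c a b b d] assms by (metis distinct_length_2_or_more doubleton_eq_iff)
  show "pv_exp a b + pv_exp c d \<noteq> pv_exp a d + pv_exp b c"
    using 1[of a b c d] 0[of a d a b b c] assms by (metis distinct_length_2_or_more doubleton_eq_iff)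
  show "pv_exp a c + pv_exp b d \<noteq> pv_exp a d + pv_exp b c"
    using 1[of a c b d] 0[of a d a c b c] assms by (metis distinct_length_2_or_more doubleton_eq_iff)
qed

definition pluecker_relation :: "nat \<Rightarrow> nat \<Rightarrow> nat \<Rightarrow> nat \<Rightarrow> ppoly"
  where "pluecker_relation a b c d = pv a b * pv c d - pv a c * pv b d + pv a d * pv b c"

lemma initial_form_pluecker:
  fixes w :: weight
  assumes d: "distinct [a, b, c, d]"
  defines "x1 \<equiv> wt w a b + wt w c d" and "x2 \<equiv> wt w a c + wt w b d" and "x3 \<equiv> wt w a d + wt w b c"
  defines "m \<equiv> min x1 (min x2 x3)"
  shows "initial_form w (pluecker_relation a b c d) =
    (if x1 = m then pv a b * pv c d else 0) - (if x2 = m then pv a c * pv b d else 0)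
      + (if x3 = m then pv a d * pv b c else 0)"
proof -
  let ?g = "\<lambda>P. (if P x1 then pv a b * pv c d else 0) - (if P x2 then pv a c * pv b d else 0)
      + (if P x3 then pv a d * pv b c else 0)"
  have k: "weight_of w u = x1 \<and> P x1 \<or> weight_of w u = x2 \<and> P x2 \<or> weight_of w u = x3 \<and> P x3"
    if u: "u \<in> keys (?g P)" for u P
  proof -
    have sub: "keys (A - B + C) \<subseteq> keys A \<union> keys B \<union> keys C" for A B C :: ppoly
      using keys_add[of "A - B" C] keys_diff_subset[of A B] by blast
    have "u \<in> keys (if P x1 then pv a b * pv c d else 0) \<union> keys (if P x2 then pv a c * pv b d else 0)
        \<union> keys (if P x3 then pv a d * pv b c else 0)"
      by (rule subsetD[OF sub u])
    then have "P x1 \<and> u \<in> keys (pv a b * pv c d) \<or> P x2 \<and> u \<in> keys (pv a c * pv b d)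
        \<or> P x3 \<and> u \<in> keys (pv a d * pv b c)"
      by (cases "P x1"; cases "P x2"; cases "P x3") simp_all
    moreover have "weight_of w u = wt w a b + wt w c d" if "u \<in> keys (pv a b * pv c d)" for a b c d
      using that by (simp add: pv_mult pv_exp_weight split: if_splits)
    ultimately show ?thesis unfolding x1_def x2_def x3_def by metis
  qed
  have split: "pluecker_relation a b c d = ?g (\<lambda>x. x = m) + ?g (\<lambda>x. x \<noteq> m)"
    by (simp add: pluecker_relation_def)
  have "initial_form w (?g (\<lambda>x. x = m) + ?g (\<lambda>x. x \<noteq> m)) = ?g (\<lambda>x. x = m)"
  proof (rule initial_form_eqI)
    show "weight_of w u = m" if "u \<in> keys (?g (\<lambda>x. x = m))" for u using k[OF that] by auto
    show "m < weight_of w u" if "u \<in> keys (?g (\<lambda>x. x \<noteq> m))" for u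
      using k[OF that] unfolding m_def by (auto simp: min_def split: if_splits)
    have "x1 = m \<or> x2 = m \<or> x3 = m" unfolding m_def by (auto simp: min_def)
    then show "?g (\<lambda>x. x = m) \<noteq> 0"
    proof (elim disjE)
      assume "x1 = m"
      then have "lookup (?g (\<lambda>x. x = m)) (pv_exp a b + pv_exp c d) \<noteq> 0"
        using pv_exp_distinct[OF d] by (auto simp: pv_mult lookup_add lookup_minus lookup_single when_def)
      then show ?thesis by (metis lookup_zero)
    next
      assume "x2 = m"
      then have "lookup (?g (\<lambda>x. x = m)) (pv_exp a c + pv_exp b d) \<noteq> 0"
        using pv_exp_distinct[OF d] by (auto simp: pv_mult lookup_add lookup_minus lookup_single when_def)
      then show ?thesis by (metis lookup_zero)
    next
      assume "x3 = m"
      then have "lookup (?g (\<lambda>x. x = m)) (pv_exp a d + pv_exp b c) \<noteq> 0"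
        using pv_exp_distinct[OF d] by (auto simp: pv_mult lookup_add lookup_minus lookup_single when_def)
      then show ?thesis by (metis lookup_zero)
    qed
  qed
  then show ?thesis unfolding split .
qed

lemma pluecker_relation_mem:
  "distinct [a, b, c, d] \<Longrightarrow> {a, b, c, d} \<subseteq> {1..n} \<Longrightarrow> pluecker_relation a b c d \<in> plucker_ideal n"
  unfolding pluecker_relation_def by (rule pv_pluecker)

text \<open>
  If a single term of a Pluecker relation had minimal weight, it would be a monomial in the initial ideal.
\<close>

lemma pv_product_not_initial:
  assumes "w \<in> trop_gr n"
  shows "pv a b * pv c d \<notin> initial_ideal n w"
proof
  let ?e = "(if a < b then 1 else -1) * (if c < d then 1 else -1) :: complex"
  assume *: "pv a b * pv c d \<in> initial_ideal n w"
  have "const_poly ?e * (pv a b * pv c d) \<in> initial_ideal n w"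
    by (rule initial.mult_mem'[OF *]) (rule poly_alg_const_closed)
  moreover have "const_poly ?e * (pv a b * pv c d) = single (pv_exp a b + pv_exp c d) 1"
    by (simp add: pv_mult const_poly_mult_single)
  ultimately show False using assms by (simp add: trop_gr_def)
qed

text \<open>The four point condition: in no Pluecker relation does a single term have minimal weight.\<close>

lemma trop_four_point:
  assumes w: "w \<in> trop_gr n" and d: "distinct [a, b, c, d]" "{a, b, c, d} \<subseteq> {1..n}"
  shows "\<not> (wt w a b + wt w c d < wt w a c + wt w b d \<and> wt w a b + wt w c d < wt w a d + wt w b c)"
proof
  assume *: "wt w a b + wt w c d < wt w a c + wt w b d \<and> wt w a b + wt w c d < wt w a d + wt w b c"
  have "initial_form w (pluecker_relation a b c d) = pv a b * pv c d"
    unfolding initial_form_pluecker[OF d(1)] using * by (auto simp: min_def)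
  then have "pv a b * pv c d \<in> initial_ideal n w"
    using initial_form_mem[OF pluecker_relation_mem[OF d], of w] by simp
  then show False using pv_product_not_initial[OF w] by blast
qed

subsection \<open>Leading terms\<close>

text \<open>
  The first exponent of \<open>g\<close> is \<open>e\<close>, with coefficient \<open>c\<close>. As with \<open>lowest\<close> the coefficient may be zero.
\<close>

definition lead :: "('e \<Rightarrow> 'e \<Rightarrow> bool) \<Rightarrow> ('e \<Rightarrow>\<^sub>0 complex) \<Rightarrow> 'e \<Rightarrow> complex \<Rightarrow> bool"
  where "lead lt g e c \<longleftrightarrow> (\<forall>k\<in>keys (g - single e c). lt e k)"

lemma leadI:
  assumes "lookup g e = c" "\<And>k. k \<in> keys g \<Longrightarrow> k = e \<or> lt e k"
  shows "lead lt g e c"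
  unfolding lead_def
proof
  fix k assume k: "k \<in> keys (g - single e c)"
  then have "k \<noteq> e" using assms(1) by (auto simp: in_keys_iff lookup_minus)
  then show "lt e k" using k assms(2)[of k] by (simp add: in_keys_iff lookup_minus lookup_single_not_eq)
qed

lemma lead_single: "lead lt (single e c) e c"
  by (simp add: lead_def)

locale exponent_order =
  fixes lt :: "'e::cancel_comm_monoid_add \<Rightarrow> 'e \<Rightarrow> bool"
  assumes irrefl: "\<not> lt a a" and trans: "lt a b \<Longrightarrow> lt b c \<Longrightarrow> lt a c"
    and add_iff: "lt (a + c) (b + c) \<longleftrightarrow> lt a b"
begin

lemma add_left: "lt a b \<Longrightarrow> lt (c + a) (c + b)"
  using add_iff[of a c b] by (simp add: add.commute)

lemma lead_lookup: "lead lt g e c \<Longrightarrow> lookup g e = c"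
  using irrefl[of e] unfolding lead_def by (auto simp: in_keys_iff lookup_minus dest: bspec[of _ _ e])

lemma lead_lookup_lower:
  assumes "lead lt g e c" "lt a e" shows "lookup g a = 0"
proof (rule ccontr)
  assume "lookup g a \<noteq> 0"
  moreover have "a \<noteq> e" using assms(2) irrefl by blast
  ultimately have "a \<in> keys (g - single e c)" by (simp add: in_keys_iff lookup_minus lookup_single)
  then have "lt e a" using assms(1) by (simp add: lead_def)
  then show False using assms(2) irrefl trans by blast
qed

lemma lead_keys: "lead lt g e c \<Longrightarrow> k \<in> keys g \<Longrightarrow> k = e \<or> lt e k"
  unfolding lead_def by (cases "k = e") (auto simp: in_keys_iff lookup_minus lookup_single_not_eq)

lemma lead_mult:
  assumes "lead lt g e c" "lead lt g' e' c'"
  shows "lead lt (g * g') (e + e') (c * c')"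
proof -
  let ?r = "g - single e c" and ?r' = "g' - single e' c'"
  have eq: "g * g' - single (e + e') (c * c') = ?r * ?r' + ?r * single e' c' + single e c * ?r'"
    by (simp add: algebra_simps mult_single)
  have "lt (e + e') k" if "k \<in> keys (g * g' - single (e + e') (c * c'))" for k
  proof -
    have "k \<in> keys (?r * ?r') \<or> k \<in> keys (?r * single e' c') \<or> k \<in> keys (single e c * ?r')"
      using that unfolding eq by (auto dest!: set_mp[OF keys_add])
    then consider x y where "k = x + y" "x \<in> keys ?r" "y \<in> keys ?r'"
      | x where "k = x + e'" "x \<in> keys ?r" | y where "k = e + y" "y \<in> keys ?r'"
      using keys_mult[of ?r ?r'] keys_mult[of ?r "single e' c'"] keys_mult[of "single e c" ?r']
      by (auto split: if_splits)
    then show ?thesis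
    proof cases
      case 1
      then have "lt (e + e') (x + e')" "lt (x + e') (x + y)"
        using assms add_iff add_left unfolding lead_def by auto
      then show ?thesis using 1 trans by blast
    next
      case 2
      then show ?thesis using assms add_iff unfolding lead_def by auto
    next
      case 3
      then show ?thesis using assms add_left unfolding lead_def by auto
    qed
  qed
  then show ?thesis by (simp add: lead_def)
qed

lemma lead_one: "lead lt 1 0 1"
  using lead_single[of lt 0 1] by simp

lemma lead_smult: "lead lt g e c \<Longrightarrow> lead lt (single 0 a * g) e (a * c)"
  using lead_mult[OF lead_single[of lt 0 a]] by simp

lemma lead_uminus: "lead lt g e c \<Longrightarrow> lead lt (- g) e (- c)"
  using lead_smult[of g e c "-1"] by (simp add: single_uminus)

end

section \<open>The toric degeneration of a labeled iterated sequence\<close>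

type_synonym target = "(nat \<times> (nat \<Rightarrow>\<^sub>0 int)) \<Rightarrow>\<^sub>0 complex"

text \<open>
  Position \<open>k\<close> in the construction of the tree carries the label \<open>\<sigma> k\<close>, and \<open>\<rho>\<close> is the inverse of \<open>\<sigma>\<close>. For
  the cone of a sequence the labeling is the identity; a general maximal cone requires a permutation.
\<close>

locale labeled = iterated +
  fixes \<sigma> \<rho> :: "nat \<Rightarrow> nat"
  assumes \<sigma>: "k \<in> {1..n} \<Longrightarrow> \<sigma> k \<in> {1..n} \<and> \<rho> (\<sigma> k) = k"
    and \<rho>: "a \<in> {1..n} \<Longrightarrow> \<rho> a \<in> {1..n} \<and> \<sigma> (\<rho> a) = a"
begin

lemma \<sigma>_inj: "k \<in> {1..n} \<Longrightarrow> l \<in> {1..n} \<Longrightarrow> \<sigma> k = \<sigma> l \<longleftrightarrow> k = l"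
  using \<sigma> by metis

lemma \<rho>_inj: "a \<in> {1..n} \<Longrightarrow> b \<in> {1..n} \<Longrightarrow> \<rho> a = \<rho> b \<longleftrightarrow> a = b"
  using \<rho> by metis

definition emb :: "(nat \<Rightarrow>\<^sub>0 nat) \<Rightarrow> nat \<times> (nat \<Rightarrow>\<^sub>0 int)"
  where "emb u = (0, zexp u)"

lemma exponent_hom_emb: "exponent_hom emb"
  by (simp add: exponent_hom_def emb_def zexp_add zero_prod_def)

definition lt :: "nat \<times> (nat \<Rightarrow>\<^sub>0 int) \<Rightarrow> nat \<times> (nat \<Rightarrow>\<^sub>0 int) \<Rightarrow> bool"
  where "lt p q \<longleftrightarrow> prec S (snd p) (snd q)"

sublocale lt: exponent_order lt
  by unfold_locales (auto simp: lt_def prec_irrefl prec_add intro: prec_trans)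

definition top_exp :: "nat \<Rightarrow> nat \<Rightarrow> nat \<times> (nat \<Rightarrow>\<^sub>0 int)"
  where "top_exp k l = (1, zexp (E k l))"

text \<open>
  \<open>psi\<close> is the parametrization by the minors and \<open>phi\<close> its leading part. The first component of an
  exponent is the degree, without which the semigroup would not be graded.
\<close>

definition psi_var :: "nat \<Rightarrow> nat \<Rightarrow> target"
  where "psi_var a b = single (1, 0) 1 * minor (generic_point emb) (\<rho> a) (\<rho> b)"

definition phi_var :: "nat \<Rightarrow> nat \<Rightarrow> target"
  where "phi_var a b = single (top_exp (\<rho> a) (\<rho> b)) (sg (\<rho> a) (\<rho> b))"

definition psi :: "ppoly \<Rightarrow> target" where "psi = poly_subst (single 0) (\<lambda>(a, b). psi_var a b)"
definition phi :: "ppoly \<Rightarrow> target" where "phi = poly_subst (single 0) (\<lambda>(a, b). phi_var a b)"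

definition pos_wt :: "weight \<Rightarrow> nat \<Rightarrow> nat \<Rightarrow> real"
  where "pos_wt w k l = wt w (\<sigma> k) (\<sigma> l)"

definition open_cone :: "weight set" where "open_cone = {w \<in> weights n. level (<) (pos_wt w)}"
definition closed_cone :: "weight set" where "closed_cone = {w \<in> weights n. level (\<le>) (pos_wt w)}"

lemma open_closed: "w \<in> open_cone \<Longrightarrow> w \<in> closed_cone"
  unfolding open_cone_def closed_cone_def level_def by (auto intro: less_imp_le)

text \<open>
  The weights of the variables \<open>x\<^sub>l\<close> and \<open>z\<^sub>l\<close> for which the leading exponent of \<open>p(k, l)\<close> gets exactly
  the weight of the coordinate. They are solved from the pairs \<open>(j\<^sub>l, l)\<close> and \<open>(i\<^sub>l, l)\<close>.
\<close>

definition var_weight :: "weight \<Rightarrow> nat \<Rightarrow> real"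
  where "var_weight w k = (let l = n - k div 2 in
    (if even k then pos_wt w (j l) l else pos_wt w (i l) l) - pos_wt w (i l) (j l))"

definition omega :: "weight \<Rightarrow> nat \<times> (nat \<Rightarrow>\<^sub>0 int) \<Rightarrow> real"
  where "omega w p = real (fst p) * pos_wt w 1 2
    + (\<Sum>k<2 * (n - 2). of_int (lookup (snd p) k) * var_weight w k)"

lemma omega_zero: "omega w 0 = 0"
  by (simp add: omega_def)

lemma omega_add: "omega w (p + q) = omega w p + omega w q"
  by (simp add: omega_def lookup_add distrib_right sum.distrib)

lemma omega_single: "k < 2 * (n - 2) \<Longrightarrow> omega w (emb (single k 1)) = var_weight w k"
proof -
  assume k: "k < 2 * (n - 2)"
  have "omega w (emb (single k 1)) = (\<Sum>m<2 * (n - 2). of_int (lookup (zexp (single k 1)) m) * var_weight w m)"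
    by (simp add: omega_def emb_def)
  also have "\<dots> = (\<Sum>m<2 * (n - 2). if m = k then var_weight w m else 0)"
    by (rule sum.cong) (auto simp: lookup_single when_def)
  finally have "omega w (emb (single k 1)) = (\<Sum>m<2 * (n - 2). if m = k then var_weight w m else 0)" .
  then show ?thesis using k by simp
qed

lemma omega_x: "3 \<le> l \<Longrightarrow> l \<le> n \<Longrightarrow>
    omega w (emb (single (x_var l) 1)) = pos_wt w (j l) l - pos_wt w (i l) (j l)"
  and omega_z: "3 \<le> l \<Longrightarrow> l \<le> n \<Longrightarrow>
    omega w (emb (single (z_var l) 1)) = pos_wt w (i l) l - pos_wt w (i l) (j l)"
  by (subst omega_single, simp add: x_var_def, simp add: var_weight_def x_var_def)
    (subst omega_single, simp add: z_var_def, simp add: var_weight_def z_var_def)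

lemma pos_wt_sym: "pos_wt w k l = pos_wt w l k"
  by (simp add: pos_wt_def wt_sym)

lemma omega_E:
  assumes w: "w \<in> closed_cone" and kl: "k \<in> {1..n}" "l \<in> {1..n}" "k \<noteq> l"
  shows "omega w (emb (E k l)) = pos_wt w k l - pos_wt w 1 2"
proof -
  have L: "level (\<le>) (pos_wt w)" using w by (simp add: closed_cone_def)
  have emb_add: "omega w (emb (u + v)) = omega w (emb u) + omega w (emb v)" for u v
    using exponent_hom_emb by (simp add: exponent_hom_def omega_add)
  have *: "omega w (emb (E k l)) = pos_wt w k l - pos_wt w 1 2" if "1 \<le> k" "k < l" "l \<le> n" for k l
    using that
  proof (induction rule: position_induct)
    case base
    then show ?case using E_base exponent_hom_emb by (simp add: exponent_hom_def omega_zero)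
  next
    case (x k l)
    have r: "i l \<in> {1..<l}" "j l \<in> {1..<l}" "i l \<noteq> j l" using i_range j_range i_neq_j x by auto
    have IH: "omega w (emb (E k (i l))) = pos_wt w k (i l) - pos_wt w 1 2"
      using x(6)[of k "i l"] x(6)[of "i l" k] x(1-5) r E_sym[of k "i l"] pos_wt_sym[of w k "i l"]
      by (cases k "i l" rule: linorder_cases) auto
    have "pos_wt w k l = (pos_wt w (j l) l - pos_wt w (i l) (j l)) + pos_wt w k (i l)"
    proof (cases "k = j l")
      case True then show ?thesis by (simp add: pos_wt_sym)
    next
      case False
      have "card {k, i l, j l} \<le> card {1..<l}" by (rule card_mono) (use x r in auto)
      then have "4 \<le> l" using x r False by auto
      then have "pos_wt w k l + pos_wt w (i l) (j l) = pos_wt w (j l) l + pos_wt w (i l) k"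
        using levelD(1)[OF L, of l k "j l"] x r False by auto
      then show ?thesis using pos_wt_sym[of w k "i l"] by simp
    qed
    then show ?case using IH omega_x[OF x(1,2)] E_x[OF x(1,2,4,5)] by (simp add: emb_add)
  next
    case (z l)
    have r: "i l \<in> {1..<l}" "j l \<in> {1..<l}" "i l \<noteq> j l" using i_range j_range i_neq_j z by auto
    have IH: "omega w (emb (E (i l) (j l))) = pos_wt w (i l) (j l) - pos_wt w 1 2"
      using z(3)[of "j l" "i l"] z(3)[of "i l" "j l"] z(1-2) r E_sym[of "i l" "j l"] pos_wt_sym[of w "j l" "i l"]
      by (cases "j l" "i l" rule: linorder_cases) auto
    then show ?case using omega_z[OF z(1,2)] E_z[OF z(1,2)] by (simp add: emb_add)
  qed
  show ?thesis
    using *[of k l] *[of l k] kl E_sym[of k l] pos_wt_sym[of w k l] by (cases k l rule: linorder_cases) auto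
qed

lemma omega_top:
  assumes "w \<in> closed_cone" "k \<in> {1..n}" "l \<in> {1..n}" "k \<noteq> l"
  shows "omega w (top_exp k l) = pos_wt w k l"
proof -
  have "top_exp k l = (1, 0) + emb (E k l)" by (simp add: top_exp_def emb_def)
  then show ?thesis using omega_E[OF assms] by (simp only: omega_add) (simp add: omega_def)
qed

lemma pos_wt_\<rho>: "a \<in> {1..n} \<Longrightarrow> b \<in> {1..n} \<Longrightarrow> pos_wt w (\<rho> a) (\<rho> b) = wt w a b"
  using \<rho> by (simp add: pos_wt_def)

lemma level_lt: "level lt (\<lambda>k l. emb (E k l))"
  using level_E unfolding level_def lt_def emb_def by (simp add: zexp_add[symmetric] zexp_inj)

lemma level_omega:
  assumes "w \<in> weights n" "level leq (pos_wt w)" "w \<in> closed_cone"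
    and leq: "\<And>a b c. leq (a + c) (b + c) \<longleftrightarrow> leq a (b::real)"
  shows "level (\<lambda>p q. leq (omega w p) (omega w q)) (\<lambda>k l. emb (E k l))"
  unfolding level_def
proof (intro ballI impI conjI)
  fix l k c assume *: "l \<in> {4..n}" "k \<in> {1..<l} - {i l}" "c \<in> {1..<l} - {i l}" "k \<noteq> c"
  then have r: "i l \<in> {1..<l}" "j l \<in> {1..<l}" "l \<in> {4..n}" using i_range[of l] j_range[of l] by auto
  show "emb (E k l) + emb (E (i l) c) = emb (E c l) + emb (E (i l) k)"
    using levelD(1)[OF level_lt, of l k c] * by auto
  have "leq (pos_wt w k l + pos_wt w (i l) c) (pos_wt w (i l) l + pos_wt w k c)"
    using levelD(2)[OF assms(2), of l k c] * by auto
  then have "leq ((pos_wt w k l - pos_wt w 1 2 + (pos_wt w (i l) c - pos_wt w 1 2)) + 2 * pos_wt w 1 2)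
      ((pos_wt w (i l) l - pos_wt w 1 2 + (pos_wt w k c - pos_wt w 1 2)) + 2 * pos_wt w 1 2)"
    by simp
  then have "leq (pos_wt w k l - pos_wt w 1 2 + (pos_wt w (i l) c - pos_wt w 1 2))
      (pos_wt w (i l) l - pos_wt w 1 2 + (pos_wt w k c - pos_wt w 1 2))"
    by (simp only: leq)
  then show "leq (omega w (emb (E k l) + emb (E (i l) c))) (omega w (emb (E (i l) l) + emb (E k c)))"
    unfolding omega_add using omega_E[OF assms(3), of k l] omega_E[OF assms(3), of "i l" c]
      omega_E[OF assms(3), of "i l" l] omega_E[OF assms(3), of k c] * r by auto
qed

lemma psi_keys:
  assumes "e \<in> keys (psi_var a b)"
  obtains e' where "e = (1, 0) + e'" "e' \<in> keys (minor (generic_point emb) (\<rho> a) (\<rho> b))"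
  using assms keys_single_mult[of "(1, 0)"] unfolding psi_var_def by blast

lemma psi_var_prec:
  assumes ab: "a \<in> {1..n}" "b \<in> {1..n}" "a \<noteq> b"
  shows "lead lt (psi_var a b) (top_exp (\<rho> a) (\<rho> b)) (sg (\<rho> a) (\<rho> b))"
proof (rule leadI)
  let ?k = "\<rho> a" and ?l = "\<rho> b"
  have kl: "?k \<in> {1..n}" "?l \<in> {1..n}" "?k \<noteq> ?l" using \<rho> \<rho>_inj ab by auto
  have top: "top_exp ?k ?l = (1, 0) + emb (E ?k ?l)" by (simp add: top_exp_def emb_def)
  note z = level_z[OF exponent_hom_emb level_lt iffD1[OF lt.add_iff]]
  have "lookup (minor (generic_point emb) ?k ?l) (emb (E ?k ?l)) = sg ?k ?l"
    by (rule minor_lookup[OF exponent_hom_emb, of lt])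
      (use kl lt.irrefl lt.add_left z in \<open>auto intro: lt.trans\<close>)
  then show "lookup (psi_var a b) (top_exp ?k ?l) = sg ?k ?l"
    unfolding top psi_var_def lookup_single_mult by simp
  fix e assume "e \<in> keys (psi_var a b)"
  then obtain e' where e': "e = (1, 0) + e'" "e' \<in> keys (minor (generic_point emb) ?k ?l)"
    by (rule psi_keys)
  have "emb (E ?k ?l) = e' \<or> lt (emb (E ?k ?l)) e'"
    by (rule minor_keys[OF exponent_hom_emb, of "\<lambda>x y. x = y \<or> lt x y"])
      (use kl e' lt.add_left z in \<open>auto intro: lt.trans\<close>)
  then show "e = top_exp ?k ?l \<or> lt (top_exp ?k ?l) e"
    unfolding top e'(1) using lt.add_left by blast
qed

lemma psi_var_weak:
  assumes w: "w \<in> closed_cone" and ab: "a \<in> {1..n}" "b \<in> {1..n}" "a \<noteq> b"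
    and e: "e \<in> keys (psi_var a b)"
  shows "wt w a b \<le> omega w e"
proof -
  let ?k = "\<rho> a" and ?l = "\<rho> b"
  have kl: "?k \<in> {1..n}" "?l \<in> {1..n}" "?k \<noteq> ?l" using \<rho> \<rho>_inj ab by auto
  obtain e' where e': "e = (1, 0) + e'" "e' \<in> keys (minor (generic_point emb) ?k ?l)"
    using e by (rule psi_keys)
  have lev: "level (\<lambda>p q. omega w p \<le> omega w q) (\<lambda>k l. emb (E k l))"
    by (rule level_omega) (use w in \<open>auto simp: closed_cone_def\<close>)
  have "omega w (emb (E ?k ?l)) \<le> omega w e'"
    by (rule minor_keys[OF exponent_hom_emb, of "\<lambda>x y. omega w x \<le> omega w y"])
      (use kl e' level_z[OF exponent_hom_emb lev] in \<open>auto simp: omega_add\<close>)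
  then have "omega w ((1, 0) + emb (E ?k ?l)) \<le> omega w e"
    unfolding e' omega_add by simp
  moreover have "(1, 0) + emb (E ?k ?l) = top_exp ?k ?l" by (simp add: top_exp_def emb_def)
  ultimately show ?thesis using omega_top[OF w kl] pos_wt_\<rho> ab by simp
qed

lemma psi_var_strict:
  assumes w: "w \<in> open_cone" and ab: "a \<in> {1..n}" "b \<in> {1..n}" "a \<noteq> b"
  shows "lowest (omega w) (wt w a b) (psi_var a b) (phi_var a b)"
proof -
  let ?k = "\<rho> a" and ?l = "\<rho> b"
  have kl: "?k \<in> {1..n}" "?l \<in> {1..n}" "?k \<noteq> ?l" using \<rho> \<rho>_inj ab by auto
  have w': "w \<in> closed_cone" by (rule open_closed[OF w])
  have lev: "level (\<lambda>p q. omega w p < omega w q) (\<lambda>k l. emb (E k l))"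
    by (rule level_omega) (use w w' in \<open>auto simp: open_cone_def\<close>)
  have top: "top_exp ?k ?l = (1, 0) + emb (E ?k ?l)" by (simp add: top_exp_def emb_def)
  have omt: "omega w (top_exp ?k ?l) = wt w a b"
    using omega_top[OF w' kl] pos_wt_\<rho> ab by simp
  have big: "wt w a b < omega w e" if e: "e \<in> keys (psi_var a b)" "e \<noteq> top_exp ?k ?l" for e
  proof -
    obtain e' where e': "e = (1, 0) + e'" "e' \<in> keys (minor (generic_point emb) ?k ?l)"
      using e(1) by (rule psi_keys)
    have "emb (E ?k ?l) = e' \<or> omega w (emb (E ?k ?l)) < omega w e'"
      by (rule minor_keys[OF exponent_hom_emb, of "\<lambda>x y. x = y \<or> omega w x < omega w y"])
        (use kl e' level_z[OF exponent_hom_emb lev] in \<open>auto simp: omega_add\<close>)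
    then have "omega w (top_exp ?k ?l) < omega w e" using e(2) unfolding top e'(1) by (auto simp: omega_add)
    then show ?thesis using omt by simp
  qed
  have l: "lookup (psi_var a b) (top_exp ?k ?l) = sg ?k ?l"
    using lt.lead_lookup[OF psi_var_prec[OF ab]] .
  show ?thesis unfolding lowest_def
  proof (intro conjI ballI)
    show "omega w k = wt w a b" if "k \<in> keys (phi_var a b)" for k
      using that omt by (simp add: phi_var_def split: if_splits)
    fix k assume "k \<in> keys (psi_var a b - phi_var a b)"
    then have "k \<in> keys (psi_var a b)" "k \<noteq> top_exp ?k ?l"
      using l by (auto simp: in_keys_iff lookup_minus phi_var_def lookup_single when_def split: if_splits)
    then show "wt w a b < omega w k" by (rule big)
  qed
qed

text \<open>
  The part of a minor of the weight of its coordinate. On the boundary of the cone it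
  can have more terms than the leading term.
\<close>

definition chi_var :: "weight \<Rightarrow> nat \<Rightarrow> nat \<Rightarrow> target"
  where "chi_var w a b = restr (omega w) (wt w a b) (psi_var a b)"

definition chi :: "weight \<Rightarrow> ppoly \<Rightarrow> target"
  where "chi w = poly_subst (single 0) (\<lambda>(a, b). chi_var w a b)"

lemma psi_plucker: "f \<in> plucker_ideal n \<Longrightarrow> psi f = 0"
  unfolding psi_def
proof (rule plucker_ideal_kernel[OF coeff_hom_single])
  fix a b c d
  define N where "N = minor (generic_point emb)"
  define t :: target where "t = single (1, 0) 1"
  have "psi_var a b * psi_var c d - psi_var a c * psi_var b d + psi_var a d * psi_var b c
      = t * t * (N (\<rho> a) (\<rho> b) * N (\<rho> c) (\<rho> d) - N (\<rho> a) (\<rho> c) * N (\<rho> b) (\<rho> d)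
        + N (\<rho> a) (\<rho> d) * N (\<rho> b) (\<rho> c))"
    unfolding psi_var_def N_def[symmetric] t_def[symmetric] by (simp add: algebra_simps)
  then show "psi_var a b * psi_var c d - psi_var a c * psi_var b d + psi_var a d * psi_var b c = 0"
    unfolding N_def minor_pluecker by simp
qed

lemma pair_mem: "x \<in> pairs n \<Longrightarrow> fst x \<in> {1..n} \<and> snd x \<in> {1..n} \<and> fst x < snd x"
  by (auto simp: pairs_def)

text \<open>
  For a weight \<open>w\<close> of the closed cone the lowest part of \<open>psi f\<close> is \<open>chi\<close> of the initial form of \<open>f\<close>;
  and \<open>psi f = 0\<close> for \<open>f\<close> in the Pluecker ideal.
\<close>

lemma chi_initial:
  assumes w: "w \<in> closed_cone" and f: "f \<in> initial_ideal n w"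
  shows "chi w f = 0"
  unfolding chi_def
proof (rule initial_ideal_kernel[OF coeff_hom_single _ f])
  fix f assume f: "f \<in> plucker_ideal n"
  show "poly_subst (single 0) (\<lambda>(a, b). chi_var w a b) (initial_form w f) = 0"
  proof (rule lowest_subst[of "omega w", OF omega_zero omega_add, where V = "pairs n"])
    fix x assume "x \<in> pairs n"
    then obtain a b where x: "x = (a, b)" "a \<in> {1..n}" "b \<in> {1..n}" "a < b" using pair_mem by (cases x) auto
    have "lookup w (a, b) = wt w a b" using x by (simp add: wt_def)
    then show "lowest (omega w) (lookup w x) (case x of (a, b) \<Rightarrow> psi_var a b) (case x of (a, b) \<Rightarrow> chi_var w a b)"
      using lowest_restr[of "psi_var a b" "wt w a b" "omega w"] psi_var_weak[OF w] x
      unfolding chi_var_def by auto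
  qed (use f plucker.subset psi_plucker in \<open>auto simp: psi_def\<close>)
qed

text \<open>
  In the interior of the cone the part of lowest weight of a minor is its leading term, so \<open>chi\<close> is \<open>phi\<close>.
\<close>

lemma phi_initial:
  assumes w: "w \<in> open_cone" and f: "f \<in> initial_ideal n w"
  shows "phi f = 0"
  unfolding phi_def
proof (rule initial_ideal_kernel[OF coeff_hom_single _ f])
  fix f assume f: "f \<in> plucker_ideal n"
  show "poly_subst (single 0) (\<lambda>(a, b). phi_var a b) (initial_form w f) = 0"
  proof (rule lowest_subst[of "omega w", OF omega_zero omega_add, where V = "pairs n"])
    fix x assume "x \<in> pairs n"
    then obtain a b where x: "x = (a, b)" "a \<in> {1..n}" "b \<in> {1..n}" "a < b" using pair_mem by (cases x) auto
    have "lookup w (a, b) = wt w a b" using x by (simp add: wt_def)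
    then show "lowest (omega w) (lookup w x) (case x of (a, b) \<Rightarrow> psi_var a b) (case x of (a, b) \<Rightarrow> phi_var a b)"
      using psi_var_strict[OF w] x by auto
  qed (use f plucker.subset psi_plucker in \<open>auto simp: psi_def\<close>)
qed

end

context labeled
begin

subsection \<open>Monomials as edge multisets\<close>

definition edge_var :: "nat \<Rightarrow> nat \<Rightarrow> ppoly"
  where "edge_var k l = const_poly (sg k l) * pv (\<sigma> k) (\<sigma> l)"

definition edge_mono :: "(nat \<times> nat) multiset \<Rightarrow> ppoly"
  where "edge_mono A = (\<Prod>(k, l)\<in>#A. edge_var k l)"

definition fibre :: "(nat \<times> nat) multiset \<Rightarrow> nat \<times> (nat \<Rightarrow>\<^sub>0 int)"
  where "fibre A = (size A, zexp (E_sum A))"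

lemma edge_mono_simps [simp]: "edge_mono {#} = 1"
  "edge_mono (add_mset (k, l) A) = edge_var k l * edge_mono A"
  "edge_mono (A + B) = edge_mono A * edge_mono B"
  by (simp_all add: edge_mono_def)

lemma fibre_simps [simp]: "fibre {#} = 0" "fibre (add_mset (k, l) A) = top_exp k l + fibre A"
  "fibre (A + B) = fibre A + fibre B"
  by (simp_all add: fibre_def top_exp_def zexp_add zero_prod_def)

lemma const_poly_mult: "const_poly a * const_poly b = const_poly (a * b)"
  by (simp add: const_poly_def mult_single)

lemma const_poly_one [simp]: "const_poly 1 = 1"
  by (simp add: const_poly_def)

lemma const_poly_zero [simp]: "const_poly 0 = 0"
  by (simp add: const_poly_def)

lemma const_poly_add: "const_poly (a + b) = const_poly a + const_poly b"
  by (simp add: const_poly_def single_add)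

lemma const_poly_minus: "const_poly (- a) = - const_poly a"
  by (simp add: const_poly_def single_uminus)

lemma edge_sym:
  assumes "(k, l) \<in> edges n" shows "edge_var k l = edge_var l k"
proof -
  have *: "k \<in> {1..n}" "l \<in> {1..n}" "k \<noteq> l" using assms by (auto simp: edges_def)
  then have "sg l k = - sg k l" by (rule sg_antisym)
  moreover have "pv (\<sigma> l) (\<sigma> k) = - pv (\<sigma> k) (\<sigma> l)"
    by (rule pv_antisym) (simp add: \<sigma>_inj[OF *(1,2)] *(3))
  ultimately show ?thesis by (simp add: edge_var_def const_poly_minus)
qed

lemma edge_\<sigma>:
  assumes "(k, l) \<in> edges n"
  shows "\<sigma> k \<in> {1..n}" "\<sigma> l \<in> {1..n}" "\<sigma> k \<noteq> \<sigma> l" "\<rho> (\<sigma> k) = k" "\<rho> (\<sigma> l) = l"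
proof -
  have "k \<in> {1..n}" "l \<in> {1..n}" "k \<noteq> l" using assms by (simp_all add: edges_def)
  then show "\<sigma> k \<in> {1..n}" "\<sigma> l \<in> {1..n}" "\<sigma> k \<noteq> \<sigma> l" "\<rho> (\<sigma> k) = k" "\<rho> (\<sigma> l) = l"
    using \<sigma>[of k] \<sigma>[of l] \<sigma>_inj[of k l] by simp_all
qed

lemma edge_var_closed: "(k, l) \<in> edges n \<Longrightarrow> edge_var k l \<in> carrier (plucker_ring n)"
  unfolding edge_var_def
  by (rule poly_alg_mult_closed[OF poly_alg_const_closed pv_closed]) (rule edge_\<sigma>, assumption)+

lemma edge_mono_closed: "set_mset A \<subseteq> edges n \<Longrightarrow> edge_mono A \<in> carrier (plucker_ring n)"
proof (induction A)
  case (add e A)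
  then show ?case by (cases e) (auto intro: poly_alg_mult_closed edge_var_closed)
qed simp

lemma pv_edge:
  assumes "a \<in> {1..n}" "b \<in> {1..n}" "a \<noteq> b"
  shows "pv a b = const_poly (sg (\<rho> a) (\<rho> b)) * edge_var (\<rho> a) (\<rho> b)"
proof -
  have *: "\<rho> a \<in> {1..n}" "\<rho> b \<in> {1..n}" "\<rho> a \<noteq> \<rho> b" "\<sigma> (\<rho> a) = a" "\<sigma> (\<rho> b) = b"
    using assms \<rho> \<rho>_inj by auto
  have "const_poly (sg (\<rho> a) (\<rho> b)) * edge_var (\<rho> a) (\<rho> b)
      = const_poly (sg (\<rho> a) (\<rho> b) * sg (\<rho> a) (\<rho> b)) * pv a b"
    by (simp add: edge_var_def * const_poly_mult[symmetric] mult.assoc)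
  then show ?thesis using sg_square * by simp
qed

abbreviation deg :: "((nat \<times> nat) \<Rightarrow>\<^sub>0 nat) \<Rightarrow> nat"
  where "deg u \<equiv> (\<Sum>x\<in>keys u. lookup u x)"

lemma deg_add: "deg (u + v) = deg u + deg v"
proof -
  have *: "deg u = (\<Sum>x\<in>A. lookup u x)" if "finite A" "keys u \<subseteq> A" for A u
    by (rule sum.mono_neutral_left) (use that in \<open>auto simp: in_keys_iff\<close>)
  show ?thesis
    using *[of "keys u \<union> keys v" "u + v"] *[of "keys u \<union> keys v" u] *[of "keys u \<union> keys v" v]
    by (simp add: keys_nat_add lookup_add sum.distrib)
qed

lemma monomial_edges:
  assumes "keys u \<subseteq> pairs n"
  shows "\<exists>A \<epsilon>. set_mset A \<subseteq> edges n \<and> (\<epsilon> = 1 \<or> \<epsilon> = -1) \<and>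
    single u 1 = const_poly \<epsilon> * edge_mono A \<and> size A = deg u"
  using assms
proof (induction rule: exponent_induct)
  case zero
  then show ?case by (intro exI[of _ "{#}"] exI[of _ 1]) (simp)
next
  case (add u x)
  then obtain A \<epsilon> where A: "set_mset A \<subseteq> edges n" "\<epsilon> = 1 \<or> \<epsilon> = -1"
      "single u 1 = const_poly \<epsilon> * edge_mono A" "size A = deg u"
    by blast
  obtain a b where x: "x = (a, b)" "a \<in> {1..n}" "b \<in> {1..n}" "a < b" using pair_mem[OF add(2)] by (cases x) auto
  have kl: "(\<rho> a, \<rho> b) \<in> edges n" using x \<rho> \<rho>_inj by (auto simp: edges_def)
  have "single (single x 1 + u) 1 = pv a b * single u (1::complex)"
    using x by (simp add: pv_def var_poly_def mult_single)
  also have "\<dots> = const_poly (sg (\<rho> a) (\<rho> b) * \<epsilon>) * edge_mono (add_mset (\<rho> a, \<rho> b) A)"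
    using pv_edge[of a b] x A by (simp add: const_poly_mult[symmetric] ac_simps)
  finally have "single (single x 1 + u) 1 = const_poly (sg (\<rho> a) (\<rho> b) * \<epsilon>) * edge_mono (add_mset (\<rho> a, \<rho> b) A)" .
  moreover have "sg (\<rho> a) (\<rho> b) * \<epsilon> = 1 \<or> sg (\<rho> a) (\<rho> b) * \<epsilon> = -1"
    using sg_values[of "\<rho> a" "\<rho> b"] kl A(2) by (auto simp: edges_def)
  moreover have "deg (single x 1 + u) = Suc (deg u)" by (simp add: deg_add)
  ultimately show ?case
    using A kl by (intro exI[of _ "add_mset (\<rho> a, \<rho> b) A"] exI[of _ "sg (\<rho> a) (\<rho> b) * \<epsilon>"]) simp
qed

definition edges_of :: "((nat \<times> nat) \<Rightarrow>\<^sub>0 nat) \<Rightarrow> (nat \<times> nat) multiset"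
  where "edges_of u = (SOME A. \<exists>\<epsilon>. set_mset A \<subseteq> edges n \<and> (\<epsilon> = 1 \<or> \<epsilon> = -1) \<and>
    single u 1 = const_poly \<epsilon> * edge_mono A \<and> size A = deg u)"

definition sign_of :: "((nat \<times> nat) \<Rightarrow>\<^sub>0 nat) \<Rightarrow> complex"
  where "sign_of u = (SOME \<epsilon>. (\<epsilon> = 1 \<or> \<epsilon> = -1) \<and> single u 1 = const_poly \<epsilon> * edge_mono (edges_of u))"

lemma edges_of:
  assumes "keys u \<subseteq> pairs n"
  shows "set_mset (edges_of u) \<subseteq> edges n" "size (edges_of u) = deg u"
    "sign_of u = 1 \<or> sign_of u = -1" "single u 1 = const_poly (sign_of u) * edge_mono (edges_of u)"
proof -
  have *: "\<exists>\<epsilon>. set_mset (edges_of u) \<subseteq> edges n \<and> (\<epsilon> = 1 \<or> \<epsilon> = -1) \<and>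
      single u 1 = const_poly \<epsilon> * edge_mono (edges_of u) \<and> size (edges_of u) = deg u"
    unfolding edges_of_def by (rule someI_ex) (rule monomial_edges[OF assms])
  then show "set_mset (edges_of u) \<subseteq> edges n" "size (edges_of u) = deg u" by auto
  have "(sign_of u = 1 \<or> sign_of u = -1) \<and> single u 1 = const_poly (sign_of u) * edge_mono (edges_of u)"
    unfolding sign_of_def by (rule someI_ex) (use * in blast)
  then show "sign_of u = 1 \<or> sign_of u = -1" "single u 1 = const_poly (sign_of u) * edge_mono (edges_of u)"
    by auto
qed

lemma edge_expansion:
  assumes "f \<in> carrier (plucker_ring n)"
  shows "f = (\<Sum>u\<in>keys f. const_poly (lookup f u * sign_of u) * edge_mono (edges_of u))"
proof -
  have "f = (\<Sum>u\<in>keys f. single u (lookup f u))" by (rule sum_of_terms[symmetric])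
  also have "\<dots> = (\<Sum>u\<in>keys f. const_poly (lookup f u * sign_of u) * edge_mono (edges_of u))"
  proof (rule sum.cong[OF refl])
    fix u assume "u \<in> keys f"
    then have u: "keys u \<subseteq> pairs n" using assms by (auto simp: carrier_poly_alg)
    have "single u (lookup f u) = const_poly (lookup f u) * single u 1" by (simp add: const_poly_mult_single)
    then show "single u (lookup f u) = const_poly (lookup f u * sign_of u) * edge_mono (edges_of u)"
      using edges_of(4)[OF u] by (simp add: const_poly_mult[symmetric] mult.assoc)
  qed
  finally show ?thesis .
qed

lemma sg_abs: "(k, l) \<in> edges n \<Longrightarrow> sg k l * sg k l = 1"
  using sg_square by (auto simp: edges_def)

lemma phi_pv:
  assumes "a \<in> {1..n}" "b \<in> {1..n}" "a \<noteq> b"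
  shows "phi (pv a b) = phi_var a b"
  unfolding phi_def
proof (rule poly_subst_pv[OF coeff_hom_single])
  have "\<rho> a \<in> {1..n}" "\<rho> b \<in> {1..n}" "\<rho> a \<noteq> \<rho> b" using assms \<rho> \<rho>_inj by auto
  then show "phi_var b a = - phi_var a b"
    using E_sym[of "\<rho> a" "\<rho> b"] sg_antisym[of "\<rho> a" "\<rho> b"]
    by (simp add: phi_var_def top_exp_def single_uminus)
qed (use assms in simp)

lemmas phi_hom = poly_subst_add[OF coeff_hom_single, where s = "\<lambda>(a, b). phi_var a b", folded phi_def]
  poly_subst_mult[OF coeff_hom_single, where s = "\<lambda>(a, b). phi_var a b", folded phi_def]
  poly_subst_sum[OF coeff_hom_single, where s = "\<lambda>(a, b). phi_var a b", folded phi_def]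
  poly_subst_const[OF coeff_hom_single, where s = "\<lambda>(a, b). phi_var a b", folded phi_def]
  poly_subst_diff[OF coeff_hom_single, where s = "\<lambda>(a, b). phi_var a b", folded phi_def]
  poly_subst_one[OF coeff_hom_single, where s = "\<lambda>(a, b). phi_var a b", folded phi_def]
  poly_subst_zero[OF coeff_hom_single, where s = "\<lambda>(a, b). phi_var a b", folded phi_def]

lemmas psi_hom = poly_subst_add[OF coeff_hom_single, where s = "\<lambda>(a, b). psi_var a b", folded psi_def]
  poly_subst_mult[OF coeff_hom_single, where s = "\<lambda>(a, b). psi_var a b", folded psi_def]
  poly_subst_sum[OF coeff_hom_single, where s = "\<lambda>(a, b). psi_var a b", folded psi_def]
  poly_subst_const[OF coeff_hom_single, where s = "\<lambda>(a, b). psi_var a b", folded psi_def]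
  poly_subst_diff[OF coeff_hom_single, where s = "\<lambda>(a, b). psi_var a b", folded psi_def]
  poly_subst_one[OF coeff_hom_single, where s = "\<lambda>(a, b). psi_var a b", folded psi_def]

lemmas chi_hom = poly_subst_add[OF coeff_hom_single, where s = "\<lambda>(a, b). chi_var w a b" for w, folded chi_def]
  poly_subst_mult[OF coeff_hom_single, where s = "\<lambda>(a, b). chi_var w a b" for w, folded chi_def]
  poly_subst_diff[OF coeff_hom_single, where s = "\<lambda>(a, b). chi_var w a b" for w, folded chi_def]
  poly_subst_zero[OF coeff_hom_single, where s = "\<lambda>(a, b). chi_var w a b" for w, folded chi_def]

lemma phi_edge: "(k, l) \<in> edges n \<Longrightarrow> phi (edge_var k l) = single (top_exp k l) 1"
  using phi_pv[OF edge_\<sigma>(1-3), of k l] sg_abs[of k l]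
  by (simp add: edge_var_def phi_hom phi_var_def mult_single edge_\<sigma>(4-5))

lemma phi_edge_mono: "set_mset A \<subseteq> edges n \<Longrightarrow> phi (edge_mono A) = single (fibre A) 1"
proof (induction A)
  case (add e A)
  then show ?case by (cases e) (simp add: phi_hom phi_edge mult_single)
qed (simp add: phi_hom)

lemma phi_expansion:
  assumes "f \<in> carrier (plucker_ring n)"
  shows "lookup (phi f) r = (\<Sum>u\<in>{u \<in> keys f. fibre (edges_of u) = r}. lookup f u * sign_of u)"
proof -
  have kf: "keys u \<subseteq> pairs n" if "u \<in> keys f" for u using assms that by (auto simp: carrier_poly_alg)
  have "phi f = (\<Sum>u\<in>keys f. single 0 (lookup f u * sign_of u) * phi (edge_mono (edges_of u)))"
    by (subst edge_expansion[OF assms]) (simp add: phi_hom)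
  also have "\<dots> = (\<Sum>u\<in>keys f. single (fibre (edges_of u)) (lookup f u * sign_of u))"
    by (rule sum.cong[OF refl]) (simp add: phi_edge_mono edges_of kf mult_single)
  finally have "lookup (phi f) r = (\<Sum>u\<in>keys f. if fibre (edges_of u) = r then lookup f u * sign_of u else 0)"
    by (simp add: lookup_sum lookup_single when_def)
  then show ?thesis by (simp add: sum.If_cases Int_def conj_commute)
qed

subsection \<open>Binomials span the fibres\<close>

lemma split_E_sum:
  assumes "split p q r s"
  shows "E p r + E q s = E p s + E q r" "prec S (zexp (E p r + E q s)) (zexp (E p q + E r s))"
proof -
  have "E p r + E q s = E p s + E q r \<and> prec S (zexp (E p r + E q s)) (zexp (E p q + E r s))"
    by (rule split_level[OF level_E E_sym _ assms]) (simp_all add: zexp_add prec_add)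
  then show "E p r + E q s = E p s + E q r" "prec S (zexp (E p r + E q s)) (zexp (E p q + E r s))"
    by blast+
qed

lemma move_preserves:
  assumes "move A B" "set_mset A \<subseteq> edges n"
  shows "set_mset B \<subseteq> edges n" "fibre B = fibre A"
  using assms
proof (induction rule: move.induct)
  case (flip x y C)
  { case 1 then show ?case by (auto simp: edges_def) }
  { case 2 then show ?case using E_sym[of x y] by (auto simp: edges_def top_exp_def) }
next
  case (quad p q r s C)
  { case 1 then show ?case using split_distinct[OF quad] by (auto simp: edges_def) }
  { case 2
    have "zexp (E p r) + zexp (E q s) = zexp (E p s) + zexp (E q r)"
      using split_E_sum(1)[OF quad] by (simp add: zexp_add[symmetric])
    then show ?case by (simp add: top_exp_def add.assoc[symmetric]) }
qed

lemma binomial_mem: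
  assumes zero: "D 0" and add: "\<And>f g. D f \<Longrightarrow> D g \<Longrightarrow> D (f + g)"
    and quad: "\<And>p q r s C. split p q r s \<Longrightarrow> set_mset C \<subseteq> edges n \<Longrightarrow>
      top_exp p r + top_exp q s + fibre C = e \<Longrightarrow>
      D ((edge_var p r * edge_var q s - edge_var p s * edge_var q r) * edge_mono C)"
    and A: "set_mset A \<subseteq> edges n" "set_mset B \<subseteq> edges n" "fibre A = e" "fibre B = e"
  shows "D (edge_mono A - edge_mono B)"
proof -
  have "moves A B"
    by (rule fibre_connected[OF A(1,2)]) (use A(3,4) in \<open>auto simp: fibre_def zexp_inj\<close>)
  then have "D (edge_mono A - edge_mono B) \<and> set_mset B \<subseteq> edges n \<and> fibre B = e"
  proof (induction rule: rtranclp_induct)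
    case base
    then show ?case using zero A by simp
  next
    case (step B B')
    have "D (edge_mono B - edge_mono B')"
      using step.hyps(2) step.IH
    proof (cases rule: move.cases)
      case (flip x y C)
      then have "edge_mono B = edge_mono B'" using edge_sym[of x y] step.IH by auto
      then show ?thesis using zero by simp
    next
      case (quad p q r s C)
      have "D ((edge_var p r * edge_var q s - edge_var p s * edge_var q r) * edge_mono C)"
        by (rule assms(3)[OF quad(3)]) (use step.IH quad in \<open>auto simp: add.assoc\<close>)
      then show ?thesis using quad by (simp add: algebra_simps)
    qed
    then have "D ((edge_mono A - edge_mono B) + (edge_mono B - edge_mono B'))" using add step.IH by blast
    then show ?case using move_preserves[OF step.hyps(2)] step.IH by simp
  qed
  then show ?thesis by blast
qed

text \<open>
  If the coefficients of the monomials of one fibre cancel, then the sum is a combination of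
  differences of monomials that are joined by moves.
\<close>

lemma fibre_sum_mem:
  assumes zero: "D 0" and add: "\<And>f g. D f \<Longrightarrow> D g \<Longrightarrow> D (f + g)"
    and smult: "\<And>c f. D f \<Longrightarrow> D (const_poly c * f)"
    and quad: "\<And>p q r s C. split p q r s \<Longrightarrow> set_mset C \<subseteq> edges n \<Longrightarrow>
      top_exp p r + top_exp q s + fibre C = e \<Longrightarrow>
      D ((edge_var p r * edge_var q s - edge_var p s * edge_var q r) * edge_mono C)"
    and U: "finite U" "\<And>u. u \<in> U \<Longrightarrow> keys u \<subseteq> pairs n \<and> fibre (edges_of u) = e"
    and c: "(\<Sum>u\<in>U. c u) = 0"
  shows "D (\<Sum>u\<in>U. const_poly (c u) * edge_mono (edges_of u))"
proof (cases "U = {}")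
  case False
  then obtain u0 where u0: "u0 \<in> U" by blast
  have sums: "D (sum f F)" if "\<And>u. u \<in> F \<Longrightarrow> D (f u)" for f :: "_ \<Rightarrow> ppoly" and F :: "((nat \<times> nat) \<Rightarrow>\<^sub>0 nat) set"
    using that by (induction F rule: infinite_finite_induct) (auto intro: zero add)
  have sum0: "(\<Sum>u\<in>U. const_poly (c u)) = (0 :: ppoly)"
  proof -
    have "(\<Sum>u\<in>F. const_poly (c u)) = (const_poly (sum c F) :: ppoly)" for F
      by (induction F rule: infinite_finite_induct) (auto simp: const_poly_add)
    then show ?thesis using c by simp
  qed
  have "(\<Sum>u\<in>U. const_poly (c u) * edge_mono (edges_of u))
      = (\<Sum>u\<in>U. const_poly (c u) * (edge_mono (edges_of u) - edge_mono (edges_of u0)))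
        + (\<Sum>u\<in>U. const_poly (c u)) * edge_mono (edges_of u0)"
    by (simp add: right_diff_distrib sum_subtractf sum_distrib_right)
  moreover have "D (\<Sum>u\<in>U. const_poly (c u) * (edge_mono (edges_of u) - edge_mono (edges_of u0)))"
    by (intro sums smult binomial_mem[of D e]) (use zero add quad U u0 edges_of in auto)
  ultimately show ?thesis using sum0 by simp
qed (use zero in simp)

subsection \<open>The initial ideal of a point of the cone\<close>

definition quad_coeff :: "nat \<Rightarrow> nat \<Rightarrow> nat \<Rightarrow> nat \<Rightarrow> complex"
  where "quad_coeff p q r s = sg p r * sg q s * (sg p q * sg r s)"

lemma quad_identity:
  assumes "split p q r s"
  shows "edge_var p r * edge_var q s - edge_var p s * edge_var q r
    = const_poly (- sg p r * sg q s) * (- (pv (\<sigma> p) (\<sigma> r) * pv (\<sigma> q) (\<sigma> s)) + pv (\<sigma> p) (\<sigma> s) * pv (\<sigma> q) (\<sigma> r))"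
proof -
  have 1: "edge_var a b * edge_var c d = const_poly (sg a b * sg c d) * (pv (\<sigma> a) (\<sigma> b) * pv (\<sigma> c) (\<sigma> d))"
    for a b c d
    by (simp add: edge_var_def const_poly_mult[symmetric] ac_simps)
  have "edge_var p s * edge_var q r = const_poly (sg p r * sg q s) * (pv (\<sigma> p) (\<sigma> s) * pv (\<sigma> q) (\<sigma> r))"
    unfolding 1 sg_split[OF assms] ..
  then show ?thesis unfolding 1 by (simp add: const_poly_minus algebra_simps)
qed

lemma split_\<sigma>:
  assumes "split p q r s"
  shows "distinct [\<sigma> p, \<sigma> q, \<sigma> r, \<sigma> s]" "{\<sigma> p, \<sigma> q, \<sigma> r, \<sigma> s} \<subseteq> {1..n}"
  using split_distinct[OF assms] \<sigma> \<sigma>_inj by auto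

lemma open_cone_split:
  assumes "w \<in> open_cone" "split p q r s"
  shows "pos_wt w p r + pos_wt w q s = pos_wt w p s + pos_wt w q r"
    "pos_wt w p r + pos_wt w q s < pos_wt w p q + pos_wt w r s"
  using split_level[of "(<)" "pos_wt w", OF _ pos_wt_sym _ assms(2)] assms(1)
  by (auto simp: open_cone_def)

lemma closed_cone_split:
  assumes "w \<in> closed_cone" "split p q r s"
  shows "pos_wt w p r + pos_wt w q s = pos_wt w p s + pos_wt w q r"
    "pos_wt w p r + pos_wt w q s \<le> pos_wt w p q + pos_wt w r s"
  using split_level[of "(\<le>)" "pos_wt w", OF _ pos_wt_sym _ assms(2)] assms(1)
  by (auto simp: closed_cone_def)

lemma quad_initial:
  assumes "w \<in> open_cone" "split p q r s"
  shows "edge_var p r * edge_var q s - edge_var p s * edge_var q r \<in> initial_ideal n w"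
proof -
  note d = split_\<sigma>[OF assms(2)]
  have "initial_form w (pluecker_relation (\<sigma> p) (\<sigma> q) (\<sigma> r) (\<sigma> s))
      = - (pv (\<sigma> p) (\<sigma> r) * pv (\<sigma> q) (\<sigma> s)) + pv (\<sigma> p) (\<sigma> s) * pv (\<sigma> q) (\<sigma> r)"
    unfolding initial_form_pluecker[OF d(1)]
    using open_cone_split[OF assms] by (auto simp: pos_wt_def min_def)
  then have "- (pv (\<sigma> p) (\<sigma> r) * pv (\<sigma> q) (\<sigma> s)) + pv (\<sigma> p) (\<sigma> s) * pv (\<sigma> q) (\<sigma> r) \<in> initial_ideal n w"
    using initial_form_mem[OF pluecker_relation_mem[OF d], of w] by simp
  then show ?thesis
    unfolding quad_identity[OF assms(2)] by (intro initial.mult_mem' poly_alg_const_closed)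
qed

definition ker_phi :: "ppoly set"
  where "ker_phi = {f \<in> carrier (plucker_ring n). phi f = 0}"

text \<open>
  The exchanges along splits are initial forms of Pluecker relations, and by
  \<open>fibre_sum_mem\<close> they generate the kernel of \<open>phi\<close>. The other inclusion is \<open>phi_initial\<close>.
\<close>

theorem initial_ideal_open_cone:
  assumes w: "w \<in> open_cone"
  shows "initial_ideal n w = ker_phi"
proof
  show "initial_ideal n w \<subseteq> ker_phi"
    using phi_initial[OF w] initial.subset by (auto simp: ker_phi_def)
  show "ker_phi \<subseteq> initial_ideal n w"
  proof
    fix f assume "f \<in> ker_phi"
    then have f: "f \<in> carrier (plucker_ring n)" "phi f = 0" by (auto simp: ker_phi_def)
    have kf: "keys u \<subseteq> pairs n" if "u \<in> keys f" for u using f that by (auto simp: carrier_poly_alg)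
    let ?X = "\<lambda>u. fibre (edges_of u)"
    let ?t = "\<lambda>u. const_poly (lookup f u * sign_of u) * edge_mono (edges_of u)"
    have "f = (\<Sum>u\<in>keys f. ?t u)" by (rule edge_expansion[OF f(1)])
    also have "\<dots> = (\<Sum>r\<in>?X ` keys f. \<Sum>u\<in>{u \<in> keys f. ?X u = r}. ?t u)"
      by (rule sum.image_gen) simp
    also have "\<dots> \<in> initial_ideal n w"
    proof (rule initial.sum_mem)
      fix r
      have s0: "(\<Sum>u\<in>{u \<in> keys f. ?X u = r}. lookup f u * sign_of u) = 0"
        using phi_expansion[OF f(1), of r] f(2) by simp
      show "(\<Sum>u\<in>{u \<in> keys f. ?X u = r}. ?t u) \<in> initial_ideal n w"
      proof (rule fibre_sum_mem[of "\<lambda>f. f \<in> initial_ideal n w", OF _ _ _ _ _ _ s0])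
        fix p q r s C assume "split p q r s" "set_mset C \<subseteq> edges n"
        then show "(edge_var p r * edge_var q s - edge_var p s * edge_var q r) * edge_mono C \<in> initial_ideal n w"
          by (intro initial.mult_mem quad_initial[OF w] edge_mono_closed)
      qed (use kf in \<open>auto intro: initial.zero_mem initial.add_mem initial.mult_mem' poly_alg_const_closed\<close>)
    qed
    finally show "f \<in> initial_ideal n w" .
  qed
qed

lemma chi_lead:
  assumes w: "w \<in> closed_cone" and ab: "a \<in> {1..n}" "b \<in> {1..n}" "a \<noteq> b"
  shows "lead lt (chi w (pv a b)) (top_exp (\<rho> a) (\<rho> b)) (sg (\<rho> a) (\<rho> b))"
proof -
  have pos: "\<rho> a \<in> {1..n}" "\<rho> b \<in> {1..n}" "\<rho> a \<noteq> \<rho> b" using ab \<rho> \<rho>_inj by auto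
  have "minor (generic_point emb) (\<rho> b) (\<rho> a) = - minor (generic_point emb) (\<rho> a) (\<rho> b)"
    by (rule minor_antisym)
  then have "psi_var b a = - psi_var a b" by (simp add: psi_var_def)
  then have "chi_var w b a = - chi_var w a b"
    by (intro poly_mapping_eqI) (simp add: chi_var_def lookup_restr wt_sym[of w a b])
  then have "chi w (pv a b) = chi_var w a b"
    unfolding chi_def by (rule poly_subst_pv[OF coeff_hom_single _ ab(3)])
  moreover have "lead lt (chi_var w a b) (top_exp (\<rho> a) (\<rho> b)) (sg (\<rho> a) (\<rho> b))"
  proof (rule leadI)
    show "lookup (chi_var w a b) (top_exp (\<rho> a) (\<rho> b)) = sg (\<rho> a) (\<rho> b)"
      using lt.lead_lookup[OF psi_var_prec[OF ab]] omega_top[OF w pos] pos_wt_\<rho>[OF ab(1,2)]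
      by (simp add: chi_var_def lookup_restr)
    fix k assume "k \<in> keys (chi_var w a b)"
    then have "k \<in> keys (psi_var a b)" by (auto simp: chi_var_def in_keys_iff lookup_restr split: if_splits)
    then show "k = top_exp (\<rho> a) (\<rho> b) \<or> lt (top_exp (\<rho> a) (\<rho> b)) k"
      using lt.lead_keys[OF psi_var_prec[OF ab]] by blast
  qed
  ultimately show ?thesis by simp
qed

text \<open>
  Take a split \<open>pq|rs\<close> and a weight \<open>v\<close> whose initial ideal is that of a weight of the closed cone.
  The two terms \<open>pr qs\<close> and \<open>ps qr\<close> have the same leading exponent, strictly below that of
  \<open>pq rs\<close>, so an initial form of the relation can only contain both or none of them.
\<close>

lemma initial_terms_paired:
  fixes v w :: weight
  assumes w: "w \<in> closed_cone" and eq: "initial_ideal n v = initial_ideal n w" and sp: "split p q r s"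
  defines "x1 \<equiv> pos_wt v p q + pos_wt v r s" and "x2 \<equiv> pos_wt v p r + pos_wt v q s"
    and "x3 \<equiv> pos_wt v p s + pos_wt v q r"
  defines "m \<equiv> min x1 (min x2 x3)"
  shows "x2 = m \<longleftrightarrow> x3 = m"
proof -
  note d = split_\<sigma>[OF sp]
  have pd: "p \<in> {1..n}" "q \<in> {1..n}" "r \<in> {1..n}" "s \<in> {1..n}" "distinct [p, q, r, s]"
    using split_distinct[OF sp] by auto
  define t where "t = (\<lambda>a b c d. pv (\<sigma> a) (\<sigma> b) * pv (\<sigma> c) (\<sigma> d))"
  have lead_t: "lead lt (chi w (t a b c d)) (top_exp a b + top_exp c d) (sg a b * sg c d)"
    if "a \<in> {1..n}" "b \<in> {1..n}" "c \<in> {1..n}" "d \<in> {1..n}" "a \<noteq> b" "c \<noteq> d" for a b c d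
  proof -
    have "lead lt (chi w (pv (\<sigma> x) (\<sigma> y))) (top_exp x y) (sg x y)" if "x \<in> {1..n}" "y \<in> {1..n}" "x \<noteq> y" for x y
      using chi_lead[OF w, of "\<sigma> x" "\<sigma> y"] that \<sigma> \<sigma>_inj by auto
    then show ?thesis unfolding t_def chi_hom using lt.lead_mult that by blast
  qed
  let ?e = "top_exp p r + top_exp q s"
  have e2: "?e = top_exp p s + top_exp q r"
    using split_E_sum(1)[OF sp] by (simp add: top_exp_def zexp_add[symmetric])
  have e1: "lt ?e (top_exp p q + top_exp r s)"
    using split_E_sum(2)[OF sp] by (simp add: top_exp_def lt_def zexp_add)
  have l1: "lookup (chi w (t p q r s)) ?e = 0"
    using lt.lead_lookup_lower[OF lead_t e1] pd by auto
  have l2: "lookup (chi w (t p r q s)) ?e = sg p r * sg q s"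
    using lt.lead_lookup[OF lead_t[of p r q s]] pd by auto
  have l3: "lookup (chi w (t p s q r)) ?e = sg p r * sg q s"
    unfolding e2 sg_split[OF sp] using lt.lead_lookup[OF lead_t[of p s q r]] pd by auto
  have ne: "sg p r * sg q s \<noteq> 0" using sg_values[of p r] sg_values[of q s] pd by auto
  have "initial_form v (pluecker_relation (\<sigma> p) (\<sigma> q) (\<sigma> r) (\<sigma> s)) \<in> initial_ideal n w"
    using initial_form_mem[OF pluecker_relation_mem[OF d], of v] eq by simp
  then have "chi w ((if x1 = m then t p q r s else 0) - (if x2 = m then t p r q s else 0)
      + (if x3 = m then t p s q r else 0)) = 0"
    using chi_initial[OF w] unfolding initial_form_pluecker[OF d(1)] t_def m_def x1_def x2_def x3_def pos_wt_def
    by simp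
  then have "lookup (chi w (if x1 = m then t p q r s else 0) - chi w (if x2 = m then t p r q s else 0)
      + chi w (if x3 = m then t p s q r else 0)) ?e = 0"
    by (simp only: chi_hom lookup_zero)
  then show ?thesis
    using l1 l2 l3 ne by (auto simp: lookup_add lookup_minus chi_hom split: if_splits)
qed

lemma initial_closed_cone:
  assumes w: "w \<in> closed_cone" and v: "v \<in> trop_gr n" and eq: "initial_ideal n v = initial_ideal n w"
  shows "v \<in> closed_cone"
proof -
  have "level (\<le>) (pos_wt v)"
    unfolding level_def
  proof (intro ballI impI)
    fix l k c assume *: "l \<in> {4..n}" "k \<in> {1..<l} - {i l}" "c \<in> {1..<l} - {i l}" "k \<noteq> c"
    then have sp: "split (i l) l k c" by (intro cherry) auto
    note d = split_\<sigma>[OF sp]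
    let ?x1 = "pos_wt v (i l) l + pos_wt v k c" and ?x2 = "pos_wt v (i l) k + pos_wt v l c"
      and ?x3 = "pos_wt v (i l) c + pos_wt v l k"
    have "\<not> (?x1 < ?x2 \<and> ?x1 < ?x3)"
      using trop_four_point[OF v d] by (simp add: pos_wt_def)
    then have "?x2 = ?x3 \<and> ?x2 \<le> ?x1"
      using initial_terms_paired[OF w eq sp] by (auto simp: min_def split: if_splits)
    then show "pos_wt v k l + pos_wt v (i l) c = pos_wt v c l + pos_wt v (i l) k \<and>
        pos_wt v k l + pos_wt v (i l) c \<le> pos_wt v (i l) l + pos_wt v k c"
      by (simp add: pos_wt_sym[of v k l] pos_wt_sym[of v c l])
  qed
  then show ?thesis using v by (simp add: closed_cone_def trop_gr_def)
qed

lemma monomial_not_ker_phi: "single u 1 \<notin> ker_phi"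
proof
  assume "single u 1 \<in> ker_phi"
  then have u: "keys u \<subseteq> pairs n" "phi (single u 1) = 0" by (auto simp: ker_phi_def carrier_poly_alg)
  then have "phi (const_poly (sign_of u) * edge_mono (edges_of u)) = 0" using edges_of(4)[OF u(1)] by simp
  then have "single (fibre (edges_of u)) (sign_of u) = 0"
    using edges_of[OF u(1)] by (simp add: phi_hom phi_edge_mono mult_single)
  then show False using edges_of(3)[OF u(1)] by (metis lookup_single_eq lookup_zero neg_equal_0_iff_equal zero_neq_one)
qed

lemma open_cone_trop: "w \<in> open_cone \<Longrightarrow> w \<in> trop_gr n"
  using initial_ideal_open_cone[of w] monomial_not_ker_phi by (auto simp: trop_gr_def open_cone_def)

end

section \<open>The associated graded algebra\<close>


definition zmap :: "nat cpoly \<Rightarrow> (nat \<Rightarrow>\<^sub>0 int) \<Rightarrow>\<^sub>0 complex"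
  where "zmap = poly_subst (single 0) (\<lambda>k. single (single k 1) 1)"

lemma zmap_mono: "mono_eval (\<lambda>k. single (single k (1::int)) (1::complex)) u = single (zexp u) 1"
proof -
  have "keys u \<subseteq> UNIV" by simp
  then show ?thesis
  proof (induction rule: exponent_induct)
  case (add u k)
  have "zexp (single k 1) = single k 1" by (rule poly_mapping_eqI) (simp add: lookup_single when_def)
  then show ?case using add by (simp add: mono_eval_add zexp_add mult_single)
  qed simp_all
qed

lemma lookup_zmap: "lookup (zmap g) (zexp u) = lookup g u"
proof -
  have "zmap g = (\<Sum>v\<in>keys g. single (zexp v) (lookup g v))"
    by (simp add: zmap_def poly_subst_keys[OF coeff_hom_single] zmap_mono mult_single)
  then have "lookup (zmap g) (zexp u) = (\<Sum>v\<in>keys g. if v = u then lookup g v else 0)"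
    by (simp add: lookup_sum lookup_single when_def zexp_inj)
  then show ?thesis by (simp add: in_keys_iff)
qed

lemma keys_zmap: "keys (zmap g) = zexp ` keys g"
proof
  have "zmap g = (\<Sum>v\<in>keys g. single (zexp v) (lookup g v))"
    by (simp add: zmap_def poly_subst_keys[OF coeff_hom_single] zmap_mono mult_single)
  then have "keys (zmap g) \<subseteq> (\<Union>v\<in>keys g. keys (single (zexp v) (lookup g v)))"
    by (simp only: keys_sum_subset)
  also have "\<dots> \<subseteq> zexp ` keys g" by (auto split: if_splits)
  finally show "keys (zmap g) \<subseteq> zexp ` keys g" .
  show "zexp ` keys g \<subseteq> keys (zmap g)" by (auto simp: in_keys_iff lookup_zmap)
qed

lemma zexp_keys: "keys (zexp u) = keys u"
  by (auto simp: in_keys_iff)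

lemma prec_order: "exponent_order (prec S)"
  by unfold_locales (auto simp: prec_irrefl prec_add intro: prec_trans)

interpretation prec: exponent_order "prec S" for S by (rule prec_order)

text \<open>
  The minimum over a nonempty finite set exists, because the order is total.
\<close>

lemma prec_minimum:
  assumes "finite A" "A \<noteq> {}"
  shows "\<exists>e\<in>A. \<forall>k\<in>A. k = e \<or> prec S e k"
  using assms
proof (induction A rule: finite_ne_induct)
  case (insert x A)
  then obtain e where e: "e \<in> A" "\<forall>k\<in>A. k = e \<or> prec S e k" by blast
  show ?case
  proof (cases "prec S x e")
    case True
    then show ?thesis using e prec_trans by (intro bexI[of _ x]) auto
  next
    case False
    then show ?thesis using e prec_total[of S x e] by (intro bexI[of _ e]) auto
  qed
qed auto

lemma valuation_poly_eq:
  assumes "e \<in> keys (zmap g)" "\<And>k. k \<in> keys (zmap g) \<Longrightarrow> k = e \<or> prec S e k"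
  shows "valuation_poly S g = e"
  unfolding valuation_poly_def Let_def keys_zmap[symmetric]
proof (rule the_equality)
  show "e \<in> keys (zmap g) \<and> (\<forall>v\<in>keys (zmap g). e = v \<or> prec S e v)" using assms by blast
  fix u assume u: "u \<in> keys (zmap g) \<and> (\<forall>v\<in>keys (zmap g). u = v \<or> prec S u v)"
  then show "u = e" using assms prec_trans prec_irrefl by metis
qed

context iterated
begin

interpretation L: labeled n i j "\<lambda>x. x" "\<lambda>x. x" by unfold_locales auto

text \<open>
  The pullback with exponents read as integer vectors, where the order of the valuation lives.
\<close>

definition zpull :: "ppoly \<Rightarrow> (nat \<Rightarrow>\<^sub>0 int) \<Rightarrow>\<^sub>0 complex"
  where "zpull f = zmap (psi_pullback n S f)"

lemma pullback_eq: "psi_pullback n S = poly_subst const_poly (\<lambda>(a, b). minor var_poly a b)"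
proof -
  have "psi_minor n S var_poly = (\<lambda>(a, b). minor var_poly a b :: nat cpoly)"
    by (rule ext) (auto simp: minor_def)
  then show ?thesis by (simp only: psi_pullback_def[abs_def])
qed

lemmas pull_hom = poly_subst_add[OF coeff_hom_const_poly, where s = "\<lambda>(a, b). minor var_poly a b", folded pullback_eq]
  poly_subst_mult[OF coeff_hom_const_poly, where s = "\<lambda>(a, b). minor var_poly a b", folded pullback_eq]
  poly_subst_diff[OF coeff_hom_const_poly, where s = "\<lambda>(a, b). minor var_poly a b", folded pullback_eq]
  poly_subst_zero[OF coeff_hom_const_poly, where s = "\<lambda>(a, b). minor var_poly a b", folded pullback_eq]
  poly_subst_one[OF coeff_hom_const_poly, where s = "\<lambda>(a, b). minor var_poly a b", folded pullback_eq]
  poly_subst_const[OF coeff_hom_const_poly, where s = "\<lambda>(a, b). minor var_poly a b", folded pullback_eq]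
  poly_subst_uminus[OF coeff_hom_const_poly, where s = "\<lambda>(a, b). minor var_poly a b", folded pullback_eq]

lemmas zmap_hom = poly_subst_add[OF coeff_hom_single, where s = "\<lambda>k::nat. single (single k (1::int)) (1::complex)", folded zmap_def]
  poly_subst_mult[OF coeff_hom_single, where s = "\<lambda>k::nat. single (single k (1::int)) (1::complex)", folded zmap_def]
  poly_subst_diff[OF coeff_hom_single, where s = "\<lambda>k::nat. single (single k (1::int)) (1::complex)", folded zmap_def]
  poly_subst_uminus[OF coeff_hom_single, where s = "\<lambda>k::nat. single (single k (1::int)) (1::complex)", folded zmap_def]
  poly_subst_zero[OF coeff_hom_single, where s = "\<lambda>k::nat. single (single k (1::int)) (1::complex)", folded zmap_def]
  poly_subst_one[OF coeff_hom_single, where s = "\<lambda>k::nat. single (single k (1::int)) (1::complex)", folded zmap_def]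
  poly_subst_const[OF coeff_hom_single, where s = "\<lambda>k::nat. single (single k (1::int)) (1::complex)", folded zmap_def]

lemma zpull_add: "zpull (f + g) = zpull f + zpull g"
  and zpull_mult: "zpull (f * g) = zpull f * zpull g"
  and zpull_diff: "zpull (f - g) = zpull f - zpull g"
  and zpull_uminus: "zpull (- f) = - zpull f"
  and zpull_zero [simp]: "zpull 0 = 0"
  and zpull_one [simp]: "zpull 1 = 1"
  and zpull_const: "zpull (const_poly c) = single 0 c"
  by (simp_all only: zpull_def pull_hom zmap_hom)

lemma zpull_sum: "zpull (sum f A) = (\<Sum>x\<in>A. zpull (f x))"
  by (induction A rule: infinite_finite_induct) (auto simp: zpull_add)

lemma pullback_plucker: "f \<in> plucker_ideal n \<Longrightarrow> psi_pullback n S f = 0"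
  unfolding pullback_eq by (rule plucker_ideal_kernel[OF coeff_hom_const_poly minor_pluecker])

lemma zpull_plucker: "f \<in> plucker_ideal n \<Longrightarrow> zpull f = 0"
  by (simp only: zpull_def pullback_plucker zmap_hom)

lemma generic_point_id: "generic_point (\<lambda>u. u) = var_poly"
  by (simp add: fun_eq_iff generic_point_def var_poly_def)

lemma zpull_pv:
  assumes ab: "a \<in> {1..n}" "b \<in> {1..n}" "a \<noteq> b"
  shows "lead (prec S) (zpull (pv a b)) (zexp (E a b)) (sg a b)"
proof -
  define lt where "lt = (\<lambda>u v. prec S (zexp u) (zexp v))"
  have id: "exponent_hom (\<lambda>u. u :: nat \<Rightarrow>\<^sub>0 nat)" by (simp add: exponent_hom_def)
  interpret lt: exponent_order lt
    by unfold_locales (auto simp: lt_def zexp_add prec_irrefl prec_add intro: prec_trans)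
  have "level lt E" unfolding lt_def by (rule level_E)
  note z = level_z[OF id this iffD1[OF lt.add_iff]]
  have "psi_pullback n S (pv a b) = minor var_poly a b"
    unfolding pullback_eq by (rule poly_subst_pv[OF coeff_hom_const_poly minor_antisym ab(3)])
  then have eq: "zpull (pv a b) = zmap (minor (generic_point (\<lambda>u. u)) a b)"
    by (simp add: zpull_def generic_point_id)
  show ?thesis
  proof (rule leadI)
    have "lookup (minor (generic_point (\<lambda>u. u)) a b) (E a b) = sg a b"
      by (rule minor_lookup[OF id, of lt])
        (use ab lt.irrefl lt.add_left z in \<open>auto intro: lt.trans\<close>)
    then show "lookup (zpull (pv a b)) (zexp (E a b)) = sg a b" by (simp add: eq lookup_zmap)
    fix k assume "k \<in> keys (zpull (pv a b))"
    then obtain u where u: "u \<in> keys (minor (generic_point (\<lambda>u. u)) a b)" "k = zexp u"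
      by (auto simp: eq keys_zmap)
    have "E a b = u \<or> lt (E a b) u"
      by (rule minor_keys[OF id, of "\<lambda>u v. u = v \<or> lt u v"])
        (use ab u(1) lt.add_left z in \<open>auto intro: lt.trans\<close>)
    then show "k = zexp (E a b) \<or> prec S (zexp (E a b)) k" using u by (auto simp: lt_def)
  qed
qed

lemma zpull_edge: "(k, l) \<in> edges n \<Longrightarrow> lead (prec S) (zpull (L.edge_var k l)) (zexp (E k l)) 1"
  using prec.lead_smult[OF zpull_pv[of k l], of "sg k l"] sg_square[of k l]
  by (auto simp: L.edge_var_def zpull_mult zpull_const edges_def)

lemma zpull_edge_mono:
  "set_mset A \<subseteq> edges n \<Longrightarrow> lead (prec S) (zpull (L.edge_mono A)) (zexp (E_sum A)) 1"
proof (induction A)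
  case empty
  then show ?case using prec.lead_one by simp
next
  case (add e A)
  obtain k l where e: "e = (k, l)" by (cases e)
  then show ?case
    using prec.lead_mult[OF zpull_edge[of k l] add.IH] add.prems by (simp add: zpull_mult zexp_add)
qed

subsection \<open>Straightening\<close>

abbreviation expo :: "((nat \<times> nat) \<Rightarrow>\<^sub>0 nat) \<Rightarrow> nat \<Rightarrow>\<^sub>0 int"
  where "expo u \<equiv> zexp (E_sum (L.edges_of u))"

lemma hom_closed: "f \<in> homogeneous_polys n m \<Longrightarrow> f \<in> carrier (plucker_ring n)"
  and hom_deg: "f \<in> homogeneous_polys n m \<Longrightarrow> u \<in> keys f \<Longrightarrow> L.deg u = m"
  and hom_keys: "f \<in> homogeneous_polys n m \<Longrightarrow> u \<in> keys f \<Longrightarrow> keys u \<subseteq> pairs n"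
  by (auto simp: homogeneous_polys_def carrier_poly_alg)

lemma homI: "(\<And>u. u \<in> keys f \<Longrightarrow> keys u \<subseteq> pairs n \<and> L.deg u = m) \<Longrightarrow> f \<in> homogeneous_polys n m"
  by (auto simp: homogeneous_polys_def carrier_poly_alg)

lemma hom_zero: "0 \<in> homogeneous_polys n m"
  by (rule homI) simp

lemma hom_subset:
  assumes "f \<in> homogeneous_polys n m" "g \<in> homogeneous_polys n m" "keys h \<subseteq> keys f \<union> keys g"
  shows "h \<in> homogeneous_polys n m"
proof (rule homI)
  fix u assume "u \<in> keys h"
  then have "u \<in> keys f \<or> u \<in> keys g" using assms(3) by blast
  then show "keys u \<subseteq> pairs n \<and> L.deg u = m"
    using hom_keys[OF assms(1)] hom_keys[OF assms(2)] hom_deg[OF assms(1)] hom_deg[OF assms(2)] by blast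
qed

lemma hom_add: "f \<in> homogeneous_polys n m \<Longrightarrow> g \<in> homogeneous_polys n m \<Longrightarrow> f + g \<in> homogeneous_polys n m"
  by (rule hom_subset[OF _ _ keys_add])

lemma hom_diff: "f \<in> homogeneous_polys n m \<Longrightarrow> g \<in> homogeneous_polys n m \<Longrightarrow> f - g \<in> homogeneous_polys n m"
  by (rule hom_subset[OF _ _ keys_diff_subset])

lemma hom_smult: "f \<in> homogeneous_polys n m \<Longrightarrow> const_poly c * f \<in> homogeneous_polys n m"
  by (rule hom_subset[of f m f]) (auto dest: subsetD[OF keys_const_poly_mult])

lemma hom_minus: "f \<in> homogeneous_polys n m \<Longrightarrow> - f \<in> homogeneous_polys n m"
  by (rule homI) (simp add: hom_deg hom_keys)

lemma hom_one: "1 \<in> homogeneous_polys n 0"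
  by (rule homI) simp

lemma hom_mult:
  assumes "f \<in> homogeneous_polys n m" "g \<in> homogeneous_polys n m'"
  shows "f * g \<in> homogeneous_polys n (m + m')"
proof (rule homI)
  fix u assume "u \<in> keys (f * g)"
  then obtain a b where "u = a + b" "a \<in> keys f" "b \<in> keys g" using keys_mult[of f g] by blast
  then have "keys u \<subseteq> pairs n" "L.deg u = L.deg a + L.deg b"
    using hom_keys[OF assms(1)] hom_keys[OF assms(2)] L.deg_add[of a b] by (auto simp: keys_nat_add)
  then show "keys u \<subseteq> pairs n \<and> L.deg u = m + m'"
    using hom_deg[OF assms(1)] hom_deg[OF assms(2)] \<open>a \<in> keys f\<close> \<open>b \<in> keys g\<close> by simp
qed

lemma edge_mono_monomial:
  assumes "set_mset A \<subseteq> edges n"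
  shows "\<exists>u c. keys u \<subseteq> pairs n \<and> L.deg u = size A \<and> L.edge_mono A = single u c \<and> c \<noteq> 0
    \<and> E_sum (L.edges_of u) = E_sum A"
proof -
  have "\<exists>u c. keys u \<subseteq> pairs n \<and> L.deg u = size A \<and> L.edge_mono A = single u c \<and> c \<noteq> 0"
    using assms
  proof (induction A)
    case empty
    then show ?case by (intro exI[of _ 0] exI[of _ 1]) simp
  next
    case (add e A)
    then obtain u c where u: "keys u \<subseteq> pairs n" "L.deg u = size A" "L.edge_mono A = single u c" "c \<noteq> 0" by auto
    obtain k l where e: "e = (k, l)" by (cases e)
    then have kl: "k \<in> {1..n}" "l \<in> {1..n}" "k \<noteq> l" using add.prems by (auto simp: edges_def)
    define x where "x = (min k l, max k l)"
    have x: "x \<in> pairs n" using kl by (auto simp: x_def pairs_def min_def max_def)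
    have "L.edge_var k l = single (single x 1) (sg k l * (if k < l then 1 else -1))"
      by (simp add: L.edge_var_def pv_single pv_exp_def x_def const_poly_mult_single)
    then have "L.edge_mono (add_mset e A) = single (single x 1 + u) (sg k l * (if k < l then 1 else -1) * c)"
      using u by (simp add: e mult_single)
    moreover have "sg k l * (if k < l then 1 else -1) * c \<noteq> 0"
      using sg_values[OF kl] u(4) by auto
    moreover have "L.deg (single x 1 + u) = size (add_mset e A)" using u(2) by (simp add: L.deg_add)
    moreover have "keys (single x 1 + u) \<subseteq> pairs n" using x u(1) by (simp add: keys_nat_add)
    ultimately show ?case by blast
  qed
  then obtain u c where u: "keys u \<subseteq> pairs n" "L.deg u = size A" "L.edge_mono A = single u c" "c \<noteq> 0" by blast
  have "single u c = const_poly (c * L.sign_of u) * L.edge_mono (L.edges_of u)"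
    using L.edges_of(4)[OF u(1)] const_poly_mult_single[of c u 1]
    by (simp add: L.const_poly_mult[symmetric] mult.assoc)
  then have "L.phi (single u c) = single (L.fibre (L.edges_of u)) (c * L.sign_of u)"
    using L.edges_of(1)[OF u(1)] by (simp add: L.phi_hom L.phi_edge_mono mult_single)
  then have "single (L.fibre A) 1 = single (L.fibre (L.edges_of u)) (c * L.sign_of u)"
    using L.phi_edge_mono[OF assms] u(3) by simp
  then have "L.fibre A = L.fibre (L.edges_of u)"
    by (metis keys_single one_neq_zero singleton_inject insert_not_empty)
  then show ?thesis using u by (auto simp: L.fibre_def zexp_inj)
qed

lemma finite_expos: "finite {zexp (E_sum A) | A. set_mset A \<subseteq> edges n \<and> size A = m}"
proof -
  have "edges n \<subseteq> {1..n} \<times> {1..n}" by (auto simp: edges_def)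
  then have "finite (edges n)" by (rule finite_subset) auto
  then have "finite ((\<lambda>xs. zexp (E_sum (mset xs))) ` {xs. set xs \<subseteq> edges n \<and> length xs = m})"
    by (intro finite_imageI finite_lists_length_eq)
  moreover have "{zexp (E_sum A) | A. set_mset A \<subseteq> edges n \<and> size A = m}
      \<subseteq> (\<lambda>xs. zexp (E_sum (mset xs))) ` {xs. set xs \<subseteq> edges n \<and> length xs = m}"
  proof safe
    fix A assume "set_mset A \<subseteq> edges n" "m = size A"
    moreover obtain xs where "A = mset xs" by (metis ex_mset)
    ultimately show "zexp (E_sum A) \<in> (\<lambda>xs. zexp (E_sum (mset xs))) ` {xs. set xs \<subseteq> edges n \<and> length xs = size A}"
      by auto
  qed
  ultimately show ?thesis by (rule finite_subset[rotated])
qed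

lemma zpull_expansion:
  assumes f: "f \<in> carrier (plucker_ring n)" and e: "\<And>u. u \<in> keys f \<Longrightarrow> expo u = e \<or> prec S e (expo u)"
  shows "lead (prec S) (zpull f) e (\<Sum>u\<in>{u \<in> keys f. expo u = e}. lookup f u * L.sign_of u)"
proof (rule leadI)
  have kf: "keys u \<subseteq> pairs n" if "u \<in> keys f" for u using f that by (auto simp: carrier_poly_alg)
  let ?t = "\<lambda>u. single 0 (lookup f u * L.sign_of u) * zpull (L.edge_mono (L.edges_of u))"
  have zf: "zpull f = (\<Sum>u\<in>keys f. ?t u)"
    by (subst L.edge_expansion[OF f]) (simp add: zpull_sum zpull_mult zpull_const)
  have lead: "lead (prec S) (?t u) (expo u) (lookup f u * L.sign_of u)" if "u \<in> keys f" for u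
    using prec.lead_smult[OF zpull_edge_mono[OF L.edges_of(1)[OF kf[OF that]]], of "lookup f u * L.sign_of u"]
    by simp
  have "lookup (zpull f) e = (\<Sum>u\<in>keys f. if expo u = e then lookup f u * L.sign_of u else 0)"
    unfolding zf lookup_sum
  proof (rule sum.cong[OF refl])
    fix u assume u: "u \<in> keys f"
    show "lookup (?t u) e = (if expo u = e then lookup f u * L.sign_of u else 0)"
      using prec.lead_lookup[OF lead[OF u]] prec.lead_lookup_lower[OF lead[OF u]] e[OF u] by auto
  qed
  then show "lookup (zpull f) e = (\<Sum>u\<in>{u \<in> keys f. expo u = e}. lookup f u * L.sign_of u)"
    by (simp add: sum.If_cases Int_def conj_commute)
  fix k assume "k \<in> keys (zpull f)"
  then obtain u where u: "u \<in> keys f" "k \<in> keys (?t u)"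
    using keys_sum_subset[of ?t "keys f"] unfolding zf by blast
  then show "k = e \<or> prec S e k"
    using prec.lead_keys[OF lead[OF u(1)] u(2)] e[OF u(1)] prec_trans by blast
qed

text \<open>
  If the leading coefficients of the monomials with first exponent \<open>e\<close> cancel, then these
  monomials are a combination of exchanges. Modulo the ideal each exchange is, up to sign, the third term of its Pluecker
  relation, and that term has a later exponent.
\<close>

lemma straightening_step:
  assumes f: "f \<in> homogeneous_polys n m" and e: "\<And>u. u \<in> keys f \<Longrightarrow> expo u = e \<or> prec S e (expo u)"
    and zero: "(\<Sum>u\<in>{u \<in> keys f. expo u = e}. lookup f u * L.sign_of u) = 0"
  obtains f' where "f' \<in> homogeneous_polys n m" "f - f' \<in> plucker_ideal n"
    "\<And>u. u \<in> keys f' \<Longrightarrow> prec S e (expo u)"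
proof -
  define D where "D g \<longleftrightarrow> (\<exists>h\<in>homogeneous_polys n m. g - h \<in> plucker_ideal n \<and> (\<forall>u\<in>keys h. prec S e (expo u)))" for g
  let ?U = "{u \<in> keys f. expo u = e}"
  let ?t = "\<lambda>u. const_poly (lookup f u * L.sign_of u) * L.edge_mono (L.edges_of u)"
  have "D (\<Sum>u\<in>?U. ?t u)"
  proof (rule L.fibre_sum_mem[of D "(m, e)", OF _ _ _ _ _ _ zero])
    show "D 0" unfolding D_def by (intro bexI[of _ 0]) (simp_all add: plucker.zero_mem hom_zero)
    show "D (f + g)" if D: "D f" "D g" for f g
    proof -
      obtain h h' where h: "h \<in> homogeneous_polys n m" "f - h \<in> plucker_ideal n" "\<forall>u\<in>keys h. prec S e (expo u)"
        "h' \<in> homogeneous_polys n m" "g - h' \<in> plucker_ideal n" "\<forall>u\<in>keys h'. prec S e (expo u)"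
        using D unfolding D_def by blast
      have eq: "(f + g) - (h + h') = (f - h) + (g - h')" by simp
      have "(f + g) - (h + h') \<in> plucker_ideal n" unfolding eq by (rule plucker.add_mem[OF h(2,5)])
      moreover have "\<forall>u\<in>keys (h + h'). prec S e (expo u)" using h(3,6) keys_add[of h h'] by blast
      ultimately show ?thesis unfolding D_def using hom_add[OF h(1,4)] by blast
    qed
    show "D (const_poly c * f)" if D: "D f" for c f
    proof -
      obtain h where h: "h \<in> homogeneous_polys n m" "f - h \<in> plucker_ideal n" "\<forall>u\<in>keys h. prec S e (expo u)"
        using D unfolding D_def by blast
      have "const_poly c * f - const_poly c * h = const_poly c * (f - h)" by (simp add: algebra_simps)
      then have "const_poly c * f - const_poly c * h \<in> plucker_ideal n"
        using plucker.mult_mem'[OF h(2) poly_alg_const_closed] by simp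
      moreover have "\<forall>u\<in>keys (const_poly c * h). prec S e (expo u)"
        using h(3) keys_const_poly_mult[of c h] by blast
      ultimately show ?thesis unfolding D_def using hom_smult[OF h(1)] by blast
    qed
    fix p q r s C
    assume sp: "split p q r s" and C: "set_mset C \<subseteq> edges n" and fib: "L.top_exp p r + L.top_exp q s + L.fibre C = (m, e)"
    let ?P = "pluecker_relation p q r s" and ?c = "- sg p r * sg q s"
    have d: "distinct [p, q, r, s]" "{p, q, r, s} \<subseteq> {1..n}" using split_distinct[OF sp] by auto
    let ?B = "add_mset (p, q) (add_mset (r, s) C)"
    have B: "set_mset ?B \<subseteq> edges n" using d C by (auto simp: edges_def)
    have pq: "pv p q * pv r s = const_poly (sg p q * sg r s) * (L.edge_var p q * L.edge_var r s)"
      using L.pv_edge[of p q] L.pv_edge[of r s] d by (simp add: L.const_poly_mult[symmetric] ac_simps)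
    define c where "c = sg p r * sg q s * (sg p q * sg r s)"
    define h where "h = const_poly c * L.edge_mono ?B"
    have "(L.edge_var p r * L.edge_var q s - L.edge_var p s * L.edge_var q r) * L.edge_mono C - h
        = const_poly ?c * ?P * L.edge_mono C"
    proof -
      have h: "h = - (const_poly ?c * (pv p q * pv r s)) * L.edge_mono C"
        unfolding h_def c_def pq by (simp add: L.const_poly_mult[symmetric] L.const_poly_minus ac_simps)
      show ?thesis
        unfolding h L.quad_identity[OF sp] pluecker_relation_def by (simp add: algebra_simps)
    qed
    moreover have "const_poly ?c * ?P * L.edge_mono C \<in> plucker_ideal n"
      by (intro plucker.mult_mem plucker.mult_mem' pluecker_relation_mem d poly_alg_const_closed L.edge_mono_closed C)
    ultimately have "(L.edge_var p r * L.edge_var q s - L.edge_var p s * L.edge_var q r) * L.edge_mono C - h \<in> plucker_ideal n"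
      by simp
    moreover have m: "size ?B = m" "zexp (E p r + E q s + E_sum C) = e"
      using fib by (auto simp: L.top_exp_def L.fibre_def zexp_add)
    have "prec S e (zexp (E_sum ?B))"
      using L.split_E_sum(2)[OF sp] prec_add[of S "zexp (E p r + E q s)" "zexp (E_sum C)" "zexp (E p q + E r s)"]
      unfolding m(2)[symmetric] by (simp add: zexp_add add.assoc)
    moreover obtain u c' where u: "keys u \<subseteq> pairs n" "L.deg u = size ?B" "L.edge_mono ?B = single u c'"
        "E_sum (L.edges_of u) = E_sum ?B"
      using edge_mono_monomial[OF B] by blast
    have "h = single u (c * c')" unfolding h_def u(3) by (rule const_poly_mult_single)
    then have kh: "keys h \<subseteq> {u}" by simp
    have "h \<in> homogeneous_polys n m"
      by (rule homI) (use kh u(1,2) m(1) in auto)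
    moreover have "\<forall>v\<in>keys h. prec S e (expo v)"
      using kh u(4) \<open>prec S e (zexp (E_sum ?B))\<close> by auto
    ultimately show "D ((L.edge_var p r * L.edge_var q s - L.edge_var p s * L.edge_var q r) * L.edge_mono C)"
      unfolding D_def by blast
  next
    show "finite ?U" by simp
    show "keys u \<subseteq> pairs n \<and> L.fibre (L.edges_of u) = (m, e)" if "u \<in> ?U" for u
      using that hom_keys[OF f] hom_deg[OF f] L.edges_of(2) by (auto simp: L.fibre_def)
  qed
  then obtain h where h: "h \<in> homogeneous_polys n m" "(\<Sum>u\<in>?U. ?t u) - h \<in> plucker_ideal n"
      "\<forall>u\<in>keys h. prec S e (expo u)"
    unfolding D_def by blast
  have t: "?t u = single u (lookup f u)" if "u \<in> keys f" for u
    using L.edges_of(4)[OF hom_keys[OF f that]] const_poly_mult_single[of "lookup f u" u 1]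
    by (simp add: L.const_poly_mult[symmetric] mult.assoc)
  define g where "g = (\<Sum>u\<in>?U. ?t u)"
  have g: "g = (\<Sum>u\<in>?U. single u (lookup f u))" unfolding g_def by (rule sum.cong) (use t in auto)
  have lg: "lookup g u = (if u \<in> ?U then lookup f u else 0)" for u
  proof -
    have "lookup g u = (\<Sum>v\<in>?U. if v = u then lookup f v else 0)"
      by (simp add: g lookup_sum lookup_single when_def)
    also have "finite ?U" by simp
    then have "(\<Sum>v\<in>?U. if v = u then lookup f v else 0) = (if u \<in> ?U then lookup f u else 0)"
      by (simp add: sum.delta)
    finally show ?thesis .
  qed
  have kg: "u \<in> keys f \<and> expo u \<noteq> e" if "u \<in> keys (f - g)" for u
    using that by (auto simp: in_keys_iff lookup_minus lg split: if_splits)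
  have gh: "f - g \<in> homogeneous_polys n m" by (rule homI) (use kg hom_keys[OF f] hom_deg[OF f] in blast)
  show thesis
  proof (rule that[of "(f - g) + h"])
    show "(f - g) + h \<in> homogeneous_polys n m" by (rule hom_add[OF gh h(1)])
    show "f - ((f - g) + h) \<in> plucker_ideal n" using h(2) by (simp add: g_def)
    fix u assume "u \<in> keys ((f - g) + h)"
    then have "u \<in> keys (f - g) \<or> u \<in> keys h" using keys_add[of "f - g" h] by blast
    then show "prec S e (expo u)" using kg e h(3) by blast
  qed
qed

text \<open>
  Repeating the step terminates, since in a fixed degree only finitely many exponents occur.
\<close>

theorem straightening:
  assumes "f \<in> homogeneous_polys n m"
  shows "\<exists>f'\<in>homogeneous_polys n m. f - f' \<in> plucker_ideal n \<and> (f' = 0 \<or>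
    (\<exists>A c. set_mset A \<subseteq> edges n \<and> size A = m \<and> c \<noteq> 0 \<and> lead (prec S) (zpull f') (zexp (E_sum A)) c))"
proof -
  define Ev where "Ev = {zexp (E_sum A) | A. set_mset A \<subseteq> edges n \<and> size A = m}"
  have fin: "finite Ev" unfolding Ev_def by (rule finite_expos)
  define U where "U f = {e \<in> Ev. \<exists>u\<in>keys f. expo u = e \<or> prec S (expo u) e}" for f :: ppoly
  show ?thesis
    using assms
  proof (induction "card (U f)" arbitrary: f rule: less_induct)
    case less
    show ?case
    proof (cases "f = 0")
      case True
      then show ?thesis using hom_zero plucker.zero_mem by (intro bexI[of _ 0]) simp_all
    next
      case False
      then have "keys f \<noteq> {}" by (metis keys_eq_empty)
      then obtain e where "e \<in> expo ` keys f" "\<forall>k\<in>expo ` keys f. k = e \<or> prec S e k"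
        using prec_minimum[of "expo ` keys f" S] by auto
      then obtain u0 where e: "u0 \<in> keys f" "e = expo u0" "\<And>u. u \<in> keys f \<Longrightarrow> expo u = e \<or> prec S e (expo u)"
        by blast
      have A: "set_mset (L.edges_of u0) \<subseteq> edges n" "size (L.edges_of u0) = m"
        using L.edges_of[OF hom_keys[OF less.prems e(1)]] hom_deg[OF less.prems e(1)] by auto
      let ?c = "\<Sum>u\<in>{u \<in> keys f. expo u = e}. lookup f u * L.sign_of u"
      show ?thesis
      proof (cases "?c = 0")
        case False
        have "lead (prec S) (zpull f) e ?c" by (rule zpull_expansion[OF hom_closed[OF less.prems] e(3)])
        then show ?thesis
          using less.prems plucker.zero_mem A False e(2) by (intro bexI[of _ f] conjI disjI2) auto
      next
        case True
        obtain f' where f': "f' \<in> homogeneous_polys n m" "f - f' \<in> plucker_ideal n"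
            "\<And>u. u \<in> keys f' \<Longrightarrow> prec S e (expo u)"
          using straightening_step[OF less.prems e(3) True] by blast
        have "U f' \<subseteq> U f"
          using f'(3) e(1,2) prec_trans unfolding U_def by blast
        moreover have "e \<in> U f" using e(1,2) A unfolding U_def Ev_def by blast
        moreover have "e \<notin> U f'" using f'(3) prec_irrefl prec_trans unfolding U_def by blast
        ultimately have "card (U f') < card (U f)"
          using fin by (intro psubset_card_mono) (auto simp: U_def)
        from less.hyps[OF this f'(1)] obtain f'' where f'': "f'' \<in> homogeneous_polys n m" "f' - f'' \<in> plucker_ideal n"
            "f'' = 0 \<or> (\<exists>A c. set_mset A \<subseteq> edges n \<and> size A = m \<and> c \<noteq> 0 \<and> lead (prec S) (zpull f'') (zexp (E_sum A)) c)"
          by blast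
        have "f - f'' \<in> plucker_ideal n" using plucker.add_mem[OF f'(2) f''(2)] by simp
        then show ?thesis using f'' by blast
      qed
    qed
  qed
qed

text \<open>
  A straightened polynomial has a nonzero pullback unless it is zero. In particular the
  Pluecker ideal is the full kernel of the parametrization in every degree.
\<close>

lemma zpull_zero_iff:
  assumes f: "f \<in> homogeneous_polys n m"
  shows "zpull f = 0 \<longleftrightarrow> f \<in> plucker_ideal n"
proof
  assume z: "zpull f = 0"
  obtain f' where f': "f - f' \<in> plucker_ideal n" "f' = 0 \<or> (\<exists>e c. c \<noteq> 0 \<and> lead (prec S) (zpull f') e c)"
    using straightening[OF f] by blast
  have "zpull f' = 0" using zpull_plucker[OF f'(1)] z by (simp add: zpull_diff)
  then have "f' = 0" using f'(2) prec.lead_lookup[of S "zpull f'"] by fastforce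
  then show "f \<in> plucker_ideal n" using f'(1) by simp
qed (rule zpull_plucker)

end

context iterated
begin

interpretation L: labeled n i j "\<lambda>x. x" "\<lambda>x. x" by unfold_locales auto

subsection \<open>The components of the associated graded algebra\<close>

abbreviation cst :: "ppoly \<Rightarrow> ppoly set" where "cst f \<equiv> plucker_ideal n +>\<^bsub>plucker_ring n\<^esub> f"

lemma cst_eq: "cst f = cst g \<longleftrightarrow> f - g \<in> plucker_ideal n"
  by (rule plucker.coset_eq_iff)

lemma cst_zpull: "cst f = cst g \<Longrightarrow> zpull f = zpull g"
  using zpull_plucker[of "f - g"] by (simp add: cst_eq zpull_diff)

definition above :: "(nat \<Rightarrow>\<^sub>0 int) \<Rightarrow> ((nat \<Rightarrow>\<^sub>0 int) \<Rightarrow>\<^sub>0 complex) \<Rightarrow> bool"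
  where "above a g \<longleftrightarrow> (\<forall>k\<in>keys g. k = a \<or> prec S a k)"

text \<open>The classes in degree \<open>(m, a)\<close> whose leading coefficient is \<open>c\<close>.\<close>

definition cls :: "nat \<times> (nat \<Rightarrow>\<^sub>0 int) \<Rightarrow> complex \<Rightarrow> ppoly set set"
  where "cls r c = {cst f | f. f \<in> homogeneous_polys n (fst r) \<and> above (snd r) (zpull f) \<and> lookup (zpull f) (snd r) = c}"

lemma clsI: "f \<in> homogeneous_polys n m \<Longrightarrow> above a (zpull f) \<Longrightarrow> lookup (zpull f) a = c \<Longrightarrow> cst f \<in> cls (m, a) c"
  by (auto simp: cls_def)

lemma cls_mem_iff:
  assumes "f \<in> homogeneous_polys n (fst r)"
  shows "cst f \<in> cls r c \<longleftrightarrow> above (snd r) (zpull f) \<and> lookup (zpull f) (snd r) = c"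
proof
  assume "cst f \<in> cls r c"
  then obtain g where g: "cst f = cst g" "above (snd r) (zpull g)" "lookup (zpull g) (snd r) = c"
    unfolding cls_def by blast
  then show "above (snd r) (zpull f) \<and> lookup (zpull f) (snd r) = c" using cst_zpull[OF g(1)] by simp
next
  assume "above (snd r) (zpull f) \<and> lookup (zpull f) (snd r) = c"
  then show "cst f \<in> cls r c" using assms unfolding cls_def by blast
qed

lemma above_lead: "above a g \<longleftrightarrow> lead (prec S) g a (lookup g a)"
  using prec.lead_keys[of S g a "lookup g a"] unfolding above_def by (auto intro: leadI)

lemma above_zero [simp]: "above a 0" by (simp add: above_def)

lemma above_add: "above a g \<Longrightarrow> above a h \<Longrightarrow> above a (g + h)"
  unfolding above_def using keys_add[of g h] by blast

lemma above_uminus: "above a g \<Longrightarrow> above a (- g)"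
  unfolding above_def by simp

lemma above_diff: "above a g \<Longrightarrow> above a h \<Longrightarrow> above a (g - h)"
  unfolding above_def using keys_diff_subset[of g h] by blast

lemma above_mult:
  assumes "above a g" "above b h"
  shows "above (a + b) (g * h)" "lookup (g * h) (a + b) = lookup g a * lookup h b"
proof -
  have l: "lead (prec S) (g * h) (a + b) (lookup g a * lookup h b)"
    using assms prec.lead_mult unfolding above_lead by blast
  show e: "lookup (g * h) (a + b) = lookup g a * lookup h b" using prec.lead_lookup[OF l] .
  show "above (a + b) (g * h)" using l unfolding above_lead e .
qed

definition semigroup :: "(nat \<times> (nat \<Rightarrow>\<^sub>0 int)) set"
  where "semigroup = L.fibre ` {A. set_mset A \<subseteq> edges n}"

lemma semigroup_gr_index: "semigroup \<subseteq> gr_index n"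
proof -
  have "keys (E_sum A) \<subseteq> {..<2 * (n - 2)}" if "set_mset A \<subseteq> edges n" for A
    using that
  proof (induction A)
    case (add e A)
    obtain k l where e: "e = (k, l)" by (cases e)
    then have "keys (E k l) \<subseteq> {2 * (n - max k l)..<2 * (n - 2)}"
      using add.prems by (intro keys_E) (auto simp: edges_def)
    then show ?case using add e by (auto simp: keys_nat_add)
  qed simp
  then show ?thesis unfolding semigroup_def
    by (intro image_subsetI) (simp add: gr_index_def L.fibre_def zexp_keys)
qed

lemma cls_scale:
  assumes "X \<in> cls r c" shows "\<exists>Y. Y \<in> cls r (d * c)"
proof -
  obtain f where f: "f \<in> homogeneous_polys n (fst r)" "above (snd r) (zpull f)" "lookup (zpull f) (snd r) = c"
    using assms by (auto simp: cls_def)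
  have "above (0 + snd r) (zpull (const_poly d) * zpull f)"
      "lookup (zpull (const_poly d) * zpull f) (0 + snd r) = d * c"
    using above_mult[of 0 "zpull (const_poly d)" "snd r" "zpull f"] f by (auto simp: zpull_const above_def)
  then have "cst (const_poly d * f) \<in> cls r (d * c)"
    using hom_smult[OF f(1)] by (auto simp: cls_def zpull_mult)
  then show ?thesis by blast
qed

lemma cls_zero: "cst 0 \<in> cls r 0"
  using hom_zero by (auto simp: cls_def)

text \<open>
  By straightening, the leading exponent of a nonzero pullback is the exponent sum of a monomial of
  the same degree; conversely every scalar multiple of a monomial is a representative.
\<close>

lemma cls_nonempty: "cls r c \<noteq> {} \<longleftrightarrow> c = 0 \<or> r \<in> semigroup"
proof
  assume "cls r c \<noteq> {}"
  then obtain f where f: "f \<in> homogeneous_polys n (fst r)" "above (snd r) (zpull f)" "lookup (zpull f) (snd r) = c"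
    by (auto simp: cls_def)
  show "c = 0 \<or> r \<in> semigroup"
  proof (cases "c = 0")
    case False
    obtain f' where f': "f - f' \<in> plucker_ideal n" "f' = 0 \<or>
        (\<exists>A d. set_mset A \<subseteq> edges n \<and> size A = fst r \<and> d \<noteq> 0 \<and> lead (prec S) (zpull f') (zexp (E_sum A)) d)"
      using straightening[OF f(1)] by blast
    have eq: "zpull f' = zpull f" using zpull_plucker[OF f'(1)] by (simp add: zpull_diff)
    then have "f' \<noteq> 0" using f(3) False by auto
    then obtain A d where A: "set_mset A \<subseteq> edges n" "size A = fst r" "d \<noteq> 0" "lead (prec S) (zpull f) (zexp (E_sum A)) d"
      using f'(2) eq by auto
    have "zexp (E_sum A) \<in> keys (zpull f)" using prec.lead_lookup[OF A(4)] A(3) by (simp add: in_keys_iff)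
    moreover have "snd r \<in> keys (zpull f)" using f(3) False by (simp add: in_keys_iff)
    ultimately have "zexp (E_sum A) = snd r"
      using f(2) prec.lead_keys[OF A(4), of "snd r"] prec_irrefl[of S "snd r"]
        prec_trans[of S "snd r" "zexp (E_sum A)" "snd r"] by (auto simp: above_def)
    then have "r = L.fibre A" using A(2) by (auto simp: L.fibre_def prod_eq_iff)
    then show ?thesis using A(1) by (auto simp: semigroup_def)
  qed simp
next
  assume "c = 0 \<or> r \<in> semigroup"
  then show "cls r c \<noteq> {}"
  proof
    assume "r \<in> semigroup"
    then obtain A where A: "set_mset A \<subseteq> edges n" "r = L.fibre A" by (auto simp: semigroup_def)
    obtain u d where u: "keys u \<subseteq> pairs n" "L.deg u = size A" "L.edge_mono A = single u d"
      using edge_mono_monomial[OF A(1)] by blast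
    have h: "L.edge_mono A \<in> homogeneous_polys n (size A)" unfolding u(3) by (rule homI) (use u in \<open>auto split: if_splits\<close>)
    note l = zpull_edge_mono[OF A(1)]
    have "cst (L.edge_mono A) \<in> cls r 1"
      unfolding A(2) L.fibre_def
      by (rule clsI[OF h]) (use l prec.lead_lookup[OF l] in \<open>auto simp: above_lead\<close>)
    then show ?thesis using cls_scale[of _ r 1 c] by auto
  qed (use cls_zero in blast)
qed

lemma cls_inj: "cls r c = cls r d \<Longrightarrow> cls r c \<noteq> {} \<Longrightarrow> c = d"
proof -
  assume eq: "cls r c = cls r d" and "cls r c \<noteq> {}"
  then obtain X where X: "X \<in> cls r c" by blast
  then obtain f where f: "f \<in> homogeneous_polys n (fst r)" "X = cst f" by (auto simp: cls_def)
  have "lookup (zpull f) (snd r) = c" using X cls_mem_iff[OF f(1)] f(2) by simp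
  moreover have "lookup (zpull f) (snd r) = d" using X eq cls_mem_iff[OF f(1)] f(2) by simp
  ultimately show "c = d" by simp
qed

lemma graded_part: "plucker_graded_part n m = cst ` homogeneous_polys n m"
  by (simp add: plucker_graded_part_def)

lemma alg_add: "f \<in> homogeneous_polys n m \<Longrightarrow> g \<in> homogeneous_polys n m' \<Longrightarrow>
    cst f \<oplus>\<^bsub>plucker_alg n\<^esub> cst g = cst (f + g)"
  unfolding plucker_alg_def by (intro plucker.quot_add hom_closed)

lemma alg_mult: "f \<in> homogeneous_polys n m \<Longrightarrow> g \<in> homogeneous_polys n m' \<Longrightarrow>
    cst f \<otimes>\<^bsub>plucker_alg n\<^esub> cst g = cst (f * g)"
  unfolding plucker_alg_def by (intro plucker.quot_mult hom_closed)

lemma alg_smult: "f \<in> homogeneous_polys n m \<Longrightarrow> c \<odot>\<^bsub>plucker_alg n\<^esub> cst f = cst (const_poly c * f)"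
  unfolding plucker_alg_def by (intro plucker.quot_smult hom_closed)

lemma alg_zero: "\<zero>\<^bsub>plucker_alg n\<^esub> = cst 0"
  by (simp add: plucker_alg_def plucker.quot_zero plucker.coset_zero)

lemma alg_one: "\<one>\<^bsub>plucker_alg n\<^esub> = cst 1"
  by (simp add: plucker_alg_def plucker.quot_one)

text \<open>
  The pullback is constant on a coset, so the element chosen in the definition of the valuation does not matter.
\<close>

lemma valuation_cst:
  assumes f: "f \<in> homogeneous_polys n m" and nz: "cst f \<noteq> cst 0"
  shows "valuation n S (cst f) \<in> keys (zpull f)"
    "k \<in> keys (zpull f) \<Longrightarrow> k = valuation n S (cst f) \<or> prec S (valuation n S (cst f)) k"
proof -
  have "psi_pullback n S g = psi_pullback n S f" if "g \<in> cst f" for g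
  proof -
    have "g - f \<in> plucker_ideal n" using that by (simp add: plucker.coset_mem)
    then show ?thesis using pullback_plucker[of "g - f"] by (simp add: pull_hom)
  qed
  then have "psi_pullback n S ` cst f = {psi_pullback n S f}"
    using plucker.coset_self[of f] by blast
  then have v: "valuation n S (cst f) = valuation_poly S (psi_pullback n S f)"
    by (simp add: valuation_def)
  have "zpull f \<noteq> 0" using zpull_zero_iff[OF f] nz by (simp add: cst_eq)
  then have "keys (zpull f) \<noteq> {}" by (metis keys_eq_empty)
  then obtain e where e: "e \<in> keys (zpull f)" "\<forall>k\<in>keys (zpull f). k = e \<or> prec S e k"
    using prec_minimum[of "keys (zpull f)" S] by auto
  have "valuation n S (cst f) = e"
    unfolding v by (rule valuation_poly_eq) (use e in \<open>auto simp: zpull_def\<close>)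
  then show "valuation n S (cst f) \<in> keys (zpull f)"
    "k \<in> keys (zpull f) \<Longrightarrow> k = valuation n S (cst f) \<or> prec S (valuation n S (cst f)) k"
    using e by auto
qed

lemma filt_ge_eq: "filt_ge n S r = (\<Union>c. cls r c)"
proof -
  obtain m a where r: "r = (m, a)" by (cases r)
  have key: "valuation n S (cst f) = a \<or> prec S a (valuation n S (cst f)) \<longleftrightarrow> above a (zpull f)"
    if "f \<in> homogeneous_polys n m" "cst f \<noteq> cst 0" for f
  proof
    assume *: "valuation n S (cst f) = a \<or> prec S a (valuation n S (cst f))"
    have "k = a \<or> prec S a k" if k: "k \<in> keys (zpull f)" for k
      using valuation_cst(2)[OF \<open>f \<in> _\<close> \<open>cst f \<noteq> _\<close> k] * prec_trans[of S a "valuation n S (cst f)" k] by auto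
    then show "above a (zpull f)" by (simp add: above_def)
  next
    assume "above a (zpull f)"
    then show "valuation n S (cst f) = a \<or> prec S a (valuation n S (cst f))"
      using valuation_cst(1)[OF that] by (simp add: above_def)
  qed
  show ?thesis
  proof (intro Set.set_eqI iffI)
    fix X assume "X \<in> filt_ge n S r"
    then consider "X = cst 0" | f where "f \<in> homogeneous_polys n m" "X = cst f" "cst f \<noteq> cst 0" "above a (zpull f)"
      using key by (auto simp: filt_ge_def r alg_zero graded_part)
    then show "X \<in> (\<Union>c. cls r c)"
    proof cases
      case 1 then show ?thesis using cls_zero by blast
    next
      case 2 then show ?thesis using clsI r by blast
    qed
  next
    fix X assume "X \<in> (\<Union>c. cls r c)"
    then obtain f where "f \<in> homogeneous_polys n m" "X = cst f" "above a (zpull f)" by (auto simp: cls_def r)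
    then show "X \<in> filt_ge n S r"
      using key[of f] by (cases "cst f = cst 0") (auto simp: filt_ge_def r alg_zero graded_part)
  qed
qed

lemma filt_gt_eq: "filt_gt n S r = cls r 0"
proof -
  obtain m a where r: "r = (m, a)" by (cases r)
  have key: "prec S a (valuation n S (cst f)) \<longleftrightarrow> above a (zpull f) \<and> lookup (zpull f) a = 0"
    if "f \<in> homogeneous_polys n m" "cst f \<noteq> cst 0" for f
  proof
    assume "prec S a (valuation n S (cst f))"
    then have "prec S a k" if "k \<in> keys (zpull f)" for k
      using valuation_cst(2)[OF \<open>f \<in> _\<close> \<open>cst f \<noteq> _\<close> that] prec_trans[of S a "valuation n S (cst f)" k]
      by auto
    then show "above a (zpull f) \<and> lookup (zpull f) a = 0"
      using prec_irrefl[of S a] unfolding above_def by (auto simp: in_keys_iff)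
  next
    assume "above a (zpull f) \<and> lookup (zpull f) a = 0"
    then show "prec S a (valuation n S (cst f))"
      using valuation_cst(1)[OF that] unfolding above_def by (auto simp: in_keys_iff)
  qed
  show ?thesis
  proof (intro Set.set_eqI iffI)
    fix X assume "X \<in> filt_gt n S r"
    then consider "X = cst 0" | f where "f \<in> homogeneous_polys n m" "X = cst f" "above a (zpull f)" "lookup (zpull f) a = 0"
      using key by (auto simp: filt_gt_def r alg_zero graded_part)
    then show "X \<in> cls r 0"
    proof cases
      case 1 then show ?thesis using cls_zero by blast
    next
      case 2 then show ?thesis using clsI r by blast
    qed
  next
    fix X assume "X \<in> cls r 0"
    then obtain f where "f \<in> homogeneous_polys n m" "X = cst f" "above a (zpull f)" "lookup (zpull f) a = 0"
      by (auto simp: cls_def r)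
    then show "X \<in> filt_gt n S r"
      using key[of f] by (cases "cst f = cst 0") (auto simp: filt_gt_def r alg_zero graded_part)
  qed
qed

lemma cls_add:
  assumes "Y \<in> cls r d"
  shows "(\<lambda>X. X \<oplus>\<^bsub>plucker_alg n\<^esub> Y) ` cls r c = cls r (c + d)"
proof -
  obtain g where g: "g \<in> homogeneous_polys n (fst r)" "above (snd r) (zpull g)" "lookup (zpull g) (snd r) = d" "Y = cst g"
    using assms by (auto simp: cls_def)
  show ?thesis
  proof (intro Set.set_eqI iffI)
    fix X assume "X \<in> (\<lambda>X. X \<oplus>\<^bsub>plucker_alg n\<^esub> Y) ` cls r c"
    then obtain f where f: "f \<in> homogeneous_polys n (fst r)" "above (snd r) (zpull f)" "lookup (zpull f) (snd r) = c"
        "X = cst f \<oplus>\<^bsub>plucker_alg n\<^esub> cst g"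
      by (auto simp: cls_def g)
    then show "X \<in> cls r (c + d)"
      using g by (auto simp: alg_add cls_mem_iff hom_add zpull_add above_add lookup_add)
  next
    fix X assume "X \<in> cls r (c + d)"
    then obtain f where f: "f \<in> homogeneous_polys n (fst r)" "above (snd r) (zpull f)" "lookup (zpull f) (snd r) = c + d"
        "X = cst f"
      by (auto simp: cls_def)
    have "cst (f - g) \<in> cls r c"
      using f g by (auto simp: cls_mem_iff hom_diff zpull_diff above_diff lookup_minus)
    moreover have "X = cst (f - g) \<oplus>\<^bsub>plucker_alg n\<^esub> Y"
      using f g alg_add[OF hom_diff[OF f(1) g(1)] g(1)] by simp
    ultimately show "X \<in> (\<lambda>X. X \<oplus>\<^bsub>plucker_alg n\<^esub> Y) ` cls r c" by blast
  qed
qed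

lemma coset_cls: "Y \<in> cls r d \<Longrightarrow> filt_gt n S r +>\<^bsub>plucker_alg n\<^esub> Y = cls r d"
  using cls_add[of Y r d 0] by (auto simp: filt_gt_eq a_r_coset_def r_coset_def)

text \<open>
  A class in the component of degree \<open>r\<close> is determined by its leading coefficient, so the component is
  at most one-dimensional.
\<close>

lemma component_carrier: "carrier (gr_component n S r) = {cls r c | c. cls r c \<noteq> {}}"
proof -
  have "carrier (gr_component n S r) = (\<lambda>Y. filt_gt n S r +>\<^bsub>plucker_alg n\<^esub> Y) ` filt_ge n S r"
    by (auto simp: gr_component_def FactGroup_def RCOSETS_def a_r_coset_def r_coset_def)
  also have "\<dots> = {cls r c | c. cls r c \<noteq> {}}"
    using coset_cls by (fastforce simp: filt_ge_eq)
  finally show ?thesis .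
qed

lemma component_one: "\<one>\<^bsub>gr_component n S r\<^esub> = cls r 0"
  by (simp add: gr_component_def FactGroup_def filt_gt_eq)

lemma component_mult:
  assumes "cls r c \<noteq> {}" "cls r d \<noteq> {}"
  shows "cls r c \<otimes>\<^bsub>gr_component n S r\<^esub> cls r d = cls r (c + d)"
proof -
  have "cls r c \<otimes>\<^bsub>gr_component n S r\<^esub> cls r d = (\<Union>Y\<in>cls r d. (\<lambda>X. X \<oplus>\<^bsub>plucker_alg n\<^esub> Y) ` cls r c)"
    by (auto simp: gr_component_def FactGroup_def set_mult_def)
  also have "\<dots> = cls r (c + d)" using cls_add assms(2) by auto
  finally show ?thesis .
qed

lemma cls_closed: "cls r c \<noteq> {} \<Longrightarrow> cls r d \<noteq> {} \<Longrightarrow> cls r (c + d) \<noteq> {}"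
  by (auto simp: cls_nonempty)

lemma component_comm_group: "comm_group (gr_component n S r)"
proof (rule comm_groupI)
  let ?G = "gr_component n S r"
  have rep: "\<exists>c. X = cls r c \<and> cls r c \<noteq> {}" if "X \<in> carrier ?G" for X
    using that by (auto simp: component_carrier)
  have mem: "cls r c \<in> carrier ?G" if "cls r c \<noteq> {}" for c
    using that by (auto simp: component_carrier)
  have z: "cls r 0 \<noteq> {}" using cls_zero by blast
  show "\<one>\<^bsub>?G\<^esub> \<in> carrier ?G" using mem[OF z] by (simp add: component_one)
  fix X assume "X \<in> carrier ?G"
  then obtain c where c: "X = cls r c" "cls r c \<noteq> {}" using rep by blast
  show "\<one>\<^bsub>?G\<^esub> \<otimes>\<^bsub>?G\<^esub> X = X" using component_mult[OF z c(2)] by (simp add: component_one c(1))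
  have "cls r (- c) \<noteq> {}" using c(2) by (simp add: cls_nonempty)
  then show "\<exists>Y\<in>carrier ?G. Y \<otimes>\<^bsub>?G\<^esub> X = \<one>\<^bsub>?G\<^esub>"
    using component_mult[of r "- c" c] mem[of "- c"] c by (intro bexI[of _ "cls r (- c)"]) (simp_all add: component_one)
  fix Y assume "Y \<in> carrier ?G"
  then obtain d where d: "Y = cls r d" "cls r d \<noteq> {}" using rep by blast
  have cd: "X \<otimes>\<^bsub>?G\<^esub> Y = cls r (c + d)" using component_mult[OF c(2) d(2)] c(1) d(1) by simp
  show "X \<otimes>\<^bsub>?G\<^esub> Y \<in> carrier ?G" unfolding cd by (rule mem[OF cls_closed[OF c(2) d(2)]])
  show "X \<otimes>\<^bsub>?G\<^esub> Y = Y \<otimes>\<^bsub>?G\<^esub> X"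
    unfolding cd using component_mult[OF d(2) c(2)] c(1) d(1) by (simp add: add.commute)
  fix Z assume "Z \<in> carrier ?G"
  then obtain e where e: "Z = cls r e" "cls r e \<noteq> {}" using rep by blast
  show "X \<otimes>\<^bsub>?G\<^esub> Y \<otimes>\<^bsub>?G\<^esub> Z = X \<otimes>\<^bsub>?G\<^esub> (Y \<otimes>\<^bsub>?G\<^esub> Z)"
    using component_mult[OF cls_closed[OF c(2) d(2)] e(2)] component_mult[OF c(2) cls_closed[OF d(2) e(2)]]
      component_mult[OF c(2) d(2)] component_mult[OF d(2) e(2)]
    by (simp add: c(1) d(1) e(1) add.assoc)
qed

lemma component_finprod:
  assumes "finite A" "\<And>x. x \<in> A \<Longrightarrow> cls r (c x) \<noteq> {}"
  shows "finprod (gr_component n S r) (\<lambda>x. cls r (c x)) A = cls r (\<Sum>x\<in>A. c x) \<and> cls r (\<Sum>x\<in>A. c x) \<noteq> {}"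
proof -
  interpret G: comm_group "gr_component n S r" by (rule component_comm_group)
  show ?thesis
    using assms
  proof (induction A)
    case empty
    then show ?case using cls_zero[of r] by (auto simp: component_one)
  next
    case (insert x A)
    have "finprod (gr_component n S r) (\<lambda>x. cls r (c x)) (insert x A)
        = cls r (c x) \<otimes>\<^bsub>gr_component n S r\<^esub> finprod (gr_component n S r) (\<lambda>x. cls r (c x)) A"
      by (rule G.finprod_insert) (use insert in \<open>auto simp: component_carrier\<close>)
    then show ?case using insert component_mult cls_closed by auto
  qed
qed

lemma class_mult:
  assumes "cls p c \<noteq> {}" "cls q d \<noteq> {}"
  shows "gr_class_mult n S (p + q) (cls p c) (cls q d) = cls (p + q) (c * d)" "cls (p + q) (c * d) \<noteq> {}"
proof -
  have *: "X \<otimes>\<^bsub>plucker_alg n\<^esub> Y \<in> cls (p + q) (c * d)" if "X \<in> cls p c" "Y \<in> cls q d" for X Y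
  proof -
    obtain f g where f: "f \<in> homogeneous_polys n (fst p)" "above (snd p) (zpull f)" "lookup (zpull f) (snd p) = c" "X = cst f"
      and g: "g \<in> homogeneous_polys n (fst q)" "above (snd q) (zpull g)" "lookup (zpull g) (snd q) = d" "Y = cst g"
      using \<open>X \<in> cls p c\<close> \<open>Y \<in> cls q d\<close> by (auto simp: cls_def)
    have "f * g \<in> homogeneous_polys n (fst (p + q))" using hom_mult[OF f(1) g(1)] by simp
    then show ?thesis
      using above_mult[OF f(2) g(2)] f g by (auto simp: alg_mult cls_mem_iff zpull_mult)
  qed
  then have "filt_gt n S (p + q) +>\<^bsub>plucker_alg n\<^esub> (X \<otimes>\<^bsub>plucker_alg n\<^esub> Y) = cls (p + q) (c * d)"
    if "X \<in> cls p c" "Y \<in> cls q d" for X Y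
    using coset_cls that by blast
  then show "gr_class_mult n S (p + q) (cls p c) (cls q d) = cls (p + q) (c * d)"
    using assms by (auto simp: gr_class_mult_def)
  show "cls (p + q) (c * d) \<noteq> {}" using * assms by blast
qed

lemma class_smult:
  assumes "cls r d \<noteq> {}"
  shows "(\<Union>f\<in>cls r d. filt_gt n S r +>\<^bsub>plucker_alg n\<^esub> (c \<odot>\<^bsub>plucker_alg n\<^esub> f)) = cls r (c * d)"
proof -
  have *: "c \<odot>\<^bsub>plucker_alg n\<^esub> X \<in> cls r (c * d)" if X: "X \<in> cls r d" for X
  proof -
    obtain f where f: "f \<in> homogeneous_polys n (fst r)" "above (snd r) (zpull f)" "lookup (zpull f) (snd r) = d" "X = cst f"
      using X by (auto simp: cls_def)
    have "above (0 + snd r) (zpull (const_poly c) * zpull f)"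
        "lookup (zpull (const_poly c) * zpull f) (0 + snd r) = c * d"
      using above_mult[of 0 "zpull (const_poly c)" "snd r" "zpull f"] f by (auto simp: zpull_const above_def)
    then show ?thesis using f hom_smult[OF f(1), of c] by (auto simp: alg_smult cls_mem_iff zpull_mult)
  qed
  then have "filt_gt n S r +>\<^bsub>plucker_alg n\<^esub> (c \<odot>\<^bsub>plucker_alg n\<^esub> X) = cls r (c * d)" if "X \<in> cls r d" for X
    using coset_cls that by blast
  then show ?thesis using assms by auto
qed

subsection \<open>The semigroup algebra\<close>

definition sg_alg :: "(complex, target) module"
  where "sg_alg = \<lparr>carrier = {g. keys g \<subseteq> semigroup}, mult = (*), one = 1, zero = 0, add = (+),
    smult = (\<lambda>c g. single 0 c * g)\<rparr>"

text \<open>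
  A coefficient \<open>c\<close> at the exponent \<open>r\<close> corresponds to the class in degree \<open>r\<close> with leading coefficient \<open>c\<close>.
\<close>

definition to_gr :: "target \<Rightarrow> nat \<times> (nat \<Rightarrow>\<^sub>0 int) \<Rightarrow> ppoly set set"
  where "to_gr g = (\<lambda>r\<in>gr_index n. cls r (lookup g r))"

lemma gr_carrier: "carrier (gr_alg n S) = {X \<in> \<Pi>\<^sub>E r\<in>gr_index n. carrier (gr_component n S r).
    finite {r \<in> gr_index n. X r \<noteq> \<one>\<^bsub>gr_component n S r\<^esub>}}"
proof -
  have "group (gr_component n S r)" for r using component_comm_group by (rule comm_group.axioms(2))
  then show ?thesis by (simp add: gr_alg_def Let_def carrier_sum_group)
qed

lemma cls_lookup: "keys g \<subseteq> semigroup \<Longrightarrow> cls r (lookup g r) \<noteq> {}"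
  by (auto simp: cls_nonempty in_keys_iff)

lemma to_gr_support: "keys g \<subseteq> semigroup \<Longrightarrow> gr_support n S (to_gr g) = keys g"
proof -
  assume g: "keys g \<subseteq> semigroup"
  have "cls r (lookup g r) \<noteq> cls r 0 \<longleftrightarrow> r \<in> keys g" for r
    using cls_inj[of r "lookup g r" 0] cls_lookup[OF g, of r] by (auto simp: in_keys_iff)
  then show ?thesis
    using g semigroup_gr_index by (auto simp: gr_support_def to_gr_def component_one)
qed

lemma to_gr_bij: "bij_betw to_gr (carrier sg_alg) (carrier (gr_alg n S))"
  unfolding bij_betw_def
proof
  show "inj_on to_gr (carrier sg_alg)"
  proof (rule inj_onI)
    fix g h assume *: "g \<in> carrier sg_alg" "h \<in> carrier sg_alg" "to_gr g = to_gr h"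
    show "g = h"
    proof (rule poly_mapping_eqI)
      fix r show "lookup g r = lookup h r"
      proof (cases "r \<in> gr_index n")
        case True
        then have "cls r (lookup g r) = cls r (lookup h r)" using fun_cong[OF *(3), of r] by (simp add: to_gr_def)
        then show ?thesis using cls_inj cls_lookup * by (simp add: sg_alg_def)
      next
        case False
        then have "r \<notin> keys g" "r \<notin> keys h" using *(1,2) semigroup_gr_index unfolding sg_alg_def by auto
        then show ?thesis by (simp add: in_keys_iff)
      qed
    qed
  qed
  show "to_gr ` carrier sg_alg = carrier (gr_alg n S)"
  proof (intro Set.set_eqI iffI)
    fix X assume "X \<in> to_gr ` carrier sg_alg"
    then obtain g where g: "keys g \<subseteq> semigroup" "X = to_gr g" by (auto simp: sg_alg_def)
    have "gr_support n S X = keys g" using to_gr_support g by simp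
    then have "finite {r \<in> gr_index n. X r \<noteq> \<one>\<^bsub>gr_component n S r\<^esub>}" by (simp add: gr_support_def)
    then show "X \<in> carrier (gr_alg n S)"
      using cls_lookup[OF g(1)] by (auto simp: gr_carrier g(2) to_gr_def component_carrier)
  next
    fix X assume X: "X \<in> carrier (gr_alg n S)"
    then have "\<exists>c. X r = cls r c \<and> cls r c \<noteq> {}" if "r \<in> gr_index n" for r
      using that by (auto simp: gr_carrier component_carrier PiE_iff)
    then obtain c where c: "\<And>r. r \<in> gr_index n \<Longrightarrow> X r = cls r (c r) \<and> cls r (c r) \<noteq> {}" by metis
    have supp: "{r \<in> gr_index n. c r \<noteq> 0} \<subseteq> {r \<in> gr_index n. X r \<noteq> \<one>\<^bsub>gr_component n S r\<^esub>}"
    proof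
      fix r assume "r \<in> {r \<in> gr_index n. c r \<noteq> 0}"
      then have r: "r \<in> gr_index n" "c r \<noteq> 0" by auto
      then have "X r \<noteq> \<one>\<^bsub>gr_component n S r\<^esub>"
        using c[OF r(1)] cls_inj[of r "c r" 0] by (auto simp: component_one)
      then show "r \<in> {r \<in> gr_index n. X r \<noteq> \<one>\<^bsub>gr_component n S r\<^esub>}" using r by simp
    qed
    then have fin: "finite {r. r \<in> gr_index n \<and> c r \<noteq> 0}"
      using X finite_subset by (auto simp: gr_carrier)
    define g where "g = Abs_poly_mapping (\<lambda>r. if r \<in> gr_index n then c r else 0)"
    have lg: "lookup g = (\<lambda>r. if r \<in> gr_index n then c r else 0)"
      unfolding g_def by (rule lookup_Abs_poly_mapping) (rule finite_subset[OF _ fin], auto split: if_splits)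
    have "r \<in> semigroup" if "r \<in> keys g" for r
    proof -
      have "r \<in> gr_index n" "c r \<noteq> 0" using that by (simp_all add: in_keys_iff lg split: if_splits)
      then show ?thesis using c[of r] by (simp add: cls_nonempty)
    qed
    then have "keys g \<subseteq> semigroup" by blast
    moreover have "to_gr g = X"
    proof
      fix r show "to_gr g r = X r"
      proof (cases "r \<in> gr_index n")
        case True
        then show ?thesis using c[of r] by (simp add: to_gr_def lg)
      next
        case False
        have "X \<in> extensional (gr_index n)" using X by (simp add: gr_carrier PiE_def)
        from extensional_arb[OF this False] show ?thesis using False by (simp add: to_gr_def)
      qed
    qed
    ultimately show "X \<in> to_gr ` carrier sg_alg" by (auto simp: sg_alg_def)
  qed
qed

lemma lookup_target_mult:
  fixes g h :: target
  shows "lookup (g * h) r = (\<Sum>(p, q)\<in>{(p, q). p \<in> keys g \<and> q \<in> keys h \<and> p + q = r}. lookup g p * lookup h q)"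
proof -
  have "g * h = (\<Sum>p\<in>keys g. \<Sum>q\<in>keys h. single (p + q) (lookup g p * lookup h q))"
    by (subst (1 2) sum_of_terms[symmetric]) (simp only: sum_product mult_single)
  then have "lookup (g * h) r = (\<Sum>p\<in>keys g. \<Sum>q\<in>keys h. if p + q = r then lookup g p * lookup h q else 0)"
    by (simp only: lookup_sum lookup_single when_def)
  then have "lookup (g * h) r = (\<Sum>(p, q)\<in>keys g \<times> keys h. if p + q = r then lookup g p * lookup h q else 0)"
    by (simp only: sum.cartesian_product)
  also have "\<dots> = (\<Sum>(p, q)\<in>{(p, q). p \<in> keys g \<and> q \<in> keys h \<and> p + q = r}. lookup g p * lookup h q)"
    by (rule sum.mono_neutral_cong_right) (auto split: if_splits)
  finally show ?thesis .
qed

lemma to_gr_mult: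
  assumes g: "keys g \<subseteq> semigroup" and h: "keys h \<subseteq> semigroup"
  shows "to_gr (g * h) = gr_mult n S (to_gr g) (to_gr h)"
proof -
  have "cls r (lookup (g * h) r) = finprod (gr_component n S r)
      (\<lambda>(p, q). gr_class_mult n S r (to_gr g p) (to_gr h q))
      {(p, q). p \<in> gr_support n S (to_gr g) \<and> q \<in> gr_support n S (to_gr h) \<and> p + q = r}" for r
  proof -
    let ?P = "{(p, q). p \<in> keys g \<and> q \<in> keys h \<and> p + q = r}"
    have fin: "finite ?P" by (rule finite_subset[of _ "keys g \<times> keys h"]) auto
    have term_eq: "(case x of (p, q) \<Rightarrow> gr_class_mult n S r (to_gr g p) (to_gr h q))
        = cls r (case x of (p, q) \<Rightarrow> lookup g p * lookup h q)
        \<and> cls r (case x of (p, q) \<Rightarrow> lookup g p * lookup h q) \<noteq> {}" if x: "x \<in> ?P" for x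
    proof -
      obtain p q where pq: "x = (p, q)" "p \<in> keys g" "q \<in> keys h" "r = p + q" using x by auto
      have "p \<in> gr_index n" "q \<in> gr_index n" using pq g h semigroup_gr_index by blast+
      then show ?thesis using class_mult[OF cls_lookup[OF g, of p] cls_lookup[OF h, of q]] pq by (simp add: to_gr_def)
    qed
    interpret G: comm_group "gr_component n S r" by (rule component_comm_group)
    have "finprod (gr_component n S r) (\<lambda>(p, q). gr_class_mult n S r (to_gr g p) (to_gr h q)) ?P
        = finprod (gr_component n S r) (\<lambda>x. cls r (case x of (p, q) \<Rightarrow> lookup g p * lookup h q)) ?P"
      by (rule G.finprod_cong') (use term_eq in \<open>auto simp: component_carrier\<close>)
    also have "\<dots> = cls r (\<Sum>x\<in>?P. case x of (p, q) \<Rightarrow> lookup g p * lookup h q)"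
      using component_finprod[OF fin] term_eq by blast
    finally show ?thesis by (simp add: to_gr_support[OF g] to_gr_support[OF h] lookup_target_mult)
  qed
  then show ?thesis unfolding gr_mult_def to_gr_def[of "g * h"] by (intro restrict_ext) simp
qed

text \<open>
  Classes add and multiply as their leading coefficients do, because leading terms of products
  are products of leading terms. The product in degree \<open>r\<close> is then the coefficient of a product of polynomials.
\<close>

theorem to_gr_iso: "to_gr \<in> ring_iso sg_alg (gr_alg n S)"
  and to_gr_smult: "g \<in> carrier sg_alg \<Longrightarrow> to_gr (c \<odot>\<^bsub>sg_alg\<^esub> g) = c \<odot>\<^bsub>gr_alg n S\<^esub> to_gr g"
proof -
  show "to_gr \<in> ring_iso sg_alg (gr_alg n S)"
  proof (rule ring_iso_memI)
    show "bij_betw to_gr (carrier sg_alg) (carrier (gr_alg n S))" by (rule to_gr_bij)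
    then show "to_gr g \<in> carrier (gr_alg n S)" if "g \<in> carrier sg_alg" for g
      using that by (rule bij_betwE[THEN bspec])
    show "to_gr (g \<otimes>\<^bsub>sg_alg\<^esub> h) = to_gr g \<otimes>\<^bsub>gr_alg n S\<^esub> to_gr h"
      if "g \<in> carrier sg_alg" "h \<in> carrier sg_alg" for g h
      using to_gr_mult that by (simp add: sg_alg_def gr_alg_def Let_def)
    show "to_gr (g \<oplus>\<^bsub>sg_alg\<^esub> h) = to_gr g \<oplus>\<^bsub>gr_alg n S\<^esub> to_gr h"
      if "g \<in> carrier sg_alg" "h \<in> carrier sg_alg" for g h
    proof -
      have "cls r (lookup (g + h) r) = cls r (lookup g r) \<otimes>\<^bsub>gr_component n S r\<^esub> cls r (lookup h r)" for r
        using component_mult[OF cls_lookup cls_lookup, of g h r] that by (simp add: sg_alg_def lookup_add)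
      then show ?thesis by (auto simp: sg_alg_def gr_alg_def Let_def to_gr_def intro!: restrict_ext)
    qed
    have one: "cls 0 1 = filt_gt n S 0 +>\<^bsub>plucker_alg n\<^esub> cst 1"
    proof (rule coset_cls[symmetric])
      show "cst 1 \<in> cls 0 1"
        using clsI[OF hom_one, of 0 1] by (simp add: above_def zero_prod_def)
    qed
    show "to_gr \<one>\<^bsub>sg_alg\<^esub> = \<one>\<^bsub>gr_alg n S\<^esub>"
      by (auto simp: sg_alg_def gr_alg_def Let_def to_gr_def lookup_one one alg_one component_one when_def
          intro!: restrict_ext)
  qed
  show "to_gr (c \<odot>\<^bsub>sg_alg\<^esub> g) = c \<odot>\<^bsub>gr_alg n S\<^esub> to_gr g" if "g \<in> carrier sg_alg"
  proof -
    have "cls r (lookup (single 0 c * g) r) = (\<Union>f\<in>cls r (lookup g r). filt_gt n S r +>\<^bsub>plucker_alg n\<^esub> (c \<odot>\<^bsub>plucker_alg n\<^esub> f))" for r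
      using class_smult[OF cls_lookup, of g r c] that lookup_single_mult[of 0 c g r] by (simp add: sg_alg_def)
    then show ?thesis by (auto simp: sg_alg_def gr_alg_def Let_def to_gr_def intro!: restrict_ext)
  qed
qed

end

section \<open>The maximal cones of the tropical Grassmannian\<close>

lemma lookup_scaleR: "lookup (r *\<^sub>R x) k = r *\<^sub>R lookup x k"
  for x :: "'a \<Rightarrow>\<^sub>0 'b::real_vector"
proof -
  have "finite {i. r *\<^sub>R lookup x i \<noteq> 0}"
    by (rule finite_subset[of _ "keys x"]) (auto simp: in_keys_iff)
  then show ?thesis by (simp add: scaleR_poly_mapping_def)
qed

text \<open>
  The norm of a finitely supported function bounds each of its entries. The cones are therefore cut out by continuous linear functions.
\<close>

lemma lookup_bounded_linear: "bounded_linear (\<lambda>x :: weight. lookup x k)"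
proof (rule bounded_linear_intro[where K = 1])
  fix x :: weight
  have "\<bar>lookup x k\<bar> \<le> (\<Sum>n\<in>keys x. \<bar>lookup x n\<bar>)"
  proof (cases "k \<in> keys x")
    case True
    then show ?thesis by (intro member_le_sum[of k "keys x" "\<lambda>n. \<bar>lookup x n\<bar>"]) auto
  next
    case False
    then show ?thesis by (simp add: in_keys_iff sum_nonneg)
  qed
  then show "norm (lookup x k) \<le> norm x * 1"
    by (simp add: norm_poly_mapping_def dist_poly_mapping_def dist_real_def)
qed (simp_all add: lookup_add lookup_scaleR)

lemma continuous_on_lookup: "continuous_on UNIV (\<lambda>x :: weight. lookup x k)"
  using lookup_bounded_linear by (rule linear_continuous_on)

lemma weights_closed: "closed (weights n)"
proof -
  have "weights n = (\<Inter>k\<in>- pairs n. {w. lookup w k = 0})"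
    by (auto simp: weights_def in_keys_iff)
  moreover have "closed {w :: weight. lookup w k = 0}" for k
    by (rule closed_Collect_eq) (auto intro: continuous_on_lookup)
  ultimately show ?thesis by auto
qed

lemma weights_lin: "u \<in> weights n \<Longrightarrow> v \<in> weights n \<Longrightarrow> r *\<^sub>R u + s *\<^sub>R v \<in> weights n"
proof -
  assume u: "u \<in> weights n" and v: "v \<in> weights n"
  have "x \<in> pairs n" if "lookup (r *\<^sub>R u + s *\<^sub>R v) x \<noteq> 0" for x
  proof (rule ccontr)
    assume "x \<notin> pairs n"
    then have "lookup u x = 0" "lookup v x = 0" using u v by (auto simp: weights_def in_keys_iff)
    then show False using that by (simp add: lookup_add lookup_scaleR)
  qed
  then show ?thesis by (auto simp: weights_def in_keys_iff)
qed

lemma wt_lin: "wt (r *\<^sub>R u + s *\<^sub>R v) a b = r * wt u a b + s * wt v a b"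
  by (simp add: wt_def lookup_add lookup_scaleR)

context labeled
begin

definition gap_set :: "(nat \<times> nat \<times> nat) set"
  where "gap_set = {(l, k, c). l \<in> {4..n} \<and> k \<in> {1..<l} - {i l} \<and> c \<in> {1..<l} - {i l} \<and> k \<noteq> c}"

text \<open>
  The equation and the inequality that the level condition imposes for a stage \<open>l\<close> and two leaves \<open>k, c\<close>.
\<close>

definition eq_gap :: "nat \<times> nat \<times> nat \<Rightarrow> weight \<Rightarrow> real"
  where "eq_gap = (\<lambda>(l, k, c) w. pos_wt w k l + pos_wt w (i l) c - (pos_wt w c l + pos_wt w (i l) k))"

definition gap :: "nat \<times> nat \<times> nat \<Rightarrow> weight \<Rightarrow> real"
  where "gap = (\<lambda>(l, k, c) w. pos_wt w (i l) l + pos_wt w k c - (pos_wt w k l + pos_wt w (i l) c))"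

lemma finite_gap_set: "finite gap_set"
  by (rule finite_subset[of _ "{..n} \<times> {..n} \<times> {..n}"]) (auto simp: gap_set_def)

lemma open_cone_gap: "w \<in> open_cone \<longleftrightarrow> w \<in> weights n \<and> (\<forall>g\<in>gap_set. eq_gap g w = 0 \<and> 0 < gap g w)"
  unfolding open_cone_def level_def gap_set_def eq_gap_def gap_def by fastforce

lemma closed_cone_gap: "w \<in> closed_cone \<longleftrightarrow> w \<in> weights n \<and> (\<forall>g\<in>gap_set. eq_gap g w = 0 \<and> 0 \<le> gap g w)"
  unfolding closed_cone_def level_def gap_set_def eq_gap_def gap_def by fastforce

lemma pos_wt_lin: "pos_wt (r *\<^sub>R u + s *\<^sub>R v) k l = r * pos_wt u k l + s * pos_wt v k l"
  by (simp add: pos_wt_def wt_lin)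

lemma gap_lin: "gap g (r *\<^sub>R u + s *\<^sub>R v) = r * gap g u + s * gap g v"
  and eq_gap_lin: "eq_gap g (r *\<^sub>R u + s *\<^sub>R v) = r * eq_gap g u + s * eq_gap g v"
  by (cases g, simp add: gap_def eq_gap_def pos_wt_lin algebra_simps)+

lemma continuous_gap: "continuous_on UNIV (gap g)" "continuous_on UNIV (eq_gap g)"
  by (cases g, auto simp: gap_def eq_gap_def pos_wt_def wt_def intro!: continuous_intros continuous_on_lookup)+

lemma closed_closed_cone: "closed closed_cone"
proof -
  have "closed_cone = weights n \<inter> (\<Inter>g\<in>gap_set. {w. eq_gap g w = 0} \<inter> {w. 0 \<le> gap g w})"
    by (auto simp: closed_cone_gap)
  moreover have *: "closed {w. eq_gap g w = 0}" "closed {w. 0 \<le> gap g w}" for g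
    by (rule closed_Collect_eq closed_Collect_le continuous_gap continuous_on_const)+
  have "closed (weights n \<inter> (\<Inter>g\<in>gap_set. {w. eq_gap g w = 0} \<inter> {w. 0 \<le> gap g w}))"
    by (intro closed_Int closed_INT ballI weights_closed *)
  ultimately show ?thesis by simp
qed

lemma open_closed_segment:
  assumes "u \<in> open_cone" "v \<in> closed_cone" "0 < r"
  shows "v + r *\<^sub>R u \<in> open_cone"
proof -
  have eq: "v + r *\<^sub>R u = 1 *\<^sub>R v + r *\<^sub>R u" by simp
  have w: "u \<in> weights n" "v \<in> weights n" and "\<forall>g\<in>gap_set. eq_gap g u = 0 \<and> 0 < gap g u"
    "\<forall>g\<in>gap_set. eq_gap g v = 0 \<and> 0 \<le> gap g v"
    using assms by (simp_all add: open_cone_gap closed_cone_gap)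
  then have "\<forall>g\<in>gap_set. 1 * eq_gap g v + r * eq_gap g u = 0 \<and> 0 < 1 * gap g v + r * gap g u"
    using assms(3) by (simp add: add_nonneg_pos)
  then show ?thesis
    unfolding eq open_cone_gap gap_lin eq_gap_lin using weights_lin[OF w(2,1)] by blast
qed

text \<open>
  Moving a point of the closed cone slightly towards a point of the open cone makes all inequalities strict.
\<close>

lemma closure_open_cone:
  assumes "open_cone \<noteq> {}"
  shows "closure open_cone = closed_cone"
proof
  show "closure open_cone \<subseteq> closed_cone"
    by (rule closure_minimal) (auto simp: closed_closed_cone open_closed)
  obtain u where u: "u \<in> open_cone" using assms by blast
  show "closed_cone \<subseteq> closure open_cone"
  proof
    fix v assume v: "v \<in> closed_cone"
    have "(\<lambda>m. v + (1 / real (Suc m)) *\<^sub>R u) \<longlonglongrightarrow> v + 0 *\<^sub>R u"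
      by (intro tendsto_intros LIMSEQ_Suc[OF lim_1_over_n])
    moreover have "v + (1 / real (Suc m)) *\<^sub>R u \<in> open_cone" for m
      by (rule open_closed_segment[OF u v]) simp
    ultimately show "v \<in> closure open_cone"
      unfolding closure_sequential by (intro exI[of _ "\<lambda>m. v + (1 / real (Suc m)) *\<^sub>R u"]) simp
  qed
qed

text \<open>
  From a point of the relative interior one can move a little away from a point of the open cone,
  which is impossible if one of the inequalities is an equality. Conversely, the finitely many strict
  inequalities are an open condition within the affine hull.
\<close>

lemma rel_interior_closed_cone:
  assumes "open_cone \<noteq> {}"
  shows "rel_interior closed_cone = open_cone"
proof
  obtain u where u: "u \<in> open_cone" using assms by blast
  show "rel_interior closed_cone \<subseteq> open_cone"
  proof
    fix v assume "v \<in> rel_interior closed_cone"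
    then obtain e where v: "v \<in> closed_cone" and e: "e > 0" "ball v e \<inter> affine hull closed_cone \<subseteq> closed_cone"
      unfolding mem_rel_interior_ball by blast
    define N where "N = norm (v - u) + 1"
    define r where "r = e / (2 * N)"
    have r: "0 < r" "r * norm (v - u) < e"
    proof -
      have "0 < N" by (simp add: N_def add_nonneg_pos)
      then show "0 < r" using e(1) by (simp add: r_def)
      have "r * norm (v - u) \<le> r * N" using \<open>0 < r\<close> by (simp add: N_def)
      also have "\<dots> = e / 2" using \<open>0 < N\<close> by (simp add: r_def)
      finally show "r * norm (v - u) < e" using e(1) by simp
    qed
    let ?x = "(1 + r) *\<^sub>R v + (- r) *\<^sub>R u"
    have "?x \<in> affine hull closed_cone"
      using u v open_closed by (intro mem_affine[OF affine_affine_hull] hull_inc) auto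
    moreover have "?x = v + r *\<^sub>R (v - u)" by (simp add: algebra_simps)
    then have "dist v ?x < e" using r by (simp add: dist_norm)
    ultimately have x: "?x \<in> closed_cone" using e(2) by auto
    have "0 < gap g v" if g: "g \<in> gap_set" for g
    proof -
      have "0 \<le> gap g ?x" using x g by (simp add: closed_cone_gap)
      then have "r * gap g u \<le> (1 + r) * gap g v" by (simp only: gap_lin)
      moreover have "0 < r * gap g u" using r u g by (simp add: open_cone_gap)
      ultimately have "0 < (1 + r) * gap g v" by linarith
      then show ?thesis using r(1) by (simp add: zero_less_mult_iff)
    qed
    then show "v \<in> open_cone" using v by (simp add: open_cone_gap closed_cone_gap)
  qed
  show "open_cone \<subseteq> rel_interior closed_cone"
  proof
    fix v assume v: "v \<in> open_cone"
    let ?T = "\<Inter>g\<in>gap_set. {w. 0 < gap g w}"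
    let ?L = "{w \<in> weights n. \<forall>g\<in>gap_set. eq_gap g w = 0}"
    have T: "open ?T" using finite_gap_set by (intro open_INT ballI open_Collect_less) (auto intro: continuous_gap)
    have "affine ?L" unfolding affine_def
      by (auto simp: eq_gap_lin intro: weights_lin)
    then have "affine hull closed_cone \<subseteq> ?L"
      by (intro hull_minimal) (auto simp: closed_cone_gap)
    then have "?T \<inter> affine hull closed_cone \<subseteq> ?T \<inter> ?L" by blast
    also have "\<dots> \<subseteq> closed_cone"
      unfolding closed_cone_gap subset_iff by (metis (mono_tags, lifting) INT_iff Int_iff less_imp_le mem_Collect_eq)
    finally have "?T \<inter> affine hull closed_cone \<subseteq> closed_cone" .
    then show "v \<in> rel_interior closed_cone"
      unfolding mem_rel_interior using T v open_closed[OF v] by (intro exI[of _ ?T]) (auto simp: open_cone_gap)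
  qed
qed

text \<open>
  A weight with the toric initial ideal lies in the closed cone. If an inequality were an equality,
  the initial form of the corresponding Pluecker relation would have three terms; together with the
  exchange in the ideal this would leave a single monomial.
\<close>

lemma ker_phi_open_cone:
  assumes "open_cone \<noteq> {}" and v: "v \<in> weights n" "initial_ideal n v = ker_phi"
  shows "v \<in> open_cone"
proof -
  obtain w where w: "w \<in> open_cone" using assms by blast
  have trop: "v \<in> trop_gr n" using v monomial_not_ker_phi by (simp add: trop_gr_def)
  have vc: "v \<in> closed_cone"
    by (rule initial_closed_cone[OF open_closed[OF w] trop]) (simp add: v initial_ideal_open_cone[OF w])
  have "0 < gap g v" if g: "g \<in> gap_set" for g
  proof (rule ccontr)
    assume "\<not> 0 < gap g v"
    then have z: "gap g v = 0" using vc g by (force simp: closed_cone_gap)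
    obtain l k c where g': "g = (l, k, c)" by (cases g)
    have lkc: "l \<in> {4..n}" "k \<in> {1..<l} - {i l}" "c \<in> {1..<l} - {i l}" "k \<noteq> c"
      using g by (auto simp: g' gap_set_def)
    then have sp: "split (i l) l k c" by (intro cherry) auto
    note d = split_\<sigma>[OF sp]
    have e: "pos_wt v (i l) k + pos_wt v l c = pos_wt v (i l) c + pos_wt v l k"
      using closed_cone_split(1)[OF vc sp] by simp
    have e': "pos_wt v (i l) l + pos_wt v k c = pos_wt v (i l) k + pos_wt v l c"
      using z closed_cone_split(1)[OF vc sp] by (simp add: g' gap_def pos_wt_sym[of v k l])
    let ?P = "pluecker_relation (\<sigma> (i l)) (\<sigma> l) (\<sigma> k) (\<sigma> c)"
    have "initial_form v ?P = ?P"
      using initial_form_pluecker[OF d(1), of v] e e' by (simp add: pos_wt_def) (simp add: pluecker_relation_def)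
    then have P: "?P \<in> ker_phi"
      using initial_form_mem[OF pluecker_relation_mem[OF d], of v] v(2) by simp
    have "edge_var (i l) k * edge_var l c - edge_var (i l) c * edge_var l k \<in> ker_phi"
      using quad_initial[OF w sp] initial_ideal_open_cone[OF w] by simp
    then have "phi (const_poly (- sg (i l) k * sg l c) * ?P) = 0" "phi (const_poly (- sg (i l) k * sg l c) *
        (- (pv (\<sigma> (i l)) (\<sigma> k) * pv (\<sigma> l) (\<sigma> c)) + pv (\<sigma> (i l)) (\<sigma> c) * pv (\<sigma> l) (\<sigma> k))) = 0"
      using P unfolding quad_identity[OF sp] by (simp_all add: ker_phi_def phi_hom)
    then have "phi (const_poly (- sg (i l) k * sg l c) * (pv (\<sigma> (i l)) (\<sigma> l) * pv (\<sigma> k) (\<sigma> c))) = 0"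
      by (simp add: pluecker_relation_def phi_hom algebra_simps)
    moreover have "\<rho> (\<sigma> x) = x" if "x \<in> {i l, l, k, c}" for x
      using split_distinct[OF sp] that \<sigma> by blast
    ultimately have "single (top_exp (i l) l + top_exp k c)
        (- sg (i l) k * sg l c * (sg (i l) l * sg k c)) = 0"
      using d by (simp add: phi_hom phi_pv phi_var_def mult_single)
    then have "sg (i l) k * sg l c * (sg (i l) l * sg k c) = 0"
      by (metis lookup_single_eq lookup_zero mult_minus_left neg_equal_0_iff_equal)
    moreover have "sg x y \<noteq> 0" if "x \<in> {i l, l, k, c}" "y \<in> {i l, l, k, c}" "x \<noteq> y" for x y
      using split_distinct[OF sp] that sg_values[of x y] by fastforce
    ultimately show False using split_distinct[OF sp] by auto
  qed
  then show ?thesis using vc by (simp add: closed_cone_gap open_cone_gap)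
qed

lemma initial_class:
  assumes "open_cone \<noteq> {}" "w \<in> open_cone"
  shows "{v \<in> weights n. initial_ideal n v = initial_ideal n w} = open_cone"
  using ker_phi_open_cone[OF assms(1)] initial_ideal_open_cone assms(2)
  by (auto simp: open_cone_def)

lemma closed_cone_trop_cone: "open_cone \<noteq> {} \<Longrightarrow> closed_cone \<in> trop_cones n"
proof -
  assume ne: "open_cone \<noteq> {}"
  then obtain w where w: "w \<in> open_cone" by blast
  have "closed_cone = closure {v \<in> weights n. initial_ideal n v = initial_ideal n w}"
    by (subst initial_class[OF ne w]) (rule closure_open_cone[OF ne, symmetric])
  then show ?thesis
    unfolding trop_cones_def using open_cone_trop[OF w] by (rule image_eqI)
qed

lemma cone_ideal_closed_cone: "open_cone \<noteq> {} \<Longrightarrow> cone_ideal n closed_cone = ker_phi"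
proof -
  assume ne: "open_cone \<noteq> {}"
  then have "\<exists>w. w \<in> open_cone" by blast
  then have "(SOME w. w \<in> rel_interior closed_cone) \<in> open_cone"
    unfolding rel_interior_closed_cone[OF ne] by (rule someI_ex)
  then show ?thesis unfolding cone_ideal_def by (rule initial_ideal_open_cone)
qed

lemma trop_cone_subset:
  assumes "w \<in> trop_gr n" "w \<in> closed_cone" "D = closure {v \<in> weights n. initial_ideal n v = initial_ideal n w}"
  shows "D \<subseteq> closed_cone"
  unfolding assms(3)
proof (rule closure_minimal[OF _ closed_closed_cone], safe)
  fix v assume v: "v \<in> weights n" "initial_ideal n v = initial_ideal n w"
  then have "v \<in> trop_gr n" using assms(1) by (simp add: trop_gr_def)
  then show "v \<in> closed_cone" using initial_closed_cone[OF assms(2)] v(2) by blast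
qed

end

text \<open>
  At \<open>v\<close> the first tree splits any four leaves strictly. The weak comparisons for the second tree at \<open>v\<close> leave
  only the same split, so \<open>v\<close> lies in the second open cone as well. An open cone is determined by the
  initial ideal of any of its points.
\<close>

lemma closed_cone_eq:
  assumes A: "labeled n i j \<sigma> \<rho>" and B: "labeled n i' j' \<sigma>' \<rho>'"
    and v: "v \<in> labeled.open_cone n i \<sigma>" "v \<in> labeled.closed_cone n i' \<sigma>'"
  shows "labeled.closed_cone n i \<sigma> = labeled.closed_cone n i' \<sigma>'"
proof -
  interpret A: labeled n i j \<sigma> \<rho> by (rule A)
  interpret B: labeled n i' j' \<sigma>' \<rho>' by (rule B)
  have "0 < B.gap g v" if g: "g \<in> B.gap_set" for g
  proof -
    obtain l k c where g': "g = (l, k, c)" by (cases g)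
    have lkc: "l \<in> {4..n}" "k \<in> {1..<l} - {i' l}" "c \<in> {1..<l} - {i' l}" "k \<noteq> c"
      using g by (auto simp: g' B.gap_set_def)
    then have spB: "B.split (i' l) l k c" by (intro B.cherry) auto
    let ?p = "\<rho> (\<sigma>' (i' l))" and ?q = "\<rho> (\<sigma>' l)" and ?r = "\<rho> (\<sigma>' k)" and ?s = "\<rho> (\<sigma>' c)"
    have d: "distinct [?p, ?q, ?r, ?s]" "{?p, ?q, ?r, ?s} \<subseteq> {1..n}"
      using B.split_\<sigma>[OF spB] A.\<rho> A.\<rho>_inj by auto
    have pw: "A.pos_wt v ?p ?q = B.pos_wt v (i' l) l" "A.pos_wt v ?r ?s = B.pos_wt v k c"
      "A.pos_wt v ?p ?r = B.pos_wt v (i' l) k" "A.pos_wt v ?q ?s = B.pos_wt v l c"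
      "A.pos_wt v ?p ?s = B.pos_wt v (i' l) c" "A.pos_wt v ?q ?r = B.pos_wt v l k"
      using B.split_\<sigma>(2)[OF spB] A.pos_wt_\<rho> by (simp_all add: B.pos_wt_def)
    have weak: "B.pos_wt v (i' l) k + B.pos_wt v l c = B.pos_wt v (i' l) c + B.pos_wt v l k"
      "B.pos_wt v (i' l) k + B.pos_wt v l c \<le> B.pos_wt v (i' l) l + B.pos_wt v k c"
      using B.closed_cone_split[OF v(2) spB] by auto
    have "B.pos_wt v (i' l) k + B.pos_wt v l c < B.pos_wt v (i' l) l + B.pos_wt v k c"
      using A.split_exists[OF d]
    proof (elim disjE)
      assume "A.split ?p ?q ?r ?s"
      then show ?thesis using A.open_cone_split[OF v(1)] pw by metis
    next
      assume "A.split ?p ?r ?q ?s"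
      from A.open_cone_split[OF v(1) this] show ?thesis
        using weak pw A.pos_wt_sym[of v ?r ?q] by simp
    next
      assume "A.split ?p ?s ?q ?r"
      from A.open_cone_split[OF v(1) this] show ?thesis
        using weak pw A.pos_wt_sym[of v ?s ?r] A.pos_wt_sym[of v ?s ?q] by simp
    qed
    then show ?thesis
      using weak(1) by (simp add: g' B.gap_def B.pos_wt_sym[of v k l] B.pos_wt_sym[of v c l])
  qed
  then have vB: "v \<in> B.open_cone" using v(2) by (simp add: B.open_cone_gap B.closed_cone_gap)
  have neA: "A.open_cone \<noteq> {}" and neB: "B.open_cone \<noteq> {}" using v(1) vB by blast+
  have "A.open_cone = B.open_cone"
    using A.initial_class[OF neA v(1)] B.initial_class[OF neB vB] by simp
  then show ?thesis using A.closure_open_cone[OF neA] B.closure_open_cone[OF neB] by simp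
qed

section \<open>Trees\<close>

subsection \<open>Paths and cuts\<close>

text \<open>
  In a tree every edge \<open>e\<close> cuts the vertices into two sides, recorded by \<open>s e\<close>, and \<open>e\<close> is the
  only edge that joins the sides.
\<close>

definition cuts :: "vertex set set \<Rightarrow> (vertex set \<Rightarrow> vertex \<Rightarrow> bool) \<Rightarrow> bool"
  where "cuts T s \<longleftrightarrow> (\<forall>e\<in>T. \<forall>x y. {x, y} \<in> T \<longrightarrow> (s e x \<noteq> s e y \<longleftrightarrow> {x, y} = e))"

lemma path_edges_simps [simp]: "path_edges [] = {}" "path_edges [x] = {}"
  "path_edges (x # y # p) = insert {x, y} (path_edges (y # p))"
proof -
  show "path_edges [] = {}" "path_edges [x] = {}" by (auto simp: path_edges_def)
  have "{{(x # y # p) ! k, (x # y # p) ! Suc k} |k. Suc k < length (x # y # p)}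
      = insert {x, y} {{(y # p) ! k, (y # p) ! Suc k} |k. Suc k < length (y # p)}"
  proof (intro Set.set_eqI iffI)
    fix e assume "e \<in> {{(x # y # p) ! k, (x # y # p) ! Suc k} |k. Suc k < length (x # y # p)}"
    then obtain k where k: "e = {(x # y # p) ! k, (x # y # p) ! Suc k}" "Suc k < length (x # y # p)" by blast
    show "e \<in> insert {x, y} {{(y # p) ! k, (y # p) ! Suc k} |k. Suc k < length (y # p)}"
    proof (cases k)
      case 0 then show ?thesis using k by simp
    next
      case (Suc m) then show ?thesis using k by auto
    qed
  next
    fix e assume "e \<in> insert {x, y} {{(y # p) ! k, (y # p) ! Suc k} |k. Suc k < length (y # p)}"
    then consider "e = {x, y}" | k where "e = {(y # p) ! k, (y # p) ! Suc k}" "Suc k < length (y # p)" by blast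
    then show "e \<in> {{(x # y # p) ! k, (x # y # p) ! Suc k} |k. Suc k < length (x # y # p)}"
    proof cases
      case 1 then show ?thesis by (intro CollectI exI[of _ 0]) simp
    next
      case 2 then show ?thesis by (intro CollectI exI[of _ "Suc k"]) simp
    qed
  qed
  then show "path_edges (x # y # p) = insert {x, y} (path_edges (y # p))" by (simp add: path_edges_def)
qed

lemma path_edges_subset: "e \<in> path_edges p \<Longrightarrow> e \<subseteq> set p"
  by (auto simp: path_edges_def)

text \<open>
  A path without repeated vertices crosses an edge at most once, namely if and only if its ends lie on
  different sides.
\<close>

lemma path_edges_cut:
  assumes "cuts T s"
  shows "p \<noteq> [] \<Longrightarrow> distinct p \<Longrightarrow> path_edges p \<subseteq> T \<Longrightarrow> path_edges p = {e \<in> T. s e (hd p) \<noteq> s e (last p)}"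
proof (induction p rule: induct_list012)
  case (3 x y p)
  have IH: "path_edges (y # p) = {e \<in> T. s e y \<noteq> s e (last (y # p))}" using 3 by simp
  have xy: "{x, y} \<in> T" using 3 by simp
  have "{x, y} \<notin> path_edges (y # p)" using path_edges_subset[of "{x, y}" "y # p"] 3(4) by auto
  then have 1: "s {x, y} y = s {x, y} (last (y # p))" using IH xy by auto
  have 2: "s e x \<noteq> s e y \<longleftrightarrow> {x, y} = e" if "e \<in> T" for e
    using assms that xy unfolding cuts_def by blast
  show ?case
  proof (intro Set.set_eqI)
    fix e
    show "e \<in> path_edges (x # y # p) \<longleftrightarrow> e \<in> {e \<in> T. s e (hd (x # y # p)) \<noteq> s e (last (x # y # p))}"
      using 1 2[of e] IH xy by (cases "e = {x, y}") auto
  qed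
qed auto

text \<open>
  Since the edges of a path are determined by its ends, it is enough that the edges and the first
  vertex determine a path.
\<close>

lemma path_unique:
  assumes "distinct p" "distinct q" "p \<noteq> []" "q \<noteq> []" "hd p = hd q" "path_edges p = path_edges q"
  shows "p = q"
  using assms
proof (induction p arbitrary: q rule: induct_list012)
  case (2 x)
  then show ?case by (cases q; cases "tl q") auto
next
  case (3 x y p)
  obtain y' q' where q: "q = x # y' # q'"
    using "3.prems" by (cases q; cases "tl q") auto
  have "{x, y} \<in> path_edges q" using 3 by auto
  then have "{x, y} = {x, y'} \<or> {x, y} \<subseteq> set (y' # q')" using path_edges_subset[of "{x, y}" "y' # q'"] by (auto simp: q)
  then have y: "y = y'" using 3(4) by (auto simp: q doubleton_eq_iff)
  have "{x, y} \<notin> path_edges (y # p)" "{x, y} \<notin> path_edges (y' # q')"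
    using path_edges_subset[of "{x, y}" "y # p"] path_edges_subset[of "{x, y}" "y' # q'"] 3(3,4) by (auto simp: q)
  then have "path_edges (y # p) = path_edges (y' # q')" using 3(8) unfolding q y by (simp add: insert_ident)
  then have "y # p = y' # q'" using 3 by (intro "3.IH"(2)) (auto simp: q y)
  then show ?case by (simp add: q)
qed auto

lemma path_exists:
  assumes "(x, y) \<in> {(x, y). {x, y} \<in> T}\<^sup>*"
  shows "\<exists>p. p \<noteq> [] \<and> distinct p \<and> hd p = x \<and> last p = y \<and> path_edges p \<subseteq> T"
  using assms
proof (induction rule: converse_rtrancl_induct)
  case base
  then show ?case by (intro exI[of _ "[y]"]) auto
next
  case (step x z)
  then obtain p where p: "p \<noteq> []" "distinct p" "hd p = z" "last p = y" "path_edges p \<subseteq> T" by blast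
  show ?case
  proof (cases "x \<in> set p")
    case True
    then obtain p1 p2 where p12: "p = p1 @ x # p2" by (meson split_list)
    have "path_edges (x # p2) \<subseteq> path_edges (p1 @ x # p2)"
    proof (induction p1)
      case (Cons a p1) then show ?case by (cases p1) auto
    qed simp
    then show ?thesis using p p12 by (intro exI[of _ "x # p2"]) auto
  next
    case False
    obtain p' where "p = z # p'" using p(1,3) by (cases p) auto
    then show ?thesis using p step(1) False by (intro exI[of _ "x # p"]) auto
  qed
qed

lemma tree_path_edges:
  assumes "cuts T s" "(x, y) \<in> {(x, y). {x, y} \<in> T}\<^sup>*"
  shows "path_edges (tree_path T x y) = {e \<in> T. s e x \<noteq> s e y}"
proof -
  let ?P = "\<lambda>p. p \<noteq> [] \<and> distinct p \<and> hd p = x \<and> last p = y \<and> path_edges p \<subseteq> T"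
  obtain p where p: "?P p" using path_exists[OF assms(2)] by blast
  have unique: "q = p" if q: "?P q" for q
  proof -
    have "path_edges q = {e \<in> T. s e x \<noteq> s e y}" "path_edges p = {e \<in> T. s e x \<noteq> s e y}"
      using path_edges_cut[OF assms(1), of q] path_edges_cut[OF assms(1), of p] p q by simp_all
    then show ?thesis using path_unique[of q p] p q by simp
  qed
  have "?P (tree_path T x y)" unfolding tree_path_def by (rule theI[of ?P, OF p unique])
  then show ?thesis using path_edges_cut[OF assms(1), of "tree_path T x y"] by simp
qed

subsection \<open>Growing a tree\<close>

text \<open>
  The properties of the stages of the construction that determine the path lengths. Instead of the
  absence of cycles the cuts \<open>s\<close> are carried along. The vertices are named by the stage at which they
  appear, so the vertices of the next stage are new.
\<close>

definition grown_tree :: "nat \<Rightarrow> vertex set set \<Rightarrow> (vertex set \<Rightarrow> vertex \<Rightarrow> bool) \<Rightarrow> bool"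
  where "grown_tree l T s \<longleftrightarrow> finite T \<and> cuts T s \<and>
    (\<forall>e\<in>T. \<exists>p. Inner p \<in> e) \<and> (\<forall>e\<in>T. \<exists>x y. x \<noteq> y \<and> e = {x, y}) \<and>
    \<Union>T \<subseteq> Leaf ` {1..l} \<union> Inner ` {3..l} \<and>
    (\<forall>k\<in>{1..l}. \<exists>!x. {x, Leaf k} \<in> T) \<and>
    (\<forall>p\<in>{3..l}. \<exists>e\<in>T. \<exists>f\<in>T. e \<noteq> f \<and> Inner p \<in> e \<and> Inner p \<in> f) \<and>
    (\<forall>x\<in>Leaf ` {1..l} \<union> Inner ` {3..l}. \<forall>y\<in>Leaf ` {1..l} \<union> Inner ` {3..l}. (x, y) \<in> {(x, y). {x, y} \<in> T}\<^sup>*)"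

lemma grown_treeD:
  assumes "grown_tree l T s"
  shows "finite T" "cuts T s"
    and "\<And>e. e \<in> T \<Longrightarrow> \<exists>p. Inner p \<in> e" and "\<And>e. e \<in> T \<Longrightarrow> \<exists>x y. x \<noteq> y \<and> e = {x, y}"
    and "\<And>e x. e \<in> T \<Longrightarrow> x \<in> e \<Longrightarrow> x \<in> Leaf ` {1..l} \<union> Inner ` {3..l}"
    and "\<And>k. k \<in> {1..l} \<Longrightarrow> \<exists>!x. {x, Leaf k} \<in> T"
    and "\<And>p. p \<in> {3..l} \<Longrightarrow> \<exists>e\<in>T. \<exists>f\<in>T. e \<noteq> f \<and> Inner p \<in> e \<and> Inner p \<in> f"
    and "\<And>x y. x \<in> Leaf ` {1..l} \<union> Inner ` {3..l} \<Longrightarrow> y \<in> Leaf ` {1..l} \<union> Inner ` {3..l} \<Longrightarrow>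
        (x, y) \<in> {(x, y). {x, y} \<in> T}\<^sup>*"
proof -
  note c = assms[unfolded grown_tree_def]
  show "finite T" by (rule c[THEN conjunct1])
  show "cuts T s" by (rule c[THEN conjunct2, THEN conjunct1])
  note c = c[THEN conjunct2, THEN conjunct2]
  show "\<And>e. e \<in> T \<Longrightarrow> \<exists>p. Inner p \<in> e" by (rule c[THEN conjunct1, THEN bspec])
  note c = c[THEN conjunct2]
  show "\<And>e. e \<in> T \<Longrightarrow> \<exists>x y. x \<noteq> y \<and> e = {x, y}" by (rule c[THEN conjunct1, THEN bspec])
  note c = c[THEN conjunct2]
  show "\<And>e x. e \<in> T \<Longrightarrow> x \<in> e \<Longrightarrow> x \<in> Leaf ` {1..l} \<union> Inner ` {3..l}"
    by (rule subsetD[OF c[THEN conjunct1]], rule UnionI)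
  note c = c[THEN conjunct2]
  show "\<And>k. k \<in> {1..l} \<Longrightarrow> \<exists>!x. {x, Leaf k} \<in> T" by (rule c[THEN conjunct1, THEN bspec])
  note c = c[THEN conjunct2]
  show "\<And>p. p \<in> {3..l} \<Longrightarrow> \<exists>e\<in>T. \<exists>f\<in>T. e \<noteq> f \<and> Inner p \<in> e \<and> Inner p \<in> f"
    by (rule c[THEN conjunct1, THEN bspec])
  show "\<And>x y. x \<in> Leaf ` {1..l} \<union> Inner ` {3..l} \<Longrightarrow> y \<in> Leaf ` {1..l} \<union> Inner ` {3..l} \<Longrightarrow>
      (x, y) \<in> {(x, y). {x, y} \<in> T}\<^sup>*"
    by (rule c[THEN conjunct2, THEN bspec, THEN bspec])
qed

text \<open>
  The number of inner edges that separate two leaves. For a grown tree this is the number of inner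
  edges on the path between them (\<open>tree_dist_card\<close>).
\<close>

definition tree_dist :: "vertex set set \<Rightarrow> (vertex set \<Rightarrow> vertex \<Rightarrow> bool) \<Rightarrow> nat \<Rightarrow> nat \<Rightarrow> nat"
  where "tree_dist T s x y = card {e \<in> T. (\<forall>k. Leaf k \<notin> e) \<and> s e (Leaf x) \<noteq> s e (Leaf y)}"

lemma internal_edges_grown:
  assumes "grown_tree l T s"
  shows "internal_edges T = {e \<in> T. \<forall>k. Leaf k \<notin> e}"
proof -
  have fin: "finite T" by (rule grown_treeD(1)[OF assms])
  have leaf: "valency T (Leaf k) = 1" if "k \<in> {1..l}" for k
  proof -
    obtain x where x: "{x, Leaf k} \<in> T" "\<And>y. {y, Leaf k} \<in> T \<Longrightarrow> y = x"
      using grown_treeD(6)[OF assms \<open>k \<in> {1..l}\<close>] by blast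
    have "e = {x, Leaf k}" if e: "e \<in> T" "Leaf k \<in> e" for e
    proof -
      obtain u v where uv: "e = {u, v}" "u \<noteq> v" using grown_treeD(4)[OF assms e(1)] by blast
      then show ?thesis using x(2)[of u] x(2)[of v] e by (auto simp: insert_commute)
    qed
    then have "{e \<in> T. Leaf k \<in> e} = {{x, Leaf k}}" using x(1) by blast
    then show ?thesis by (simp add: valency_def)
  qed
  have inner: "valency T (Inner p) \<noteq> 1" if p: "p \<in> {3..l}" for p
  proof
    assume v: "valency T (Inner p) = 1"
    obtain e f where ef: "e \<in> T" "f \<in> T" "e \<noteq> f" "Inner p \<in> e" "Inner p \<in> f"
      using grown_treeD(7)[OF assms p] by blast
    obtain g where g: "{e \<in> T. Inner p \<in> e} = {g}" using v unfolding valency_def by (rule card_1_singletonE)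
    have "e \<in> {e \<in> T. Inner p \<in> e}" "f \<in> {e \<in> T. Inner p \<in> e}" using ef by simp_all
    then show False using ef(3) unfolding g by simp
  qed
  have vert: "x \<in> Leaf ` {1..l} \<union> Inner ` {3..l}" if "e \<in> T" "x \<in> e" for e x
    by (rule grown_treeD(5)[OF assms that])
  show ?thesis
    unfolding internal_edges_def
  proof (intro Collect_cong conj_cong refl iffI ballI allI)
    fix e k assume e: "e \<in> T" and v: "\<forall>x\<in>e. valency T x \<noteq> 1"
    show "Leaf k \<notin> e"
    proof
      assume k: "Leaf k \<in> e"
      have "k \<in> {1..l}" using vert[OF e k] by auto
      then show False using leaf v k by blast
    qed
  next
    fix e x assume e: "e \<in> T" "\<forall>k. Leaf k \<notin> e" "x \<in> e"
    then show "valency T x \<noteq> 1" using vert[OF e(1,3)] inner by auto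
  qed
qed

lemma tree_dist_card:
  assumes "grown_tree l T s" "x \<in> {1..l}" "y \<in> {1..l}"
  shows "card (internal_edges T \<inter> path_edges (tree_path T (Leaf x) (Leaf y))) = tree_dist T s x y"
proof -
  have "path_edges (tree_path T (Leaf x) (Leaf y)) = {e \<in> T. s e (Leaf x) \<noteq> s e (Leaf y)}"
    by (rule tree_path_edges[OF grown_treeD(2)[OF assms(1)] grown_treeD(8)[OF assms(1)]])
      (use assms(2,3) in auto)
  then have "internal_edges T \<inter> path_edges (tree_path T (Leaf x) (Leaf y))
      = {e \<in> T. (\<forall>k. Leaf k \<notin> e) \<and> s e (Leaf x) \<noteq> s e (Leaf y)}"
    using internal_edges_grown[OF assms(1)] by auto
  then show ?thesis by (simp add: tree_dist_def)
qed

lemma tree_dist_sym: "tree_dist T s x y = tree_dist T s y x"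
  by (simp add: tree_dist_def eq_commute)

lemma tree_dist_triangle: "finite T \<Longrightarrow> tree_dist T s x z \<le> tree_dist T s x y + tree_dist T s y z"
  unfolding tree_dist_def by (rule order.trans[OF card_mono card_Un_le]) auto

lemma grown_tree_base:
  "\<exists>s. grown_tree 3 {{Inner 3, Leaf 1}, {Inner 3, Leaf 2}, {Inner 3, Leaf 3}} s"
proof -
  let ?T = "{{Inner 3, Leaf 1}, {Inner 3, Leaf 2}, {Inner 3, Leaf 3}}"
  define s where "s = (\<lambda>e v. v \<in> (e :: vertex set) \<and> v \<noteq> Inner 3)"
  have k3: "{1..3} = {1, 2, 3 :: nat}" by auto
  have conn1: "(Inner 3, x) \<in> {(x, y). {x, y} \<in> ?T}\<^sup>*" "(x, Inner 3) \<in> {(x, y). {x, y} \<in> ?T}\<^sup>*"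
    if "x \<in> Leaf ` {1..3} \<union> Inner ` {3..3}" for x
    using that unfolding k3 by (auto simp: insert_commute)
  have conn: "(x, y) \<in> {(x, y). {x, y} \<in> ?T}\<^sup>*"
    if "x \<in> Leaf ` {1..3} \<union> Inner ` {3..3}" "y \<in> Leaf ` {1..3} \<union> Inner ` {3..3}" for x y
    using conn1(2)[OF that(1)] conn1(1)[OF that(2)] by (rule rtrancl_trans)
  have "cuts ?T s" unfolding cuts_def s_def by (auto simp: doubleton_eq_iff)
  moreover have "\<forall>k\<in>{1..3}. \<exists>!x. {x, Leaf k} \<in> ?T" unfolding k3 by (auto simp: doubleton_eq_iff)
  moreover have "\<exists>e\<in>?T. \<exists>f\<in>?T. e \<noteq> f \<and> Inner 3 \<in> e \<and> Inner 3 \<in> f"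
    by (intro bexI[of _ "{Inner 3, Leaf 1}"] bexI[of _ "{Inner 3, Leaf 2}"]) (auto simp: doubleton_eq_iff)
  moreover have "\<forall>e\<in>?T. \<exists>x y. x \<noteq> y \<and> e = {x, y}" by blast
  moreover have "\<Union>?T \<subseteq> Leaf ` {1..3} \<union> Inner ` {3..3}" by auto
  moreover have "\<forall>e\<in>?T. \<exists>p. Inner p \<in> e" by blast
  moreover have "finite ?T" by simp
  ultimately have "grown_tree 3 ?T s" unfolding grown_tree_def using conn by simp
  then show ?thesis by blast
qed

text \<open>
  The new inner edge is the one that separates the cherry from the rest. Hence the distances from the
  leaf \<open>a\<close> grow by one, and the new leaf has the same distances as \<open>a\<close>.
\<close>

lemma grown_tree_attach:
  assumes T: "grown_tree m T s" and a: "a \<in> {1..m}" and m: "3 \<le> m"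
  shows "\<exists>s'. grown_tree (Suc m) (attach_leaf a (Suc m) T) s' \<and>
    (\<forall>x\<in>{1..m}. \<forall>y\<in>{1..m}. x \<noteq> y \<longrightarrow> tree_dist (attach_leaf a (Suc m) T) s' x y
        = tree_dist T s x y + (if x = a \<or> y = a then 1 else 0)) \<and>
    (\<forall>x\<in>{1..m}. tree_dist (attach_leaf a (Suc m) T) s' x (Suc m) = tree_dist (attach_leaf a (Suc m) T) s' x a)"
proof -
  let ?A = "Leaf a" and ?L = "Leaf (Suc m)" and ?I = "Inner (Suc m)"
  have fin: "finite T" and cut: "cuts T s" and inn: "\<And>e. e \<in> T \<Longrightarrow> \<exists>p. Inner p \<in> e"
    and two: "\<And>e. e \<in> T \<Longrightarrow> \<exists>x y. x \<noteq> y \<and> e = {x, y}"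
    and vert: "\<And>e x. e \<in> T \<Longrightarrow> x \<in> e \<Longrightarrow> x \<in> Leaf ` {1..m} \<union> Inner ` {3..m}"
    and leaf: "\<And>k. k \<in> {1..m} \<Longrightarrow> \<exists>!x. {x, Leaf k} \<in> T"
    and inner: "\<And>p. p \<in> {3..m} \<Longrightarrow> \<exists>e\<in>T. \<exists>f\<in>T. e \<noteq> f \<and> Inner p \<in> e \<and> Inner p \<in> f"
    and conn: "\<And>x y. x \<in> Leaf ` {1..m} \<union> Inner ` {3..m} \<Longrightarrow> y \<in> Leaf ` {1..m} \<union> Inner ` {3..m} \<Longrightarrow>
        (x, y) \<in> {(x, y). {x, y} \<in> T}\<^sup>*"
    by (fact grown_treeD[OF T])+
  obtain q where q: "{q, ?A} \<in> T" "\<And>x. {x, ?A} \<in> T \<Longrightarrow> x = q" using leaf[OF a] by blast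
  have the_q: "(THE x. {x, ?A} \<in> T) = q" using q by blast
  define T' where "T' = T - {{q, ?A}} \<union> {{q, ?I}, {?I, ?A}, {?I, ?L}}"
  have T': "attach_leaf a (Suc m) T = T'" by (simp add: attach_leaf_def the_q T'_def)
  have onlyA: "e = {q, ?A}" if "e \<in> T" "?A \<in> e" for e
  proof -
    obtain x y where xy: "x \<noteq> y" "e = {x, y}" using two[OF \<open>e \<in> T\<close>] by blast
    then show ?thesis using q(2)[of x] q(2)[of y] that by (auto simp: insert_commute)
  qed
  obtain p0 where "Inner p0 \<in> {q, ?A}" using inn[OF q(1)] by blast
  then have qi: "q = Inner p0" by auto
  have new: "?I \<notin> e" "?L \<notin> e" if "e \<in> T" for e using vert[OF that] by fastforce+
  have ne: "q \<noteq> ?I" "q \<noteq> ?L" "q \<noteq> ?A" "?A \<noteq> ?L" using new[OF q(1)] qi a by auto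
  define s' where "s' = (\<lambda>e v. if e = {q, ?I} then v \<in> {?I, ?L, ?A} else if e = {?I, ?A} then v = ?A
      else if e = {?I, ?L} then v = ?L else if v \<in> {?I, ?L} then s e ?A else s e v)"
  have s'1: "s' {q, ?I} v \<longleftrightarrow> v \<in> {?I, ?L, ?A}" "s' {?I, ?A} v \<longleftrightarrow> v = ?A" "s' {?I, ?L} v \<longleftrightarrow> v = ?L" for v
    using ne by (auto simp: s'_def doubleton_eq_iff)
  have s'2: "s' e v \<longleftrightarrow> (if v \<in> {?I, ?L} then s e ?A else s e v)" if "e \<in> T" for e v
  proof -
    have "e \<noteq> {q, ?I}" "e \<noteq> {?I, ?A}" "e \<noteq> {?I, ?L}" using new[OF that] by auto
    then show ?thesis by (simp add: s'_def)
  qed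
  have cut': "cuts T' s'" unfolding cuts_def
  proof (intro ballI allI impI)
    fix e x y assume e: "e \<in> T'" and xy: "{x, y} \<in> T'"
    have old: "s e x \<noteq> s e y \<longleftrightarrow> {x, y} = e" if "e \<in> T" "{x, y} \<in> T" for e x y
      using cut that unfolding cuts_def by blast
    have xyc: "({x, y} \<in> T \<and> x \<noteq> ?I \<and> y \<noteq> ?I \<and> x \<noteq> ?L \<and> y \<noteq> ?L \<and> x \<noteq> ?A \<and> y \<noteq> ?A) \<or> {x, y} = {q, ?I} \<or> {x, y} = {?I, ?A} \<or> {x, y} = {?I, ?L}"
    proof -
      consider "{x, y} \<in> T" "{x, y} \<noteq> {q, ?A}" | "{x, y} = {q, ?I}" | "{x, y} = {?I, ?A}" | "{x, y} = {?I, ?L}"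
        using xy unfolding T'_def by blast
      then show ?thesis
      proof cases
        case 1
        have "?I \<notin> {x, y}" "?L \<notin> {x, y}" by (rule new[OF 1(1)])+
        moreover have "?A \<notin> {x, y}"
        proof
          assume "?A \<in> {x, y}"
          from onlyA[OF 1(1) this] 1(2) show False by contradiction
        qed
        ultimately show ?thesis using 1(1) by auto
      qed simp_all
    qed
    consider "e \<in> T" "e \<noteq> {q, ?A}" | "e = {q, ?I}" | "e = {?I, ?A}" | "e = {?I, ?L}" using e unfolding T'_def by blast
    then show "s' e x \<noteq> s' e y \<longleftrightarrow> {x, y} = e"
    proof cases
      case 1
      have eq: "s e q = s e ?A" using old[OF 1(1) q(1)] 1(2) by auto
      have nI: "e \<noteq> {q, ?I}" "e \<noteq> {?I, ?A}" "e \<noteq> {?I, ?L}" using new[OF 1(1)] by auto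
      from xyc show ?thesis
      proof (elim disjE)
        assume "{x, y} \<in> T \<and> x \<noteq> ?I \<and> y \<noteq> ?I \<and> x \<noteq> ?L \<and> y \<noteq> ?L \<and> x \<noteq> ?A \<and> y \<noteq> ?A"
        then show ?thesis using old[OF 1(1), of x y] s'2[OF 1(1)] by simp
      next
        assume "{x, y} = {q, ?I}"
        then show ?thesis using eq nI s'2[OF 1(1)] ne by (auto simp: doubleton_eq_iff)
      next
        assume "{x, y} = {?I, ?A}"
        then show ?thesis using nI s'2[OF 1(1)] ne by (auto simp: doubleton_eq_iff)
      next
        assume "{x, y} = {?I, ?L}"
        then show ?thesis using nI s'2[OF 1(1)] by (auto simp: doubleton_eq_iff)
      qed
    next
      case 2
      from xyc show ?thesis unfolding 2 s'1 using ne by (elim disjE) (auto simp: doubleton_eq_iff)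
    next
      case 3
      from xyc show ?thesis unfolding 3 s'1 using ne by (elim disjE) (auto simp: doubleton_eq_iff)
    next
      case 4
      from xyc show ?thesis unfolding 4 s'1 using ne by (elim disjE) (auto simp: doubleton_eq_iff)
    qed
  qed
  have a_pos: "a \<in> {1..Suc m}" using a by auto
  have leaf': "\<exists>!x. {x, Leaf k} \<in> T'" if k: "k \<in> {1..Suc m}" for k
  proof -
    consider "k = Suc m" | "k = a" | "k \<in> {1..m}" "k \<noteq> a" "k \<noteq> Suc m" using k by force
    then show ?thesis
    proof cases
      case 1
      have "{x, ?L} \<notin> T" for x using new(2)[of "{x, ?L}"] by blast
      then have "{x, ?L} \<in> T' \<longleftrightarrow> x = ?I" for x using ne by (auto simp: T'_def doubleton_eq_iff)
      then show ?thesis unfolding 1 by simp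
    next
      case 2
      have "{x, ?A} \<in> T \<longleftrightarrow> {x, ?A} = {q, ?A}" for x using q(1) onlyA[of "{x, ?A}"] by auto
      then have "{x, ?A} \<in> T' \<longleftrightarrow> x = ?I" for x using ne by (auto simp: T'_def doubleton_eq_iff)
      then show ?thesis unfolding 2 by simp
    next
      case 3
      have "{x, Leaf k} \<in> T' \<longleftrightarrow> {x, Leaf k} \<in> T" for x using 3 qi by (auto simp: T'_def doubleton_eq_iff)
      then show ?thesis using leaf[OF 3(1)] by simp
    qed
  qed
  have inner': "\<exists>e\<in>T'. \<exists>f\<in>T'. e \<noteq> f \<and> Inner p \<in> e \<and> Inner p \<in> f" if p: "p \<in> {3..Suc m}" for p
  proof (cases "p = Suc m")
    case True
    have "{?I, ?A} \<in> T'" "{?I, ?L} \<in> T'" "{?I, ?A} \<noteq> {?I, ?L}" using ne by (auto simp: T'_def doubleton_eq_iff)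
    then show ?thesis unfolding True by (intro bexI[of _ "{?I, ?A}"] bexI[of _ "{?I, ?L}"]) simp_all
  next
    case False
    then obtain e f where ef: "e \<in> T" "f \<in> T" "e \<noteq> f" "Inner p \<in> e" "Inner p \<in> f" using inner[of p] p by auto
    define g where "g = (\<lambda>e. if e = {q, ?A} then {q, ?I} else e)"
    have g: "g e \<in> T'" "Inner p \<in> g e" if "e \<in> T" "Inner p \<in> e" for e using that by (auto simp: g_def T'_def)
    have "{q, ?I} \<notin> T" using new(1)[of "{q, ?I}"] by blast
    then have "g e \<noteq> g f" using ef(1-3) by (auto simp: g_def)
    then show ?thesis using g ef by blast
  qed
  have step: "(x, y) \<in> {(x, y). {x, y} \<in> T'}\<^sup>*" if "{x, y} \<in> T" for x y
  proof (cases "{x, y} = {q, ?A}")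
    case True
    have "(q, ?I) \<in> {(x, y). {x, y} \<in> T'}" "(?I, ?A) \<in> {(x, y). {x, y} \<in> T'}"
      "(?A, ?I) \<in> {(x, y). {x, y} \<in> T'}" "(?I, q) \<in> {(x, y). {x, y} \<in> T'}"
      by (auto simp: T'_def insert_commute)
    then show ?thesis using True by (auto simp: doubleton_eq_iff intro: rtrancl_trans[OF r_into_rtrancl r_into_rtrancl])
  next
    case False
    then show ?thesis using that by (intro r_into_rtrancl) (auto simp: T'_def)
  qed
  have conn_old: "(x, y) \<in> {(x, y). {x, y} \<in> T'}\<^sup>*" if "(x, y) \<in> {(x, y). {x, y} \<in> T}\<^sup>*" for x y
    using that by (induction rule: rtrancl_induct) (auto intro: rtrancl_trans step)
  have VA: "?A \<in> Leaf ` {1..m} \<union> Inner ` {3..m}" using a by auto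
  have conn_A: "(?A, x) \<in> {(x, y). {x, y} \<in> T'}\<^sup>*" "(x, ?A) \<in> {(x, y). {x, y} \<in> T'}\<^sup>*"
    if x: "x \<in> Leaf ` {1..Suc m} \<union> Inner ` {3..Suc m}" for x
  proof -
    have e: "(?A, ?I) \<in> {(x, y). {x, y} \<in> T'}" "(?I, ?A) \<in> {(x, y). {x, y} \<in> T'}"
      "(?I, ?L) \<in> {(x, y). {x, y} \<in> T'}" "(?L, ?I) \<in> {(x, y). {x, y} \<in> T'}"
      by (auto simp: T'_def insert_commute)
    have "x = ?I \<or> x = ?L \<or> x \<in> Leaf ` {1..m} \<union> Inner ` {3..m}" using x by (auto simp: le_Suc_eq)
    then have "(?A, x) \<in> {(x, y). {x, y} \<in> T'}\<^sup>* \<and> (x, ?A) \<in> {(x, y). {x, y} \<in> T'}\<^sup>*"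
    proof (elim disjE)
      assume "x = ?I"
      then show ?thesis using r_into_rtrancl[OF e(1)] r_into_rtrancl[OF e(2)] by simp
    next
      assume "x = ?L" 
      then show ?thesis using rtrancl_trans[OF r_into_rtrancl[OF e(1)] r_into_rtrancl[OF e(3)]]
          rtrancl_trans[OF r_into_rtrancl[OF e(4)] r_into_rtrancl[OF e(2)]] by simp
    next
      assume "x \<in> Leaf ` {1..m} \<union> Inner ` {3..m}"
      then show ?thesis using conn_old[OF conn[OF VA, of x]] conn_old[OF conn[OF _ VA, of x]] by simp
    qed
    then show "(?A, x) \<in> {(x, y). {x, y} \<in> T'}\<^sup>*" "(x, ?A) \<in> {(x, y). {x, y} \<in> T'}\<^sup>*" by auto
  qed
  have conn': "(x, y) \<in> {(x, y). {x, y} \<in> T'}\<^sup>*"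
    if "x \<in> Leaf ` {1..Suc m} \<union> Inner ` {3..Suc m}" "y \<in> Leaf ` {1..Suc m} \<union> Inner ` {3..Suc m}" for x y
    using conn_A(2)[OF that(1)] conn_A(1)[OF that(2)] by (rule rtrancl_trans)
  have vert': "\<Union>T' \<subseteq> Leaf ` {1..Suc m} \<union> Inner ` {3..Suc m}"
  proof -
    have grow: "Leaf ` {1..m} \<union> Inner ` {3..m} \<subseteq> Leaf ` {1..Suc m} \<union> Inner ` {3..Suc m}" by auto
    have new_vert: "?I \<in> Leaf ` {1..Suc m} \<union> Inner ` {3..Suc m}" "?L \<in> Leaf ` {1..Suc m} \<union> Inner ` {3..Suc m}"
      using m by simp_all
    show ?thesis
    proof
      fix x assume "x \<in> \<Union>T'"
      then obtain e where e: "e \<in> T'" "x \<in> e" by (rule UnionE)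
      then consider "e \<in> T" | "x \<in> {q, ?A}" | "x = ?I" | "x = ?L" unfolding T'_def by blast
      then show "x \<in> Leaf ` {1..Suc m} \<union> Inner ` {3..Suc m}"
      proof cases
        case 1 then show ?thesis by (rule subsetD[OF grow vert[OF _ e(2)]])
      next
        case 2 show ?thesis by (rule subsetD[OF grow vert[OF q(1) 2]])
      next
        case 3 show ?thesis unfolding 3 by (rule new_vert)
      next
        case 4 show ?thesis unfolding 4 by (rule new_vert)
      qed
    qed
  qed
  have two': "\<exists>x y. x \<noteq> y \<and> e = {x, y}" if "e \<in> T'" for e
  proof -
    consider "e \<in> T" | "e = {q, ?I}" | "e = {?I, ?A}" | "e = {?I, ?L}"
      using \<open>e \<in> T'\<close> unfolding T'_def by blast
    then show ?thesis
    proof cases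
      case 1 then show ?thesis by (rule two)
    next
      case 2 then show ?thesis using ne(1) by blast
    next
      case 3 then show ?thesis by (intro exI[of _ ?I] exI[of _ ?A]) simp
    next
      case 4 then show ?thesis by (intro exI[of _ ?I] exI[of _ ?L]) simp
    qed
  qed
  have inn': "\<exists>p. Inner p \<in> e" if "e \<in> T'" for e
  proof -
    have "e \<in> T \<or> ?I \<in> e" using that unfolding T'_def by blast
    then show ?thesis using inn by blast
  qed
  have grown: "grown_tree (Suc m) T' s'"
  proof (unfold grown_tree_def, intro conjI ballI)
    show "finite T'" using fin by (simp add: T'_def)
  qed (fact cut' inn' two' vert' leaf' inner' conn')+
  have internal: "{e \<in> T'. (\<forall>k. Leaf k \<notin> e) \<and> P e} = {e \<in> T. (\<forall>k. Leaf k \<notin> e) \<and> P e} \<union> (if P {q, ?I} then {{q, ?I}} else {})"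
    for P
    using qi by (auto simp: T'_def)
  have dist_old: "tree_dist T' s' x y = tree_dist T s x y + (if x = a \<or> y = a then 1 else 0)"
    if x: "x \<in> {1..m}" and y: "y \<in> {1..m}" and xy: "x \<noteq> y" for x y
  proof -
    have P: "s' {q, ?I} (Leaf x) \<noteq> s' {q, ?I} (Leaf y) \<longleftrightarrow> x = a \<or> y = a"
      using x y xy by (auto simp: s'1)
    have "{e \<in> T. (\<forall>k. Leaf k \<notin> e) \<and> s' e (Leaf x) \<noteq> s' e (Leaf y)}
        = {e \<in> T. (\<forall>k. Leaf k \<notin> e) \<and> s e (Leaf x) \<noteq> s e (Leaf y)}"
    proof -
      have "s' e (Leaf x) = s e (Leaf x)" "s' e (Leaf y) = s e (Leaf y)" if "e \<in> T" for e
        using s'2[OF that, of "Leaf x"] s'2[OF that, of "Leaf y"] x y by simp_all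
      then show ?thesis by blast
    qed
    moreover have "{q, ?I} \<notin> T" using new(1)[of "{q, ?I}"] by blast
    ultimately show ?thesis
      unfolding tree_dist_def internal[of "\<lambda>e. s' e (Leaf x) \<noteq> s' e (Leaf y)"] P using fin by simp
  qed
  have dist_new: "tree_dist T' s' x (Suc m) = tree_dist T' s' x a" if x: "x \<in> {1..m}" for x
  proof -
    have "s' e ?L = s' e ?A" if "e \<in> T'" "\<forall>k. Leaf k \<notin> e" for e
    proof -
      have "e = {q, ?I} \<or> e \<in> T" using that by (auto simp: T'_def)
      then show ?thesis
      proof
        assume "e = {q, ?I}"
        then show ?thesis by (simp add: s'1(1))
      next
        assume "e \<in> T"
        then show ?thesis using s'2[of e ?L] s'2[of e ?A] ne by simp
      qed
    qed
    then have "{e \<in> T'. (\<forall>k. Leaf k \<notin> e) \<and> s' e (Leaf x) \<noteq> s' e ?L} = {e \<in> T'. (\<forall>k. Leaf k \<notin> e) \<and> s' e (Leaf x) \<noteq> s' e ?A}"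
      by auto
    then show ?thesis by (simp add: tree_dist_def)
  qed
  show ?thesis unfolding T' using grown dist_old dist_new by blast
qed

context iterated
begin

lemma sequence_tree_Suc: "3 \<le> m \<Longrightarrow> sequence_tree (Suc m) i = attach_leaf (i (Suc m)) (Suc m) (sequence_tree m i)"
  by (simp add: sequence_tree_def)

text \<open>
  Attaching a leaf at \<open>a\<close> adds to \<open>d x y\<close> the number of ends at \<open>a\<close>, which changes all sums of a
  level condition equally. For the new stage the condition is the triangle inequality plus one.
\<close>

lemma sequence_tree_level:
  assumes "3 \<le> m" "m \<le> n"
  shows "\<exists>s. grown_tree m (sequence_tree m i) s \<and>
    (\<forall>l\<in>{4..m}. \<forall>k\<in>{1..<l} - {i l}. \<forall>c\<in>{1..<l} - {i l}. k \<noteq> c \<longrightarrow>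
      (let d = tree_dist (sequence_tree m i) s in
        d k l + d (i l) c = d c l + d (i l) k \<and> d (i l) l + d k c < d k l + d (i l) c))"
  using assms
proof (induction m rule: dec_induct)
  case base
  then show ?case using grown_tree_base by (simp add: sequence_tree_def)
next
  case (step m)
  define a where "a = i (Suc m)"
  have a: "a \<in> {1..m}" using i_range[of "Suc m"] step by (auto simp: a_def)
  obtain s where s: "grown_tree m (sequence_tree m i) s"
    "\<And>l k c. l \<in> {4..m} \<Longrightarrow> k \<in> {1..<l} - {i l} \<Longrightarrow> c \<in> {1..<l} - {i l} \<Longrightarrow> k \<noteq> c \<Longrightarrow>
      (let d = tree_dist (sequence_tree m i) s in
        d k l + d (i l) c = d c l + d (i l) k \<and> d (i l) l + d k c < d k l + d (i l) c)"
    using step.IH step.prems by auto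
  define d where "d = tree_dist (sequence_tree m i) s"
  define T' where "T' = sequence_tree (Suc m) i"
  have T': "T' = attach_leaf a (Suc m) (sequence_tree m i)" using sequence_tree_Suc step by (simp add: T'_def a_def)
  obtain s' where s': "grown_tree (Suc m) T' s'"
    "\<And>x y. x \<in> {1..m} \<Longrightarrow> y \<in> {1..m} \<Longrightarrow> x \<noteq> y \<Longrightarrow> tree_dist T' s' x y = d x y + (if x = a \<or> y = a then 1 else 0)"
    "\<And>x. x \<in> {1..m} \<Longrightarrow> tree_dist T' s' x (Suc m) = tree_dist T' s' x a"
    using grown_tree_attach[OF s(1) a step(1)] unfolding T' d_def by metis
  define d' where "d' = tree_dist T' s'"
  define b where "b x = (if x = a then 1 else 0 :: nat)" for x
  have d': "d' x y = d x y + b x + b y" if "x \<in> {1..m}" "y \<in> {1..m}" "x \<noteq> y" for x y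
    using s'(2)[OF that] that by (auto simp: d'_def b_def)
  have "d' k l + d' (i l) c = d' c l + d' (i l) k \<and> d' (i l) l + d' k c < d' k l + d' (i l) c"
    if l: "l \<in> {4..Suc m}" and k: "k \<in> {1..<l} - {i l}" and c: "c \<in> {1..<l} - {i l}" and kc: "k \<noteq> c" for l k c
  proof (cases "l = Suc m")
    case False
    then have lm: "l \<in> {4..m}" using l by auto
    have il: "i l \<in> {1..<l}" using i_range[of l] lm step by auto
    have "d k l + d (i l) c = d c l + d (i l) k" "d (i l) l + d k c < d k l + d (i l) c"
      using s(2)[OF lm k c kc] by (simp_all add: Let_def d_def)
    moreover have "d' k l = d k l + b k + b l" "d' (i l) c = d (i l) c + b (i l) + b c"
      "d' c l = d c l + b c + b l" "d' (i l) k = d (i l) k + b (i l) + b k"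
      "d' (i l) l = d (i l) l + b (i l) + b l" "d' k c = d k c + b k + b c"
      using d' lm k c kc il by auto
    ultimately show ?thesis by simp
  next
    case True
    have kc': "k \<in> {1..m}" "c \<in> {1..m}" "k \<noteq> a" "c \<noteq> a" using k c True by (auto simp: a_def)
    have "d' k l = d k a + 1" "d' c l = d c a + 1" "d' a c = d a c + 1" "d' a k = d a k + 1" "d' k c = d k c"
      using s'(3) d' kc' kc a True by (auto simp: d'_def[symmetric] b_def)
    moreover have "d' a l = 0"
      using s'(3)[OF a] True by (simp add: d'_def tree_dist_def)
    moreover have "d a k = d k a" "d a c = d c a" by (simp_all add: d_def tree_dist_sym)
    moreover have "d k c \<le> d k a + d a c"
      unfolding d_def by (rule tree_dist_triangle[OF grown_treeD(1)[OF s(1)]])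
    ultimately show ?thesis using True by (simp add: a_def[symmetric])
  qed
  then show ?case using s'(1) unfolding d'_def T'_def Let_def by blast
qed

end

context labeled
begin

definition transported_weight :: "(nat \<Rightarrow> nat \<Rightarrow> real) \<Rightarrow> weight"
  where "transported_weight d = (\<Sum>(a, b)\<in>pairs n. single (a, b) (d (\<rho> a) (\<rho> b)))"

lemma lookup_sum_pairs:
  "lookup (\<Sum>(a, b)\<in>pairs n. single (a, b) (f a b :: real)) (x, y) = (if (x, y) \<in> pairs n then f x y else 0)"
proof -
  have fin: "finite (pairs n)" by (rule finite_subset[of _ "{1..n} \<times> {1..n}"]) (auto simp: pairs_def)
  have "lookup (\<Sum>(a, b)\<in>pairs n. single (a, b) (f a b)) (x, y)
      = (\<Sum>p\<in>pairs n. if p = (x, y) then f x y else 0)"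
    unfolding lookup_sum by (rule sum.cong) (auto simp: lookup_single when_def split: if_splits)
  then show ?thesis using fin by simp
qed

lemma transported_weight_open_cone:
  assumes "level (<) d" and sym: "\<And>k l. d k l = d l k"
  shows "transported_weight d \<in> open_cone"
proof -
  have "keys (transported_weight d) \<subseteq> pairs n"
    unfolding transported_weight_def by (auto simp: in_keys_iff lookup_sum_pairs split: if_splits)
  moreover have pw: "pos_wt (transported_weight d) k l = d k l" if "k \<in> {1..n}" "l \<in> {1..n}" "k \<noteq> l" for k l
  proof -
    have "\<sigma> k \<in> {1..n}" "\<sigma> l \<in> {1..n}" "\<sigma> k \<noteq> \<sigma> l" "\<rho> (\<sigma> k) = k" "\<rho> (\<sigma> l) = l"
      using \<sigma>[of k] \<sigma>[of l] \<sigma>_inj[of k l] that by simp_all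
    then show ?thesis
      unfolding pos_wt_def wt_def transported_weight_def lookup_sum_pairs using sym[of k l]
      by (auto simp: pairs_def min_def max_def)
  qed
  have "level (<) (pos_wt (transported_weight d))"
    unfolding level_def
  proof (intro ballI impI)
    fix l k c assume *: "l \<in> {4..n}" "k \<in> {1..<l} - {i l}" "c \<in> {1..<l} - {i l}" "k \<noteq> c"
    then have "i l \<in> {1..<l}" using i_range[of l] by auto
    then have "pos_wt (transported_weight d) k l = d k l" "pos_wt (transported_weight d) (i l) c = d (i l) c"
      "pos_wt (transported_weight d) c l = d c l" "pos_wt (transported_weight d) (i l) k = d (i l) k"
      "pos_wt (transported_weight d) (i l) l = d (i l) l" "pos_wt (transported_weight d) k c = d k c"
      using pw * by auto
    then show "pos_wt (transported_weight d) k l + pos_wt (transported_weight d) (i l) c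
        = pos_wt (transported_weight d) c l + pos_wt (transported_weight d) (i l) k \<and>
        pos_wt (transported_weight d) k l + pos_wt (transported_weight d) (i l) c
        < pos_wt (transported_weight d) (i l) l + pos_wt (transported_weight d) k c"
      using levelD[OF assms(1), of l k c] * by auto
  qed
  ultimately show ?thesis by (simp add: open_cone_def weights_def)
qed

lemma tree_level:
  obtains s where "grown_tree n (sequence_tree n i) s"
    "level (<) (\<lambda>k l. - real (tree_dist (sequence_tree n i) s k l))"
proof -
  obtain s where s: "grown_tree n (sequence_tree n i) s"
    "\<forall>l\<in>{4..n}. \<forall>k\<in>{1..<l} - {i l}. \<forall>c\<in>{1..<l} - {i l}. k \<noteq> c \<longrightarrow>
      (let d = tree_dist (sequence_tree n i) s in
        d k l + d (i l) c = d c l + d (i l) k \<and> d (i l) l + d k c < d k l + d (i l) c)"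
    using sequence_tree_level[OF n order_refl] by blast
  have "level (<) (\<lambda>k l. - real (tree_dist (sequence_tree n i) s k l))"
    unfolding level_def
  proof (intro ballI impI)
    fix l k c assume "l \<in> {4..n}" "k \<in> {1..<l} - {i l}" "c \<in> {1..<l} - {i l}" "k \<noteq> c"
    then have "let d = tree_dist (sequence_tree n i) s in
        d k l + d (i l) c = d c l + d (i l) k \<and> d (i l) l + d k c < d k l + d (i l) c"
      using s(2) by blast
    then show "- real (tree_dist (sequence_tree n i) s k l) + - real (tree_dist (sequence_tree n i) s (i l) c)
        = - real (tree_dist (sequence_tree n i) s c l) + - real (tree_dist (sequence_tree n i) s (i l) k) \<and>
        - real (tree_dist (sequence_tree n i) s k l) + - real (tree_dist (sequence_tree n i) s (i l) c)
        < - real (tree_dist (sequence_tree n i) s (i l) l) + - real (tree_dist (sequence_tree n i) s k c)"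
      unfolding Let_def by linarith
  qed
  then show thesis using that s(1) by blast
qed

lemma open_cone_nonempty: "open_cone \<noteq> {}"
proof -
  obtain s where "level (<) (\<lambda>k l. - real (tree_dist (sequence_tree n i) s k l))" by (rule tree_level)
  from transported_weight_open_cone[OF this] show ?thesis by (auto simp: tree_dist_sym)
qed

end

lemma (in iterated) tree_weight_open_cone: "tree_weight n (sequence_tree n i) \<in> labeled.open_cone n i (\<lambda>x. x)"
proof -
  interpret L: labeled n i j "\<lambda>x. x" "\<lambda>x. x" by unfold_locales auto
  obtain s where s: "grown_tree n (sequence_tree n i) s"
    "level (<) (\<lambda>k l. - real (tree_dist (sequence_tree n i) s k l))"
    by (rule L.tree_level)
  have "tree_weight n (sequence_tree n i) = L.transported_weight (\<lambda>k l. - real (tree_dist (sequence_tree n i) s k l))"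
    unfolding tree_weight_def L.transported_weight_def
    by (rule sum.cong[OF refl]) (auto simp: pairs_def tree_dist_card[OF s(1)])
  then show ?thesis
    using L.transported_weight_open_cone[OF s(2)] by (simp add: tree_dist_sym)
qed

section \<open>Classification of the maximal cones\<close>

text \<open>
  A weight that satisfies the four point condition has a cherry: with respect to a root \<open>r\<close>, take
  the pair with the largest Gromov product.
\<close>

lemma cherry_exists:
  fixes F :: "nat \<Rightarrow> nat \<Rightarrow> real"
  assumes V: "finite V" "4 \<le> card V" and sym: "\<And>x y. F x y = F y x"
    and four: "\<And>a b c d. {a, b, c, d} \<subseteq> V \<Longrightarrow> distinct [a, b, c, d] \<Longrightarrow>
      \<not> (F a b + F c d < F a c + F b d \<and> F a b + F c d < F a d + F b c)"
  shows "\<exists>a\<in>V. \<exists>b\<in>V. a \<noteq> b \<and> (\<forall>k\<in>V - {a, b}. \<forall>c\<in>V - {a, b}. k \<noteq> c \<longrightarrow>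
    F k b + F a c = F c b + F a k \<and> F k b + F a c \<le> F a b + F k c)"
proof -
  obtain r where r: "r \<in> V" using V by force
  define g where "g x y = F x y - F x r - F y r" for x y
  define P where "P = {(x, y). x \<in> V - {r} \<and> y \<in> V - {r} \<and> x \<noteq> y}"
  have finP: "finite P" by (rule finite_subset[of _ "V \<times> V"]) (use V in \<open>auto simp: P_def\<close>)
  have "card (V - {r}) = card V - 1" using V r by simp
  then have "\<not> card (V - {r}) \<le> Suc 0" using V by simp
  then have "\<exists>x\<in>V - {r}. \<exists>y\<in>V - {r}. x \<noteq> y" using card_le_Suc0_iff_eq[of "V - {r}"] V by auto
  then have "P \<noteq> {}" by (auto simp: P_def)
  then have M: "Max ((\<lambda>(x, y). g x y) ` P) \<in> (\<lambda>(x, y). g x y) ` P" using finP by (intro Max_in) auto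
  obtain a b where "(a, b) \<in> P" and ab: "Max ((\<lambda>(x, y). g x y) ` P) = g a b" using M by auto
  then have ab': "a \<in> V" "b \<in> V" "a \<noteq> r" "b \<noteq> r" "a \<noteq> b" by (auto simp: P_def)
  have max: "g x y \<le> g a b" if "x \<in> V - {r}" "y \<in> V - {r}" "x \<noteq> y" for x y
  proof -
    have "g x y \<in> (\<lambda>(x, y). g x y) ` P" using that by (force simp: P_def)
    then show ?thesis using finP ab by (metis Max_ge finite_imageI)
  qed
  have gs: "g x y = g y x" for x y using sym[of x y] by (simp add: g_def)
  have three: "\<not> (g x y < g x z \<and> g x y < g y z)"
    if "x \<in> V - {r}" "y \<in> V - {r}" "z \<in> V - {r}" "x \<noteq> y" "x \<noteq> z" "y \<noteq> z" for x y z
  proof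
    assume *: "g x y < g x z \<and> g x y < g y z"
    have "{x, y, z, r} \<subseteq> V" "distinct [x, y, z, r]" using that r by auto
    from four[OF this] show False
      using *[THEN conjunct1] *[THEN conjunct2] unfolding g_def by linarith
  qed
  have eq: "g a c = g b c" if c: "c \<in> V - {a, b, r}" for c
    using three[of a c b] three[of b c a] max[of a c] max[of b c] ab' c gs[of c b] gs[of c a] gs[of b a] by fastforce
  show ?thesis
  proof (rule bexI[OF _ ab'(1)], rule bexI[OF _ ab'(2)], intro conjI[OF ab'(5)] ballI impI)
    fix k c assume kc: "k \<in> V - {a, b}" "c \<in> V - {a, b}" "k \<noteq> c"
    have root: "F x b + F a r = F r b + F a x \<and> F x b + F a r \<le> F a b + F x r" if "x \<in> V - {a, b, r}" for x
      using eq[OF that] max[of b x] that ab' sym[of x b] sym[of r b] by (auto simp: g_def)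
    consider "k = r" | "c = r" | "k \<noteq> r" "c \<noteq> r" by blast
    then show "F k b + F a c = F c b + F a k \<and> F k b + F a c \<le> F a b + F k c"
    proof cases
      case 1
      then show ?thesis using root[of c] kc sym[of r c] by auto
    next
      case 2
      then show ?thesis using root[of k] kc by auto
    next
      case 3
      then have e: "g a c = g b c" "g a k = g b k" using eq kc by auto
      have "g b k + g a c \<le> g a b + g k c"
      proof -
        have "\<not> (g k c < g k a \<and> g k c < g c a)" by (rule three) (use kc 3 ab' in auto)
        then consider "g k a \<le> g k c" | "g c a \<le> g k c" by linarith
        moreover have "g a c \<le> g a b" "g a k \<le> g a b" by (rule max, use kc 3 ab' in auto)+
        ultimately show ?thesis using e gs[of k a] gs[of c a] by cases linarith+
      qed
      moreover have "g k b + g a c = g c b + g a k" using e gs[of k b] gs[of c b] by simp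
      ultimately show ?thesis using gs[of b k] by (simp add: g_def)
    qed
  qed
qed

text \<open>
  Removing one leaf of a cherry leaves a set that satisfies the four point condition again; the removed
  leaf gets the last position and its partner is the leaf to which it is attached.
\<close>

lemma four_point_order:
  fixes F :: "nat \<Rightarrow> nat \<Rightarrow> real"
  assumes sym: "\<And>x y. F x y = F y x" and V: "finite V" "card V = m" "3 \<le> m"
    and four: "\<And>a b c d. {a, b, c, d} \<subseteq> V \<Longrightarrow> distinct [a, b, c, d] \<Longrightarrow>
      \<not> (F a b + F c d < F a c + F b d \<and> F a b + F c d < F a d + F b c)"
  shows "\<exists>\<sigma> i. bij_betw \<sigma> {1..m} V \<and> (\<forall>l\<in>{3..m}. i l \<in> {1..l - 1}) \<and>
    (\<forall>l\<in>{4..m}. \<forall>k\<in>{1..<l} - {i l}. \<forall>c\<in>{1..<l} - {i l}. k \<noteq> c \<longrightarrow>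
      F (\<sigma> k) (\<sigma> l) + F (\<sigma> (i l)) (\<sigma> c) = F (\<sigma> c) (\<sigma> l) + F (\<sigma> (i l)) (\<sigma> k) \<and>
      F (\<sigma> k) (\<sigma> l) + F (\<sigma> (i l)) (\<sigma> c) \<le> F (\<sigma> (i l)) (\<sigma> l) + F (\<sigma> k) (\<sigma> c))"
  using V(3,1,2) four
proof (induction m arbitrary: V rule: dec_induct)
  case base
  obtain \<sigma> where "bij_betw \<sigma> {1..3 :: nat} V"
    using finite_same_card_bij[of "{1..3 :: nat}" V] base by auto
  then show ?case by (intro exI[of _ \<sigma>] exI[of _ "\<lambda>_. 1"]) auto
next
  case (step m)
  have four_le: "4 \<le> card V" using step.prems(2) step.hyps by simp
  obtain a b where ab: "a \<in> V" "b \<in> V" "a \<noteq> b"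
    and cherry: "\<forall>k\<in>V - {a, b}. \<forall>c\<in>V - {a, b}. k \<noteq> c \<longrightarrow>
      F k b + F a c = F c b + F a k \<and> F k b + F a c \<le> F a b + F k c"
    using cherry_exists[of V F, OF step.prems(1) four_le sym step.prems(3)] by blast
  have "finite (V - {b})" "card (V - {b}) = m" using step.prems ab by auto
  moreover have "\<not> (F x y + F z t < F x z + F y t \<and> F x y + F z t < F x t + F y z)"
    if "{x, y, z, t} \<subseteq> V - {b}" "distinct [x, y, z, t]" for x y z t
    using step.prems(3)[of x y z t] that by auto
  ultimately obtain \<sigma> i where \<sigma>: "bij_betw \<sigma> {1..m} (V - {b})" and i: "\<And>l. l \<in> {3..m} \<Longrightarrow> i l \<in> {1..l - 1}"
    and lev: "\<And>l k c. l \<in> {4..m} \<Longrightarrow> k \<in> {1..<l} - {i l} \<Longrightarrow> c \<in> {1..<l} - {i l} \<Longrightarrow> k \<noteq> c \<Longrightarrow>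
      F (\<sigma> k) (\<sigma> l) + F (\<sigma> (i l)) (\<sigma> c) = F (\<sigma> c) (\<sigma> l) + F (\<sigma> (i l)) (\<sigma> k) \<and>
      F (\<sigma> k) (\<sigma> l) + F (\<sigma> (i l)) (\<sigma> c) \<le> F (\<sigma> (i l)) (\<sigma> l) + F (\<sigma> k) (\<sigma> c)"
    using step.IH[of "V - {b}"] by metis
  have "a \<in> \<sigma> ` {1..m}" using \<sigma> ab by (simp add: bij_betw_def)
  then obtain p where p: "p \<in> {1..m}" "\<sigma> p = a" by blast
  define \<sigma>' where "\<sigma>' = \<sigma>(Suc m := b)"
  define i' where "i' = i(Suc m := p)"
  have old: "\<sigma>' k = \<sigma> k" if "k \<le> m" for k using that by (simp add: \<sigma>'_def)
  have new: "\<sigma>' (Suc m) = b" by (simp add: \<sigma>'_def)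
  have img: "\<sigma> k \<in> V - {b}" if "k \<in> {1..m}" for k by (rule bij_betw_apply[OF \<sigma> that])
  have inj: "\<sigma> k = \<sigma> c \<longleftrightarrow> k = c" if "k \<in> {1..m}" "c \<in> {1..m}" for k c
    by (rule inj_on_eq_iff[OF bij_betw_imp_inj_on[OF \<sigma>] that])
  have "bij_betw \<sigma>' {1..Suc m} V"
  proof -
    have old_bij: "bij_betw \<sigma>' {1..m} (V - {b})" using \<sigma> by (rule bij_betw_cong[THEN iffD1, rotated]) (simp add: old)
    have fresh: "Suc m \<notin> {1..m}" "\<sigma>' (Suc m) \<notin> V - {b}" by (simp_all add: new)
    have "bij_betw \<sigma>' ({1..m} \<union> {Suc m}) ((V - {b}) \<union> {\<sigma>' (Suc m)})"
      by (rule notIn_Un_bij_betw[OF fresh old_bij])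
    moreover have "{1..m} \<union> {Suc m} = {1..Suc m}" by auto
    moreover have "(V - {b}) \<union> {\<sigma>' (Suc m)} = V" using ab new by auto
    ultimately show ?thesis by simp
  qed
  moreover have "\<forall>l\<in>{3..Suc m}. i' l \<in> {1..l - 1}"
    using i p by (auto simp: i'_def)
  moreover have "F (\<sigma>' k) (\<sigma>' l) + F (\<sigma>' (i' l)) (\<sigma>' c) = F (\<sigma>' c) (\<sigma>' l) + F (\<sigma>' (i' l)) (\<sigma>' k) \<and>
      F (\<sigma>' k) (\<sigma>' l) + F (\<sigma>' (i' l)) (\<sigma>' c) \<le> F (\<sigma>' (i' l)) (\<sigma>' l) + F (\<sigma>' k) (\<sigma>' c)"
    if l: "l \<in> {4..Suc m}" and k: "k \<in> {1..<l} - {i' l}" and c: "c \<in> {1..<l} - {i' l}" and kc: "k \<noteq> c" for l k c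
  proof (cases "l = Suc m")
    case True
    have km: "k \<in> {1..m}" "c \<in> {1..m}" "k \<noteq> p" "c \<noteq> p" using k c True by (auto simp: i'_def)
    then have "\<sigma> k \<in> V - {a, b}" "\<sigma> c \<in> V - {a, b}" "\<sigma> k \<noteq> \<sigma> c"
      using img[of k] img[of c] inj[of k p] inj[of c p] inj[of k c] p kc by auto
    from cherry[rule_format, OF this] show ?thesis
      using km p True by (simp add: old new i'_def)
  next
    case False
    then have lm: "l \<in> {4..m}" using l by auto
    have il: "i' l = i l" using False by (simp add: i'_def)
    have "i l \<in> {1..l - 1}" using i lm by auto
    then have "\<sigma>' l = \<sigma> l" "\<sigma>' (i l) = \<sigma> (i l)" "\<sigma>' k = \<sigma> k" "\<sigma>' c = \<sigma> c"
      using lm k c by (auto intro!: old)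
    then show ?thesis using lev[OF lm, of k c] k c kc by (simp add: il)
  qed
  ultimately show ?case by blast
qed

text \<open>
  The choice of \<open>j\<close> does not affect the cone; any position other than \<open>i\<^sub>l\<close> will do.
\<close>

lemma trop_labeled:
  assumes n: "3 \<le> n" and w: "w \<in> trop_gr n"
  shows "\<exists>i j \<sigma> \<rho>. labeled n i j \<sigma> \<rho> \<and> w \<in> labeled.closed_cone n i \<sigma>"
proof -
  have four: "\<not> (wt w a b + wt w c d < wt w a c + wt w b d \<and> wt w a b + wt w c d < wt w a d + wt w b c)"
    if "{a, b, c, d} \<subseteq> {1..n}" "distinct [a, b, c, d]" for a b c d
    using trop_four_point[OF w that(2,1)] .
  have card_range: "card {1..n} = n" by simp
  obtain \<sigma> i where \<sigma>: "bij_betw \<sigma> {1..n} {1..n}" and i: "\<forall>l\<in>{3..n}. i l \<in> {1..l - 1}"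
    and lev: "\<forall>l\<in>{4..n}. \<forall>k\<in>{1..<l} - {i l}. \<forall>c\<in>{1..<l} - {i l}. k \<noteq> c \<longrightarrow>
      wt w (\<sigma> k) (\<sigma> l) + wt w (\<sigma> (i l)) (\<sigma> c) = wt w (\<sigma> c) (\<sigma> l) + wt w (\<sigma> (i l)) (\<sigma> k) \<and>
      wt w (\<sigma> k) (\<sigma> l) + wt w (\<sigma> (i l)) (\<sigma> c) \<le> wt w (\<sigma> (i l)) (\<sigma> l) + wt w (\<sigma> k) (\<sigma> c)"
    using four_point_order[of "wt w" "{1..n}" n, OF wt_sym finite_atLeastAtMost card_range n four] by blast
  define j where "j l = (if i l = 1 then 2 else 1 :: nat)" for l
  define \<rho> where "\<rho> = inv_into {1..n} \<sigma>"
  have ind: "iterated_indices n i j"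
    unfolding iterated_indices_def
  proof
    fix l assume l: "l \<in> {3..n}"
    then show "i l \<in> {1..l - 1} \<and> j l \<in> {1..l - 1} \<and> i l \<noteq> j l" using bspec[OF i l] by (auto simp: j_def)
  qed
  interpret labeled n i j \<sigma> \<rho>
  proof
    show "\<sigma> k \<in> {1..n} \<and> \<rho> (\<sigma> k) = k" if "k \<in> {1..n}" for k
      using \<sigma> that unfolding \<rho>_def by (metis bij_betw_apply bij_betw_inv_into_left)
    show "\<rho> a \<in> {1..n} \<and> \<sigma> (\<rho> a) = a" if "a \<in> {1..n}" for a
      using bij_betw_apply[OF bij_betw_inv_into[OF \<sigma>] that] bij_betw_inv_into_right[OF \<sigma> that]
      by (simp add: \<rho>_def)
  qed (rule n, rule ind)
  have "w \<in> closed_cone"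
    using w lev unfolding closed_cone_def level_def pos_wt_def by (simp add: trop_gr_def)
  then show ?thesis using labeled_axioms by blast
qed

lemma trop_cone_in_closed_cone:
  assumes "3 \<le> n" "D \<in> trop_cones n"
  shows "\<exists>i j \<sigma> \<rho>. labeled n i j \<sigma> \<rho> \<and> D \<subseteq> labeled.closed_cone n i \<sigma>"
proof -
  obtain w where w: "w \<in> trop_gr n" "D = closure {v \<in> weights n. initial_ideal n v = initial_ideal n w}"
    using assms(2) by (auto simp: trop_cones_def)
  obtain i j \<sigma> \<rho> where L: "labeled n i j \<sigma> \<rho>" "w \<in> labeled.closed_cone n i \<sigma>"
    using trop_labeled[OF assms(1) w(1)] by blast
  then have "D \<subseteq> labeled.closed_cone n i \<sigma>" using labeled.trop_cone_subset[OF L(1) w(1) L(2) w(2)] by blast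
  then show ?thesis using L(1) by blast
qed

lemma maximal_cone_labeled:
  assumes n: "3 \<le> n" and C: "C \<in> maximal_cones n"
  shows "\<exists>i j \<sigma> \<rho>. labeled n i j \<sigma> \<rho> \<and> C = labeled.closed_cone n i \<sigma>"
proof -
  have "C \<in> trop_cones n" using C by (simp add: maximal_cones_def)
  then obtain i j \<sigma> \<rho> where L: "labeled n i j \<sigma> \<rho>" "C \<subseteq> labeled.closed_cone n i \<sigma>"
    using trop_cone_in_closed_cone[OF n] by blast
  interpret labeled n i j \<sigma> \<rho> by (rule L(1))
  have "C = closed_cone" using C L(2) closed_cone_trop_cone[OF open_cone_nonempty] by (simp add: maximal_cones_def)
  then show ?thesis using L(1) by blast
qed

lemma (in labeled) closed_cone_maximal: "closed_cone \<in> maximal_cones n"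
proof -
  have "closed_cone = D" if D: "D \<in> trop_cones n" "closed_cone \<subseteq> D" for D
  proof -
    obtain i' j' \<sigma>' \<rho>' where L: "labeled n i' j' \<sigma>' \<rho>'" "D \<subseteq> labeled.closed_cone n i' \<sigma>'"
      using trop_cone_in_closed_cone[OF n D(1)] by blast
    obtain v where v: "v \<in> open_cone" using open_cone_nonempty by blast
    then have "v \<in> labeled.closed_cone n i' \<sigma>'" using open_closed D(2) L(2) by blast
    then have "closed_cone = labeled.closed_cone n i' \<sigma>'"
      using closed_cone_eq[OF labeled_axioms L(1) v] by blast
    then show ?thesis using D(2) L(2) by blast
  qed
  then show ?thesis using closed_cone_trop_cone[OF open_cone_nonempty] by (simp add: maximal_cones_def)
qed

lemma (in iterated) sequence_cone_eq: "sequence_cone n i = labeled.closed_cone n i (\<lambda>x. x)"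
proof -
  interpret L: labeled n i j "\<lambda>x. x" "\<lambda>x. x" by unfold_locales auto
  let ?w = "tree_weight n (sequence_tree n i)"
  have w: "?w \<in> L.open_cone" by (rule tree_weight_open_cone)
  show ?thesis
    unfolding sequence_cone_def tree_cone_def
  proof (rule the_equality)
    show "L.closed_cone \<in> maximal_cones n \<and> ?w \<in> rel_interior L.closed_cone"
      using L.closed_cone_maximal w L.rel_interior_closed_cone[OF L.open_cone_nonempty] by simp
    fix C assume C: "C \<in> maximal_cones n \<and> ?w \<in> rel_interior C"
    then obtain i' j' \<sigma>' \<rho>' where L': "labeled n i' j' \<sigma>' \<rho>'" "C = labeled.closed_cone n i' \<sigma>'"
      using maximal_cone_labeled[OF n] by blast
    have "?w \<in> C" using C rel_interior_subset by blast
    then show "C = L.closed_cone" using closed_cone_eq[OF L.labeled_axioms L'(1) w] L'(2) by blast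
  qed
qed

section \<open>The quotient by the toric ideal\<close>

lemma (in iterated) labeled_identity: "labeled n i j (\<lambda>x. x) (\<lambda>x. x)"
  by unfold_locales auto

context labeled
begin

lemma ker_phi_ideal: "ideal ker_phi (plucker_ring n)"
  unfolding ker_phi_def phi_def by (rule poly_ideal_kernel[OF coeff_hom_single])

lemma phi_image: "phi ` carrier (plucker_ring n) = carrier sg_alg"
proof (intro Set.set_eqI iffI)
  fix g assume "g \<in> phi ` carrier (plucker_ring n)"
  then obtain f where f: "f \<in> carrier (plucker_ring n)" "g = phi f" by blast
  have "r \<in> semigroup" if r: "r \<in> keys g" for r
  proof -
    have "{u \<in> keys f. fibre (edges_of u) = r} \<noteq> {}"
    proof
      assume none: "{u \<in> keys f. fibre (edges_of u) = r} = {}"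
      have "lookup g r = 0" using phi_expansion[OF f(1), of r] f(2) unfolding none by simp
      then show False using r by (simp add: in_keys_iff)
    qed
    then obtain u where "u \<in> keys f" "fibre (edges_of u) = r" by blast
    moreover from this have "set_mset (edges_of u) \<subseteq> edges n"
      using f(1) edges_of(1)[of u] by (auto simp: carrier_poly_alg)
    ultimately show ?thesis
      unfolding semigroup_def by (auto simp: fibre_def labeled.fibre_def[OF labeled_identity])
  qed
  then show "g \<in> carrier sg_alg" by (auto simp: sg_alg_def)
next
  fix g assume "g \<in> carrier sg_alg"
  then have g: "keys g \<subseteq> semigroup" by (simp add: sg_alg_def)
  have "\<exists>f\<in>carrier (plucker_ring n). phi f = single r 1" if "r \<in> keys g" for r
  proof -
    have "semigroup = fibre ` {A. set_mset A \<subseteq> edges n}"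
      unfolding semigroup_def
      by (rule image_cong[OF refl]) (simp only: fibre_def labeled.fibre_def[OF labeled_identity])
    moreover have "r \<in> semigroup" using g \<open>r \<in> keys g\<close> by (rule subsetD)
    ultimately have "r \<in> fibre ` {A. set_mset A \<subseteq> edges n}" by (simp only:)
    then obtain A where A: "r = fibre A" "A \<in> {A. set_mset A \<subseteq> edges n}" by (rule imageE)
    have A': "set_mset A \<subseteq> edges n" using A(2) by (rule CollectD)
    show ?thesis
      unfolding A(1) by (rule bexI[of "\<lambda>f. phi f = single (fibre A) 1", OF phi_edge_mono[OF A'] edge_mono_closed[OF A']])
  qed
  then obtain F where F: "\<And>r. r \<in> keys g \<Longrightarrow> F r \<in> carrier (plucker_ring n) \<and> phi (F r) = single r 1" by metis
  have "phi (\<Sum>r\<in>keys g. const_poly (lookup g r) * F r) = (\<Sum>r\<in>keys g. single r (lookup g r))"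
    unfolding phi_hom by (rule sum.cong) (use F in \<open>auto simp: phi_hom mult_single\<close>)
  then have eq: "phi (\<Sum>r\<in>keys g. const_poly (lookup g r) * F r) = g" by (simp add: sum_of_terms)
  have mem: "(\<Sum>r\<in>keys g. const_poly (lookup g r) * F r) \<in> carrier (plucker_ring n)"
    by (intro poly_alg_sum_closed poly_alg_mult_closed poly_alg_const_closed) (use F in blast)
  show "g \<in> phi ` carrier (plucker_ring n)" 
    by (rule subst[OF eq, where P = "\<lambda>x. x \<in> phi ` carrier (plucker_ring n)"]) (rule imageI[OF mem])
qed

text \<open>
  The image of \<open>phi\<close> is the semigroup algebra, whatever the labeling, and the associated graded algebra
  is isomorphic to it by \<open>to_gr_iso\<close>.
\<close>

theorem quotient_gr:
  "\<exists>h\<in>ring_iso (quot_alg (plucker_ring n) ker_phi) (gr_alg n S).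
    \<forall>c. \<forall>x\<in>carrier (quot_alg (plucker_ring n) ker_phi).
      h (c \<odot>\<^bsub>quot_alg (plucker_ring n) ker_phi\<^esub> x) = c \<odot>\<^bsub>gr_alg n S\<^esub> h x"
proof -
  interpret K: poly_ideal "pairs n" ker_phi by (rule poly_ideal.intro[OF ker_phi_ideal])
  let ?Q = "quot_alg (plucker_ring n) ker_phi" and ?P = "plucker_ring n"
  let ?c = "\<lambda>f. ker_phi +>\<^bsub>?P\<^esub> f"
  define h where "h X = the_elem (phi ` X)" for X
  have h: "h (?c f) = phi f" if f: "f \<in> carrier ?P" for f
  proof -
    have "phi g = phi f" if "g \<in> ?c f" for g
    proof -
      have "phi (g - f) = 0" using that K.coset_mem[of g f] by (simp add: ker_phi_def)
      then show ?thesis by (simp add: phi_hom)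
    qed
    then have "phi ` ?c f = {phi f}" using K.coset_self[of f] by blast
    then show ?thesis by (simp add: h_def)
  qed
  have rep: "\<exists>f\<in>carrier ?P. X = ?c f" if "X \<in> carrier ?Q" for X
    using that by (auto simp: K.quot_carrier)
  have iso: "h \<in> ring_iso ?Q sg_alg"
  proof (rule ring_iso_memI)
    fix X assume "X \<in> carrier ?Q"
    then obtain f where f: "f \<in> carrier ?P" "X = ?c f" using rep by blast
    then show "h X \<in> carrier sg_alg" using h phi_image by auto
  next
    fix X Y assume "X \<in> carrier ?Q" "Y \<in> carrier ?Q"
    then obtain f g where f: "f \<in> carrier ?P" "X = ?c f" "g \<in> carrier ?P" "Y = ?c g" using rep by blast
    show "h (X \<otimes>\<^bsub>?Q\<^esub> Y) = h X \<otimes>\<^bsub>sg_alg\<^esub> h Y" "h (X \<oplus>\<^bsub>?Q\<^esub> Y) = h X \<oplus>\<^bsub>sg_alg\<^esub> h Y"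
      using f by (simp_all add: K.quot_mult K.quot_add h poly_alg_closed phi_hom) (simp_all add: sg_alg_def)
  next
    show "h \<one>\<^bsub>?Q\<^esub> = \<one>\<^bsub>sg_alg\<^esub>" unfolding K.quot_one using h[of 1] by (simp add: phi_hom) (simp add: sg_alg_def)
    have "inj_on h (carrier ?Q)"
    proof (rule inj_onI)
      fix X Y assume "X \<in> carrier ?Q" "Y \<in> carrier ?Q" and eq: "h X = h Y"
      then obtain f g where f: "f \<in> carrier ?P" "X = ?c f" "g \<in> carrier ?P" "Y = ?c g" using rep by blast
      then have "f - g \<in> ker_phi" using eq h by (simp add: ker_phi_def phi_hom poly_alg_closed)
      then show "X = Y" using f K.coset_eq_iff by blast
    qed
    moreover have "h ` carrier ?Q = carrier sg_alg"
      unfolding K.quot_carrier image_image phi_image[symmetric] by (rule image_cong) (use h in auto)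
    ultimately show "bij_betw h (carrier ?Q) (carrier sg_alg)" by (simp add: bij_betw_def)
  qed
  have "to_gr \<circ> h \<in> ring_iso ?Q (gr_alg n S)" by (rule ring_iso_set_trans[OF iso to_gr_iso])
  moreover have "(to_gr \<circ> h) (c \<odot>\<^bsub>?Q\<^esub> X) = c \<odot>\<^bsub>gr_alg n S\<^esub> (to_gr \<circ> h) X" if "X \<in> carrier ?Q" for c X
  proof -
    obtain f where f: "f \<in> carrier ?P" "X = ?c f" using rep \<open>X \<in> _\<close> by blast
    have "h (c \<odot>\<^bsub>?Q\<^esub> X) = phi (const_poly c * f)" using f by (simp add: K.quot_smult h poly_alg_closed)
    also have "\<dots> = c \<odot>\<^bsub>sg_alg\<^esub> h X" using f by (simp add: h phi_hom) (simp add: sg_alg_def)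
    finally show ?thesis using to_gr_smult[of "h X" c] f h phi_image by (auto simp: image_iff)
  qed
  ultimately show ?thesis by blast
qed

end

lemma alg_isomorphic_sym:
  assumes "alg_isomorphic A B" "ring A"
    and closed: "\<And>c x. x \<in> carrier A \<Longrightarrow> c \<odot>\<^bsub>A\<^esub> x \<in> carrier A"
  shows "alg_isomorphic B A"
proof -
  obtain h where h: "h \<in> ring_iso A B" "\<And>c x. x \<in> carrier A \<Longrightarrow> h (c \<odot>\<^bsub>A\<^esub> x) = c \<odot>\<^bsub>B\<^esub> h x"
    using assms(1) unfolding alg_isomorphic_def by blast
  have bij: "bij_betw h (carrier A) (carrier B)" using h(1) by (simp add: ring_iso_def)
  let ?g = "inv_into (carrier A) h"
  have "?g (c \<odot>\<^bsub>B\<^esub> y) = c \<odot>\<^bsub>A\<^esub> ?g y" if y: "y \<in> carrier B" for c y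
  proof -
    have gy: "?g y \<in> carrier A" "h (?g y) = y"
      using bij_betw_apply[OF bij_betw_inv_into[OF bij] y] bij_betw_inv_into_right[OF bij y] by auto
    then have "c \<odot>\<^bsub>B\<^esub> y = h (c \<odot>\<^bsub>A\<^esub> ?g y)" using h(2) by simp
    then show ?thesis using bij_betw_inv_into_left[OF bij closed[OF gy(1)]] by simp
  qed
  then show ?thesis unfolding alg_isomorphic_def using ring_iso_set_sym[OF assms(2) h(1)] by blast
qed

lemma (in labeled) quotient_alg_isomorphic:
  shows "alg_isomorphic (quot_alg (plucker_ring n) ker_phi) (gr_alg n S)"
    and "alg_isomorphic (gr_alg n S) (quot_alg (plucker_ring n) ker_phi)"
proof -
  interpret K: poly_ideal "pairs n" ker_phi by (rule poly_ideal.intro[OF ker_phi_ideal])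
  show 1: "alg_isomorphic (quot_alg (plucker_ring n) ker_phi) (gr_alg n S)"
    unfolding alg_isomorphic_def by (rule quotient_gr)
  show "alg_isomorphic (gr_alg n S) (quot_alg (plucker_ring n) ker_phi)"
  proof (rule alg_isomorphic_sym[OF 1 K.ring_quot])
    fix c x assume "x \<in> carrier (quot_alg (plucker_ring n) ker_phi)"
    then show "c \<odot>\<^bsub>quot_alg (plucker_ring n) ker_phi\<^esub> x \<in> carrier (quot_alg (plucker_ring n) ker_phi)"
      by (auto simp: K.quot_carrier K.quot_smult intro!: imageI poly_alg_closed)
  qed
qed

section \<open>Planes and their Pluecker coordinates\<close>

lemma cspan_pair:
  assumes u: "u \<in> carrier_vec n" and v: "v \<in> carrier_vec n"
  shows "cspan n {u, v} = {a \<cdot>\<^sub>v u + b \<cdot>\<^sub>v v | a b. True}"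
proof -
  interpret vec_space "TYPE(complex)" n .
  have sub: "{u, v} \<subseteq> carrier_vec n" using u v by simp
  have sp: "span {u, v} = range (\<lambda>c. lincomb c {u, v})"
    using finite_span[of "{u, v}"] u v by auto
  have lc: "lincomb c {u, v} = c u \<cdot>\<^sub>v u + (if u = v then 0 else c v) \<cdot>\<^sub>v v" for c
    by (rule eq_vecI) (use u v lincomb_dim[OF _ sub] in \<open>auto simp: lincomb_index[OF _ sub]\<close>)
  have "a \<cdot>\<^sub>v u + b \<cdot>\<^sub>v v = lincomb (\<lambda>x. if u = v then a + b else if x = u then a else b) {u, v}" for a b
    unfolding lc by (rule eq_vecI) (use u v in \<open>auto simp: algebra_simps\<close>)
  then show ?thesis unfolding sp using lc by blast
qed

definition plane_coords :: "complex vec \<Rightarrow> complex vec \<Rightarrow> nat \<times> nat \<Rightarrow> complex"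
  where "plane_coords u v = (\<lambda>(i, j). u $ (i - 1) * v $ (j - 1) - v $ (i - 1) * u $ (j - 1))"

text \<open>
  A change of basis multiplies all coordinates by its determinant.
\<close>

lemma plane_coords_change:
  assumes "u \<in> carrier_vec n" "v \<in> carrier_vec n" "x \<in> cspan n {u, v}" "y \<in> cspan n {u, v}"
  obtains D where "\<And>k l. k \<in> {1..n} \<Longrightarrow> l \<in> {1..n} \<Longrightarrow>
    plane_coords x y (k, l) = D * plane_coords u v (k, l)"
proof -
  obtain a b c d where x: "x = a \<cdot>\<^sub>v u + b \<cdot>\<^sub>v v" and y: "y = c \<cdot>\<^sub>v u + d \<cdot>\<^sub>v v"
    using assms(3,4) unfolding cspan_pair[OF assms(1,2)] by blast
  have "plane_coords x y (k, l) = (a * d - b * c) * plane_coords u v (k, l)"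
    if "k \<in> {1..n}" "l \<in> {1..n}" for k l
  proof -
    have "k - 1 < n" "l - 1 < n" using that by auto
    then show ?thesis using assms(1,2) by (simp add: x y plane_coords_def algebra_simps)
  qed
  then show thesis by (rule that)
qed

text \<open>
  A maximal linearly independent subset exists because its size is bounded by \<open>n\<close>; it is a basis of the subspace.
\<close>

lemma grassmannian2_pair:
  assumes "W \<in> grassmannian2 n"
  shows "\<exists>u\<in>carrier_vec n. \<exists>v\<in>carrier_vec n. W = cspan n {u, v}"
proof -
  interpret vec_space "TYPE(complex)" n .
  have sub: "subspace class_ring W V" and dim: "vectorspace.dim class_ring (vs W) = 2"
    using assms by (simp_all add: grassmannian2_def)
  interpret W: vectorspace class_ring "vs W" by (rule subspace_is_vs[OF sub])
  have sm: "submodule class_ring W V" using sub by simp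
  have WV: "W \<subseteq> carrier_vec n" using submodule.subset[OF sm] by simp
  have li: "W.lin_dep A \<longleftrightarrow> lin_dep A" if "A \<subseteq> W" for A
    by (rule span_li_not_depend(2)[OF that sm])
  have "\<exists>A. finite A \<and> maximal A (\<lambda>S. S \<subseteq> carrier (vs W) \<and> W.lin_indpt S)"
  proof (rule maximal_exists[of _ n "{}"])
    fix A assume "A \<subseteq> carrier (vs W) \<and> W.lin_indpt A"
    then have "A \<subseteq> W" "lin_indpt A" using li by auto
    then show "finite A \<and> card A \<le> n" using li_le_dim[of A] WV dim_is_n fin_dim by auto
  qed (auto simp: W.lin_dep_def)
  then obtain A where A: "finite A" "W.basis A" using W.max_li_is_basis by blast
  then have "card A = 2" using W.dim_basis[OF A] dim by simp
  then obtain u v where uv: "A = {u, v}" by (auto simp: card_2_iff)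
  have "A \<subseteq> W" "W.span A = W" using A(2) by (auto simp: W.basis_def)
  then have "W = span {u, v}" using span_li_not_depend(1)[OF _ sm, of A] uv by simp
  moreover have "u \<in> carrier_vec n" "v \<in> carrier_vec n" using \<open>A \<subseteq> W\<close> WV uv by auto
  ultimately show ?thesis by blast
qed

lemma cspan_pair_grassmannian2:
  assumes u: "u \<in> carrier_vec n" and v: "v \<in> carrier_vec n"
    and kl: "k \<in> {1..n}" "l \<in> {1..n}" "plane_coords u v (k, l) \<noteq> 0"
  shows "cspan n {u, v} \<in> grassmannian2 n"
proof -
  interpret vec_space "TYPE(complex)" n .
  let ?W = "span {u, v}"
  have sub: "{u, v} \<subseteq> carrier_vec n" using u v by simp
  have W: "subspace class_ring ?W V" using span_is_subspace[of "{u, v}"] sub by simp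
  have sm: "submodule class_ring ?W V" using W by simp
  interpret W: vectorspace class_ring "vs ?W" by (rule subspace_is_vs[OF W])
  have uv: "u \<noteq> v" using kl(3) by (auto simp: plane_coords_def)
  have kl': "k - 1 < n" "l - 1 < n" using kl(1,2) by auto
  have own: "{u, v} \<subseteq> ?W" using in_own_span[of "{u, v}"] sub by simp
  have li: "lin_indpt {u, v}"
  proof (rule finite_lin_indpt2)
    fix c assume "lincomb c {u, v} = 0\<^sub>v n"
    then have "lincomb c {u, v} $ m = 0" if "m < n" for m using that by simp
    then have e: "c u * u $ (k - 1) + c v * v $ (k - 1) = 0" "c u * u $ (l - 1) + c v * v $ (l - 1) = 0"
      using kl' uv by (simp_all add: lincomb_index[OF _ sub])
    have "c u * plane_coords u v (k, l) = (c u * u $ (k - 1) + c v * v $ (k - 1)) * v $ (l - 1)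
        - (c u * u $ (l - 1) + c v * v $ (l - 1)) * v $ (k - 1)"
      "c v * plane_coords u v (k, l) = (c u * u $ (l - 1) + c v * v $ (l - 1)) * u $ (k - 1)
        - (c u * u $ (k - 1) + c v * v $ (k - 1)) * u $ (l - 1)"
      by (simp_all add: plane_coords_def algebra_simps)
    then show "\<forall>x\<in>{u, v}. c x = 0" using kl(3) unfolding e by simp
  qed (use sub in auto)
  have "W.basis {u, v}"
    using li own span_li_not_depend[OF own sm] by (simp add: W.basis_def)
  then have "W.dim = 2" using W.dim_basis[of "{u, v}"] uv by simp
  then show ?thesis using W by (simp add: grassmannian2_def)
qed

lemma plucker_coords_pair:
  assumes "W \<in> grassmannian2 n"
  obtains u v where "u \<in> carrier_vec n" "v \<in> carrier_vec n" "W = cspan n {u, v}"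
    "plucker_coords n W = plane_coords u v"
proof -
  have "\<exists>p. \<exists>u\<in>carrier_vec n. \<exists>v\<in>carrier_vec n. W = cspan n {u, v} \<and>
      p = (\<lambda>(i, j). u $ (i - 1) * v $ (j - 1) - v $ (i - 1) * u $ (j - 1))"
    using grassmannian2_pair[OF assms] by blast
  then have "\<exists>u\<in>carrier_vec n. \<exists>v\<in>carrier_vec n. W = cspan n {u, v} \<and>
      plucker_coords n W = (\<lambda>(i, j). u $ (i - 1) * v $ (j - 1) - v $ (i - 1) * u $ (j - 1))"
    unfolding plucker_coords_def by (rule someI_ex)
  then show thesis using that unfolding plane_coords_def by blast
qed

lemma cspan_mem:
  assumes "u \<in> carrier_vec n" "v \<in> carrier_vec n"
  shows "u \<in> cspan n {u, v}" "v \<in> cspan n {u, v}"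
proof -
  have "u = 1 \<cdot>\<^sub>v u + 0 \<cdot>\<^sub>v v" "v = 0 \<cdot>\<^sub>v u + 1 \<cdot>\<^sub>v v" by (rule eq_vecI, use assms in auto)+
  then show "u \<in> cspan n {u, v}" "v \<in> cspan n {u, v}" unfolding cspan_pair[OF assms] by blast+
qed

text \<open>Cramer's rule.\<close>
lemma cspan_pair_eq:
  assumes u: "u \<in> carrier_vec n" and v: "v \<in> carrier_vec n"
    and x: "x = a \<cdot>\<^sub>v u + b \<cdot>\<^sub>v v" and y: "y = c \<cdot>\<^sub>v u + d \<cdot>\<^sub>v v" and D: "a * d - b * c \<noteq> 0"
  shows "cspan n {x, y} = cspan n {u, v}"
proof -
  have xy: "x \<in> carrier_vec n" "y \<in> carrier_vec n" using u v x y by auto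
  define D where "D = a * d - b * c"
  have "r \<cdot>\<^sub>v u + s \<cdot>\<^sub>v v = ((r * d - s * c) / D) \<cdot>\<^sub>v x + ((s * a - r * b) / D) \<cdot>\<^sub>v y" for r s
  proof (rule eq_vecI)
    fix k assume "k < dim_vec (((r * d - s * c) / D) \<cdot>\<^sub>v x + ((s * a - r * b) / D) \<cdot>\<^sub>v y)"
    then have k: "k < n" using xy by auto
    have "D * (r * u $ k + s * v $ k) = (r * d - s * c) * (a * u $ k + b * v $ k) + (s * a - r * b) * (c * u $ k + d * v $ k)"
      by (simp add: D_def algebra_simps)
    then have "r * u $ k + s * v $ k = (r * d - s * c) / D * (a * u $ k + b * v $ k) + (s * a - r * b) / D * (c * u $ k + d * v $ k)"
      using D unfolding D_def [symmetric] by (metis (no_types, lifting) add_divide_distrib nonzero_mult_div_cancel_left times_divide_eq_left)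
    then show "(r \<cdot>\<^sub>v u + s \<cdot>\<^sub>v v) $ k = (((r * d - s * c) / D) \<cdot>\<^sub>v x + ((s * a - r * b) / D) \<cdot>\<^sub>v y) $ k"
      using k u v by (simp add: x y)
  qed (use u v xy in auto)
  moreover have "r \<cdot>\<^sub>v x + s \<cdot>\<^sub>v y = (r * a + s * c) \<cdot>\<^sub>v u + (r * b + s * d) \<cdot>\<^sub>v v" for r s
    unfolding x y by (rule eq_vecI) (use u v in \<open>auto simp: algebra_simps\<close>)
  ultimately show ?thesis unfolding cspan_pair[OF u v] cspan_pair[OF xy] by blast
qed

section \<open>Iterated sequences are birational\<close>

context iterated
begin

definition plane_minor :: "complex vec set \<Rightarrow> nat \<Rightarrow> nat \<Rightarrow> complex"
  where "plane_minor W k l = plucker_coords n W (k, l)"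

lemma plane_minor_antisym: "W \<in> grassmannian2 n \<Longrightarrow> plane_minor W l k = - plane_minor W k l"
  by (rule plucker_coords_pair[of W n]) (auto simp: plane_minor_def plane_coords_def)

lemma eval_pv:
  assumes "W \<in> grassmannian2 n" "k \<noteq> l"
  shows "eval_plucker n (pv k l) W = plane_minor W k l"
  using poly_subst_pv[OF coeff_hom_id, of "plane_minor W" l k] plane_minor_antisym[OF assms(1), of l k] assms(2)
  by (simp add: eval_plucker_def plane_minor_def)

lemma pv_homogeneous:
  assumes "k \<in> {1..n}" "l \<in> {1..n}" "k \<noteq> l"
  shows "pv k l \<in> homogeneous_polys n 1"
proof -
  have "var_poly (p :: nat \<times> nat) \<in> homogeneous_polys n 1" if "p \<in> pairs n" for p
    using that by (simp add: homogeneous_polys_def carrier_poly_alg var_poly_def)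
  note var = this
  show ?thesis
  proof (cases "k < l")
    case True
    then show ?thesis using var[of "(k, l)"] assms by (simp add: pv_def pairs_def)
  next
    case False
    then show ?thesis using hom_minus[OF var[of "(l, k)"]] assms by (simp add: pv_def pairs_def)
  qed
qed

lemma sequence_map_plane:
  fixes y :: "complex vec"
  defines "W \<equiv> sequence_map n S y"
  shows sequence_map_grassmannian2: "W \<in> grassmannian2 n"
    and sequence_map_minor: "\<exists>D. \<forall>k\<in>{1..n}. \<forall>l\<in>{1..n}. plane_minor W k l = D * minor (\<lambda>k. y $ k) k l"
proof -
  define M where "M = psi_mat n S (\<lambda>k. y $ k)"
  have M: "M \<in> carrier_mat n n" unfolding M_def by (rule psi_mat_carrier)
  have c: "col M 0 \<in> carrier_vec n" "col M 1 \<in> carrier_vec n"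
    using col_dim[of M 0] col_dim[of M 1] carrier_matD(1)[OF M] by simp_all
  have W: "W = cspan n {col M 0, col M 1}" by (simp add: W_def sequence_map_def M_def Let_def)
  have m: "plane_coords (col M 0) (col M 1) (k, l) = minor (\<lambda>k. y $ k) k l"
    if "k \<in> {1..n}" "l \<in> {1..n}" for k l
  proof -
    have "k - 1 < n" "l - 1 < n" using that by auto
    then show ?thesis using M n
      by (simp add: plane_coords_def minor_def psi_minor_def M_def[symmetric] Let_def)
  qed
  show gr: "W \<in> grassmannian2 n"
    unfolding W
  proof (rule cspan_pair_grassmannian2[OF c])
    show "1 \<in> {1..n}" "2 \<in> {1..n}" using n by auto
    then show "plane_coords (col M 0) (col M 1) (1, 2) \<noteq> 0" by (simp only: m minor_base) simp
  qed
  obtain u v where uv: "u \<in> carrier_vec n" "v \<in> carrier_vec n" "W = cspan n {u, v}" "plucker_coords n W = plane_coords u v"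
    using plucker_coords_pair[OF gr] .
  have "u \<in> cspan n {col M 0, col M 1}" "v \<in> cspan n {col M 0, col M 1}"
    using cspan_mem[OF uv(1,2)] uv(3) W by auto
  then obtain D where "\<And>k l. k \<in> {1..n} \<Longrightarrow> l \<in> {1..n} \<Longrightarrow>
      plane_coords u v (k, l) = D * plane_coords (col M 0) (col M 1) (k, l)"
    using plane_coords_change[OF c] by metis
  then show "\<exists>D. \<forall>k\<in>{1..n}. \<forall>l\<in>{1..n}. plane_minor W k l = D * minor (\<lambda>k. y $ k) k l"
    using m by (auto simp: plane_minor_def uv(4))
qed

text \<open>
  Row \<open>l\<close> of a \<open>2\<close>-column matrix is a combination of rows \<open>i\<^sub>l\<close> and \<open>j\<^sub>l\<close>, and Cramer's rule expresses the
  coefficients by minors. Coordinates \<open>2 (n - l)\<close> and \<open>2 (n - l) + 1\<close> belong to the roots that end in \<open>l\<close>.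
\<close>

definition recovered_parameters :: "complex vec set \<Rightarrow> complex vec"
  where "recovered_parameters W = vec (2 * (n - 2)) (\<lambda>k. let l = n - k div 2 in
    if even k then plane_minor W (j l) l / plane_minor W (j l) (i l)
    else plane_minor W (i l) l / plane_minor W (i l) (j l))"

lemma recovered_parameters_index:
  assumes "3 \<le> l" "l \<le> n"
  shows "recovered_parameters W $ x_var l = plane_minor W (j l) l / plane_minor W (j l) (i l)"
    and "recovered_parameters W $ z_var l = plane_minor W (i l) l / plane_minor W (i l) (j l)"
proof -
  have "x_var l < 2 * (n - 2)" "z_var l < 2 * (n - 2)" "n - x_var l div 2 = l" "n - z_var l div 2 = l"
    using assms by (auto simp: x_var_def z_var_def)
  moreover have "even (x_var l)" "odd (z_var l)" by (simp_all add: x_var_def z_var_def)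
  ultimately show "recovered_parameters W $ x_var l = plane_minor W (j l) l / plane_minor W (j l) (i l)"
    "recovered_parameters W $ z_var l = plane_minor W (i l) l / plane_minor W (i l) (j l)"
    by (simp_all add: recovered_parameters_def)
qed

lemma parameter_cases:
  assumes "k < 2 * (n - 2)"
  obtains l where "3 \<le> l" "l \<le> n" "k = x_var l \<or> k = z_var l"
proof -
  have q: "k div 2 < n - 2" using assms by (intro less_mult_imp_div_less) simp
  then have "3 \<le> n - k div 2" "n - k div 2 \<le> n" "n - (n - k div 2) = k div 2" by simp_all
  moreover have "k = 2 * (k div 2) \<or> k = 2 * (k div 2) + 1" by presburger
  ultimately have "3 \<le> n - k div 2" "n - k div 2 \<le> n" "k = x_var (n - k div 2) \<or> k = z_var (n - k div 2)"
    unfolding x_var_def z_var_def by simp_all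
  then show thesis by (rule that)
qed

text \<open>
  The product of all denominators, and of \<open>p(1, 2)\<close>, which does not vanish on the image of the parametrization.
\<close>

definition generic_form :: ppoly
  where "generic_form = pv 1 2 * (\<Prod>l\<in>{3..n}. pv (i l) (j l))"

definition generic_planes :: "complex vec set set"
  where "generic_planes = {W \<in> grassmannian2 n. eval_plucker n generic_form W \<noteq> 0}"

lemma generic_form_homogeneous: "\<exists>m. generic_form \<in> homogeneous_polys n m"
proof -
  have "\<exists>m. (\<Prod>l\<in>A. pv (i l) (j l)) \<in> homogeneous_polys n m" if "finite A" "A \<subseteq> {3..n}" for A
    using that
  proof (induction A rule: finite_induct)
    case empty
    then show ?case using hom_one by auto
  next
    case (insert l A)
    then obtain m where m: "(\<Prod>l\<in>A. pv (i l) (j l)) \<in> homogeneous_polys n m" by auto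
    have "pv (i l) (j l) \<in> homogeneous_polys n 1"
      using i_range[of l] j_range[of l] i_neq_j[of l] insert by (intro pv_homogeneous) auto
    then show ?case using hom_mult[OF _ m] insert by auto
  qed
  from this[of "{3..n}"] obtain m where "(\<Prod>l\<in>{3..n}. pv (i l) (j l)) \<in> homogeneous_polys n m" by auto
  then show ?thesis unfolding generic_form_def using hom_mult[OF pv_homogeneous[of 1 2]] n by auto
qed

lemma generic_planes_iff:
  "W \<in> generic_planes \<longleftrightarrow> W \<in> grassmannian2 n \<and> plane_minor W 1 2 \<noteq> 0 \<and>
    (\<forall>l. 3 \<le> l \<longrightarrow> l \<le> n \<longrightarrow> plane_minor W (i l) (j l) \<noteq> 0)"
proof -
  have "eval_plucker n generic_form W = plane_minor W 1 2 * (\<Prod>l\<in>{3..n}. plane_minor W (i l) (j l))"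
    if W: "W \<in> grassmannian2 n"
  proof -
    have m: "eval_plucker n (f * g) W = eval_plucker n f W * eval_plucker n g W" for f g
      by (simp add: eval_plucker_def poly_subst_mult[OF coeff_hom_id])
    have p: "eval_plucker n (\<Prod>l\<in>A. f l) W = (\<Prod>l\<in>A. eval_plucker n (f l) W)" for f and A :: "nat set"
      by (induction A rule: infinite_finite_induct)
        (simp_all add: m, simp_all add: eval_plucker_def poly_subst_one[OF coeff_hom_id])
    show ?thesis
      unfolding generic_form_def m p
    proof (intro arg_cong2[of _ _ _ _ "(*)"] prod.cong refl)
      show "eval_plucker n (pv 1 2) W = plane_minor W 1 2" by (rule eval_pv[OF W]) simp
      show "eval_plucker n (pv (i l) (j l)) W = plane_minor W (i l) (j l)" if "l \<in> {3..n}" for l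
        by (rule eval_pv[OF W]) (use i_neq_j[of l] that in auto)
    qed
  qed
  then show ?thesis by (auto simp: generic_planes_def)
qed

lemma zariski_open_generic_planes: "zariski_open_gr n generic_planes"
  unfolding zariski_open_gr_def using generic_form_homogeneous
  by (intro exI[of _ "{generic_form}"]) (auto simp: generic_planes_def)

text \<open>
  The plane spanned by \<open>(1, 1, \<dots>)\<close> and \<open>(0, 1, 2, \<dots>)\<close> has no vanishing Pluecker coordinate.
\<close>

lemma generic_planes_nonempty: "generic_planes \<noteq> {}"
proof -
  define u v :: "complex vec" where "u = vec n (\<lambda>_. 1)" and "v = vec n of_nat"
  have uv: "u \<in> carrier_vec n" "v \<in> carrier_vec n" by (simp_all add: u_def v_def)
  have nz: "plane_coords u v (k, l) \<noteq> 0" if "k \<in> {1..n}" "l \<in> {1..n}" "k \<noteq> l" for k l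
    using that by (simp add: plane_coords_def u_def v_def) (auto simp: of_nat_diff)
  have W: "cspan n {u, v} \<in> grassmannian2 n"
    by (rule cspan_pair_grassmannian2[OF uv, of 1 2]) (use n nz[of 1 2] in auto)
  obtain u' v' where uv': "u' \<in> carrier_vec n" "v' \<in> carrier_vec n" "cspan n {u, v} = cspan n {u', v'}"
    "plucker_coords n (cspan n {u, v}) = plane_coords u' v'"
    using plucker_coords_pair[OF W] .
  obtain D where D: "\<And>k l. k \<in> {1..n} \<Longrightarrow> l \<in> {1..n} \<Longrightarrow>
      plane_coords u v (k, l) = D * plane_coords u' v' (k, l)"
    using plane_coords_change[OF uv'(1,2), of u v] cspan_mem[OF uv] uv'(3) by metis
  have nz': "plane_minor (cspan n {u, v}) k l \<noteq> 0" if "k \<in> {1..n}" "l \<in> {1..n}" "k \<noteq> l" for k l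
    using D[OF that(1,2)] nz[OF that] by (auto simp: plane_minor_def uv'(4))
  have "plane_minor (cspan n {u, v}) (i l) (j l) \<noteq> 0" if "3 \<le> l" "l \<le> n" for l
    using i_range[OF that] j_range[OF that] i_neq_j[OF that] that by (intro nz') auto
  then have "cspan n {u, v} \<in> generic_planes"
    unfolding generic_planes_iff using W nz'[of 1 2] n by auto
  then show ?thesis by blast
qed

lemma recovered_parameters_regular:
  assumes "k < 2 * (n - 2)"
  shows "regular_on_gr n generic_planes (\<lambda>W. recovered_parameters W $ k)"
proof -
  obtain l where l: "3 \<le> l" "l \<le> n" and k: "k = x_var l \<or> k = z_var l" using parameter_cases[OF assms] .
  have r: "i l \<in> {1..n}" "j l \<in> {1..n}" "l \<in> {1..n}" "i l \<noteq> l" "j l \<noteq> l" "i l \<noteq> j l"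
    using i_range[OF l] j_range[OF l] i_neq_j[OF l] l by auto
  have "\<exists>F\<in>homogeneous_polys n 1. \<exists>G\<in>homogeneous_polys n 1. \<forall>X\<in>generic_planes.
      eval_plucker n G X \<noteq> 0 \<and> recovered_parameters X $ k = eval_plucker n F X / eval_plucker n G X"
    using k
  proof
    assume k: "k = x_var l"
    have "eval_plucker n (pv (j l) (i l)) X \<noteq> 0 \<and>
        recovered_parameters X $ k = eval_plucker n (pv (j l) l) X / eval_plucker n (pv (j l) (i l)) X"
      if "X \<in> generic_planes" for X
    proof -
      have "X \<in> grassmannian2 n" "plane_minor X (i l) (j l) \<noteq> 0" using that l by (auto simp: generic_planes_iff)
      then show ?thesis
        using r plane_minor_antisym[of X "i l" "j l"] by (simp add: k eval_pv recovered_parameters_index[OF l])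
    qed
    then show ?thesis
      using pv_homogeneous[OF r(2,3,5)] pv_homogeneous[OF r(2,1) r(6)[symmetric]] by blast
  next
    assume k: "k = z_var l"
    have "eval_plucker n (pv (i l) (j l)) X \<noteq> 0 \<and>
        recovered_parameters X $ k = eval_plucker n (pv (i l) l) X / eval_plucker n (pv (i l) (j l)) X"
      if "X \<in> generic_planes" for X
    proof -
      have "X \<in> grassmannian2 n" "plane_minor X (i l) (j l) \<noteq> 0" using that l by (auto simp: generic_planes_iff)
      then show ?thesis using r by (simp add: k eval_pv recovered_parameters_index[OF l])
    qed
    then show ?thesis
      using pv_homogeneous[OF r(1,3,4)] pv_homogeneous[OF r(1,2,6)] by blast
  qed
  then show ?thesis
    unfolding regular_on_gr_def using zariski_open_generic_planes by blast
qed

text \<open>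
  By induction on the rows, both spanning vectors satisfy the recursion of the columns of \<open>\<psi>\<^sub>S(y)\<close>. So
  they are combinations of these columns with the coefficients in their first two entries.
\<close>

lemma sequence_map_recovered_parameters:
  assumes "W \<in> generic_planes"
  shows "sequence_map n S (recovered_parameters W) = W"
proof -
  have gr: "W \<in> grassmannian2 n" and base: "plane_minor W 1 2 \<noteq> 0"
    and nz: "\<And>l. 3 \<le> l \<Longrightarrow> l \<le> n \<Longrightarrow> plane_minor W (i l) (j l) \<noteq> 0"
    using assms by (auto simp: generic_planes_iff)
  obtain u v where uv: "u \<in> carrier_vec n" "v \<in> carrier_vec n" "W = cspan n {u, v}" "plucker_coords n W = plane_coords u v"
    using plucker_coords_pair[OF gr] .
  have pm: "plane_minor W k l = u $ (k - 1) * v $ (l - 1) - v $ (k - 1) * u $ (l - 1)" for k l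
    by (simp add: plane_minor_def uv(4) plane_coords_def)
  define y where "y = (\<lambda>k. recovered_parameters W $ k)"
  define M where "M = psi_mat n S y"
  have M: "M \<in> carrier_mat n n" unfolding M_def by (rule psi_mat_carrier)
  have c: "col M 0 \<in> carrier_vec n" "col M 1 \<in> carrier_vec n"
    using col_dim[of M 0] col_dim[of M 1] carrier_matD(1)[OF M] by simp_all
  have rows: "w $ (l - 1) = M $$ (l - 1, 0) * w $ 0 + M $$ (l - 1, 1) * w $ 1"
    if w: "w = u \<or> w = v" and "l \<in> {1..n}" for w l
    using that(2)
  proof (induction l rule: less_induct)
    case (less l)
    show ?case
    proof (cases "l < 3")
      case True
      then have "l = 1 \<or> l = 2" using less by auto
      then show ?thesis
        using psi_mat_top[of 0 0 y] psi_mat_top[of 0 1 y] psi_mat_top[of 1 0 y] psi_mat_top[of 1 1 y]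
        by (auto simp: M_def)
    next
      case False
      then have l: "3 \<le> l" "l \<le> n" using less by auto
      have il: "i l < l" "i l \<in> {1..n}" "j l < l" "j l \<in> {1..n}" using i_range[OF l] j_range[OF l] l by auto
      have nz': "plane_minor W (i l) (j l) \<noteq> 0" by (rule nz[OF l])
      have y: "y (x_var l) = plane_minor W l (j l) / plane_minor W (i l) (j l)"
        "y (z_var l) = plane_minor W (i l) l / plane_minor W (i l) (j l)"
        unfolding y_def recovered_parameters_index[OF l]
        by (simp_all add: plane_minor_antisym[OF gr, of "j l" l] plane_minor_antisym[OF gr, of "j l" "i l"])
      have "plane_minor W (i l) (j l) * w $ (l - 1)
          = plane_minor W l (j l) * w $ (i l - 1) + plane_minor W (i l) l * w $ (j l - 1)"
        using w by (auto simp: pm algebra_simps)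
      then have "w $ (l - 1) = y (x_var l) * w $ (i l - 1) + y (z_var l) * w $ (j l - 1)"
        unfolding y using nz' by (simp add: field_simps)
      also have "\<dots> = M $$ (l - 1, 0) * w $ 0 + M $$ (l - 1, 1) * w $ 1"
        using less.IH[OF il(1,2)] less.IH[OF il(3,4)] psi_mat_row[OF l, of 0 y] psi_mat_row[OF l, of 1 y]
        by (simp add: M_def[symmetric] algebra_simps)
      finally show ?thesis .
    qed
  qed
  have comb: "w = w $ 0 \<cdot>\<^sub>v col M 0 + w $ 1 \<cdot>\<^sub>v col M 1" if w: "w = u \<or> w = v" for w
  proof (rule eq_vecI)
    fix r assume "r < dim_vec (w $ 0 \<cdot>\<^sub>v col M 0 + w $ 1 \<cdot>\<^sub>v col M 1)"
    then have r: "r < n" using M by simp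
    then show "w $ r = (w $ 0 \<cdot>\<^sub>v col M 0 + w $ 1 \<cdot>\<^sub>v col M 1) $ r"
      using rows[OF w, of "Suc r"] M n by simp
  qed (use w uv M in auto)
  have "cspan n {u, v} = cspan n {col M 0, col M 1}"
    by (rule cspan_pair_eq[OF c comb comb]) (use base in \<open>simp_all add: pm mult.commute\<close>)
  then show ?thesis by (simp add: uv(3) sequence_map_def M_def y_def Let_def)
qed

lemma recovered_parameters_sequence_map:
  assumes y: "y \<in> carrier_vec (2 * (n - 2))" and W: "sequence_map n S y \<in> generic_planes"
  shows "recovered_parameters (sequence_map n S y) = y"
proof (rule eq_vecI)
  define W where "W = sequence_map n S y"
  obtain D where D: "\<And>k l. k \<in> {1..n} \<Longrightarrow> l \<in> {1..n} \<Longrightarrow> plane_minor W k l = D * minor (\<lambda>k. y $ k) k l"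
    using sequence_map_minor[of y] unfolding W_def by blast
  have nz: "plane_minor W (i l) (j l) \<noteq> 0" if "3 \<le> l" "l \<le> n" for l
    using W that by (simp add: generic_planes_iff W_def)
  fix k assume "k < dim_vec y"
  then have "k < 2 * (n - 2)" using y by simp
  then obtain l where l: "3 \<le> l" "l \<le> n" and k: "k = x_var l \<or> k = z_var l" by (rule parameter_cases)
  have r: "i l \<in> {1..n}" "j l \<in> {1..n}" "l \<in> {1..n}" using i_range[OF l] j_range[OF l] l by auto
  have m: "minor (\<lambda>k. y $ k) (j l) l = y $ x_var l * minor (\<lambda>k. y $ k) (j l) (i l)"
    "minor (\<lambda>k. y $ k) (i l) l = y $ z_var l * minor (\<lambda>k. y $ k) (i l) (j l)"
    using minor_step[OF l, of "\<lambda>k. y $ k" "j l"] minor_step[OF l, of "\<lambda>k. y $ k" "i l"] by simp_all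
  have nz': "D \<noteq> 0" "minor (\<lambda>k. y $ k) (i l) (j l) \<noteq> 0" "minor (\<lambda>k. y $ k) (j l) (i l) \<noteq> 0"
    using nz[OF l] D[OF r(1,2)] minor_antisym[of "\<lambda>k. y $ k" "i l" "j l"] by auto
  show "recovered_parameters (sequence_map n S y) $ k = y $ k"
    unfolding W_def[symmetric]
    using k nz' D[OF r(1,2)] D[OF r(2,1)] D[OF r(1,3)] D[OF r(2,3)]
    by (elim disjE) (simp_all add: recovered_parameters_index[OF l] m)
qed (use y in \<open>simp add: recovered_parameters_def\<close>)

lemma birational_iterated_sequence: "birational_sequence n S"
  unfolding birational_sequence_def
proof (intro conjI exI[of _ generic_planes] exI[of _ recovered_parameters] allI impI ballI)
  show "set S \<subseteq> pairs n"
    using i_range j_range by (auto simp: iterated_sequence_def pairs_def)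
  show "recovered_parameters W \<in> carrier_vec (2 * (n - 2))" for W
    by (simp add: recovered_parameters_def)
qed (fact length_S zariski_open_generic_planes generic_planes_nonempty
  | (rule recovered_parameters_regular sequence_map_recovered_parameters recovered_parameters_sequence_map, assumption+))+

end

theorem theorem2:
  fixes n :: nat
  assumes "n \<ge> 3"
  shows "(\<forall>i j. iterated_indices n i j \<longrightarrow>
            alg_isomorphic (gr_alg n (iterated_sequence n i j))
              (quot_alg (plucker_ring n) (cone_ideal n (sequence_cone n i)))) \<and>
         (\<forall>C \<in> maximal_cones n. prime_cone n C \<longrightarrow>
            (\<exists>S. birational_sequence n S \<and>
              alg_isomorphic (quot_alg (plucker_ring n) (cone_ideal n C)) (gr_alg n S)))"
proof (intro conjI allI impI ballI)
  fix i j assume "iterated_indices n i j"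
  with assms interpret iterated n i j by unfold_locales
  interpret L: labeled n i j "\<lambda>x. x" "\<lambda>x. x" by (rule labeled_identity)
  have "cone_ideal n (sequence_cone n i) = L.ker_phi"
    unfolding sequence_cone_eq by (rule L.cone_ideal_closed_cone[OF L.open_cone_nonempty])
  then show "alg_isomorphic (gr_alg n (iterated_sequence n i j))
      (quot_alg (plucker_ring n) (cone_ideal n (sequence_cone n i)))"
    using L.quotient_alg_isomorphic(2) by simp
next
  fix C assume "C \<in> maximal_cones n"
  then obtain i j \<sigma> \<rho> where L: "labeled n i j \<sigma> \<rho>" "C = labeled.closed_cone n i \<sigma>"
    using maximal_cone_labeled[OF assms] by blast
  interpret labeled n i j \<sigma> \<rho> by (rule L(1))
  have "cone_ideal n C = ker_phi"
    unfolding L(2) by (rule cone_ideal_closed_cone[OF open_cone_nonempty])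
  then have "alg_isomorphic (quot_alg (plucker_ring n) (cone_ideal n C)) (gr_alg n (iterated_sequence n i j))"
    using quotient_alg_isomorphic(1) by simp
  then show "\<exists>S. birational_sequence n S \<and>
      alg_isomorphic (quot_alg (plucker_ring n) (cone_ideal n C)) (gr_alg n S)"
    using birational_iterated_sequence by blast
qed

end
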